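(* For every integer $p\ge2$, the triplet vertex operator algebra $\mathcal{W}(p)$ admits a logarithmic module (with non-semisimple action of $L(0)$) of lowest (generalized) conformal weight $h_{p-1,1}$. Moreover, the ideal $\mathbb{I}_{h_{p-1,1}}$ of Zhu's algebra $A(\mathcal{W}(p))$ is two-dimensional.
   Context: Definition of $\mathcal{W}(p)$. Let $L=\mathbb{Z}\alpha$ with $\langle\alpha,\alpha\rangle=2p$, and let $V_L=\mathcal{U}(\hat{\mathfrak h}_{<0})\otimes\mathbb{C}[L]$ be the lattice vertex algebra with vacuum $\mathbf 1$ and conformal vector $\omega=\frac{\alpha(-1)^2}{4p}\mathbf 1+\frac{p-1}{2p}\alpha(-2)\mathbf 1$ (central charge $1-\frac{6(p-1)^2}{p}$), with Virasoro operators $L(n)$. Let $L^\circ=\mathbb{Z}\frac{\alpha}{2p}$, let $V_{L^\circ}$ be the associated generalized vertex algebra, and let $\tilde Q=e^{-\alpha/p}_0:V_L\to V_{L^\circ}$, where $u_n$ is the coefficient of $x^{-n-1}$ in $Y(u,x)$. Then $\mathcal{W}(p)=\operatorname{Ker}(\tilde Q|_{V_L})$, a vertex operator algebra with conformal vector $\omega$. A logarithmic module is a weak module which decomposes into generalized $L(0)$-eigenspaces; here it is understood to be non-trivially logarithmic, i.e. $L(0)$ has a non-trivial Jordan block. Zhu's algebra. For a vertex operator algebra $V$ and homogeneous $a\in V$, $b\in V$, set $a*b=\operatorname{Res}_x Y(a,x)\frac{(1+x)^{\mathrm{wt}(a)}}{x}b$ and $a\circ b=\operatorname{Res}_xY(a,x)\frac{(1+x)^{\mathrm{wt}(a)}}{x^2}b$,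 extended bilinearly. $O(V)$ is the span of all $a\circ b$, $A(V)=V/O(V)$ is a unital associative algebra under $*$, and $[v]$ is the image of $v\in V$. Weights: $h_{m,1}=\frac{(m-1)(m-2p+1)}{4p}$; note $h_{i,1}=h_{2p-i,1}$. The ideals $\mathbb{I}_{h_{i,1}}$. For $1\le i\le p-1$, let $f_i(x)=\prod_{1\le j\le 3p-1,\ j\ne i,\ j\ne 2p-i}(x-h_{j,1})$, $v_i=(\lambda_i[\omega]+\nu_i)f_i([\omega])\in A(\mathcal{W}(p))$ with $\lambda_i=-\frac{f_i'(h_{i,1})}{f_i(h_{i,1})^2}$, $\nu_i=\frac{1}{f_i(h_{i,1})}+\frac{h_{i,1}f_i'(h_{i,1})}{f_i(h_{i,1})^2}$, and $w_i=\prod_{1\le j\le 3p-1,\ j\ne i}([\omega]-h_{j,1})\in A(\mathcal{W}(p))$. Then $\mathbb{I}_{h_{i,1}}$ is the ideal of $A(\mathcal{W}(p))$ spanned by $v_i$ and $w_i$. *)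

theory Defs
  imports
    Complex_Main
    "HOL-Library.Poly_Mapping"
    "HOL-Library.Product_Plus"
    "HOL-Library.Multiset"
    "HOL-Computational_Algebra.Polynomial"
    "HOL-Algebra.Embedded_Algebras"
begin

section \<open>The generalized lattice vertex algebra of rank one\<close>

text \<open>
  The basis vector indexed by \<open>({#n\<^sub>1, \<dots>, n\<^sub>r#}, k)\<close> is
  \<open>\<alpha>(-n\<^sub>1-1) \<cdots> \<alpha>(-n\<^sub>r-1) \<otimes> exp(k\<alpha>/(2p))\<close>, so the type is the underlying space of the generalized
  vertex algebra of the dual lattice \<open>\<int> \<alpha>/(2p)\<close>.  The convolution product of finitely supported
  functions is the product of the symmetric algebra tensored with the group algebra; in particular
  \<open>1\<close> is the vacuum.
\<close>

type_synonym fock = "(nat multiset \<times> int) \<Rightarrow>\<^sub>0 complex"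

definition fscale :: "complex \<Rightarrow> fock \<Rightarrow> fock" where
  "fscale c v = Poly_Mapping.map ((*) c) v"

lemma lookup_fscale [simp]: "Poly_Mapping.lookup (fscale c v) b = c * Poly_Mapping.lookup v b"
  by (simp add: fscale_def map.rep_eq when_def)

lemma vector_space_fscale: "vector_space fscale"
  by unfold_locales (auto intro!: poly_mapping_eqI simp: lookup_add algebra_simps)

definition lin_ext :: "(nat multiset \<times> int \<Rightarrow> fock) \<Rightarrow> fock \<Rightarrow> fock" where
  "lin_ext f v = (\<Sum>b\<in>Poly_Mapping.keys v. fscale (Poly_Mapping.lookup v b) (f b))"

text \<open>The group-like element \<open>exp(k\<alpha>/(2p))\<close>.\<close>

definition lat_exp :: "int \<Rightarrow> fock" where
  "lat_exp k = Poly_Mapping.single ({#}, k) 1"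

definition charge_part :: "int \<Rightarrow> fock \<Rightarrow> fock" where
  "charge_part l = lin_ext (\<lambda>(\<mu>, l'). if l' = l then Poly_Mapping.single (\<mu>, l') 1 else 0)"

text \<open>
  The operator \<open>\<alpha>(n)\<close>: multiplication for negative \<open>n\<close>, the scalar
  \<open>\<langle>\<alpha>, l\<alpha>/(2p)\<rangle> = l\<close> for \<open>n = 0\<close>, and \<open>\<langle>\<alpha>, \<alpha>\<rangle> n \<partial>/\<partial>\<alpha>(-n)\<close> with \<open>\<langle>\<alpha>, \<alpha>\<rangle> = 2p\<close> for positive \<open>n\<close>.
\<close>

definition heis :: "nat \<Rightarrow> int \<Rightarrow> fock \<Rightarrow> fock" where
  "heis p n = lin_ext (\<lambda>(\<mu>, l).
     if n < 0 then Poly_Mapping.single (add_mset (nat (- n - 1)) \<mu>, l) 1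
     else if n = 0 then Poly_Mapping.single (\<mu>, l) (of_int l)
     else Poly_Mapping.single (\<mu> - {#nat (n - 1)#}, l)
            (of_nat (2 * p) * of_int n * of_nat (count \<mu> (nat (n - 1)))))"

text \<open>
  For commuting operators \<open>A 1, A 2, \<dots>\<close>, the coefficient of \<open>x\<^sup>N\<close> in the \<open>j\<close>-th power,
  respectively in the exponential, of the series \<open>\<Sum>n\<ge>1. A n x\<^sup>n\<close>.
\<close>

primrec opser_power :: "(nat \<Rightarrow> fock \<Rightarrow> fock) \<Rightarrow> nat \<Rightarrow> nat \<Rightarrow> fock \<Rightarrow> fock" where
  "opser_power A 0 N v = (if N = 0 then v else 0)"
| "opser_power A (Suc j) N v = (\<Sum>n = 1..N. A n (opser_power A j (N - n) v))"

definition opser_exp :: "(nat \<Rightarrow> fock \<Rightarrow> fock) \<Rightarrow> nat \<Rightarrow> fock \<Rightarrow> fock" where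
  "opser_exp A N v = (\<Sum>j\<le>N. fscale (1 / fact j) (opser_power A j N v))"

text \<open>
  With \<open>\<beta> = k\<alpha>/(2p)\<close>: the coefficient of \<open>x\<^sup>i\<close> in \<open>exp(\<Sum>n>0. \<beta>(-n) x\<^sup>n / n)\<close>, and the coefficient of
  \<open>x\<close> to the power \<open>-j\<close> in \<open>exp(- \<Sum>n>0. \<beta>(n) x\<^bsup>-n\<^esup> / n)\<close>.
\<close>

definition exp_creation :: "nat \<Rightarrow> int \<Rightarrow> nat \<Rightarrow> fock \<Rightarrow> fock" where
  "exp_creation p k i =
     opser_exp (\<lambda>n v. fscale (of_int k / of_nat (2 * p * n)) (heis p (- int n) v)) i"

definition exp_annihilation :: "nat \<Rightarrow> int \<Rightarrow> nat \<Rightarrow> fock \<Rightarrow> fock" where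
  "exp_annihilation p k j =
     opser_exp (\<lambda>n v. fscale (- of_int k / of_nat (2 * p * n)) (heis p (int n) v)) j"

text \<open>
  The coefficient of \<open>x\<close> to the power \<open>-n-1\<close> in \<open>Y(exp \<beta>, x) w\<close>, \<open>\<beta> = k\<alpha>/(2p)\<close>.  On the charge
  \<open>l\<close> component the factor \<open>x\<^bsup>\<beta>(0)\<^esup>\<close> contributes the exponent \<open>kl/(2p)\<close>, which is why modes have
  rational indices.  The lattice has rank one and \<open>\<langle>\<alpha>, \<alpha>\<rangle>\<close> is even, so the 2-cocycle is taken to be
  trivial.  All but finitely many summands vanish, as in every use of \<open>Sum_any\<close> below.
\<close>

definition exp_mode :: "nat \<Rightarrow> int \<Rightarrow> rat \<Rightarrow> fock \<Rightarrow> fock" where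
  "exp_mode p k n w = Sum_any (\<lambda>(l :: int, i :: nat, j :: nat).
     if of_nat i - of_nat j + of_int (k * l) / of_nat (2 * p) = - n - 1
     then exp_creation p k i (exp_annihilation p k j (lat_exp k * charge_part l w))
     else 0)"

text \<open>
  Modes of \<open>\<alpha>(-m\<^sub>1-1) \<cdots> \<alpha>(-m\<^sub>r-1) exp(k\<alpha>/(2p))\<close>.  The recursion is the normally ordered product
  of the \<open>m\<close>-th divided derivative of \<open>\<alpha>(x)\<close> with \<open>Y(v, x)\<close>: creation modes \<open>\<alpha>(r)\<close>, \<open>r < 0\<close>, stand to
  the left of \<open>Y(v, x)\<close>, and the modes \<open>\<alpha>(r)\<close>, \<open>r \<ge> 0\<close>, to the right.
\<close>

primrec mon_mode :: "nat \<Rightarrow> nat list \<Rightarrow> int \<Rightarrow> rat \<Rightarrow> fock \<Rightarrow> fock" where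
  "mon_mode p [] k n w = exp_mode p k n w"
| "mon_mode p (m # ms) k n w = Sum_any (\<lambda>j :: nat. fscale (of_nat ((m + j) choose m))
     (heis p (- int m - 1 - int j) (mon_mode p ms k (n + of_nat j) w)
      + fscale ((- 1) ^ m) (mon_mode p ms k (n - of_nat j - of_nat m - 1) (heis p (int j) w))))"

text \<open>\<open>lat_mode p u n w\<close> is \<open>u\<^sub>n w\<close>, the coefficient of \<open>x\<close> to the power \<open>-n-1\<close> in \<open>Y(u, x) w\<close>.\<close>

definition lat_mode :: "nat \<Rightarrow> fock \<Rightarrow> rat \<Rightarrow> fock \<Rightarrow> fock" where
  "lat_mode p u n w = (\<Sum>(\<mu>, k)\<in>Poly_Mapping.keys u.
     fscale (Poly_Mapping.lookup u (\<mu>, k)) (mon_mode p (sorted_list_of_multiset \<mu>) k n w))"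

text \<open>\<open>V\<^sub>L\<close> for \<open>L = \<int>\<alpha>\<close>: note that \<open>\<alpha> = 2p \<cdot> \<alpha>/(2p)\<close>.\<close>

definition lattice_space :: "nat \<Rightarrow> fock set" where
  "lattice_space p = {v. \<forall>(\<mu>, k)\<in>Poly_Mapping.keys v. int (2 * p) dvd k}"

definition lattice_conf :: "nat \<Rightarrow> fock" where
  "lattice_conf p = fscale (1 / of_nat (4 * p)) (heis p (- 1) (heis p (- 1) 1))
     + fscale (of_nat (p - 1) / of_nat (2 * p)) (heis p (- 2) 1)"

text \<open>The screening operator, the zeroth mode of \<open>exp(-\<alpha>/p)\<close>.\<close>

definition screening :: "nat \<Rightarrow> fock \<Rightarrow> fock" where
  "screening p = lat_mode p (lat_exp (- 2)) 0"


section \<open>Vertex algebras, weak modules and Zhu's algebra\<close>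

record 'v vertex_data =
  vspace :: "'v set"
  vscale :: "complex \<Rightarrow> 'v \<Rightarrow> 'v"
  vmode :: "'v \<Rightarrow> int \<Rightarrow> 'v \<Rightarrow> 'v"
  vac :: 'v
  conf :: 'v

definition triplet :: "nat \<Rightarrow> fock vertex_data" where
  "triplet p = \<lparr> vspace = {v \<in> lattice_space p. screening p v = 0},
                 vscale = fscale,
                 vmode = (\<lambda>u n. lat_mode p u (of_int n)),
                 vac = 1,
                 conf = lattice_conf p \<rparr>"

text \<open>
  A weak module has carrier \<open>M\<close>, a subspace of an ambient complex vector space with scalar
  multiplication \<open>s\<close>; \<open>act u n w\<close> is \<open>u\<^sub>n w\<close>.  The last clause is the Jacobi identity in components.
  The action need not be related to any structure of the ambient space.  Over an algebra of countable
  dimension, finitely many vectors generate a submodule of countable dimension, so for existence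
  questions any ambient space of countably infinite dimension is general enough.
\<close>

definition weak_module ::
  "'v::ab_group_add vertex_data \<Rightarrow> (complex \<Rightarrow> 'm \<Rightarrow> 'm) \<Rightarrow> 'm::ab_group_add set
     \<Rightarrow> ('v \<Rightarrow> int \<Rightarrow> 'm \<Rightarrow> 'm) \<Rightarrow> bool" where
  "weak_module V s M act \<longleftrightarrow>
     vector_space s \<and> Modules.module.subspace s M \<and>
     (\<forall>u\<in>vspace V. \<forall>n. \<forall>w\<in>M. act u n w \<in> M) \<and>
     (\<forall>u\<in>vspace V. \<forall>n. \<forall>w\<in>M. \<forall>w'\<in>M. \<forall>c.
        act u n (w + w') = act u n w + act u n w' \<and> act u n (s c w) = s c (act u n w)) \<and>
     (\<forall>u\<in>vspace V. \<forall>v\<in>vspace V. \<forall>n. \<forall>w\<in>M. \<forall>c.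
        act (u + v) n w = act u n w + act v n w \<and> act (vscale V c u) n w = s c (act u n w)) \<and>
     (\<forall>u\<in>vspace V. \<forall>w\<in>M. \<exists>N. \<forall>n\<ge>N. act u n w = 0) \<and>
     (\<forall>n. \<forall>w\<in>M. act (vac V) n w = (if n = - 1 then w else 0)) \<and>
     (\<forall>u\<in>vspace V. \<forall>v\<in>vspace V. \<forall>w\<in>M. \<forall>k m n :: int.
        Sum_any (\<lambda>i :: nat. s (of_int m gchoose i) (act (vmode V u (k + int i) v) (m + n - int i) w))
        = Sum_any (\<lambda>i :: nat. s ((- 1) ^ i * (of_int k gchoose i))
            (act u (m + k - int i) (act v (n + int i) w)
             - s ((- 1) powi k) (act v (n + k - int i) (act u (m + int i) w)))))"

text \<open>The Virasoro operators are \<open>L(n) = \<omega>\<^bsub>n+1\<^esub>\<close>.\<close>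

definition gen_weight_space ::
  "'v::ab_group_add vertex_data \<Rightarrow> (complex \<Rightarrow> 'm \<Rightarrow> 'm) \<Rightarrow> 'm::ab_group_add set
     \<Rightarrow> ('v \<Rightarrow> int \<Rightarrow> 'm \<Rightarrow> 'm) \<Rightarrow> complex \<Rightarrow> 'm set" where
  "gen_weight_space V s M act h =
     {w \<in> M. \<exists>k :: nat. ((\<lambda>w'. act (conf V) 1 w' - s h w') ^^ k) w = 0}"

definition logarithmic_module ::
  "'v::ab_group_add vertex_data \<Rightarrow> (complex \<Rightarrow> 'm \<Rightarrow> 'm) \<Rightarrow> 'm::ab_group_add set
     \<Rightarrow> ('v \<Rightarrow> int \<Rightarrow> 'm \<Rightarrow> 'm) \<Rightarrow> bool" where
  "logarithmic_module V s M act \<longleftrightarrow>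
     weak_module V s M act \<and>
     M = Modules.module.span s (\<Union>h. gen_weight_space V s M act h) \<and>
     (\<exists>h. \<exists>w\<in>gen_weight_space V s M act h. act (conf V) 1 w \<noteq> s h w)"

text \<open>
  Lowest weight \<open>h\<close>: the generalized weight \<open>h\<close> occurs and all others lie in \<open>h + \<nat>\<close>.
\<close>

definition lowest_gen_weight ::
  "'v::ab_group_add vertex_data \<Rightarrow> (complex \<Rightarrow> 'm \<Rightarrow> 'm) \<Rightarrow> 'm::ab_group_add set
     \<Rightarrow> ('v \<Rightarrow> int \<Rightarrow> 'm \<Rightarrow> 'm) \<Rightarrow> complex \<Rightarrow> bool" where
  "lowest_gen_weight V s M act h \<longleftrightarrow>
     gen_weight_space V s M act h \<noteq> {0} \<and>
     (\<forall>h'. gen_weight_space V s M act h' \<noteq> {0} \<longrightarrow> (\<exists>n :: nat. h' = h + of_nat n))"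

definition weight_space :: "'v::ab_group_add vertex_data \<Rightarrow> int \<Rightarrow> 'v set" where
  "weight_space V n = {a \<in> vspace V. vmode V (conf V) 1 a = vscale V (of_int n) a}"

text \<open>The family of homogeneous components of a vector.\<close>

definition hom_comp :: "'v::ab_group_add vertex_data \<Rightarrow> 'v \<Rightarrow> int \<Rightarrow> 'v" where
  "hom_comp V a =
     (THE f. (\<forall>n. f n \<in> weight_space V n) \<and> finite {n. f n \<noteq> 0} \<and> Sum_any f = a)"

text \<open>
  For \<open>a\<close> of weight \<open>n\<close>, the residue of \<open>Y(a, x) (1+x)\<^sup>n x\<^bsup>-r\<^esup> b\<close>; the cases \<open>r = 1\<close> and \<open>r = 2\<close> are
  \<open>a * b\<close> and \<open>a \<circ> b\<close>.
\<close>

definition zhu_residue :: "'v::ab_group_add vertex_data \<Rightarrow> nat \<Rightarrow> int \<Rightarrow> 'v \<Rightarrow> 'v \<Rightarrow> 'v" where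
  "zhu_residue V r n a b =
     Sum_any (\<lambda>i :: nat. vscale V (of_int n gchoose i) (vmode V a (int i - int r) b))"

definition zhu_star :: "'v::ab_group_add vertex_data \<Rightarrow> 'v \<Rightarrow> 'v \<Rightarrow> 'v" where
  "zhu_star V a b = Sum_any (\<lambda>n :: int. zhu_residue V 1 n (hom_comp V a n) b)"

definition zhu_O :: "'v::ab_group_add vertex_data \<Rightarrow> 'v set" where
  "zhu_O V = Modules.module.span (vscale V)
     {zhu_residue V 2 n a b | n a b. a \<in> weight_space V n \<and> b \<in> vspace V}"

text \<open>
  The record to which \<open>Quot\<close> is applied is not a ring, since \<open>*\<close> is not associative on \<open>V\<close>; only the
  quotient \<open>A(V)\<close> is.  Its elements are the cosets of \<open>O(V)\<close>.
\<close>

definition zhu_algebra :: "'v::ab_group_add vertex_data \<Rightarrow> 'v set ring" where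
  "zhu_algebra V =
     \<lparr> carrier = vspace V, monoid.mult = zhu_star V, one = vac V, zero = 0, add = (+) \<rparr> Quot zhu_O V"

definition zhu_class :: "'v::ab_group_add vertex_data \<Rightarrow> 'v \<Rightarrow> 'v set" where
  "zhu_class V a = {b \<in> vspace V. b - a \<in> zhu_O V}"

text \<open>
  Complex scalars are identified with multiples of the unit, so that linear algebra in \<open>A(V)\<close>
  is linear algebra over the central subfield \<open>zhu_scalars V\<close>.
\<close>

definition zhu_scalar :: "'v::ab_group_add vertex_data \<Rightarrow> complex \<Rightarrow> 'v set" where
  "zhu_scalar V c = zhu_class V (vscale V c (vac V))"

definition zhu_scalars :: "'v::ab_group_add vertex_data \<Rightarrow> 'v set set" where
  "zhu_scalars V = range (zhu_scalar V)"

definition zhu_eval :: "'v::ab_group_add vertex_data \<Rightarrow> complex poly \<Rightarrow> 'v set \<Rightarrow> 'v set" where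
  "zhu_eval V f a = (\<Oplus>\<^bsub>zhu_algebra V\<^esub>k\<in>{..Polynomial.degree f}.
     zhu_scalar V (Polynomial.coeff f k) \<otimes>\<^bsub>zhu_algebra V\<^esub> a [^]\<^bsub>zhu_algebra V\<^esub> k)"


section \<open>The ideals of Zhu's algebra of the triplet algebra\<close>

text \<open>\<open>hw p m\<close> is the weight \<open>h\<^bsub>m,1\<^esub>\<close>.\<close>

definition hw :: "nat \<Rightarrow> nat \<Rightarrow> complex" where
  "hw p m = (of_nat m - 1) * (of_nat m - 2 * of_nat p + 1) / (4 * of_nat p)"

definition zhu_f :: "nat \<Rightarrow> nat \<Rightarrow> complex poly" where
  "zhu_f p i = (\<Prod>j\<in>{1..3 * p - 1} - {i, 2 * p - i}. [:- hw p j, 1:])"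

definition zhu_lambda :: "nat \<Rightarrow> nat \<Rightarrow> complex" where
  "zhu_lambda p i = - (poly (pderiv (zhu_f p i)) (hw p i) / (poly (zhu_f p i) (hw p i))\<^sup>2)"

definition zhu_nu :: "nat \<Rightarrow> nat \<Rightarrow> complex" where
  "zhu_nu p i = 1 / poly (zhu_f p i) (hw p i)
     + hw p i * poly (pderiv (zhu_f p i)) (hw p i) / (poly (zhu_f p i) (hw p i))\<^sup>2"

definition zhu_v :: "nat \<Rightarrow> nat \<Rightarrow> fock set" where
  "zhu_v p i = (let V = triplet p; A = zhu_algebra V; w = zhu_class V (conf V) in
     (zhu_scalar V (zhu_lambda p i) \<otimes>\<^bsub>A\<^esub> w \<oplus>\<^bsub>A\<^esub> zhu_scalar V (zhu_nu p i))
       \<otimes>\<^bsub>A\<^esub> zhu_eval V (zhu_f p i) w)"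

definition zhu_w :: "nat \<Rightarrow> nat \<Rightarrow> fock set" where
  "zhu_w p i = zhu_eval (triplet p) (\<Prod>j\<in>{1..3 * p - 1} - {i}. [:- hw p j, 1:])
     (zhu_class (triplet p) (conf (triplet p)))"

text \<open>
  The linear span; that it is a two-sided ideal is not part of the definition.
\<close>

definition zhu_ideal :: "nat \<Rightarrow> nat \<Rightarrow> fock set set" where
  "zhu_ideal p i =
     ring.Span (zhu_algebra (triplet p)) (zhu_scalars (triplet p)) [zhu_v p i, zhu_w p i]"

end

theory Submission
 imports Defs "HOL-Computational_Algebra.Formal_Power_Series"
begin

text \<open>
 The logarithmic module is \<open>M = V\<^bsub>L+\<alpha>/2\<^esub> \<oplus> V\<^bsub>L+\<alpha>/2-\<alpha>/p\<^esub>\<close>.  As the screening current \<open>e = exp(-\<alpha>/p)\<close> maps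
 the first summand to the second and is made to act as zero on the second, and \<open>e\<^sub>0\<close> kills \<open>W(p)\<close>, the operators
 \<open>Y(exp(\<Sum>j\<ge>1. (-1)\<^bsup>j-1\<^esup>/j e\<^sub>j x\<^bsup>-j\<^esup>) u, x)\<close> again satisfy the Jacobi identity.  The new \<open>L(0)\<close> differs from the old
 one by \<open>e\<^sub>0\<close>, which maps the lowest weight vector \<open>exp(\<alpha>/2)\<close> to \<open>exp(\<alpha>/2-\<alpha>/p) \<noteq> 0\<close>.

 For the ideal, put \<open>F = exp(-\<alpha>)\<close>, \<open>H = QF\<close>, \<open>E = Q\<^sup>2F\<close> with \<open>Q\<close> the zeroth mode of \<open>exp(\<alpha>)\<close>.  The products
 \<open>H \<star> H\<close> and \<open>H \<circ> F\<close> are Virasoro descendants of \<open>1\<close> and \<open>F\<close>, whence \<open>[H]\<^sup>2 = P\<^sub>0([\<omega>])\<close> and \<open>P\<^sub>1([\<omega>])[u] = 0\<close> for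
 \<open>u = F, H, E\<close>; zero modes on the vectors \<open>exp(k\<alpha>/(2p))\<close> identify \<open>P\<^sub>0\<close> and \<open>P\<^sub>1\<close> up to scalars as the products of \<open>x - h\<^bsub>j,1\<^esub>\<close> over
 \<open>j < 2p\<close> and \<open>2p \<le> j < 3p\<close>.  With \<open>h = h\<^bsub>p-1,1\<^esub>\<close> and \<open>f = f\<^bsub>p-1\<^esub>\<close> this gives \<open>P\<^sub>0 P\<^sub>1 = (x - h)\<^sup>2 f\<close>
 up to a scalar and \<open>P\<^sub>1\<close> divides \<open>f\<close>.  Hence the space of all \<open>g([\<omega>]) f([\<omega>])\<close> is spanned by \<open>v\<close> and \<open>w\<close>
 and is annihilated by \<open>[F], [H], [E]\<close>; it is an ideal because \<open>\<omega>, F, H, E\<close> generate \<open>W(p)\<close> strongly.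
 The vectors \<open>v, w\<close> are independent: on the lowest weight vector of \<open>M\<close>, the zero mode of \<open>g([\<omega>])\<close>
 yields \<open>g(h) exp(\<alpha>/2) + g'(h) exp(\<alpha>/2-\<alpha>/p)\<close>.
\<close>

text \<open>The modes are explicit formulas, so the Jacobi identity itself has to be extracted from
  them. Commutators with the Heisenberg modes reduce it to exponentials, and there to one scalar
  residue identity; even pairing of the two charges matches the trivial cocycle. The products H_m H
  and H_m F are governed by a singular vector of level three over F. For w = F or H it expresses H_m
  w through descendants of H_{m+j} w, except where H_m w has weight 0, 2p-1 or 6p-2. The weight 2p-1
  in H_m H is the obstacle, since H itself might enter there; skew-symmetry excludes it. The
  resulting polynomials are only known to exist. A degree bound with p zeros and one nonzero value
  fixes \<open>P1\<close>, infinitely many values fix \<open>P0\<close>. Strong generation serves to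
  show that the span is an ideal. It is drawn from the same zero-mode relations: in weight n they
  express \<open>P0\<close>(n) \<open>P1\<close>(n) t by generator modes. The weights where this
  scalar vanishes are below 2p-1, and there a lowest weight argument excludes nonzero
  charge.\<close>

abbreviation (input) "sc \<equiv> fscale"
abbreviation (input) "xp \<equiv> lat_exp"
abbreviation (input) lookup where "lookup \<equiv> Poly_Mapping.lookup"
abbreviation (input) single where "single \<equiv> Poly_Mapping.single"
abbreviation (input) keys where "keys \<equiv> Poly_Mapping.keys"
abbreviation (input) degree where "degree \<equiv> Polynomial.degree"
abbreviation (input) coeff where "coeff \<equiv> Polynomial.coeff"
abbreviation (input) smult where "smult \<equiv> Polynomial.smult"

interpretation fock: vector_space fscale
 by (rule vector_space_fscale)

lemmas sc_add = fock.scale_right_distrib and sc_add_left = fock.scale_left_distrib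
 and sc_diff = fock.scale_right_diff_distrib and sc_diff_left = fock.scale_left_diff_distrib
 and sc_sum = fock.scale_sum_right and sc_sc = fock.scale_scale

section \<open>Linear maps on the Fock space\<close>

definition flin :: "(fock => fock) => bool" where
 "flin f \<longleftrightarrow> (\<forall>x y. f (x + y) = f x + f y) \<and> (\<forall>c x. f (sc c x) = sc c (f x))"

lemma flinI: "(!!x y. f (x + y) = f x + f y) ==> (!!c x. f (sc c x) = sc c (f x)) ==> flin f"
 by (simp add: flin_def)

lemma flin_add: "flin f ==> f (x + y) = f x + f y"
 and flin_scale: "flin f ==> f (sc c x) = sc c (f x)"
 by (simp_all add: flin_def)

lemma flin_zero: "flin f ==> f 0 = 0"
 using flin_scale[of f 0 0] by simp

lemma flin_uminus: "flin f ==> f (- x) = - f x"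
 using flin_scale[of f "-1" x] by simp

lemma flin_diff: "flin f ==> f (x - y) = f x - f y"
 using flin_add[of f x "- y"] flin_uminus[of f y] by simp

lemma flin_sum: "flin f ==> f (sum g A) = (\<Sum>x\<in>A. f (g x))"
 by (induction A rule: infinite_finite_induct) (auto simp: flin_zero flin_add)

lemma flin_id [intro]: "flin (%x. x)"
 and flin_0 [intro]: "flin (%x. 0)"
 and flin_fscale [intro]: "flin f ==> flin (%x. sc c (f x))"
 and flin_plus [intro]: "flin f ==> flin g ==> flin (%x. f x + g x)"
 and flin_minus [intro]: "flin f ==> flin g ==> flin (%x. f x - g x)"
 and flin_comp: "flin f ==> flin g ==> flin (%x. f (g x))"
 by (auto simp: flin_def algebra_simps fock.scale_left_commute)

lemma flin_setsum [intro]: "(!!i. i \<in> A ==> flin (f i)) ==> flin (%x. \<Sum>i\<in>A. f i x)"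
 by (induction A rule: infinite_finite_induct) auto

lemma flin_mult [intro]: "flin f ==> flin (%x. u * f x)"
 by (auto simp: flin_def algebra_simps fscale_def mult_map_scale_conv_mult)

lemma fscale_eq_mult: "sc c v = single 0 c * v"
 by (simp add: fscale_def mult_map_scale_conv_mult)

lemma fscale_mult_left: "sc c u * v = sc c (u * v)"
 and fscale_mult_right: "u * sc c v = sc c (u * v)"
 by (simp_all add: fscale_eq_mult mult_ac)

lemma fscale_single [simp]: "sc c (single b x) = single b (c * x)"
 by (rule poly_mapping_eqI) (simp add: lookup_single when_def)

lemma lookup_fsum: "lookup (sum f A) b = (\<Sum>x\<in>A. lookup (f x) b)"
 by (rule lookup_sum)

lemma fock_expand:
 "v = (\<Sum>b\<in>keys v. sc (lookup v b) (single b 1))"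
proof (rule poly_mapping_eqI)
 fix b
 show "lookup v b = lookup
   (\<Sum>b\<in>keys v. sc (lookup v b) (single b 1)) b"
  by (auto simp: lookup_fsum lookup_single when_def sum.delta in_keys_iff)
qed

lemma flin_eqI:
 assumes "flin f" "flin g" "!!b. b \<in> keys v ==> f (single b 1) = g (single b 1)"
 shows "f v = g v"
proof -
 have *: "h v = (\<Sum>b\<in>keys v. sc (lookup v b) (h (single b 1)))"
  if "flin h" for h
  using arg_cong[OF fock_expand[of v], of h]
  by (simp add: flin_sum[OF that] flin_scale[OF that] del: fscale_single)
 show ?thesis
  unfolding *[OF assms(1)] *[OF assms(2)] using assms(3) by (intro sum.cong) auto
qed

lemma lin_ext_superset:
 assumes "finite A" "keys v \<subseteq> A"
 shows "lin_ext f v = (\<Sum>b\<in>A. sc (lookup v b) (f b))"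
 unfolding lin_ext_def using assms
 by (intro sum.mono_neutral_left) (auto simp: in_keys_iff)

lemma flin_lin_ext [intro]: "flin (lin_ext f)"
proof (rule flinI)
 fix x y :: fock
 let ?A = "keys x \<union> keys y"
 have "keys (x + y) \<subseteq> ?A" by (rule Poly_Mapping.keys_add)
 then show "lin_ext f (x + y) = lin_ext f x + lin_ext f y"
  by (simp add: lin_ext_superset[where A = ?A] lookup_add sc_add_left sum.distrib)
next
 fix c and x :: fock
 let ?A = "keys x"
 have "keys (sc c x) \<subseteq> ?A" by (auto simp: in_keys_iff)
 then show "lin_ext f (sc c x) = sc c (lin_ext f x)"
  by (simp add: lin_ext_superset[where A = ?A] sc_sum)
qed

lemma lin_ext_single [simp]: "lin_ext f (single b 1) = f b"
 by (simp add: lin_ext_def)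

section \<open>Sums over eventually vanishing families\<close>

lemma Sum_any_nat:
 fixes f :: "nat => 'a::comm_monoid_add"
 assumes "!!i. i >= N ==> f i = 0"
 shows "Sum_any f = sum f {..<N}"
 by (rule Sum_any.expand_superset) (use assms not_less in auto)

definition evz :: "(nat => 'a::zero) => bool" where
 "evz f \<longleftrightarrow> (\<exists>N. ALL i>=N. f i = 0)"

lemma evzI: "(!!i. i >= N ==> f i = 0) ==> evz f"
 by (auto simp: evz_def)

lemma evzE: assumes "evz f" obtains N where "!!i. i >= N ==> f i = 0"
 using assms by (auto simp: evz_def)

lemma evz_finite: "evz f ==> finite {i. f i ~= 0}"
 by (erule evzE, rule finite_subset[of _ "{..<_}"]) (use not_less in auto)

lemma evz_flin: "evz f ==> flin L ==> evz (%i. L (f i))"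
 unfolding evz_def by (metis flin_zero)

lemma evz_fscale: "evz f ==> evz (%i. sc (c i) (f i))"
 by (auto simp: evz_def)

lemma evz_add:
 fixes f g :: "nat => 'a::monoid_add"
 assumes "evz f" "evz g" shows "evz (%i. f i + g i)"
proof -
 from assms obtain N M where "!!i. i >= N ==> f i = 0" "!!i. i >= M ==> g i = 0"
  by (metis evzE)
 then show ?thesis by (intro evzI[of "max N M"]) auto
qed

lemma evz_sum:
 fixes f :: "'b => nat => 'a::comm_monoid_add"
 shows "(!!j. j \<in> A ==> evz (f j)) ==> evz (%i. \<Sum>j\<in>A. f j i)"
 by (induction A rule: infinite_finite_induct) (auto intro: evzI evz_add)

lemma Sum_any_flin:
 fixes f :: "nat => fock"
 assumes "evz f" "flin L"
 shows "L (Sum_any f) = Sum_any (%i. L (f i))"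
proof -
 from assms(1) obtain N where N: "!!i. i >= N ==> f i = 0" by (metis evzE)
 then have "!!i. i >= N ==> L (f i) = 0" by (simp add: flin_zero assms(2))
 with N show ?thesis
  by (simp add: Sum_any_nat[of N] flin_sum[OF assms(2)])
qed

lemma Sum_any_add:
 fixes f g :: "nat => 'a::comm_monoid_add"
 assumes "evz f" "evz g"
 shows "Sum_any (%i. f i + g i) = Sum_any f + Sum_any g"
 by (rule Sum_any.distrib) (use assms in \<open>auto intro: evz_finite\<close>)

lemma Sum_any_uminus:
 fixes f :: "nat => 'a::ab_group_add"
 shows "Sum_any (%i. - f i) = - Sum_any f"
 by (simp add: Sum_any.expand_set sum_negf)

lemma Sum_any_diff:
 fixes f g :: "nat => 'a::ab_group_add"
 assumes "evz f" "evz g"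
 shows "Sum_any (%i. f i - g i) = Sum_any f - Sum_any g"
proof -
 have "evz (%i. - g i)" using assms(2) by (auto simp: evz_def)
 from Sum_any_add[OF assms(1) this] show ?thesis by (simp add: Sum_any_uminus)
qed

lemma Sum_any_fscale:
 assumes "evz (f :: nat => fock)"
 shows "Sum_any (%i. sc c (f i)) = sc c (Sum_any f)"
 using Sum_any_flin[OF assms flin_fscale[OF flin_id, of c]] by simp

lemma Sum_any_sum:
 fixes f :: "'b => nat => 'a::comm_monoid_add"
 assumes "!!j. j \<in> A ==> evz (f j)"
 shows "Sum_any (%i. \<Sum>j\<in>A. f j i) = (\<Sum>j\<in>A. Sum_any (f j))"
 using assms
 by (induction A rule: infinite_finite_induct) (auto simp: Sum_any_add evz_sum)

lemma Sum_any_shift: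
 fixes f :: "nat => 'a::comm_monoid_add"
 assumes "!!i. i < k ==> f i = 0"
 shows "Sum_any f = Sum_any (%i. f (i + k))"
proof (cases "finite {i. f i ~= 0}")
 case True
 then obtain N where N: "!!i. f i ~= 0 ==> i < N"
  using finite_nat_set_iff_bounded by auto
 then have z: "!!i. i >= N ==> f i = 0" by (meson not_less)
 have "Sum_any f = sum f {..<N + k}"
  by (rule Sum_any_nat) (use z in auto)
 also have "... = sum f {k..<N + k}"
  by (rule sum.mono_neutral_right) (use assms in auto)
 also have "... = (\<Sum>i<N. f (i + k))"
  using sum.shift_bounds_nat_ivl[of f 0 k N] by (simp add: atLeast0LessThan)
 also have "... = Sum_any (%i. f (i + k))"
  by (rule Sum_any_nat[symmetric]) (use z in auto)
 finally show ?thesis .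
next
 \<comment> \<open>\<open>Sum_any\<close> is 0 by convention on an infinite support, and dropping
   \<open>k\<close> zero entries keeps the support infinite, so both sides are 0.\<close>
 case False
 have "{i. f i ~= 0} \<subseteq> (%i. i + k) ` {i. f (i + k) ~= 0}"
 proof
  fix i assume "i \<in> {i. f i ~= 0}"
  then have "f i ~= 0" by simp
  then have "k \<le> i" using assms not_less by blast
  then show "i \<in> (%i. i + k) ` {i. f (i + k) ~= 0}"
   using \<open>f i ~= 0\<close> by (auto simp: image_iff intro!: exI[of _ "i - k"])
 qed
 then have "infinite {i. f (i + k) ~= 0}"
  using False finite_surj by blast
 with False show ?thesis by simp
qed

text \<open>A bound on \<open>i\<close> that is uniform in \<open>j\<close> makes the outer sum
  finite, after which a bound on \<open>j\<close> for each single \<open>i\<close> is enough. Sums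
  of modes of fields have exactly this asymmetric kind of finiteness.\<close>

lemma Sum_any_swap_nat:
 fixes f :: "nat => nat => 'a::comm_monoid_add"
 assumes "!!i j. i >= N ==> f i j = 0" "!!i. evz (f i)"
 shows "Sum_any (%i. Sum_any (f i)) = Sum_any (%j. Sum_any (%i. f i j))"
proof -
 have "Sum_any (%i. Sum_any (f i)) = (\<Sum>i<N. Sum_any (f i))"
  by (rule Sum_any_nat) (simp add: assms)
 also have "... = Sum_any (%j. \<Sum>i<N. f i j)"
  by (rule Sum_any_sum[symmetric]) (simp add: assms)
 also have "... = Sum_any (%j. Sum_any (%i. f i j))"
  by (rule Sum_any.cong, rule Sum_any_nat[symmetric]) (simp add: assms)
 finally show ?thesis .
qed

section \<open>Laurent series acting on sequences\<close>

text \<open>A power series in \<open>Y\<close> acts on the integer sequences that vanish eventually, with \<open>Y\<close> acting as the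
 shift.  Expanding \<open>x\<^sup>m y\<^sup>n (x - y)\<^sup>k\<close> in each of the three domains turns the Jacobi identity
 into statements about this action.\<close>

definition bdd :: "(int => fock) => bool" where
 "bdd G \<longleftrightarrow> (\<exists>N. ALL b>=N. G b = 0)"

definition cv :: "complex fps => (int => fock) => int => fock" where
 "cv ka G b = Sum_any (%s. sc (fps_nth ka s) (G (b + int s)))"

lemma bddI: "(!!b. b >= N ==> G b = 0) ==> bdd G"
 by (auto simp: bdd_def)

lemma bddE: assumes "bdd G" obtains N where "!!b. b >= N ==> G b = 0"
 using assms by (auto simp: bdd_def)

lemma bdd_evz: "bdd G ==> evz (%s. G (b + int s))"
proof (erule bddE)
 fix N assume "!!b. N \<le> b ==> G b = 0"
 then show ?thesis by (intro evzI[of "nat (N - b)"]) auto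
qed

lemma bdd_cv_evz: "bdd G ==> evz (%s. sc (ka s) (G (b + int s)))"
 by (rule evz_fscale, rule bdd_evz)

lemma bdd_flin: "bdd G ==> flin L ==> bdd (%b. L (G b))"
 unfolding bdd_def by (metis flin_zero)

lemma bdd_shift: "bdd G ==> bdd (%b. G (b + r))"
proof (erule bddE)
 fix N assume "!!b. N \<le> b ==> G b = 0"
 then show ?thesis by (intro bddI[of "N - r"]) auto
qed

lemma bdd_add: assumes "bdd G" "bdd H" shows "bdd (%b. G b + H b)"
proof -
 from assms obtain N M where "!!b. b >= N ==> G b = 0" "!!b. b >= M ==> H b = 0"
  by (metis bddE)
 then show ?thesis by (intro bddI[of "max N M"]) auto
qed

lemma bdd_sum: "(!!j. j \<in> A ==> bdd (G j)) ==> bdd (%b. \<Sum>j\<in>A. G j b)"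
 by (induction A rule: infinite_finite_induct) (auto intro: bddI bdd_add)

lemma bdd_cv: assumes "bdd G" shows "bdd (cv ka G)"
proof -
 from assms obtain N where "!!b. b >= N ==> G b = 0" by (metis bddE)
 then show ?thesis by (intro bddI[of N]) (simp add: cv_def)
qed

lemma cv_shift: "cv ka (%b. G (b + r)) b = cv ka G (b + r)"
 by (simp add: cv_def algebra_simps)

lemma cv_flin: "bdd G ==> flin L ==> L (cv ka G b) = cv ka (%b. L (G b)) b"
 by (simp add: cv_def Sum_any_flin bdd_cv_evz flin_scale)

lemma cv_add: "bdd G ==> bdd H ==> cv ka (%b. G b + H b) b = cv ka G b + cv ka H b"
 by (simp add: cv_def algebra_simps Sum_any_add bdd_cv_evz)

lemma cv_scale: "bdd G ==> cv ka (%b. sc c (G b)) b = sc c (cv ka G b)"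
 using cv_flin[of G "sc c" ka b] flin_fscale[OF flin_id] by simp

lemma cv_diff: "bdd G ==> bdd H ==> cv ka (%b. G b - H b) b = cv ka G b - cv ka H b"
 by (simp add: cv_def algebra_simps Sum_any_diff bdd_cv_evz)

lemma cv_sum: "(!!j. j \<in> A ==> bdd (G j)) ==> cv ka (%b. \<Sum>j\<in>A. G j b) b = (\<Sum>j\<in>A. cv ka (G j) b)"
 by (induction A rule: infinite_finite_induct) (auto simp: cv_add bdd_sum, auto simp: cv_def)

lemma cv_one [simp]: "cv 1 G b = G b"
proof -
 have "Sum_any (%s. sc (fps_nth 1 s) (G (b + int s))) = (\<Sum>s<1. sc (fps_nth 1 s) (G (b + int s)))"
  by (rule Sum_any_nat) simp
 then show ?thesis by (simp add: cv_def)
qed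

text \<open>Resummation along \<open>s + t = r\<close> below the bound where \<open>G\<close>
  vanishes. It allows expansions of powers of x, y and x - y to be multiplied as power
  series.\<close>

lemma cv_mult:
 assumes "bdd G"
 shows "cv ka (cv mu G) b = cv (ka * mu) G b"
proof -
 from assms obtain N where N: "!!b. b >= N ==> G b = 0" by (metis bddE)
 define M where "M = nat (N - b)"
 have z: "s >= M ==> G (b + int s) = 0" for s by (rule N) (auto simp: M_def)
 have z': "s >= M ==> cv mu G (b + int s) = 0" for s
  by (simp add: cv_def z[of "s + _", simplified, unfolded add.assoc[symmetric]] N M_def)
 have "cv ka (cv mu G) b = (\<Sum>s<M. sc (fps_nth ka s) (cv mu G (b + int s)))"
  unfolding cv_def[of ka] by (rule Sum_any_nat) (simp add: z')
 also have "... = (\<Sum>s<M. \<Sum>t<M - s. sc (fps_nth ka s * fps_nth mu t) (G (b + int (s + t))))"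
 proof (rule sum.cong, rule refl)
  fix s
  have "cv mu G (b + int s) = (\<Sum>t<M - s. sc (fps_nth mu t) (G (b + int s + int t)))"
   unfolding cv_def by (rule Sum_any_nat) (auto intro!: N simp: M_def)
  then show "sc (fps_nth ka s) (cv mu G (b + int s)) =
    (\<Sum>t<M - s. sc (fps_nth ka s * fps_nth mu t) (G (b + int (s + t))))"
   by (simp add: sc_sum add.assoc)
 qed
 also have "... = (\<Sum>(s, t)\<in>(SIGMA s:{..<M}. {..<M - s}). sc (fps_nth ka s * fps_nth mu t) (G (b + int (s + t))))"
  by (rule sum.Sigma) auto
 also have "... = (\<Sum>(r, s)\<in>(SIGMA r:{..<M}. {..r}). sc (fps_nth ka s * fps_nth mu (r - s)) (G (b + int r)))"
  by (rule sum.reindex_bij_witness[where i = "%(r, s). (s, r - s)" and j = "%(s, t). (s + t, s)"]) auto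
 also have "... = (\<Sum>r<M. \<Sum>s\<le>r. sc (fps_nth ka s * fps_nth mu (r - s)) (G (b + int r)))"
  by (rule sum.Sigma[symmetric]) auto
 also have "... = (\<Sum>r<M. sc (fps_nth (ka * mu) r) (G (b + int r)))"
  by (simp add: fps_mult_nth fock.scale_sum_left atLeast0AtMost)
 also have "... = cv (ka * mu) G b"
  unfolding cv_def by (rule Sum_any_nat[symmetric]) (simp add: z)
 finally show ?thesis .
qed

lemma cv_mult': "bdd G ==> cv ka (%b. cv mu G b) b = cv (ka * mu) G b"
 using cv_mult[of G ka mu b] by (simp add: eta_contract_eq)

text \<open>The condition under which \<open>cv\<close> may be interchanged with a sum over
  \<open>s\<close>: vanishing for large \<open>b\<close> uniformly in \<open>s\<close>, and
  finiteness in \<open>s\<close> for each \<open>b\<close>.\<close>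

definition fam :: "(nat => int => fock) => bool" where
 "fam H \<longleftrightarrow> (\<exists>N. ALL b>=N. \<forall>s. H s b = 0) \<and> (\<forall>b. evz (%s. H s b))"

lemma fam_bdd_Sum:
 assumes "fam H" shows "bdd (%b. Sum_any (%s. H s b))"
proof -
 from assms obtain N where "!!b s. b >= N ==> H s b = 0" by (auto simp: fam_def)
 then show ?thesis by (intro bddI[of N]) simp
qed

lemma fam_evz: "fam H ==> evz (%s. H s b)"
 by (auto simp: fam_def)

text \<open>Only the finitely many shifts \<open>i < M\<close> contribute, so the maximum of their
  individual bounds \<open>S i\<close> works.\<close>

lemma fam_cv_evz:
 assumes "fam H" shows "evz (%s. cv ka (H s) b)"
proof -
 from assms obtain N where N: "!!b s. b >= N ==> H s b = 0" by (auto simp: fam_def)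
 have "\<forall>i. \<exists>S. ALL s>=S. H s (b + int i) = 0" using assms by (auto simp: fam_def evz_def)
 then obtain S where S: "!!i s. s >= S i ==> H s (b + int i) = 0" by metis
 define M where "M = nat (N - b)"
 have "cv ka (H s) b = 0" if "s >= Max (insert 0 (S ` {..<M}))" for s
 proof -
  have "H s (b + int i) = 0" for i
  proof (cases "i < M")
   case True
   then have "S i \<le> Max (insert 0 (S ` {..<M}))" by (intro Max_ge) auto
   then show ?thesis using that by (intro S) (rule order_trans)
  next
   case False then show ?thesis by (intro N) (auto simp: M_def)
  qed
  then show ?thesis by (simp add: cv_def)
 qed
 then show ?thesis by (rule evzI)
qed

lemma cv_Sum_any:
 assumes "fam H"
 shows "cv ka (%b. Sum_any (%s. H s b)) b = Sum_any (%s. cv ka (H s) b)"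
proof -
 from assms obtain N where N: "!!b s. b >= N ==> H s b = 0" by (auto simp: fam_def)
 have "cv ka (%b. Sum_any (%s. H s b)) b = Sum_any (%i. Sum_any (%s. sc (fps_nth ka i) (H s (b + int i))))"
  by (simp add: cv_def Sum_any_fscale fam_evz assms)
 also have "... = Sum_any (%s. Sum_any (%i. sc (fps_nth ka i) (H s (b + int i))))"
  by (rule Sum_any_swap_nat[where N = "nat (N - b)"])
   (auto intro!: N evz_fscale fam_evz[OF assms])
 finally show ?thesis by (simp add: cv_def)
qed

definition bp :: "int => complex fps" where "bp m = fps_binomial (of_int m)"
text \<open>The expansion of (1 - Y)^k, as \<open>bp m\<close> is that of (1 + Y)^m; they occur for
  (x - y)^k expanded in y/x and for x^m = (y + z)^m expanded in z/y.\<close>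

definition bn :: "int => complex fps" where "bn k = Abs_fps (%i. (-1) ^ i * (of_int k gchoose i))"

lemma bp_nth [simp]: "fps_nth (bp m) i = of_int m gchoose i"
 by (simp add: bp_def)

lemma bn_nth [simp]: "fps_nth (bn k) i = (-1) ^ i * (of_int k gchoose i)"
 by (simp add: bn_def)

lemma bp_add: "bp (m + n) = bp m * bp n"
 by (simp add: bp_def fps_binomial_add_mult)

lemma bn_add: "bn (k + l) = bn k * bn l"
proof (rule fps_ext)
 fix i
 have "(\<Sum>j=0..i. ((-1) ^ j * (of_int k gchoose j)) * ((-1) ^ (i - j) * (of_int l gchoose (i - j))))
   = (\<Sum>j=0..i. (-1) ^ i * ((of_int k gchoose j) * (of_int l gchoose (i - j)) :: complex))"
  by (rule sum.cong) (auto simp: algebra_simps simp flip: power_add)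
 also have "... = (-1) ^ i * (of_int (k + l) gchoose i)"
  using gbinomial_Vandermonde[of "of_int k :: complex" "of_int l" i]
  by (simp add: sum_distrib_left[symmetric])
 finally show "fps_nth (bn (k + l)) i = fps_nth (bn k * bn l) i"
  by (simp add: fps_mult_nth)
qed

lemma bp_0 [simp]: "bp 0 = 1" and bn_0 [simp]: "bn 0 = 1"
 by (simp add: bp_def) (rule fps_ext, simp add: gbinomial_0_left)

lemma gbinomial_neg_nat:
 "(of_int (- int q - 1) gchoose s :: complex) = (-1) ^ s * of_nat ((q + s) choose s)"
proof -
 have "(of_int (- int q - 1) gchoose s :: complex) = (- (of_nat q + 1)) gchoose s" by simp
 also have "... = (-1) ^ s * ((of_nat q + 1 + of_nat s - 1) gchoose s)" by (rule gbinomial_minus)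
 also have "(of_nat q + 1 + of_nat s - 1 :: complex) = of_nat (q + s)" by simp
 finally show ?thesis by (simp only: binomial_gbinomial)
qed

lemma bn_neg_nth: "fps_nth (bn (- int q - 1)) s = of_nat ((q + s) choose s)"
 by (simp add: gbinomial_neg_nat[simplified] flip: power_add mult.assoc)

section \<open>Supports, charges and levels\<close>

definition supp :: "(nat multiset \<times> int) set => fock set" where
 "supp S = {v. keys v \<subseteq> S}"

definition chs :: "int set => fock set" where
 "chs K = supp {b. snd b \<in> K}"

text \<open>An entry \<open>i\<close> stands for \<alpha>(-i-1), hence the \<open>+ 1\<close>.
  Integer values let negative levels be named, and a vector of negative level is 0.\<close>

definition lev :: "nat multiset => int" where
 "lev mu = (\<Sum>i\<in>#mu. int i + 1)"

definition grd :: "int => int => fock set" where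
 "grd k N = supp {b. snd b = k \<and> lev (fst b) = N}"

lemma lev_simps [simp]: "lev {#} = 0" "lev (add_mset q mu) = lev mu + int q + 1"
 by (simp_all add: lev_def)

lemma lev_nonneg [simp]: "lev mu >= 0"
 by (induction mu) auto

lemma lev_diff: "q \<in># mu ==> lev (mu - {#q#}) = lev mu - int q - 1"
 by (auto dest!: multi_member_split)

lemma lev_eq_0_iff: "lev mu = 0 \<longleftrightarrow> mu = {#}"
proof (cases mu)
 case (add q \<nu>)
 with lev_nonneg[of \<nu>] have "lev mu ~= 0" by (simp del: lev_nonneg)
 with add show ?thesis by (metis add_mset_not_empty)
qed simp

lemma supp_0 [simp, intro]: "0 \<in> supp S"
 and supp_add [intro]: "u \<in> supp S ==> v \<in> supp S ==> u + v \<in> supp S"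
 and supp_scale [intro]: "u \<in> supp S ==> sc c u \<in> supp S"
 and supp_uminus [intro]: "u \<in> supp S ==> - u \<in> supp S"
 and supp_diff [intro]: "u \<in> supp S ==> v \<in> supp S ==> u - v \<in> supp S"
 by (auto simp: supp_def in_keys_iff lookup_add lookup_minus subset_iff) (metis add_0)+

lemma supp_sum [intro]: "(!!i. i \<in> A ==> f i \<in> supp S) ==> sum f A \<in> supp S"
 by (induction A rule: infinite_finite_induct) auto

lemma supp_Sum_any [intro]: "(!!i. f i \<in> supp S) ==> Sum_any f \<in> supp S"
 by (simp add: Sum_any.expand_set supp_sum)

lemma supp_mono: "S \<subseteq> T ==> supp S \<subseteq> supp T"
 by (auto simp: supp_def)

lemma supp_single: "b \<in> S ==> single b c \<in> supp S"
 by (auto simp: supp_def)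

lemma supp_flin:
 assumes "flin f" "!!b. b \<in> S ==> f (single b 1) \<in> supp T" "v \<in> supp S"
 shows "f v \<in> supp T"
proof -
 have "f v = (\<Sum>b\<in>keys v. sc (lookup v b) (f (single b 1)))"
  using arg_cong[OF fock_expand[of v], of f]
  by (simp add: flin_sum[OF assms(1)] flin_scale[OF assms(1)] del: fscale_single)
 also have "... \<in> supp T" using assms(2,3) unfolding supp_def[of S] by blast
 finally show ?thesis .
qed

lemma grd_add [intro]: "u \<in> grd k N ==> v \<in> grd k N ==> u + v \<in> grd k N"
 and grd_scale [intro]: "u \<in> grd k N ==> sc c u \<in> grd k N"
 and grd_0 [simp, intro]: "0 \<in> grd k N"
 and grd_sum [intro]: "(!!i. i \<in> A ==> f i \<in> grd k N) ==> sum f A \<in> grd k N"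
 and grd_Sum_any [intro]: "(!!i. f i \<in> grd k N) ==> Sum_any f \<in> grd k N"
 by (auto simp: grd_def)

lemma grd_keys: "v \<in> grd k N ==> b \<in> keys v ==> snd b = k \<and> lev (fst b) = N"
 unfolding grd_def supp_def by blast

lemma chs_keys: "v \<in> chs K ==> b \<in> keys v ==> snd b \<in> K"
 unfolding chs_def supp_def by blast

lemma fock_eq_0I: "(!!b. b \<notin> keys v) ==> v = (0 :: fock)"
 by (intro poly_mapping_eqI) (simp add: in_keys_iff)

lemma grd_neg: assumes "N < 0" "v \<in> grd k N" shows "v = 0"
proof (rule fock_eq_0I)
 fix b show "b \<notin> keys v"
  by (metis assms grd_keys lev_nonneg not_less)
qed

lemma chs_add [intro]: "u \<in> chs K ==> v \<in> chs K ==> u + v \<in> chs K"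
 and chs_scale [intro]: "u \<in> chs K ==> sc c u \<in> chs K"
 and chs_0 [simp, intro]: "0 \<in> chs K"
 and chs_sum [intro]: "(!!i. i \<in> A ==> f i \<in> chs K) ==> sum f A \<in> chs K"
 and chs_Sum_any [intro]: "(!!i. g i \<in> chs K) ==> Sum_any g \<in> chs K"
 by (auto simp: chs_def)

lemma grd_chs: "v \<in> grd k N ==> v \<in> chs {k}"
 unfolding grd_def chs_def using supp_mono[of "{b. snd b = k \<and> lev (fst b) = N}" "{b. snd b \<in> {k}}"] by auto

lemma chs_mono: "K \<subseteq> L ==> v \<in> chs K ==> v \<in> chs L"
 unfolding chs_def using supp_mono[of "{b. snd b \<in> K}" "{b. snd b \<in> L}"] by auto

lemma grd_single: "single (mu, k) c \<in> grd k (lev mu)"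
 by (auto simp: grd_def intro: supp_single)

lemma lat_exp_grd [intro]: "xp k \<in> grd k 0"
 using grd_single[of "{#}" k 1] by (simp add: lat_exp_def)

lemma grd_0_eq:
 assumes "v \<in> grd k 0"
 shows "v = sc (lookup v ({#}, k)) (xp k)"
proof (rule poly_mapping_eqI)
 fix b
 have "b \<in> keys v ==> b = ({#}, k)"
  using grd_keys[OF assms] by (auto simp: lev_eq_0_iff prod_eq_iff)
 then show "lookup v b = lookup (sc (lookup v ({#}, k)) (xp k)) b"
  by (auto simp: lat_exp_def lookup_single when_def in_keys_iff)
qed

lemma one_eq_lat_exp: "1 = xp 0"
 by (simp add: lat_exp_def flip: single_one) (simp add: zero_prod_def zero_multiset_def)

lemma charge_part_single:
 "charge_part l (single (mu, k) 1) = (if k = l then single (mu, k) 1 else 0)"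
 by (simp add: charge_part_def)

lemma flin_charge_part [intro]: "flin (charge_part l)"
 unfolding charge_part_def by (rule flin_lin_ext)

lemma charge_part_chs: "charge_part l v \<in> chs {l}"
 unfolding chs_def
 by (rule supp_flin[of _ UNIV]) (auto simp: charge_part_single intro!: supp_single, auto simp: supp_def)

lemma lookup_charge_part:
 "lookup (charge_part l v) b = (if snd b = l then lookup v b else 0)"
proof -
 have "lookup (charge_part l v) b
   = (\<Sum>x\<in>keys v. if x = b then (if snd b = l then lookup v b else 0) else 0)"
  unfolding charge_part_def lin_ext_def lookup_fsum
 proof (rule sum.cong[OF refl])
  fix x
  show "lookup (sc (lookup v x)
    (case x of (mu, l') => if l' = l then single (mu, l') 1 else 0)) b
   = (if x = b then (if snd b = l then lookup v b else 0) else 0)"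
   by (cases x; cases b) (auto simp: lookup_single when_def)
 qed
 then show ?thesis by (simp add: in_keys_iff)
qed

lemma charge_decomp:
 assumes "v \<in> chs K" "finite K" shows "v = (\<Sum>l\<in>K. charge_part l v)"
 using chs_keys[OF assms(1)] assms(2)
 by (intro poly_mapping_eqI) (auto simp: lookup_fsum lookup_charge_part in_keys_iff)

lemma charge_decomp': "v = (\<Sum>l\<in>snd ` keys v. charge_part l v)"
 by (rule charge_decomp) (auto simp: chs_def supp_def)

locale rank_one =
 fixes p :: nat
 assumes p2: "2 \<le> p"
begin

abbreviation "al \<equiv> heis p"
abbreviation "tp \<equiv> int (2 * p)"

lemma p0: "p > 0" "(of_nat p :: complex) ~= 0"
 using p2 by auto

lemma flin_heis [intro]: "flin (al n)"
 unfolding heis_def by (rule flin_lin_ext)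

lemma heis_single:
 "al n (single (mu, l) c) =
  (if n < 0 then single (add_mset (nat (- n - 1)) mu, l) c
   else if n = 0 then single (mu, l) (of_int l * c)
   else single (mu - {#nat (n - 1)#}, l) (2 * of_nat p * of_int n * of_nat (count mu (nat (n - 1))) * c))"
proof -
 have "single (mu, l) c = sc c (single (mu, l) 1)" by simp
 then have "al n (single (mu, l) c) = sc c (al n (single (mu, l) 1))"
  by (simp only: flin_scale[OF flin_heis])
 then show ?thesis by (auto simp: heis_def mult_ac)
qed

text \<open>This is the product rule: a positive mode differentiates, and one more oscillator of the
  matching index raises the count in \<open>heis\<close> by one, which is the scalar.\<close>

lemma heis_comm_pos_neg:
 assumes "m > 0" "n < 0"
 shows "al m (al n (single (mu, l) 1)) = al n (al m (single (mu, l) 1))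
  + (if m + n = 0 then sc (2 * of_nat p * of_int m) (single (mu, l) 1) else 0)"
proof -
 define r q where "r = nat (m - 1)" and "q = nat (- n - 1)"
 define c :: complex where "c = 2 * of_nat p * of_int m"
 have 1: "al m (al n (single (mu, l) 1))
   = single (add_mset q mu - {#r#}, l) (c * of_nat (count (add_mset q mu) r))"
  using assms by (simp add: heis_single r_def q_def c_def)
 have 2: "al n (al m (single (mu, l) 1))
   = single (add_mset q (mu - {#r#}), l) (c * of_nat (count mu r))"
  using assms by (simp add: heis_single r_def q_def c_def)
 show ?thesis
 proof (cases "m + n = 0")
  case True
  then have [simp]: "q = r" by (simp add: r_def q_def)
  have 3: "single (add_mset r (mu - {#r#}), l) (c * of_nat (count mu r))
   = single (mu, l) (c * of_nat (count mu r))"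
   by (cases "r \<in># mu") (simp_all add: not_in_iff)
  show ?thesis unfolding 1 2 using True
   by (simp add: 3 flip: c_def single_add) (simp add: algebra_simps)
 next
  case False
  then have "q ~= r" using assms by (simp add: r_def q_def nat_eq_iff)
  then show ?thesis unfolding 1 2 using False
   by (cases "r \<in># mu") (simp_all add: not_in_iff)
 qed
qed

lemma heis_comm:
 "al m (al n v) = al n (al m v) + (if m + n = 0 then sc (2 * of_nat p * of_int m) v else 0)"
proof (rule flin_eqI[where f = "%v. al m (al n v)"
   and g = "%v. al n (al m v) + (if m + n = 0 then sc (2 * of_nat p * of_int m) v else 0)"])
 show "flin (%v. al m (al n v))" by (rule flin_comp[OF flin_heis flin_heis])
 show "flin (%v. al n (al m v) + (if m + n = 0 then sc (2 * of_nat p * of_int m) v else 0))"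
  by (cases "m + n = 0") (simp_all add: flin_plus[OF flin_comp[OF flin_heis flin_heis] flin_fscale[OF flin_id]]
    flin_comp[OF flin_heis flin_heis])
next
 fix b :: "nat multiset \<times> int"
 obtain mu l where b: "b = (mu, l)" by (cases b)
 consider "m > 0" "n > 0" | "m > 0" "n < 0" | "m < 0" "n > 0" | "m < 0" "n < 0" | "m = 0" | "n = 0" by linarith
 then show "al m (al n (single b 1)) = al n (al m (single b 1))
   + (if m + n = 0 then sc (2 * of_nat p * of_int m) (single b 1) else 0)"
 proof cases
  case 1
  then show ?thesis
  proof (cases "m = n")
   case False
   then have "nat (m - 1) ~= nat (n - 1)" using 1 by simp
   then show ?thesis using 1
    by (simp add: b heis_single add_mset_commute mult_ac)
  qed simp
 next
  case 2 then show ?thesis unfolding b by (rule heis_comm_pos_neg)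
 next
  case 3
  have "of_int m = - (of_int n :: complex)" if "m + n = 0"
   using that by (simp add: eq_neg_iff_add_eq_0 flip: of_int_add)
  with heis_comm_pos_neg[OF 3(2,1), of mu l] show ?thesis unfolding b
   by (cases "m + n = 0") (simp_all add: add.commute[of n m], simp flip: single_add)
 next
  case 4 then show ?thesis by (simp add: b heis_single add_mset_commute)
 next
  case 5 then show ?thesis by (cases "n = 0") (simp_all add: b heis_single mult_ac)
 next
  case 6 then show ?thesis by (cases "m = 0") (simp_all add: b heis_single mult_ac)
 qed
qed

lemma heis_grd:
 assumes "v \<in> grd k N" shows "al n v \<in> grd k (N - n)"
 unfolding grd_def
proof (rule supp_flin[OF flin_heis])
 show "v \<in> supp {b. snd b = k \<and> lev (fst b) = N}" using assms by (simp add: grd_def)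
next
 fix b :: "nat multiset \<times> int" assume b: "b \<in> {b. snd b = k \<and> lev (fst b) = N}"
 obtain mu l where [simp]: "b = (mu, l)" by (cases b)
 show "al n (single b 1) \<in> supp {b. snd b = k \<and> lev (fst b) = N - n}"
 proof (cases "n > 0")
  case True
  show ?thesis
  proof (cases "nat (n - 1) \<in># mu")
   case in_mu: True
   then show ?thesis using b True by (auto simp: heis_single lev_diff intro!: supp_single)
  next
   case False
   then have "count mu (nat (n - 1)) = 0" by (simp add: not_in_iff)
   with True have "al n (single b 1) = 0" by (simp add: heis_single)
   then show ?thesis by simp
  qed
 qed (use b in \<open>auto simp: heis_single intro!: supp_single\<close>)
qed

lemma heis_chs:
 assumes "v \<in> chs K" shows "al n v \<in> chs K"
 unfolding chs_def
 by (rule supp_flin[OF flin_heis _ assms[unfolded chs_def]]) (auto simp: heis_single intro!: supp_single)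

lemma heis_zero: assumes "v \<in> chs {k}" shows "al 0 v = sc (of_int k) v"
proof (rule flin_eqI[of "al 0" "sc (of_int k)"])
 fix b assume "b \<in> keys v"
 with assms have "snd b = k" by (auto simp: chs_def supp_def)
 then show "al 0 (single b 1) = sc (of_int k) (single b 1)"
  by (cases b) (simp add: heis_single)
qed auto

lemma heis_lat_exp [simp]: "n > 0 ==> al n (xp k) = 0"
 by (simp add: lat_exp_def heis_single)

lemma evz_basis:
 assumes "!!j. flin (f j)" "!!b. evz (%j. f j (single b 1))"
 shows "evz (%j. f j v)"
proof -
 have "f j v = (\<Sum>b\<in>keys v. sc (lookup v b) (f j (single b 1)))" for j
  using arg_cong[OF fock_expand[of v], of "f j"]
  by (simp add: flin_sum[OF assms(1)] flin_scale[OF assms(1)] del: fscale_single)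
 then show ?thesis by (simp only:) (intro evz_sum evz_fscale assms(2))
qed

text \<open>Levels are nonnegative, so operators that lower the level by \<open>j\<close>, up to a
  constant depending on the charge, kill any basis vector once \<open>j\<close> is large; a general
  vector is a finite sum of basis vectors.\<close>

lemma evz_grd:
 assumes "!!j. flin (f j)" "!!j k N v. v \<in> grd k N ==> f j v \<in> grd (k + l) (N - int j + c k)"
 shows "evz (%j. f j v)"
proof (rule evz_basis[OF assms(1)])
 fix b :: "nat multiset \<times> int"
 obtain mu k where b: "b = (mu, k)" by (cases b)
 show "evz (%j. f j (single b 1))"
 proof (rule evzI[of "nat (lev mu + c k) + 1"])
  fix j assume j: "nat (lev mu + c k) + 1 \<le> j"
  show "f j (single b 1) = 0"
   by (rule grd_neg[OF _ assms(2)]) (use j in \<open>auto simp: b intro!: grd_single\<close>)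
 qed
qed

lemma heis_evz: "evz (%j. al (int j + c) v)"
 by (rule evz_grd[where l = 0 and c = "%_. - c"]) (auto simp: algebra_simps dest: heis_grd)

lemma fock_induct_single:
 assumes "P (xp k)" "!!q u. u \<in> chs {k} ==> P u ==> P (al (- int q - 1) u)"
 shows "P (single (mu, k) 1)"
proof (induction mu)
 case empty then show ?case using assms(1) by (simp add: lat_exp_def)
next
 case (add q mu)
 have "al (- int q - 1) (single (mu, k) 1) = single (add_mset q mu, k) 1"
  by (simp add: heis_single)
 moreover have "single (mu, k) 1 \<in> chs {k}" by (auto simp: chs_def intro: supp_single)
 ultimately show ?case using assms(2) add by metis
qed

text \<open>The Fock space is generated from the exponentials by the creation operators. Identities
  that are linear in a vector are reduced to exponentials through this rule.\<close>

lemma fock_induct [consumes 1, case_names exp heis zero add scale]: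
 assumes "v \<in> chs K"
 assumes "!!k. k \<in> K ==> P (xp k)"
  and "!!q u k. k \<in> K ==> u \<in> chs {k} ==> P u ==> P (al (- int q - 1) u)"
  and "P 0" "!!u v. P u ==> P v ==> P (u + v)" "!!c u. P u ==> P (sc c u)"
 shows "P v"
proof -
 have *: "P (single b 1)" if b: "b \<in> keys v" for b
 proof -
  obtain mu k where [simp]: "b = (mu, k)" by (cases b)
  have k: "k \<in> K" using assms(1) b by (auto simp: chs_def supp_def)
  show ?thesis unfolding \<open>b = (mu, k)\<close>
   by (rule fock_induct_single) (use k assms(2,3) in auto)
 qed
 have "P (\<Sum>b\<in>A. sc (lookup v b) (single b 1))"
  if "A \<subseteq> keys v" for A
 proof -
  have "finite A" using finite_subset[OF that finite_keys] .
  then show ?thesis using that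
   by (induction A rule: finite_induct) (auto simp: assms(4) simp del: fscale_single intro!: assms(5,6) *)
 qed
 from this[OF order_refl] show ?thesis using fock_expand[of v] by simp
qed

lemma fock_induct_UNIV [case_names exp heis zero add scale]:
 assumes "!!k. P (xp k)"
  and "!!q u k. u \<in> chs {k} ==> P u ==> P (al (- int q - 1) u)"
  and "P 0" "!!u v. P u ==> P v ==> P (u + v)" "!!c u. P u ==> P (sc c u)"
 shows "P v"
proof (rule fock_induct[of v UNIV])
 show "v \<in> chs UNIV" by (simp add: chs_def supp_def)
qed (use assms in auto)

end

section \<open>Exponentials of commuting operators\<close>

context
 fixes A :: "nat => fock => fock"
 assumes flin_A: "!!n. flin (A n)"
begin

lemma flin_opser_power: "flin (opser_power A j N)"
proof (induction j arbitrary: N)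
 case 0 then show ?case by (cases "N = 0") (auto simp: flin_def)
next
 case (Suc j)
 have "flin (%v. \<Sum>n = 1..N. A n (opser_power A j (N - n) v))"
  by (intro flin_setsum flin_comp[OF flin_A] Suc)
 then show ?case by (simp add: flin_def)
qed

lemma flin_opser_exp: "flin (opser_exp A N)"
proof -
 have "flin (%v. \<Sum>j\<le>N. sc (1 / fact j) (opser_power A j N v))"
  by (intro flin_setsum flin_fscale flin_opser_power)
 then show ?thesis by (simp add: opser_exp_def[abs_def])
qed

lemma opser_power_eq_0: "N < j ==> opser_power A j N v = 0"
 by (induction j arbitrary: N) (auto intro!: sum.neutral simp: flin_zero[OF flin_A])

lemma opser_exp_0 [simp]: "opser_exp A 0 v = v"
 by (simp add: opser_exp_def)

text \<open>\<open>B\<close> acts as a derivation with constant commutator \<open>c\<close> against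
  \<open>A r\<close>: in a j-th power each factor is replaced once, which removes x^r and leaves j
  copies of the (j-1)-th power.\<close>

lemma opser_power_comm:
 assumes "flin B" "!!n v. n >= 1 ==> B (A n v) = A n (B v) + (if n = r then sc c v else 0)" "r >= 1"
 shows "B (opser_power A j N v) = opser_power A j N (B v)
  + (if r \<le> N \<and> j > 0 then sc (of_nat j * c) (opser_power A (j - 1) (N - r) v) else 0)"
proof (induction j arbitrary: N)
 case 0 then show ?case by (auto simp: flin_zero[OF assms(1)])
next
 case (Suc j)
 have "B (opser_power A (Suc j) N v) = (\<Sum>n = 1..N. A n (B (opser_power A j (N - n) v))
   + (if n = r then sc c (opser_power A j (N - n) v) else 0))"
  by (simp add: flin_sum[OF assms(1)] assms(2))
 also have "... = (\<Sum>n = 1..N. A n (B (opser_power A j (N - n) v)))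
   + (if r \<le> N then sc c (opser_power A j (N - r) v) else 0)"
  using assms(3) by (simp add: sum.distrib sum.delta')
 also have "(\<Sum>n = 1..N. A n (B (opser_power A j (N - n) v)))
   = opser_power A (Suc j) N (B v)
    + (if r \<le> N then sc (of_nat j * c) (opser_power A j (N - r) v) else 0)"
 proof -
  have 1: "A n (B (opser_power A j (N - n) v)) = A n (opser_power A j (N - n) (B v))
   + (if r \<le> N - n \<and> 0 < j then sc (of_nat j * c) (A n (opser_power A (j - 1) (N - r - n) v)) else 0)" for n
   by (subst Suc) (simp add: flin_add[OF flin_A] flin_scale[OF flin_A] flin_zero[OF flin_A] diff_commute add.commute)
  have 2: "(\<Sum>n = 1..N. (if r \<le> N - n \<and> 0 < j then sc (of_nat j * c) (A n (opser_power A (j - 1) (N - r - n) v)) else 0))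
   = (if r \<le> N then sc (of_nat j * c) (opser_power A j (N - r) v) else 0)"
  proof (cases "r \<le> N \<and> 0 < j")
   case True
   then obtain j' where j': "j = Suc j'" by (cases j) auto
   have "(\<Sum>n = 1..N. (if r \<le> N - n \<and> 0 < j then sc (of_nat j * c) (A n (opser_power A (j - 1) (N - r - n) v)) else 0))
    = (\<Sum>n = 1..N - r. sc (of_nat j * c) (A n (opser_power A (j - 1) (N - r - n) v)))"
    using True assms(3) by (intro sum.mono_neutral_cong_right) auto
   then show ?thesis using True by (simp add: j' sc_sum)
  next
   case False
   then have "(\<Sum>n = 1..N. (if r \<le> N - n \<and> 0 < j then sc (of_nat j * c) (A n (opser_power A (j - 1) (N - r - n) v)) else 0)) = 0"
    by (intro sum.neutral) auto
   with False show ?thesis by auto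
  qed
  show ?thesis by (simp only: 1 sum.distrib 2) simp
 qed
 finally show ?case
  by (simp add: algebra_simps flip: sc_add_left)
qed

lemma opser_exp_comm:
 assumes "flin B" "!!n v. n >= 1 ==> B (A n v) = A n (B v) + (if n = r then sc c v else 0)" "r >= 1"
 shows "B (opser_exp A N v) = opser_exp A N (B v) + (if r \<le> N then sc c (opser_exp A (N - r) v) else 0)"
proof -
 have "B (opser_exp A N v) = opser_exp A N (B v)
  + (\<Sum>j\<le>N. sc (1 / fact j) (if r \<le> N \<and> j > 0 then sc (of_nat j * c) (opser_power A (j - 1) (N - r) v) else 0))"
  by (simp add: opser_exp_def flin_sum[OF assms(1)] flin_scale[OF assms(1)] opser_power_comm[OF assms]
    sc_add sum.distrib)
 also have "(\<Sum>j\<le>N. sc (1 / fact j) (if r \<le> N \<and> j > 0 then sc (of_nat j * c) (opser_power A (j - 1) (N - r) v) else 0))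
  = (if r \<le> N then sc c (opser_exp A (N - r) v) else 0)"
 proof (cases "r \<le> N")
  case True
  have "(\<Sum>j\<le>N. sc (1 / fact j) (if r \<le> N \<and> j > 0 then sc (of_nat j * c) (opser_power A (j - 1) (N - r) v) else 0))
   = (\<Sum>j\<in>{1..N}. sc (c / fact (j - 1)) (opser_power A (j - 1) (N - r) v))"
   by (rule sum.mono_neutral_cong_right) (use True in \<open>auto simp: fact_reduce\<close>)
  also have "... = (\<Sum>j<N. sc (c / fact j) (opser_power A j (N - r) v))"
   by (rule sum.reindex_bij_witness[where i = Suc and j = "%j. j - 1"]) auto
  also have "... = (\<Sum>j\<le>N - r. sc (c / fact j) (opser_power A j (N - r) v))"
   by (rule sum.mono_neutral_right) (use True assms(3) in \<open>auto simp: opser_power_eq_0\<close>)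
  finally show ?thesis using True by (simp add: opser_exp_def sc_sum)
 qed auto
 finally show ?thesis .
qed

text \<open>Coefficients of x d/dx A(x)^(j+1) = (j+1) (x A'(x)) A(x)^j. In the induction the factor
  N = n + (N - n) is divided between the first factor and the remaining power.\<close>

lemma opser_power_deriv:
 assumes "!!m n v. A m (A n v) = A n (A m v)"
 shows "sc (of_nat N) (opser_power A (Suc j) N v)
  = sc (of_nat (Suc j)) (\<Sum>n = 1..N. sc (of_nat n) (A n (opser_power A j (N - n) v)))"
proof (induction j arbitrary: N)
 case 0
 have "sc (of_nat N) (opser_power A (Suc 0) N v) = (\<Sum>n = 1..N. sc (of_nat N) (A n (if N - n = 0 then v else 0)))"
  by (simp add: sc_sum)
 also have "... = (\<Sum>n = 1..N. sc (of_nat n) (A n (if N - n = 0 then v else 0)))"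
  by (rule sum.cong) (auto simp: flin_zero[OF flin_A])
 finally show ?case by simp
next
 case (Suc j)
 have "sc (of_nat N) (opser_power A (Suc (Suc j)) N v)
  = (\<Sum>n = 1..N. sc (of_nat n) (A n (opser_power A (Suc j) (N - n) v))
    + A n (sc (of_nat (N - n)) (opser_power A (Suc j) (N - n) v)))"
  unfolding opser_power.simps(2)[of _ "Suc j"] sc_sum
  by (rule sum.cong) (auto simp: flin_scale[OF flin_A] simp flip: sc_add_left of_nat_add)
 also have "... = (\<Sum>n = 1..N. sc (of_nat n) (A n (opser_power A (Suc j) (N - n) v)))
   + (\<Sum>n = 1..N. A n (sc (of_nat (Suc j)) (\<Sum>m = 1..N - n. sc (of_nat m) (A m (opser_power A j (N - n - m) v)))))"
  by (simp only: sum.distrib Suc)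
 also have "(\<Sum>n = 1..N. A n (sc (of_nat (Suc j)) (\<Sum>m = 1..N - n. sc (of_nat m) (A m (opser_power A j (N - n - m) v)))))
  = sc (of_nat (Suc j)) (\<Sum>n = 1..N. \<Sum>m = 1..N - n. sc (of_nat m) (A m (A n (opser_power A j (N - n - m) v))))"
  by (simp add: flin_sum[OF flin_A] flin_scale[OF flin_A] sc_sum assms)
 also have "(\<Sum>n = 1..N. \<Sum>m = 1..N - n. sc (of_nat m) (A m (A n (opser_power A j (N - n - m) v))))
  = (\<Sum>m = 1..N. \<Sum>n = 1..N - m. sc (of_nat m) (A m (A n (opser_power A j (N - n - m) v))))"
  unfolding sum.Sigma[OF finite_atLeastAtMost ballI[OF finite_atLeastAtMost]]
  by (rule sum.reindex_bij_witness[where i = "%(m, n). (n, m)" and j = "%(n, m). (m, n)"]) auto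
 also have "... = (\<Sum>m = 1..N. sc (of_nat m) (A m (opser_power A (Suc j) (N - m) v)))"
  by (simp add: flin_sum[OF flin_A] sc_sum add.commute)
 finally have "sc (of_nat N) (opser_power A (Suc (Suc j)) N v)
  = (let x = (\<Sum>n = 1..N. sc (of_nat n) (A n (opser_power A (Suc j) (N - n) v)))
    in x + sc (of_nat (Suc j)) x)" by (simp only: Let_def)
 moreover have "sc (of_nat (Suc (Suc j))) x = x + sc (of_nat (Suc j)) x" for x
  by (subst of_nat_Suc) (simp only: sc_add_left fock.scale_one)
 ultimately show ?case by (simp only: Let_def)
qed

text \<open>Coefficients of x d/dx exp A = (x A') exp A. This recursion, rather than the expansion
  of the exponential, is what later computations with \<open>cre\<close> use.\<close>

lemma opser_exp_deriv:
 assumes "!!m n v. A m (A n v) = A n (A m v)"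
 shows "sc (of_nat N) (opser_exp A N v) = (\<Sum>n = 1..N. sc (of_nat n) (A n (opser_exp A (N - n) v)))"
proof -
 have "sc (of_nat N) (opser_exp A N v) = (\<Sum>j\<le>N. sc (1 / fact j) (sc (of_nat N) (opser_power A j N v)))"
  by (simp add: opser_exp_def sc_sum mult.commute)
 also have "... = (\<Sum>j\<in>{1..N}. sc (1 / fact j) (sc (of_nat N) (opser_power A j N v)))"
  by (rule sum.mono_neutral_right) (auto simp: not_le)
 also have "... = (\<Sum>j<N. sc (1 / fact (Suc j)) (sc (of_nat N) (opser_power A (Suc j) N v)))"
  by (rule sum.reindex_bij_witness[where i = Suc and j = "%j. j - 1"]) auto
 also have "... = (\<Sum>j<N. sc (1 / fact j) (\<Sum>n = 1..N. sc (of_nat n) (A n (opser_power A j (N - n) v))))"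
  unfolding opser_power_deriv[OF assms] sc_sc fact_Suc
  by (simp del: of_nat_Suc)
 also have "... = (\<Sum>n = 1..N. \<Sum>j<N. sc (1 / fact j) (sc (of_nat n) (A n (opser_power A j (N - n) v))))"
  unfolding sc_sum by (rule sum.swap)
 also have "... = (\<Sum>n = 1..N. sc (of_nat n) (A n (opser_exp A (N - n) v)))"
 proof (rule sum.cong, rule refl)
  fix n assume n: "n \<in> {1..N}"
  have "(\<Sum>j<N. sc (1 / fact j) (sc (of_nat n) (A n (opser_power A j (N - n) v))))
   = (\<Sum>j\<le>N - n. sc (1 / fact j) (sc (of_nat n) (A n (opser_power A j (N - n) v))))"
   by (rule sum.mono_neutral_right) (use n in \<open>auto simp: opser_power_eq_0 flin_zero[OF flin_A]\<close>)
  then show "(\<Sum>j<N. sc (1 / fact j) (sc (of_nat n) (A n (opser_power A j (N - n) v))))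
   = sc (of_nat n) (A n (opser_exp A (N - n) v))"
   by (simp add: opser_exp_def flin_sum[OF flin_A] flin_scale[OF flin_A] sc_sum mult.commute)
 qed
 finally show ?thesis .
qed

lemma opser_exp_grd:
 assumes "!!n k N v. v \<in> grd k N ==> A n v \<in> grd k (N + e * int n)" "v \<in> grd k M"
 shows "opser_exp A N v \<in> grd k (M + e * int N)"
proof -
 have "opser_power A j N v \<in> grd k (M + e * int N)" for j N
 proof (induction j arbitrary: N)
  case (Suc j)
  have "A n (opser_power A j (N - n) v) \<in> grd k (M + e * int N)" if "n \<in> {1..N}" for n
   using assms(1)[OF Suc[of "N - n"], of n] that by (simp add: algebra_simps of_nat_diff)
  then show ?case by (auto intro: grd_sum)
 qed (use assms(2) in auto)
 then show ?thesis by (auto simp: opser_exp_def)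
qed

end

context rank_one begin

section \<open>Modes of the exponentials\<close>

abbreviation "cre \<equiv> exp_creation p"
abbreviation "ann \<equiv> exp_annihilation p"

lemma flin_cre [intro]: "flin (cre k i)" and flin_ann [intro]: "flin (ann k i)"
 unfolding exp_creation_def[abs_def] exp_annihilation_def[abs_def]
 by (intro flin_opser_exp flin_fscale flin_heis)+

lemma cre_0 [simp]: "cre k 0 v = v" and ann_0 [simp]: "ann k 0 v = v"
 unfolding exp_creation_def exp_annihilation_def
 by (intro opser_exp_0 flin_fscale flin_heis)+

lemma grd_cong: "v \<in> grd k N ==> k = k' ==> N = N' ==> v \<in> grd k' N'"
 by simp

lemma heis_grd': "v \<in> grd k N ==> M = N - n ==> al n v \<in> grd k M"
 by (simp add: heis_grd)

lemma cre_grd: "v \<in> grd l N ==> cre k i v \<in> grd l (N + int i)"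
 unfolding exp_creation_def
 by (rule opser_exp_grd[where e = 1, unfolded mult_1]) (intro flin_fscale flin_heis grd_scale heis_grd'; simp)+

lemma ann_grd: "v \<in> grd l N ==> ann k i v \<in> grd l (N - int i)"
 unfolding exp_annihilation_def
 by (rule opser_exp_grd[where e = "- 1", unfolded mult_minus1 diff_conv_add_uminus[symmetric]])
  (intro flin_fscale flin_heis grd_scale heis_grd'; simp)+

lemma heis_cre:
 "al r (cre k i v) = cre k i (al r v) + (if 1 \<le> r \<and> nat r \<le> i then sc (of_int k) (cre k (i - nat r) v) else 0)"
proof (cases "1 \<le> r")
 case True
 show ?thesis
  unfolding exp_creation_def
  apply (subst opser_exp_comm[where r = "nat r" and c = "of_int k" and B = "al r"])
  subgoal by (intro flin_fscale flin_heis)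
  subgoal by (rule flin_heis)
  subgoal for n v
   using True p0 by (auto simp: flin_scale[OF flin_heis] heis_comm[of r] sc_add)
  using True by auto
next
 case False
 show ?thesis
  unfolding exp_creation_def
  apply (subst opser_exp_comm[where r = 1 and c = 0 and B = "al r"])
  subgoal by (intro flin_fscale flin_heis)
  subgoal by (rule flin_heis)
  subgoal for n v
   using False by (auto simp: flin_scale[OF flin_heis] flin_uminus[OF flin_heis] heis_comm[of r])
  using False by auto
qed

lemma heis_ann:
 "al r (ann k i v) = ann k i (al r v) + (if r \<le> -1 \<and> nat (- r) \<le> i then sc (of_int k) (ann k (i - nat (- r)) v) else 0)"
proof (cases "r \<le> -1")
 case True
 show ?thesis
  unfolding exp_annihilation_def
  apply (subst opser_exp_comm[where r = "nat (- r)" and c = "of_int k" and B = "al r"])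
  subgoal by (intro flin_fscale flin_heis)
  subgoal by (rule flin_heis)
  subgoal for n v
   using True p0 by (auto simp: flin_scale[OF flin_heis] flin_uminus[OF flin_heis] heis_comm[of r] sc_add)
  using True by auto
next
 case False
 show ?thesis
  unfolding exp_annihilation_def
  apply (subst opser_exp_comm[where r = 1 and c = 0 and B = "al r"])
  subgoal by (intro flin_fscale flin_heis)
  subgoal by (rule flin_heis)
  subgoal for n v
   using False by (auto simp: flin_scale[OF flin_heis] flin_uminus[OF flin_heis] heis_comm[of r])
  using False by auto
qed

lemma cre_deriv:
 "sc (of_nat i) (cre k i v) = (\<Sum>n = 1..i. sc (of_int k / of_nat (2 * p)) (al (- int n) (cre k (i - n) v)))"
proof -
 have "sc (of_nat i) (cre k i v) =
  (\<Sum>n = 1..i. sc (of_nat n) (sc (of_int k / of_nat (2 * p * n)) (al (- int n) (cre k (i - n) v))))"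
  unfolding exp_creation_def
 proof (rule opser_exp_deriv)
  show "flin (%v. sc (of_int k / of_nat (2 * p * n)) (al (- int n) v))" for n
   by (intro flin_fscale flin_heis)
 next
  fix m n and v :: fock
  have "al (- int m) (al (- int n) v) = al (- int n) (al (- int m) v)"
   by (subst heis_comm) auto
  then show "sc (of_int k / of_nat (2 * p * m)) (al (- int m) (sc (of_int k / of_nat (2 * p * n)) (al (- int n) v)))
   = sc (of_int k / of_nat (2 * p * n)) (al (- int n) (sc (of_int k / of_nat (2 * p * m)) (al (- int m) v)))"
   by (simp add: flin_scale[OF flin_heis] mult.commute)
 qed
 also have "... = (\<Sum>n = 1..i. sc (of_int k / of_nat (2 * p)) (al (- int n) (cre k (i - n) v)))"
  by (rule sum.cong) (auto simp: field_simps)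
 finally show ?thesis .
qed

text \<open>The creation factor has no negative powers of x; extending it by 0 to integer indices
  keeps index shifts free of case distinctions.\<close>

definition crez :: "int => int => fock => fock" where
 "crez k z v = (if z < 0 then 0 else cre k (nat z) v)"

lemma flin_crez [intro]: "flin (crez k z)"
 using flin_cre[of k "nat z"] by (cases "z < 0") (auto simp: crez_def flin_def)

lemma heis_crez:
 "al r (crez k z v) = crez k z (al r v) + (if 1 \<le> r then sc (of_int k) (crez k (z - r) v) else 0)"
 by (auto simp: crez_def flin_zero[OF flin_heis] heis_cre nat_diff_distrib)

lemma lat_exp_mult_single: "xp k * single (mu, l) c = single (mu, k + l) c"
 by (simp add: lat_exp_def mult_single)

lemma flin_lat_exp_mult [intro]: "flin (%v. xp k * v)"
 by (rule flin_mult[OF flin_id])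

lemma heis_lat_exp_mult:
 "al r (xp k * v) = xp k * al r v + (if r = 0 then sc (of_int k) (xp k * v) else 0)"
proof (rule flin_eqI[where f = "%v. al r (xp k * v)"
   and g = "%v. xp k * al r v + (if r = 0 then sc (of_int k) (xp k * v) else 0)"])
 show "flin (%v. al r (xp k * v))" by (rule flin_comp[OF flin_heis flin_lat_exp_mult])
 show "flin (%v. xp k * al r v + (if r = 0 then sc (of_int k) (xp k * v) else 0))"
  by (cases "r = 0") (simp_all add: flin_plus[OF flin_comp[OF flin_lat_exp_mult flin_heis] flin_fscale[OF flin_lat_exp_mult]]
    flin_comp[OF flin_lat_exp_mult flin_heis])
 fix b :: "nat multiset \<times> int"
 show "al r (xp k * single b 1) =
  xp k * al r (single b 1) + (if r = 0 then sc (of_int k) (xp k * single b 1) else 0)"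
  by (cases b) (auto simp: heis_single lat_exp_mult_single add.commute simp flip: single_add)
qed

lemma lat_exp_mult_grd: "v \<in> grd l N ==> xp k * v \<in> grd (k + l) N"
 unfolding grd_def
 by (erule supp_flin[OF flin_lat_exp_mult, rotated]) (auto simp: lat_exp_mult_single intro!: supp_single)

lemma lat_exp_mult: "xp k * xp l = xp (k + l)"
 by (simp add: lat_exp_def[of l] lat_exp_mult_single) (simp add: lat_exp_def)

lemma ann_evz: "evz (%j. ann k j v)"
 by (rule evz_grd[where l = 0 and c = "%_. 0"]) (auto dest: ann_grd)

lemma ann_lat_exp: "ann k j (xp l) = (if j = 0 then xp l else 0)"
 using grd_neg[OF _ ann_grd[OF lat_exp_grd[of l], of k j]] by auto

text \<open>\<open>e\<close> is the exponent \<open>kl/(2p)\<close> contributed by the charge \<open>l\<close> of the argument.\<close>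

definition ekc :: "int => int => int => fock => fock" where
 "ekc k e n w = Sum_any (%j. crez k (int j - n - 1 - e) (ann k j (xp k * w)))"

lemma ekc_evz: "evz (%j. crez k (int j - n - 1 - e) (ann k j x))"
proof -
 from ann_evz[of k x] obtain N where "!!j. j >= N ==> ann k j x = 0" by (metis evzE)
 then show ?thesis by (intro evzI[of N]) (simp add: flin_zero[OF flin_crez])
qed

lemma flin_ekc [intro]: "flin (ekc k e n)"
proof (rule flinI)
 fix x y
 show "ekc k e n (x + y) = ekc k e n x + ekc k e n y"
  unfolding ekc_def
  by (simp add: distrib_left flin_add[OF flin_ann] flin_add[OF flin_crez] Sum_any_add ekc_evz)
next
 fix c x
 show "ekc k e n (sc c x) = sc c (ekc k e n x)"
  unfolding ekc_def
  by (simp add: fscale_mult_right flin_scale[OF flin_ann] flin_scale[OF flin_crez] Sum_any_fscale ekc_evz)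
qed

text \<open>The extra term comes from the creation factor if r > 0, from the lattice translation if
  r = 0, and from the annihilation factor, after a shift of the summation index, if r < 0.\<close>

lemma heis_ekc: "al r (ekc k e n w) = ekc k e n (al r w) + sc (of_int k) (ekc k e (n + r) w)"
proof -
 define x where "x = xp k * w"
 have s: "al r (ekc k e n w) = Sum_any (%j. al r (crez k (int j - n - 1 - e) (ann k j x)))"
  unfolding ekc_def x_def by (rule Sum_any_flin[OF ekc_evz flin_heis])
 have e: "evz (%j. sc c (crez k (int j - m - 1 - e) (ann k j y)))" for c m y
  by (rule evz_fscale[OF ekc_evz])
 have x0: "ekc k e m w = Sum_any (%j. crez k (int j - m - 1 - e) (ann k j x))" for m
  by (simp add: ekc_def x_def)
 consider "r >= 1" | "r = 0" | "r \<le> -1" by linarith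
 then show ?thesis
 proof cases
  case 1
  then have x1: "al r x = xp k * al r w" by (simp add: x_def heis_lat_exp_mult)
  have "al r (crez k (int j - n - 1 - e) (ann k j x)) = crez k (int j - n - 1 - e) (ann k j (al r x))
    + sc (of_int k) (crez k (int j - (n + r) - 1 - e) (ann k j x))" for j
   using 1 by (simp add: heis_crez heis_ann algebra_simps)
  note h = this
  show ?thesis unfolding s h
   by (simp add: Sum_any_add ekc_evz e Sum_any_fscale x0 x1 ekc_def[of k e n "al r w"])
 next
  case 2
  then have x1: "al r x = xp k * al r w + sc (of_int k) x" by (simp add: x_def heis_lat_exp_mult)
  have "al r (crez k (int j - n - 1 - e) (ann k j x)) = crez k (int j - n - 1 - e) (ann k j (xp k * al r w))
    + sc (of_int k) (crez k (int j - (n + r) - 1 - e) (ann k j x))" for j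
   using 2 unfolding heis_crez heis_ann x1
   by (simp add: flin_add[OF flin_crez] flin_add[OF flin_ann] flin_scale[OF flin_crez] flin_scale[OF flin_ann])
  note h = this
  show ?thesis unfolding s h
   by (simp add: Sum_any_add ekc_evz e Sum_any_fscale x0 x1 ekc_def[of k e n "al r w"])
 next
  case 3
  define R where "R = nat (- r)"
  have x1: "al r x = xp k * al r w" using 3 by (simp add: x_def heis_lat_exp_mult)
  have "al r (crez k (int j - n - 1 - e) (ann k j x)) = crez k (int j - n - 1 - e) (ann k j (al r x))
    + sc (of_int k) (if R \<le> j then crez k (int j - n - 1 - e) (ann k (j - R) x) else 0)" for j
   using 3 by (simp add: heis_crez heis_ann R_def flin_add[OF flin_crez] flin_scale[OF flin_crez] flin_zero[OF flin_crez])
  moreover have ev: "evz (%j. if R \<le> j then crez k (int j - n - 1 - e) (ann k (j - R) x) else 0)"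
  proof -
   from ann_evz[of k x] obtain N where "!!j. j >= N ==> ann k j x = 0" by (metis evzE)
   then show ?thesis by (intro evzI[of "N + R"]) (simp add: flin_zero[OF flin_crez])
  qed
  moreover have "Sum_any (%j. if R \<le> j then crez k (int j - n - 1 - e) (ann k (j - R) x) else 0)
   = ekc k e (n + r) w"
   unfolding x0 using 3
   by (subst Sum_any_shift[of R]) (auto simp: R_def algebra_simps)
  ultimately show ?thesis unfolding s
   by (simp add: Sum_any_add ekc_evz evz_fscale[OF ev] Sum_any_fscale[OF ev] x1 ekc_def)
 qed
qed

text \<open>An integer mode index sees only charges \<open>l\<close> for which kl/(2p) is integral,
  and on those the creation index \<open>i\<close> is determined by \<open>j\<close>.\<close>

lemma exp_index_iff:
 "of_nat i - of_nat j + of_int (k * l) / of_nat (2 * p) = - of_int n - (1 :: rat) \<longleftrightarrow>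
  tp dvd k * l \<and> int i = int j - n - 1 - k * l div tp"
 (is "?L \<longleftrightarrow> ?R")
proof
 have p: "(of_nat (2 * p) :: rat) ~= 0" using p2 by simp
 assume ?L
 then have "of_int (k * l) / of_nat (2 * p) = (of_int (int j - int i - n - 1) :: rat)" by simp
 then have "(of_int (k * l) :: rat) = of_int (int j - int i - n - 1) * of_nat (2 * p)"
  using p by (simp only: nonzero_divide_eq_eq[OF p])
 then have "(of_int (k * l) :: rat) = of_int (tp * (int j - int i - n - 1))"
  by (simp add: mult.commute)
 then have *: "k * l = tp * (int j - int i - n - 1)" by (simp only: of_int_eq_iff)
 then have "k * l div tp = int j - int i - n - 1" using p2 by simp
 with * show ?R by simp
next
 assume R: ?R
 then obtain d where d: "k * l = tp * d" by (auto elim: dvdE)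
 then have "k * l div tp = d" using p2 by simp
 with R have "int i - int j + d = - n - 1" by simp
 then have *: "(of_int (int i - int j + d) :: rat) = of_int (- n - 1)" by simp
 have "of_int (k * l) / of_nat (2 * p) = (of_int d :: rat)" using p2 by (simp only: d) simp
 with * show ?L by simp
qed

text \<open>The modes of integer index. On charges where the powers of x are not integral the value
  is 0, which is what the index condition in \<open>exp_mode\<close> produces.\<close>

definition ek :: "int => int => fock => fock" where
 "ek k n = lin_ext (%b. if tp dvd k * snd b then ekc k (k * snd b div tp) n (single b 1) else 0)"

lemma flin_ek [intro]: "flin (ek k n)"
 unfolding ek_def by (rule flin_lin_ext)

lemma ek_chs:
 assumes "w \<in> chs {c}"
 shows "ek k n w = (if tp dvd k * c then ekc k (k * c div tp) n w else 0)"
proof (rule flin_eqI[where f = "ek k n"])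
 show "flin (%w. if tp dvd k * c then ekc k (k * c div tp) n w else 0)"
  by (cases "tp dvd k * c") (simp_all add: flin_ekc flin_0)
 fix b assume "b \<in> keys w"
 with assms have "snd b = c" by (auto dest: chs_keys)
 then show "ek k n (single b 1) = (if tp dvd k * c then ekc k (k * c div tp) n (single b 1) else 0)"
  by (simp add: ek_def)
qed auto

lemma exp_mode_eq: "exp_mode p k (of_int n) w = ek k n w"
proof -
 define L where "L = snd ` keys w"
 define e where "e l = k * l div tp" for l
 define x where "x l = xp k * charge_part l w" for l
 have "\<forall>l. \<exists>J. ALL j>=J. ann k j (x l) = 0" using ann_evz by (auto simp: evz_def)
 then obtain J where J: "!!l j. j >= J l ==> ann k j (x l) = 0" by metis
 define f where "f = (%(l, i, j). if of_nat i - of_nat j + of_int (k * l) / of_nat (2 * p) = - of_int n - (1 :: rat)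
   then cre k i (ann k j (x l)) else 0)"
 \<comment> \<open>The index condition forces \<open>i\<close>; \<open>g\<close> inserts it, so the
   triple sum becomes a finite double sum. Where the forced value is negative, \<open>nat\<close>
   truncates it, the condition fails and the term is 0.\<close>
 define g where "g = (%(l, j). (l, nat (int j - n - 1 - e l), j :: nat))"
 define S where "S = (SIGMA l : L. {..<J l})"
 have fin: "finite S" by (auto simp: S_def L_def)
 have xL: "x l = 0" if "l \<notin> L" for l
 proof -
  have "charge_part l w = 0"
  proof (rule fock_eq_0I)
   fix b show "b \<notin> keys (charge_part l w)"
    using that by (auto simp: in_keys_iff lookup_charge_part L_def image_iff)
  qed
  then show ?thesis by (simp add: x_def)
 qed
 have "exp_mode p k (of_int n) w = Sum_any f"
  by (simp add: exp_mode_def f_def x_def cong: if_cong)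
 also have "... = sum f (g ` S)"
 proof (rule Sum_any.expand_superset)
  show "finite (g ` S)" using fin by simp
  show "{a. f a ~= 0} \<subseteq> g ` S"
  proof
   fix a assume "a \<in> {a. f a ~= 0}"
   moreover obtain l i j where [simp]: "a = (l, i, j)" by (cases a)
   ultimately have "f (l, i, j) ~= 0" by simp
   then have *: "int i = int j - n - 1 - e l" and "cre k i (ann k j (x l)) ~= 0"
    unfolding f_def case_prod_conv exp_index_iff e_def by (auto split: if_splits)
   then have "ann k j (x l) ~= 0" by (auto simp: flin_zero[OF flin_cre])
   then have "l \<in> L" "j < J l"
    using xL[of l] J[of l j] by (metis flin_zero[OF flin_ann], metis not_less)
   moreover have "i = nat (int j - n - 1 - e l)" using * by linarith
   ultimately show "a \<in> g ` S" by (auto simp: S_def g_def image_iff)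
  qed
 qed
 also have "... = (\<Sum>y\<in>S. f (g y))"
  by (rule sum.reindex_cong[where l = g]) (auto simp: g_def inj_on_def)
 also have "... = (\<Sum>l\<in>L. \<Sum>j<J l. f (g (l, j)))"
  unfolding S_def by (subst sum.Sigma) (auto simp: L_def)
 also have "... = (\<Sum>l\<in>L. if tp dvd k * l then ekc k (e l) n (charge_part l w) else 0)"
 proof (rule sum.cong[OF refl])
  fix l
  have fg: "f (g (l, j)) = (if tp dvd k * l then crez k (int j - n - 1 - e l) (ann k j (x l)) else 0)" for j
  proof (cases "int j - n - 1 - e l < 0")
   case True
   then have "int (nat (int j - n - 1 - e l)) ~= int j - n - 1 - e l" by linarith
   with True show ?thesis by (simp only: f_def g_def case_prod_conv exp_index_iff e_def[symmetric]) (simp add: crez_def)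
  next
   case False
   then have "int (nat (int j - n - 1 - e l)) = int j - n - 1 - e l" by linarith
   then show ?thesis
    by (simp only: f_def g_def case_prod_conv exp_index_iff e_def[symmetric]) (use False in \<open>simp add: crez_def\<close>)
  qed
  have "ekc k (e l) n (charge_part l w) = (\<Sum>j<J l. crez k (int j - n - 1 - e l) (ann k j (x l)))"
   unfolding ekc_def x_def[symmetric]
   by (rule Sum_any_nat) (simp add: J flin_zero[OF flin_crez])
  then show "(\<Sum>j<J l. f (g (l, j))) = (if tp dvd k * l then ekc k (e l) n (charge_part l w) else 0)"
   by (simp add: fg)
 qed
 also have "... = (\<Sum>l\<in>L. ek k n (charge_part l w))"
  by (simp only: ek_chs[OF charge_part_chs] e_def)
 also have "... = ek k n w"
  using charge_decomp'[of w] by (simp add: L_def flip: flin_sum[OF flin_ek])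
 finally show ?thesis .
qed

lemma heis_ek: "al r (ek k n w) = ek k n (al r w) + sc (of_int k) (ek k (n + r) w)"
proof (rule flin_eqI[where f = "%w. al r (ek k n w)" and g = "%w. ek k n (al r w) + sc (of_int k) (ek k (n + r) w)"])
 fix b :: "nat multiset \<times> int"
 let ?w = "single b (1 :: complex)"
 have w: "?w \<in> chs {snd b}" by (auto simp: chs_def intro: supp_single)
 show "al r (ek k n ?w) = ek k n (al r ?w) + sc (of_int k) (ek k (n + r) ?w)"
  by (simp add: ek_chs[OF w] ek_chs[OF heis_chs[OF w]] heis_ekc flin_zero[OF flin_heis])
qed (intro flin_comp[OF flin_heis flin_ek] flin_plus[OF flin_comp[OF flin_ek flin_heis] flin_fscale[OF flin_ek]])+

lemma ek_grd:
 assumes "w \<in> grd c M" shows "ek k n w \<in> grd (k + c) (M - n - 1 - k * c div tp)"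
proof -
 have "crez k (int j - n - 1 - e) (ann k j (xp k * w)) \<in> grd (k + c) (M - n - 1 - e)" for j e
  by (auto simp: crez_def intro!: grd_cong[OF cre_grd[OF ann_grd[OF lat_exp_mult_grd[OF assms]]]])
 then show ?thesis
  by (simp add: ek_chs[OF grd_chs[OF assms]] ekc_def grd_Sum_any)
qed

section \<open>Fields and normally ordered products\<close>

definition fld :: "(int => fock => fock) => bool" where
 "fld B \<longleftrightarrow> (\<forall>n. flin (B n)) \<and> (\<forall>w. bdd (%n. B n w))"

lemma fld_flin: "fld B ==> flin (B n)" and fld_bdd: "fld B ==> bdd (%n. B n w)"
 by (auto simp: fld_def)

lemma fld_ek: "fld (ek k)"
 unfolding fld_def
proof (intro conjI allI)
 fix w
 have *: "\<exists>N. ALL n>=N. ek k n (single b 1) = 0" for b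
 proof -
  obtain mu c where [simp]: "b = (mu, c)" by (cases b)
  have "ek k n (single b 1) = 0" if "n >= lev mu - k * c div tp" for n
   by (rule grd_neg[OF _ ek_grd[OF grd_single[of mu c, folded \<open>b = (mu, c)\<close>]]]) (use that in simp)
  then show ?thesis by blast
 qed
 then obtain N where N: "!!b n. n >= N b ==> ek k n (single b 1) = 0" by metis
 have "ek k n w = (\<Sum>b\<in>keys w. sc (lookup w b) (ek k n (single b 1)))" for n
  by (simp add: ek_def) (simp add: lin_ext_def)
 moreover have "bdd (%n. \<Sum>b\<in>keys w. sc (lookup w b) (ek k n (single b 1)))"
 proof (rule bdd_sum)
  fix b show "bdd (%n. sc (lookup w b) (ek k n (single b 1)))"
   by (rule bddI[of "N b"]) (simp add: N)
 qed
 ultimately show "bdd (%n. ek k n w)" by simp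
qed auto

lemma fld_sum: "(!!i. i \<in> A ==> fld (B i)) ==> fld (%n w. \<Sum>i\<in>A. B i n w)"
 by (auto simp: fld_def intro!: flin_setsum bdd_sum)

lemma fld_fscale: "fld B ==> fld (%n w. sc c (B n w))"
 unfolding fld_def using bdd_flin[OF _ flin_fscale[OF flin_id]] by (blast intro: flin_fscale)

text \<open>Only finitely many of the vectors \<open>al (int i) w\<close> are nonzero, so finitely
  many truncation bounds have to be respected.\<close>

lemma fld_uniform:
 assumes "fld B" shows "\<exists>M. \<forall>i n. n >= M --> B n (al (int i) w) = 0"
proof -
 from heis_evz[of 0 w] obtain I where I: "!!i. i >= I ==> al (int i) w = 0" by (auto simp: evz_def)
 have "\<forall>i. \<exists>N. ALL n>=N. B n (al (int i) w) = 0" using fld_bdd[OF assms] by (auto simp: bdd_def)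
 then obtain N where N: "!!i n. n >= N i ==> B n (al (int i) w) = 0" by metis
 have "B n (al (int i) w) = 0" if "n >= Max (insert 0 (N ` {..<I}))" for i n
 proof (cases "i < I")
  case True
  then have "N i \<le> Max (insert 0 (N ` {..<I}))" by (intro Max_ge) auto
  then show ?thesis using that by (intro N) (rule order_trans)
 qed (use I flin_zero[OF fld_flin[OF assms]] in auto)
 then show ?thesis by blast
qed

definition bc :: "nat => nat => complex" where "bc q j = of_nat ((q + j) choose q)"

lemma bc_eq: "bc q j = of_nat ((q + j) choose j)"
 unfolding bc_def by (subst binomial_symmetric) auto

definition nop :: "nat => (int => fock => fock) => int => fock => fock" where
 "nop q B n w = Sum_any (%j. sc (bc q j) (al (- int q - 1 - int j) (B (n + int j) w)
   + sc ((- 1) ^ q) (B (n - int j - int q - 1) (al (int j) w))))"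

lemma nop_evz1:
 assumes "fld B" shows "evz (%j. al (- int q - 1 - int j) (B (n + int j) w))"
proof -
 from fld_bdd[OF assms] obtain N where "!!n. n >= N ==> B n w = 0" by (metis bddE)
 then show ?thesis by (intro evzI[of "nat (N - n)"]) (auto simp: flin_zero[OF flin_heis])
qed

lemma nop_evz2:
 assumes "!!n. flin (B n)" shows "evz (%j. sc c (B (n - int j - int q - 1) (al (int j) w)))"
proof -
 from heis_evz[of 0 w] obtain I where I: "!!i. i >= I ==> al (int i) w = 0" by (auto simp: evz_def)
 then show ?thesis by (intro evzI[of I]) (simp add: flin_zero[OF assms])
qed

lemma nop_evz:
 assumes "fld B"
 shows "evz (%j. sc (bc q j) (al (- int q - 1 - int j) (B (n + int j) w)
   + sc ((- 1) ^ q) (B (n - int j - int q - 1) (al (int j) w))))"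
 by (intro evz_fscale evz_add nop_evz1[OF assms] nop_evz2 fld_flin[OF assms])

lemma flin_nop: assumes "fld B" shows "flin (nop q B n)"
proof (rule flinI)
 fix x y
 show "nop q B n (x + y) = nop q B n x + nop q B n y"
  unfolding nop_def
  by (subst Sum_any_add[symmetric, OF nop_evz[OF assms] nop_evz[OF assms]])
   (simp add: flin_add[OF flin_heis] flin_add[OF fld_flin[OF assms]] algebra_simps)
next
 fix c x
 show "nop q B n (sc c x) = sc c (nop q B n x)"
  unfolding nop_def
  by (subst Sum_any_fscale[symmetric, OF nop_evz[OF assms]])
   (simp add: flin_scale[OF flin_heis] flin_scale[OF fld_flin[OF assms]] algebra_simps)
qed

lemma fld_nop: assumes "fld B" shows "fld (nop q B)"
 unfolding fld_def
proof (intro conjI allI)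
 fix w
 from fld_bdd[OF assms] obtain N where N: "!!n. n >= N ==> B n w = 0" by (metis bddE)
 from fld_uniform[OF assms] obtain M where M: "!!i n. n >= M ==> B n (al (int i) w) = 0" by blast
 from heis_evz[of 0 w] obtain I where I: "!!i. i >= I ==> al (int i) w = 0" by (auto simp: evz_def)
 have "nop q B n w = 0" if "n >= max N (M + int I + int q + 1)" for n
 proof -
  have "B (n - int j - int q - 1) (al (int j) w) = 0" for j
   using that by (cases "j < I") (auto intro!: M simp: I flin_zero[OF fld_flin[OF assms]])
  moreover have "B (n + int j) w = 0" for j using that by (intro N) auto
  ultimately show ?thesis by (simp add: nop_def flin_zero[OF flin_heis])
 qed
 then show "bdd (%n. nop q B n w)" by (rule bddI)
qed (rule flin_nop[OF assms])

text \<open>Creation modes stand on the left and commute with each other, nonnegative modes stand on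
  the right and commute with each other, so the two double sums have the same terms \<open>F\<close>
  with exchanged indices. Hence the modes of a monomial do not depend on the order of the list that
  encodes it.\<close>

lemma nop_commute:
 assumes B: "fld B" shows "nop q (nop r B) n w = nop r (nop q B) n w"
proof -
 define F where "F q r j i = sc (bc q j * bc r i)
   ((al (- int q - 1 - int j) (al (- int r - 1 - int i) (B (n + int j + int i) w))
   + sc ((-1) ^ r) (al (- int q - 1 - int j) (B (n + int j - int i - int r - 1) (al (int i) w))))
   + (sc ((-1) ^ q) (al (- int r - 1 - int i) (B (n - int j - int q - 1 + int i) (al (int j) w)))
   + sc ((-1) ^ (q + r)) (B (n - int j - int q - 1 - int i - int r - 1) (al (int i) (al (int j) w)))))" for q r j i
 note lin = flin_add[OF flin_heis] flin_scale[OF flin_heis] flin_zero[OF flin_heis]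
  flin_add[OF fld_flin[OF B]] flin_scale[OF fld_flin[OF B]] flin_zero[OF fld_flin[OF B]]
 have com: "al (- int q - 1 - int j) (al (- int r - 1 - int i) x) = al (- int r - 1 - int i) (al (- int q - 1 - int j) x)"
  "al (int i) (al (int j) x) = al (int j) (al (int i) x)" for q j r i x
  by (subst heis_comm; auto)+
 have exp: "nop q (nop r B) n w = Sum_any (%j. Sum_any (F q r j))" for q r
  unfolding nop_def[of q "nop r B"]
 proof (rule Sum_any.cong)
  fix j
  define f where "f i = sc (bc r i) (al (- int q - 1 - int j) (al (- int r - 1 - int i) (B (n + int j + int i) w))
    + sc ((-1) ^ r) (al (- int q - 1 - int j) (B (n + int j - int i - int r - 1) (al (int i) w))))" for i
  define g where "g i = sc (bc r i) (sc ((-1) ^ q) (al (- int r - 1 - int i) (B (n - int j - int q - 1 + int i) (al (int j) w)))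
   + sc ((-1) ^ (q + r)) (B (n - int j - int q - 1 - int i - int r - 1) (al (int i) (al (int j) w))))" for i
  have 1: "al (- int q - 1 - int j) (nop r B (n + int j) w) = Sum_any f"
   unfolding nop_def f_def by (subst Sum_any_flin[OF nop_evz[OF B] flin_heis]) (simp add: lin)
  have 2: "sc ((- 1) ^ q) (nop r B (n - int j - int q - 1) (al (int j) w)) = Sum_any g"
   unfolding nop_def g_def
   by (subst Sum_any_flin[OF nop_evz[OF B] flin_fscale[OF flin_id]]) (simp add: sc_add mult_ac power_add)
  have ef: "evz f"
   using evz_flin[OF nop_evz[OF B, of r "n + int j" w] flin_heis[of "- int q - 1 - int j"]]
   by (simp add: lin f_def[abs_def])
  have eg: "evz g"
   using evz_flin[OF nop_evz[OF B, of r "n - int j - int q - 1" "al (int j) w"] flin_fscale[OF flin_id, of "(-1) ^ q"]]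
   by (simp add: g_def[abs_def] sc_add mult_ac power_add)
  have "F q r j = (%i. sc (bc q j) (f i + g i))"
   by (intro ext) (simp add: F_def f_def g_def sc_add mult_ac add_ac)
  then show "sc (bc q j) (al (- int q - 1 - int j) (nop r B (n + int j) w) +
       sc ((- 1) ^ q) (nop r B (n - int j - int q - 1) (al (int j) w))) = Sum_any (F q r j)"
   by (simp only: 1 2 Sum_any_fscale[OF evz_add[OF ef eg]] Sum_any_add[OF ef eg])
 qed
 from fld_bdd[OF B] obtain N where N: "!!n. n >= N ==> B n w = 0" by (metis bddE)
 from fld_uniform[OF B] obtain M where M: "!!i n. n >= M ==> B n (al (int i) w) = 0" by blast
 from heis_evz[of 0 w] obtain I where I: "!!i. i >= I ==> al (int i) w = 0" by (auto simp: evz_def)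
 have z: "F q r j i = 0" if "j >= nat (N - n) + nat (M - n + int I + int r + 1) + I" for j i
 proof -
  have 1: "B (n + int j + int i) w = 0" using that by (intro N) linarith
  have 2: "B (n + int j - int i - int r - 1) (al (int i) w) = 0"
  proof (cases "i < I")
   case True then show ?thesis using that by (intro M) linarith
  qed (simp add: I lin)
  have 3: "al (int j) w = 0" using that by (intro I) linarith
  show ?thesis by (simp add: F_def 1 2 3 lin)
 qed
 have z': "evz (F q r j)" for j
 proof (rule evzI)
  fix i assume i: "i >= nat (N - n) + I + nat (M - n + int j + int q + 1)"
  have 1: "B (n + int j + int i) w = 0" using i by (intro N) linarith
  have 2: "B (n - int j - int q - 1 + int i) (al (int j) w) = 0" using i by (intro M) linarith
  have 3: "al (int i) w = 0" using i by (intro I) linarith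
  have 4: "al (int i) (al (int j) w) = 0" by (simp add: com(2)[of i j] 3 lin)
  show "F q r j i = 0" by (simp add: F_def 1 2 3 4 lin)
 qed
 have "Sum_any (%j. Sum_any (F q r j)) = Sum_any (%i. Sum_any (%j. F q r j i))"
  by (rule Sum_any_swap_nat[OF z z'])
 also have "(%i. Sum_any (%j. F q r j i)) = (%i. Sum_any (%j. F r q i j))"
 proof (intro ext Sum_any.cong)
  fix i j
  show "F q r j i = F r q i j"
   unfolding F_def com(1)[of q j r i] com(2)[of i j w] by (simp add: algebra_simps)
 qed
 finally show ?thesis by (simp add: exp)
qed

definition mm :: "nat list => int => int => fock => fock" where
 "mm ms k n w = mon_mode p ms k (of_int n) w"

lemma mm_Nil: "mm [] k = ek k"
 by (intro ext) (simp add: mm_def exp_mode_eq)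

lemma mm_Cons: "mm (m # ms) k = nop m (mm ms k)"
proof (intro ext)
 fix n w
 have *: "(of_int n + of_nat j :: rat) = of_int (n + int j)"
  "(of_int n - of_nat j - of_nat m - 1 :: rat) = of_int (n - int j - int m - 1)" for j by simp_all
 show "mm (m # ms) k n w = nop m (mm ms k) n w"
  unfolding mm_def nop_def mon_mode.simps * bc_def ..
qed

lemma fld_mm: "fld (mm ms k)"
 by (induction ms) (auto simp: mm_Nil mm_Cons fld_ek fld_nop)

lemma mm_remove1: "x \<in> set xs ==> mm xs k = nop x (mm (remove1 x xs) k)"
proof (induction xs)
 case (Cons y ys)
 show ?case
 proof (cases "x = y")
  case False
  with Cons have "mm (y # ys) k = nop y (nop x (mm (remove1 x ys) k))" by (simp add: mm_Cons)
  also have "... = nop x (nop y (mm (remove1 x ys) k))" by (intro ext nop_commute fld_mm)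
  finally show ?thesis using False by (simp add: mm_Cons)
 qed (simp add: mm_Cons)
qed simp

lemma mm_perm: "mset xs = mset ys ==> mm xs k = mm ys k"
proof (induction xs arbitrary: ys)
 case (Cons x xs)
 from Cons.prems have "x \<in> set ys" by (metis list.set_intros(1) mset_eq_setD)
 moreover have "mset xs = mset (remove1 x ys)" using Cons.prems by (simp flip: Cons.prems)
 ultimately show ?case using Cons.IH[of "remove1 x ys"] by (simp add: mm_Cons mm_remove1[of x ys])
qed simp

definition md :: "fock => int => fock => fock" where
 "md u n w = lat_mode p u (of_int n) w"

lemma md_lin_ext: "md u n w = lin_ext (%(mu, k). mm (sorted_list_of_multiset mu) k n w) u"
 unfolding md_def lat_mode_def lin_ext_def mm_def
 by (rule sum.cong) (auto simp: case_prod_beta)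

lemma flin_md1: "flin (%u. md u n w)"
 unfolding md_lin_ext by (rule flin_lin_ext)

lemma md_single: "md (single (mu, k) 1) = mm (sorted_list_of_multiset mu) k"
 by (intro ext) (simp add: md_lin_ext)

lemma md_lat_exp: "md (xp k) = ek k"
 by (simp add: lat_exp_def md_single mm_Nil)

lemma fld_md: "fld (md u)"
proof -
 have "md u = (%n w. \<Sum>b\<in>keys u. sc (lookup u b) (mm (sorted_list_of_multiset (fst b)) (snd b) n w))"
  by (intro ext) (simp add: md_lin_ext lin_ext_def case_prod_beta)
 then show ?thesis by (simp only:) (intro fld_sum fld_fscale fld_mm)
qed

lemma flin_md2: "flin (md u n)" and bdd_md: "bdd (%n. md u n w)"
 by (rule fld_flin[OF fld_md], rule fld_bdd[OF fld_md])

lemma flin_nop1: "flin (%u. nop q (md u) n w)"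
proof (rule flinI)
 fix x y
 show "nop q (md (x + y)) n w = nop q (md x) n w + nop q (md y) n w"
  unfolding nop_def
  by (subst Sum_any_add[symmetric, OF nop_evz[OF fld_md] nop_evz[OF fld_md]])
   (simp add: flin_add[OF flin_heis] flin_add[OF flin_md1] algebra_simps)
next
 fix c x
 show "nop q (md (sc c x)) n w = sc c (nop q (md x) n w)"
  unfolding nop_def
  by (subst Sum_any_fscale[symmetric, OF nop_evz[OF fld_md]])
   (simp add: flin_scale[OF flin_heis] flin_scale[OF flin_md1] algebra_simps)
qed

text \<open>The list of a monomial may be reordered by \<open>mm_perm\<close>, so any new oscillator
  can be taken as the outermost normally ordered factor. Inductions on \<open>u\<close> run through
  this equation.\<close>

lemma md_heis: "md (al (- int q - 1) u) n w = nop q (md u) n w"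
proof (rule flin_eqI[where f = "%u. md (al (- int q - 1) u) n w", OF flin_comp[OF flin_md1 flin_heis] flin_nop1])
 fix b :: "nat multiset \<times> int"
 obtain mu k where b: "b = (mu, k)" by (cases b)
 have "md (al (- int q - 1) (single b 1)) = mm (sorted_list_of_multiset (add_mset q mu)) k"
  by (simp add: b heis_single md_single)
 also have "... = mm (q # sorted_list_of_multiset mu) k"
  by (rule mm_perm) simp
 finally show "md (al (- int q - 1) (single b 1)) n w = nop q (md (single b 1)) n w"
  by (simp add: mm_Cons b md_single)
qed

lemma nop_split:
 assumes "fld B"
 shows "nop q B n w = Sum_any (%j. sc (bc q j) (al (- int q - 1 - int j) (B (n + int j) w)))
  + Sum_any (%j. sc (bc q j * (-1) ^ q) (B (n - int j - int q - 1) (al (int j) w)))"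
proof -
 have "evz (%j. sc (bc q j * (-1) ^ q) (B (n - int j - int q - 1) (al (int j) w)))"
  using evz_fscale[OF nop_evz2[OF fld_flin[OF assms], where c = 1 and n = n and q = q and w = w],
    where c = "%j. bc q j * (-1) ^ q"] by simp
 then show ?thesis
  unfolding nop_def
  by (subst Sum_any_add[symmetric]) (auto intro!: evz_fscale nop_evz1[OF assms] simp: sc_add)
qed

lemma md_grd:
 assumes "u \<in> grd k N" "w \<in> grd c M"
 shows "md u n w \<in> grd (k + c) (N + M - n - 1 - k * c div tp)"
 unfolding grd_def
proof (rule supp_flin[OF flin_md1 _ assms(1)[unfolded grd_def]])
 fix b :: "nat multiset \<times> int"
 assume b: "b \<in> {b. snd b = k \<and> lev (fst b) = N}"
 have "md (single (mu, k) 1) n w \<in> grd (k + c) (lev mu + M - n - 1 - k * c div tp)" for mu n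
  using assms(2)
 proof (induction mu arbitrary: n w M)
  case empty
  then show ?case using ek_grd[OF empty, of k n] by (simp add: md_lat_exp[unfolded lat_exp_def])
 next
  case (add q mu)
  have "md (single (add_mset q mu, k) 1) n w = nop q (md (single (mu, k) 1)) n w"
   using md_heis[of q "single (mu, k) 1" n w] by (simp add: heis_single)
  also have "... \<in> grd (k + c) (lev (add_mset q mu) + M - n - 1 - k * c div tp)"
   unfolding nop_def
  proof (intro grd_Sum_any grd_scale grd_add)
   fix j
   show "al (- int q - 1 - int j) (md (single (mu, k) 1) (n + int j) w)
     \<in> grd (k + c) (lev (add_mset q mu) + M - n - 1 - k * c div tp)"
    by (rule grd_cong[OF heis_grd[OF add.IH[OF add.prems]]]) simp_all
   show "md (single (mu, k) 1) (n - int j - int q - 1) (al (int j) w)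
     \<in> grd (k + c) (lev (add_mset q mu) + M - n - 1 - k * c div tp)"
    by (rule grd_cong[OF add.IH[OF heis_grd[OF add.prems]]]) simp_all
  qed
  finally show ?case .
 qed
 from this[of "fst b"] b show "md (single b 1) n w \<in>
   supp {b. snd b = k + c \<and> lev (fst b) = N + M - n - 1 - k * c div tp}"
  by (cases b) (simp add: grd_def)
qed

text \<open>The central terms of \<alpha>(r) against a divided derivative of the current collapse to
  a single one: r > q meets the creation sum, r \<le> 0 the annihilation sum, and for 0 < r \<le> q
  both sums and the binomial coefficient vanish.\<close>

lemma heis_md_central:
 "Sum_any (%i. sc (bc q i) ((if r = int q + 1 + int i then sc (2 * of_nat p * of_int r) (G (n + int i)) else 0)
   + sc ((-1) ^ q) (if r = - int i then sc (2 * of_nat p * of_int r) (G (n - int i - int q - 1)) else 0)))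
  = sc (2 * of_nat p * of_nat (q + 1) * (of_int r gchoose (q + 1))) (G (n + r - int q - 1))"
proof -
 have absorb: "(of_nat (q + 1) * (of_int r gchoose (q + 1)) :: complex) = of_int r * (of_int (r - 1) gchoose q)"
  using gbinomial_absorption[of q "of_int r :: complex"] by simp
 consider "r >= int q + 1" | "r \<le> 0" | "0 < r" "r \<le> int q" by linarith
 then show ?thesis
 proof cases
  case 1
  define i where "i = nat (r - int q - 1)"
  have ri: "r = int q + 1 + int i" using 1 by (simp add: i_def)
  have r1: "(of_int (r - 1) gchoose q :: complex) = bc q i"
   unfolding bc_def binomial_gbinomial using ri by simp
  have "Sum_any (%j. sc (bc q j) ((if r = int q + 1 + int j then sc (2 * of_nat p * of_int r) (G (n + int j)) else 0)
   + sc ((-1) ^ q) (if r = - int j then sc (2 * of_nat p * of_int r) (G (n - int j - int q - 1)) else 0)))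
   = Sum_any (%j. if j = i then sc (bc q i * (2 * of_nat p * of_int r)) (G (n + int i)) else 0)"
   by (rule Sum_any.cong) (use ri in auto)
  also have "... = sc (bc q i * (2 * of_nat p * of_int r)) (G (n + int i))" by simp
  also have "n + int i = n + r - int q - 1" using ri by simp
  also have "bc q i * (2 * of_nat p * of_int r) = 2 * of_nat p * (of_int r * (of_int (r - 1) gchoose q))"
   unfolding r1 by (simp add: mult_ac)
  finally show ?thesis unfolding absorb[symmetric] by (simp only: mult.assoc)
 next
  case 2
  define i where "i = nat (- r)"
  have ri: "r = - int i" using 2 by (simp add: i_def)
  have r1: "(of_int (r - 1) gchoose q :: complex) = (-1) ^ q * bc q i"
   using gbinomial_neg_nat[of i q] by (simp add: ri bc_def add.commute)
  have "Sum_any (%j. sc (bc q j) ((if r = int q + 1 + int j then sc (2 * of_nat p * of_int r) (G (n + int j)) else 0)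
   + sc ((-1) ^ q) (if r = - int j then sc (2 * of_nat p * of_int r) (G (n - int j - int q - 1)) else 0)))
   = Sum_any (%j. if j = i then sc (bc q i * (-1) ^ q * (2 * of_nat p * of_int r)) (G (n - int i - int q - 1)) else 0)"
   by (rule Sum_any.cong) (use ri in auto)
  also have "... = sc (bc q i * (-1) ^ q * (2 * of_nat p * of_int r)) (G (n - int i - int q - 1))" by simp
  also have "n - int i - int q - 1 = n + r - int q - 1" using ri by simp
  also have "bc q i * (-1) ^ q * (2 * of_nat p * of_int r) = 2 * of_nat p * (of_int r * (of_int (r - 1) gchoose q))"
   unfolding r1 by (simp add: mult_ac)
  finally show ?thesis unfolding absorb[symmetric] by (simp only: mult.assoc)
 next
  case 3
  define m where "m = nat (r - 1)"
  have "(of_int (r - 1) gchoose q :: complex) = of_nat (m choose q)"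
   unfolding binomial_gbinomial using 3 by (simp add: m_def)
  moreover have "m < q" using 3 by (simp add: m_def)
  ultimately have z: "(of_nat (q + 1) * (of_int r gchoose (q + 1)) :: complex) = 0"
   unfolding absorb by simp
  have "Sum_any (%j. sc (bc q j) ((if r = int q + 1 + int j then sc (2 * of_nat p * of_int r) (G (n + int j)) else 0)
   + sc ((-1) ^ q) (if r = - int j then sc (2 * of_nat p * of_int r) (G (n - int j - int q - 1)) else 0)))
   = Sum_any (%j::nat. 0)"
   by (rule Sum_any.cong) (use 3 in auto)
  then show ?thesis unfolding mult.assoc z by simp
 qed
qed

lemma md_heis_evz: "evz (%i. sc (c i) (md (al (int i) u) (m i) w))"
proof -
 from heis_evz[of 0 u] obtain N where "!!i. i >= N ==> al (int i) u = 0" by (auto simp: evz_def)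
 then show ?thesis by (intro evzI[of N]) (simp add: flin_zero[OF flin_md1])
qed

text \<open>The commutator formula for the current, obtained before the Jacobi identity and used to
  prove it. In the induction on \<open>u\<close>, \<alpha>(r) meets the modes of the shorter vector,
  covered by the induction hypothesis, and the new oscillator, which contributes the central
  terms.\<close>

lemma heis_md:
 "al r (md u n w) = md u n (al r w) + Sum_any (%i. sc (of_int r gchoose i) (md (al (int i) u) (n + r - int i) w))"
proof (induction u arbitrary: r n w rule: fock_induct_UNIV)
 case (exp k)
 have "Sum_any (%i. sc (of_int r gchoose i) (md (al (int i) (xp k)) (n + r - int i) w))
  = Sum_any (%i. if i = (0::nat) then sc (of_int k) (ek k (n + r) w) else 0)"
  by (rule Sum_any.cong) (auto simp: heis_zero[OF grd_chs[OF lat_exp_grd]] flin_scale[OF flin_md1] flin_zero[OF flin_md1] md_lat_exp)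
 then show ?case by (simp add: md_lat_exp heis_ek)
next
 case (heis q u k)
 note IH = heis.IH
 note lin = flin_add[OF flin_heis] flin_scale[OF flin_heis] flin_zero[OF flin_heis]
  flin_add[OF flin_md1] flin_scale[OF flin_md1] flin_zero[OF flin_md1]
  flin_add[OF flin_md2] flin_scale[OF flin_md2] flin_zero[OF flin_md2]
 from heis_evz[of 0 u] obtain J where J: "!!i. i >= J ==> al (int i) u = 0" by (auto simp: evz_def)
 have IH': "al r (md u n w) = md u n (al r w) + (\<Sum>i<J. sc (of_int r gchoose i) (md (al (int i) u) (n + r - int i) w))" for r n w
  by (subst IH, subst Sum_any_nat[of J]) (simp_all add: J lin)
 let ?b = "- int q - 1"
 define X where "X j i = al (?b - int i) (md (al (int j) u) (n + r - int j + int i) w)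
   + sc ((- 1) ^ q) (md (al (int j) u) (n + r - int j - int i - int q - 1) (al (int i) w))" for j i
 define C where "C i = (if r = int q + 1 + int i then sc (2 * of_nat p * of_int r) (md u (n + int i) w) else 0)
   + sc ((-1) ^ q) (if r = - int i then sc (2 * of_nat p * of_int r) (md u (n - int i - int q - 1) w) else 0)" for i
 have evX: "evz (%i. sc (bc q i) (X j i))" for j
  unfolding X_def by (rule nop_evz[OF fld_md])
 have evC: "evz (%i. sc (bc q i) (C i))"
  by (rule evzI[of "nat \<bar>r\<bar> + 1"]) (auto simp: C_def)
 have "al r (md (al ?b u) n w) = Sum_any (%i. al r (sc (bc q i) (al (?b - int i) (md u (n + int i) w)
   + sc ((- 1) ^ q) (md u (n - int i - int q - 1) (al (int i) w)))))"
  unfolding md_heis nop_def by (rule Sum_any_flin[OF nop_evz[OF fld_md] flin_heis])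
 also have "... = Sum_any (%i. sc (bc q i) (al (?b - int i) (md u (n + int i) (al r w))
   + sc ((- 1) ^ q) (md u (n - int i - int q - 1) (al (int i) (al r w))))
   + ((\<Sum>j<J. sc (of_int r gchoose j) (sc (bc q i) (X j i))) + sc (bc q i) (C i)))"
 proof (rule Sum_any.cong)
  fix i
  have 1: "al r (al (?b - int i) (md u (n + int i) w)) = al (?b - int i) (md u (n + int i) (al r w))
    + (\<Sum>j<J. sc (of_int r gchoose j) (al (?b - int i) (md (al (int j) u) (n + r - int j + int i) w)))
    + (if r = int q + 1 + int i then sc (2 * of_nat p * of_int r) (md u (n + int i) w) else 0)"
   by (subst heis_comm, subst IH') (auto simp: lin flin_sum[OF flin_heis] algebra_simps)
  have 2: "al r (md u (n - int i - int q - 1) (al (int i) w)) = md u (n - int i - int q - 1) (al (int i) (al r w))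
    + (\<Sum>j<J. sc (of_int r gchoose j) (md (al (int j) u) (n + r - int j - int i - int q - 1) (al (int i) w)))
    + (if r = - int i then sc (2 * of_nat p * of_int r) (md u (n - int i - int q - 1) w) else 0)"
   by (subst IH', subst heis_comm) (auto simp: lin algebra_simps)
  show "al r (sc (bc q i) (al (?b - int i) (md u (n + int i) w)
   + sc ((- 1) ^ q) (md u (n - int i - int q - 1) (al (int i) w))))
   = sc (bc q i) (al (?b - int i) (md u (n + int i) (al r w))
   + sc ((- 1) ^ q) (md u (n - int i - int q - 1) (al (int i) (al r w))))
   + ((\<Sum>j<J. sc (of_int r gchoose j) (sc (bc q i) (X j i))) + sc (bc q i) (C i))"
   unfolding lin 1 2
   by (simp add: X_def C_def sc_add sum.distrib sc_sum mult_ac add_ac)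
 qed
 also have "... = md (al ?b u) n (al r w)
   + ((\<Sum>j<J. sc (of_int r gchoose j) (md (al ?b (al (int j) u)) (n + r - int j) w)) + Sum_any (%i. sc (bc q i) (C i)))"
 proof -
  have e: "evz (%i. \<Sum>j<J. sc (of_int r gchoose j) (sc (bc q i) (X j i)))"
   by (intro evz_sum evz_fscale[OF evX])
  have nX: "nop q (md (al (int j) u)) (n + r - int j) w = Sum_any (%i. sc (bc q i) (X j i))" for j
   by (simp only: nop_def X_def)
  show ?thesis
   unfolding md_heis nX Sum_any_add[OF nop_evz[OF fld_md] evz_add[OF e evC]] Sum_any_add[OF e evC]
    Sum_any_sum[OF evz_fscale[OF evX]] Sum_any_fscale[OF evX]
   by (simp only: nop_def)
 qed
 also have "Sum_any (%i. sc (bc q i) (C i))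
   = sc (2 * of_nat p * of_nat (q + 1) * (of_int r gchoose (q + 1))) (md u (n + r - int q - 1) w)"
  unfolding C_def by (rule heis_md_central)
 also have "(\<Sum>j<J. sc (of_int r gchoose j) (md (al ?b (al (int j) u)) (n + r - int j) w)) + ...
  = Sum_any (%i. sc (of_int r gchoose i) (md (al (int i) (al ?b u)) (n + r - int i) w))"
 proof -
  have 1: "sc (of_int r gchoose i) (md (al (int i) (al ?b u)) (n + r - int i) w)
   = sc (of_int r gchoose i) (md (al ?b (al (int i) u)) (n + r - int i) w)
    + (if i = q + 1 then sc (2 * of_nat p * of_nat (q + 1) * (of_int r gchoose (q + 1))) (md u (n + r - int q - 1) w) else 0)" for i
   by (subst heis_comm) (auto simp: lin mult_ac algebra_simps)
  have 2: "evz (%i. sc (of_int r gchoose i) (md (al ?b (al (int i) u)) (n + r - int i) w))"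
   by (rule evzI[of J]) (simp add: J lin)
  have 3: "evz (%i. if i = q + 1 then sc (2 * of_nat p * of_nat (q + 1) * (of_int r gchoose (q + 1))) (md u (n + r - int q - 1) w) else 0)"
   by (rule evzI[of "q + 2"]) auto
  have 4: "Sum_any (%i. sc (of_int r gchoose i) (md (al ?b (al (int i) u)) (n + r - int i) w))
   = (\<Sum>i<J. sc (of_int r gchoose i) (md (al ?b (al (int i) u)) (n + r - int i) w))"
   by (rule Sum_any_nat) (simp add: J lin)
  show ?thesis unfolding 1 Sum_any_add[OF 2 3] 4 Sum_any.delta ..
 qed
 finally show ?case .
next
 case zero
 show ?case by (simp add: flin_zero[OF flin_md1] flin_zero[OF flin_heis])
next
 case (add u v)
 have ev: "evz (%i. sc (of_int r gchoose i) (md (al (int i) u) (n + r - int i) w))" for u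
  by (rule md_heis_evz)
 show ?case
  by (simp add: flin_add[OF flin_md1] flin_add[OF flin_heis] add sc_add Sum_any_add ev)
next
 case (scale c u)
 have ev: "evz (%i. sc (of_int r gchoose i) (md (al (int i) u) (n + r - int i) w))"
  by (rule md_heis_evz)
 have "Sum_any (%i. sc (of_int r gchoose i) (md (al (int i) (sc c u)) (n + r - int i) w))
  = sc c (Sum_any (%i. sc (of_int r gchoose i) (md (al (int i) u) (n + r - int i) w)))"
  by (subst Sum_any_fscale[OF ev, symmetric]) (simp add: flin_scale[OF flin_md1] flin_scale[OF flin_heis] mult_ac)
 then show ?case
  by (simp add: flin_scale[OF flin_md1] flin_scale[OF flin_heis] scale sc_add)
qed

lemma heis_md_finite:
 assumes "!!j. j >= J ==> al (int j) u = 0"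
 shows "al r (md u n w) = md u n (al r w) + (\<Sum>j<J. sc (of_int r gchoose j) (md (al (int j) u) (n + r - int j) w))"
 by (subst heis_md, subst Sum_any_nat[of J]) (simp_all add: assms flin_zero[OF flin_md1])

end

lemma Sum_any_antidiag:
 fixes f :: "nat => nat => 'a::comm_monoid_add"
 assumes "!!s t. s >= N \<or> t >= N ==> f s t = 0"
 shows "Sum_any (%s. Sum_any (f s)) = Sum_any (%r. \<Sum>s\<le>r. f s (r - s))"
proof -
 have z: "f s (r - s) = 0" if "r >= 2 * N" "s \<le> r" for s r
  using that by (intro assms) linarith
 have "Sum_any (%s. Sum_any (f s)) = (\<Sum>s<2*N. \<Sum>t<2*N - s. f s t)"
 proof (subst Sum_any_nat[of N])
  fix s assume "N \<le> s"
  then show "Sum_any (f s) = 0" by (simp add: assms)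
 next
  have "Sum_any (f s) = (\<Sum>t<2*N - s. f s t)" if "s < N" for s
   by (rule Sum_any_nat) (use that in \<open>auto intro: assms\<close>)
  then have "(\<Sum>s<N. Sum_any (f s)) = (\<Sum>s<N. \<Sum>t<2*N - s. f s t)" by simp
  also have "... = (\<Sum>s<2*N. \<Sum>t<2*N - s. f s t)"
   by (rule sum.mono_neutral_left) (auto intro!: sum.neutral assms)
  finally show "(\<Sum>s<N. Sum_any (f s)) = (\<Sum>s<2*N. \<Sum>t<2*N - s. f s t)" .
 qed
 also have "... = (\<Sum>(s, t)\<in>(SIGMA s:{..<2*N}. {..<2*N - s}). f s t)"
  by (rule sum.Sigma) auto
 also have "... = (\<Sum>(r, s)\<in>(SIGMA r:{..<2*N}. {..r}). f s (r - s))"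
  by (rule sum.reindex_bij_witness[where i = "%(r, s). (s, r - s)" and j = "%(s, t). (s + t, s)"]) auto
 also have "... = (\<Sum>r<2*N. \<Sum>s\<le>r. f s (r - s))"
  by (rule sum.Sigma[symmetric]) auto
 also have "... = Sum_any (%r. \<Sum>s\<le>r. f s (r - s))"
  by (rule Sum_any_nat[symmetric]) (auto intro!: sum.neutral z)
 finally show ?thesis .
qed

definition sg :: "int => complex" where "sg k = (-1) powi k"

lemma sg_add: "sg (k + l) = sg k * sg l"
 by (simp add: sg_def power_int_add)

lemma sg_nat: "sg (int n) = (-1) ^ n"
 by (simp add: sg_def)

lemma sg_0 [simp]: "sg 0 = 1" and sg_m1 [simp]: "sg (-1) = -1"
 by (simp_all add: sg_def)

lemma sg_sq [simp]: "sg k * sg k = 1"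
 by (simp add: sg_def flip: power_int_mult_distrib)

lemma sg_minus: "sg (- k) = sg k"
 by (simp add: sg_def power_int_minus) (metis inverse_unique power_int_mult_distrib power_int_1_left mult_minus1 minus_minus)

lemma sg_diff: "sg (k - l) = sg k * sg l"
 using sg_add[of k "- l"] by (simp add: sg_minus)

lemma sg_even: "even k ==> sg k = 1"
 by (simp add: sg_def power_int_minus_left)

context rank_one begin

lemma bc_fact: "bc q j = fact (q + j) / (fact q * fact j)"
 by (simp add: bc_def binomial_fact)

lemma bc_assoc: "bc q (r + j) * of_nat ((r + j) choose j) = bc q j * bc (q + j) r"
 and bc_assoc': "bc q s * bc (q + s) t = bc q (s + t) * of_nat ((s + t) choose s)"
 and bc_swap: "bc q s * bc (q + s) t = bc q t * bc (q + t) s"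
 by (simp_all add: bc_fact binomial_fact add_ac)

lemma bn_neg_bc: "fps_nth (bn (- int q - 1)) s = bc q s"
 by (simp only: bn_neg_nth bc_eq)

lemma bp_neg_bc: "fps_nth (bp (- int q - 1)) s = (-1) ^ s * bc q s"
 unfolding bp_nth by (simp only: gbinomial_neg_nat bc_eq)

section \<open>The Jacobi identity\<close>

text \<open>\<open>LL\<close> and \<open>RR\<close> are the residues of x^m y^n (x - y)^k against
  Y(Y(u, x - y) v, y) w and Y(u, x) Y(v, y) w. The two mode indices in each summand add up to m + n
  + k.\<close>

definition LL :: "fock => fock => fock => int => int => int => fock" where
 "LL u v w m n k = cv (bp m) (%c. md (md u c v) (m + n + k - c) w) k"

definition RR :: "fock => fock => fock => int => int => int => fock" where
 "RR u v w m n k = cv (bn k) (%b. md u (m + n + k - b) (md v b w)) n"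

definition Jac :: "fock => fock => fock => bool" where
 "Jac u v w \<longleftrightarrow> (\<forall>m n k. LL u v w m n k = RR u v w m n k - sc (sg k) (RR v u w n m k))"

lemmas md_lin = flin_add[OF flin_md1] flin_scale[OF flin_md1] flin_zero[OF flin_md1]
  flin_add[OF flin_md2] flin_scale[OF flin_md2] flin_zero[OF flin_md2]

lemmas heis_lin = flin_add[OF flin_heis] flin_scale[OF flin_heis] flin_zero[OF flin_heis]

lemma bdd_LL: "bdd (%c. md (md u c v) (d - c) w)"
proof -
 from bdd_md[of u v] obtain N where "!!c. c >= N ==> md u c v = 0" by (metis bddE)
 then show ?thesis by (intro bddI[of N]) (simp add: md_lin)
qed

lemma bdd_RR: "bdd (%b. md u (d - b) (md v b w))"
proof -
 from bdd_md[of v w] obtain N where "!!b. b >= N ==> md v b w = 0" by (metis bddE)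
 then show ?thesis by (intro bddI[of N]) (simp add: md_lin)
qed

text \<open>Normal ordering puts the creation modes of the new oscillator in front and leaves its
  nonnegative modes next to Y(v, y). Moving the latter through Y(v, y) gives the terms with
  \<alpha>(s) w and the contractions with \<alpha>(j) v, which carry (x - y)^(-q-1-j). The four step
  lemmas have matching shapes, so that the Jacobi identity is inherited term by term.\<close>

lemma RR_ustep:
 assumes J: "!!j. j >= J ==> al (int j) v = 0"
 shows "RR (al (- int q - 1) u) v w m n k =
  Sum_any (%s. sc (bc q s) (al (- int q - 1 - int s) (RR u v w (m + int s) n k)))
  + Sum_any (%s. sc (bc q s * (-1) ^ q) (RR u v (al (int s) w) (m - int s - int q - 1) n k))
  + (\<Sum>j<J. sc ((-1) ^ q * bc q j) (RR u (al (int j) v) w m n (k - int q - int j - 1)))"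
proof -
 define d where "d = m + n + k"
 define P where "P s b = sc (bc q s) (al (- int q - 1 - int s) (md u (d - b + int s) (md v b w)))" for s b
 define S1 where "S1 s b = sc (bc q s * (-1) ^ q) (md u (d - b - int s - int q - 1) (md v b (al (int s) w)))" for s b
 define S2 where "S2 j s b = sc (bc q s * (-1) ^ q * (of_int (int s) gchoose j))
   (md u (d - b - int s - int q - 1) (md (al (int j) v) (b + int s - int j) w))" for j s b
 from bdd_md[of v w] obtain N where N: "!!b. b >= N ==> md v b w = 0" by (metis bddE)
 from fld_uniform[OF fld_md[of v]] obtain M where M: "!!i n. n >= M ==> md v n (al (int i) w) = 0" by metis
 have "\<forall>j. \<exists>L. ALL b>=L. md (al (int j) v) b w = 0" using bdd_md by (auto simp: bdd_def)
 then obtain L where L: "!!j b. b >= L j ==> md (al (int j) v) b w = 0" by metis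
 from heis_evz[of 0 w] obtain I where I: "!!i. i >= I ==> al (int i) w = 0" by (auto simp: evz_def)
 have famP: "fam P"
  unfolding fam_def
 proof (intro conjI allI)
  show "\<exists>N. ALL b>=N. \<forall>s. P s b = 0" by (intro exI[of _ N]) (simp add: P_def N md_lin heis_lin)
  fix b
  from bdd_md[of u "md v b w"] obtain K where "!!c. c >= K ==> md u c (md v b w) = 0" by (metis bddE)
  then show "evz (%s. P s b)" by (intro evzI[of "nat (K - d + b)"]) (simp add: P_def heis_lin)
 qed
 have famS1: "fam S1"
  unfolding fam_def
 proof (intro conjI allI)
  show "\<exists>N. ALL b>=N. \<forall>s. S1 s b = 0" by (intro exI[of _ M]) (simp add: S1_def M md_lin)
  show "evz (%s. S1 s b)" for b by (intro evzI[of I]) (simp add: S1_def I md_lin)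
 qed
 have famS2: "fam (S2 j)" for j
  unfolding fam_def
 proof (intro conjI allI)
  show "\<exists>N. ALL b>=N. \<forall>s. S2 j s b = 0" by (intro exI[of _ "L j + int j"]) (simp add: S2_def L md_lin)
  show "evz (%s. S2 j s b)" for b by (intro evzI[of "nat (L j - b + int j)"]) (simp add: S2_def L md_lin)
 qed
 have G: "md (al (- int q - 1) u) (d - b) (md v b w)
  = Sum_any (%s. P s b) + (Sum_any (%s. S1 s b) + (\<Sum>j<J. Sum_any (%s. S2 j s b)))" for b
 proof -
  have "sc (bc q s * (-1) ^ q) (md u (d - b - int s - int q - 1) (al (int s) (md v b w)))
   = S1 s b + (\<Sum>j<J. S2 j s b)" for s
   by (subst heis_md_finite[OF J]) (simp_all add: md_lin flin_sum[OF flin_md2] S1_def S2_def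
     sc_add sc_sum)
  then show ?thesis
   unfolding md_heis nop_split[OF fld_md] P_def[symmetric]
   by (simp add: Sum_any_add[OF fam_evz[OF famS1] evz_sum[OF fam_evz[OF famS2]]] Sum_any_sum[OF fam_evz[OF famS2]])
 qed
 have "RR (al (- int q - 1) u) v w m n k = cv (bn k) (%b. Sum_any (%s. P s b) + (Sum_any (%s. S1 s b) + (\<Sum>j<J. Sum_any (%s. S2 j s b)))) n"
  unfolding RR_def d_def[symmetric] G ..
 also have "... = Sum_any (%s. cv (bn k) (P s) n) + (Sum_any (%s. cv (bn k) (S1 s) n) + (\<Sum>j<J. Sum_any (%s. cv (bn k) (S2 j s) n)))"
  by (simp add: cv_add cv_sum cv_Sum_any bdd_add bdd_sum fam_bdd_Sum famP famS1 famS2)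
 also have "(%s. cv (bn k) (P s) n) = (%s. sc (bc q s) (al (- int q - 1 - int s) (RR u v w (m + int s) n k)))"
 proof
  fix s
  have "P s = (%b. sc (bc q s) (al (- int q - 1 - int s) (md u (m + int s + n + k - b) (md v b w))))"
   by (rule ext) (simp add: P_def d_def algebra_simps)
  then show "cv (bn k) (P s) n = sc (bc q s) (al (- int q - 1 - int s) (RR u v w (m + int s) n k))"
   unfolding RR_def by (simp only: cv_scale[OF bdd_flin[OF bdd_RR flin_heis]] cv_flin[OF bdd_RR flin_heis])
 qed
 also have "(%s. cv (bn k) (S1 s) n) = (%s. sc (bc q s * (-1) ^ q) (RR u v (al (int s) w) (m - int s - int q - 1) n k))"
 proof
  fix s
  have "S1 s = (%b. sc (bc q s * (-1) ^ q) (md u (m - int s - int q - 1 + n + k - b) (md v b (al (int s) w))))"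
   by (rule ext) (simp add: S1_def d_def algebra_simps)
  then show "cv (bn k) (S1 s) n = sc (bc q s * (-1) ^ q) (RR u v (al (int s) w) (m - int s - int q - 1) n k)"
   unfolding RR_def by (simp only: cv_scale[OF bdd_RR])
 qed
 also have "(%j. Sum_any (%s. cv (bn k) (S2 j s) n)) = (%j. sc ((-1) ^ q * bc q j) (RR u (al (int j) v) w m n (k - int q - int j - 1)))"
 proof
  fix j
  define H where "H b = md u (m + n + (k - int q - int j - 1) - b) (md (al (int j) v) b w)" for b
  have bH: "bdd H" unfolding H_def by (rule bdd_RR)
  have 1: "cv (bn k) (S2 j s) n = sc (bc q s * (-1) ^ q * of_nat (s choose j)) (cv (bn k) H (n + (int s - int j)))" for s
  proof -
   have "S2 j s = (%b. sc (bc q s * (-1) ^ q * of_nat (s choose j)) (H (b + (int s - int j))))"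
    by (rule ext) (simp add: S2_def H_def d_def algebra_simps binomial_gbinomial)
   then show ?thesis by (simp only: cv_scale[OF bdd_shift[OF bH]] cv_shift)
  qed
  \<comment> \<open>The terms with s < j vanish; after the shift the coefficients form the expansion
    of (1 - Y)^(-q-j-1), which lowers the exponent k.\<close>
  have "Sum_any (%s. cv (bn k) (S2 j s) n) = Sum_any (%r. sc (bc q (r + j) * (-1) ^ q * of_nat ((r + j) choose j)) (cv (bn k) H (n + int r)))"
   unfolding 1 by (subst Sum_any_shift[of j]) simp_all
  also have "... = Sum_any (%r. sc ((-1) ^ q * bc q j) (sc (fps_nth (bn (- int (q + j) - 1)) r) (cv (bn k) H (n + int r))))"
  proof (rule Sum_any.cong)
   fix r
   have "bc q (r + j) * (-1) ^ q * of_nat ((r + j) choose j) = (-1) ^ q * (bc q (r + j) * of_nat ((r + j) choose j))"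
    by (simp add: mult_ac)
   also have "... = (-1) ^ q * bc q j * fps_nth (bn (- int (q + j) - 1)) r"
    unfolding bc_assoc bn_neg_bc by (simp add: mult_ac)
   finally show "sc (bc q (r + j) * (-1) ^ q * of_nat ((r + j) choose j)) (cv (bn k) H (n + int r)) =
     sc ((-1) ^ q * bc q j) (sc (fps_nth (bn (- int (q + j) - 1)) r) (cv (bn k) H (n + int r)))"
    by simp
  qed
  also have "... = sc ((-1) ^ q * bc q j) (cv (bn (- int (q + j) - 1)) (cv (bn k) H) n)"
   by (subst Sum_any_fscale[OF bdd_cv_evz[OF bdd_cv[OF bH]]]) (simp only: cv_def[of "bn (- int (q + j) - 1)"])
  also have "... = sc ((-1) ^ q * bc q j) (RR u (al (int j) v) w m n (k - int q - int j - 1))"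
  proof -
   have "- int (q + j) - 1 + k = k - int q - int j - 1" by simp
   then have "cv (bn (- int (q + j) - 1)) (cv (bn k) H) n = cv (bn (k - int q - int j - 1)) H n"
    by (simp only: cv_mult[OF bH] bn_add[symmetric])
   then show ?thesis by (simp only: RR_def H_def[abs_def])
  qed
  finally show "Sum_any (%s. cv (bn k) (S2 j s) n) = ..." .
 qed
 finally show ?thesis by (simp only: add.assoc)
qed

text \<open>The creation modes of the new oscillator now stand between the two fields and have to be
  moved to the left through Y(u, x); this yields the contractions with \<alpha>(j) u, with a minus
  sign.\<close>

lemma RR_vstep:
 assumes J: "!!j. j >= J ==> al (int j) u = 0"
 shows "RR u (al (- int q - 1) v) w m n k =
  Sum_any (%s. sc (bc q s) (al (- int q - 1 - int s) (RR u v w m (n + int s) k)))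
  + Sum_any (%s. sc (bc q s * (-1) ^ q) (RR u v (al (int s) w) m (n - int s - int q - 1) k))
  - (\<Sum>j<J. sc ((-1) ^ j * bc q j) (RR (al (int j) u) v w m n (k - int q - int j - 1)))"
proof -
 define d where "d = m + n + k"
 define t where "t s = - int q - 1 - int s" for s
 define P where "P s b = sc (bc q s) (al (t s) (md u (d - b) (md v (b + int s) w)))" for s b
 define S1 where "S1 s b = sc (bc q s * (-1) ^ q) (md u (d - b) (md v (b - int s - int q - 1) (al (int s) w)))" for s b
 define S2 where "S2 j s b = sc (bc q s * (of_int (t s) gchoose j))
   (md (al (int j) u) (d - b + t s - int j) (md v (b + int s) w))" for j s b
 from bdd_md[of v w] obtain N where N: "!!b. b >= N ==> md v b w = 0" by (metis bddE)
 from fld_uniform[OF fld_md[of v]] obtain M where M: "!!i n. n >= M ==> md v n (al (int i) w) = 0" by metis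
 from heis_evz[of 0 w] obtain I where I: "!!i. i >= I ==> al (int i) w = 0" by (auto simp: evz_def)
 have famP: "fam P"
  unfolding fam_def
 proof (intro conjI allI)
  show "\<exists>N. ALL b>=N. \<forall>s. P s b = 0" by (intro exI[of _ N]) (simp add: P_def N md_lin heis_lin)
  show "evz (%s. P s b)" for b by (intro evzI[of "nat (N - b)"]) (simp add: P_def N md_lin heis_lin)
 qed
 have famS1: "fam S1"
  unfolding fam_def
 proof (intro conjI allI)
  have "S1 s b = 0" if "b >= M + int I + int q + 1" for s b
   using that by (cases "s < I") (auto simp: S1_def M I md_lin)
  then show "\<exists>N. ALL b>=N. \<forall>s. S1 s b = 0" by blast
  show "evz (%s. S1 s b)" for b by (intro evzI[of I]) (simp add: S1_def I md_lin)
 qed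
 have famS2: "fam (S2 j)" for j
  unfolding fam_def
 proof (intro conjI allI)
  show "\<exists>N. ALL b>=N. \<forall>s. S2 j s b = 0" by (intro exI[of _ N]) (simp add: S2_def N md_lin)
  show "evz (%s. S2 j s b)" for b by (intro evzI[of "nat (N - b)"]) (simp add: S2_def N md_lin)
 qed
 have G: "md u (d - b) (md (al (- int q - 1) v) b w)
  = Sum_any (%s. P s b) - (\<Sum>j<J. Sum_any (%s. S2 j s b)) + Sum_any (%s. S1 s b)" for b
 proof -
  have 1: "sc (bc q s) (md u (d - b) (al (- int q - 1 - int s) (md v (b + int s) w)))
   = P s b - (\<Sum>j<J. S2 j s b)" for s
   using heis_md_finite[OF J, where r = "t s" and n = "d - b" and w = "md v (b + int s) w"]
   by (simp add: md_lin P_def S2_def t_def[symmetric] sc_add sc_sum)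
  have e1: "evz (%j. sc (bc q j) (al (- int q - 1 - int j) (md v (b + int j) w)))"
   by (rule evz_fscale[OF nop_evz1[OF fld_md]])
  have e2: "evz (%j. sc (bc q j * (-1) ^ q) (md v (b - int j - int q - 1) (al (int j) w)))"
   by (rule evzI[of I]) (simp add: I md_lin)
  show ?thesis
   unfolding md_heis nop_split[OF fld_md] flin_add[OF flin_md2] Sum_any_flin[OF e1 flin_md2] Sum_any_flin[OF e2 flin_md2]
    flin_scale[OF flin_md2] 1 S1_def[symmetric]
   by (simp add: Sum_any_diff[OF fam_evz[OF famP] evz_sum[OF fam_evz[OF famS2]]] Sum_any_sum[OF fam_evz[OF famS2]])
 qed
 have "RR u (al (- int q - 1) v) w m n k = cv (bn k) (%b. Sum_any (%s. P s b) - (\<Sum>j<J. Sum_any (%s. S2 j s b)) + Sum_any (%s. S1 s b)) n"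
  unfolding RR_def d_def[symmetric] G ..
 also have "... = Sum_any (%s. cv (bn k) (P s) n) - (\<Sum>j<J. Sum_any (%s. cv (bn k) (S2 j s) n)) + Sum_any (%s. cv (bn k) (S1 s) n)"
 proof -
  have b: "bdd (%b. \<Sum>j<J. Sum_any (%s. S2 j s b))" by (intro bdd_sum fam_bdd_Sum famS2)
  have "bdd (%b. - (\<Sum>j<J. Sum_any (%s. S2 j s b)))"
   using bdd_flin[OF b flin_fscale[OF flin_id, of "-1"]] by simp
  from bdd_add[OF fam_bdd_Sum[OF famP] this]
  have b2: "bdd (%b. Sum_any (%s. P s b) - (\<Sum>j<J. Sum_any (%s. S2 j s b)))" by simp
  show ?thesis
   by (simp add: cv_add[OF b2 fam_bdd_Sum[OF famS1]] cv_diff[OF fam_bdd_Sum[OF famP] b] cv_sum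
     cv_Sum_any fam_bdd_Sum famP famS1 famS2)
 qed
 also have "(%s. cv (bn k) (P s) n) = (%s. sc (bc q s) (al (- int q - 1 - int s) (RR u v w m (n + int s) k)))"
 proof
  fix s
  let ?G = "%b. md u (m + (n + int s) + k - b) (md v b w)"
  have "P s = (%b. sc (bc q s) (al (t s) (?G (b + int s))))"
   by (rule ext) (simp add: P_def d_def algebra_simps)
  moreover have "cv (bn k) (%b. al (t s) (?G (b + int s))) n = al (t s) (cv (bn k) (%b. ?G (b + int s)) n)"
   by (rule cv_flin[symmetric, OF bdd_shift[OF bdd_RR] flin_heis])
  moreover have "cv (bn k) (%b. ?G (b + int s)) n = cv (bn k) ?G (n + int s)"
   by (rule cv_shift)
  ultimately show "cv (bn k) (P s) n = sc (bc q s) (al (- int q - 1 - int s) (RR u v w m (n + int s) k))"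
   unfolding RR_def t_def by (simp only: cv_scale[OF bdd_flin[OF bdd_shift[OF bdd_RR] flin_heis]])
 qed
 also have "(%s. cv (bn k) (S1 s) n) = (%s. sc (bc q s * (-1) ^ q) (RR u v (al (int s) w) m (n - int s - int q - 1) k))"
 proof
  fix s
  let ?r = "- int s - int q - 1"
  let ?G = "%b. md u (m + (n - int s - int q - 1) + k - b) (md v b (al (int s) w))"
  have "S1 s = (%b. sc (bc q s * (-1) ^ q) (?G (b + ?r)))"
   by (rule ext) (simp add: S1_def d_def algebra_simps)
  moreover have "cv (bn k) (%b. ?G (b + ?r)) n = cv (bn k) ?G (n + ?r)"
   by (rule cv_shift)
  moreover have "n + ?r = n - int s - int q - 1" by simp
  ultimately show "cv (bn k) (S1 s) n = sc (bc q s * (-1) ^ q) (RR u v (al (int s) w) m (n - int s - int q - 1) k)"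
   unfolding RR_def by (simp only: cv_scale[OF bdd_shift[OF bdd_RR]])
 qed
 also have "(%j. Sum_any (%s. cv (bn k) (S2 j s) n)) = (%j. sc ((-1) ^ j * bc q j) (RR (al (int j) u) v w m n (k - int q - int j - 1)))"
 proof
  fix j
  define H where "H b = md (al (int j) u) (m + n + (k - int q - int j - 1) - b) (md v b w)" for b
  have bH: "bdd H" unfolding H_def by (rule bdd_RR)
  have co: "bc q s * (of_int (t s) gchoose j) = (-1) ^ j * bc q j * fps_nth (bn (- int (q + j) - 1)) s" for s
  proof -
   have "(of_int (t s) gchoose j :: complex) = (-1) ^ j * bc (q + s) j"
    using gbinomial_neg_nat[of "q + s" j] by (simp add: t_def bc_eq algebra_simps)
   then show ?thesis unfolding bn_neg_bc using bc_swap[of q s j] by (simp add: mult_ac)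
  qed
  have "cv (bn k) (S2 j s) n = sc ((-1) ^ j * bc q j) (sc (fps_nth (bn (- int (q + j) - 1)) s) (cv (bn k) H (n + int s)))" for s
  proof -
   have "S2 j s = (%b. sc ((-1) ^ j * bc q j * fps_nth (bn (- int (q + j) - 1)) s) (H (b + int s)))"
    unfolding S2_def co by (rule ext) (simp add: H_def d_def t_def algebra_simps)
   then show ?thesis by (simp only: cv_scale[OF bdd_shift[OF bH]] cv_shift sc_sc)
  qed
  then have "Sum_any (%s. cv (bn k) (S2 j s) n) = sc ((-1) ^ j * bc q j) (cv (bn (- int (q + j) - 1)) (cv (bn k) H) n)"
   unfolding cv_def[of "bn (- int (q + j) - 1)"] by (simp only: Sum_any_fscale[OF bdd_cv_evz[OF bdd_cv[OF bH]]])
  moreover have "- int (q + j) - 1 + k = k - int q - int j - 1" by simp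
  then have "cv (bn (- int (q + j) - 1)) (cv (bn k) H) n = cv (bn (k - int q - int j - 1)) H n"
   by (simp only: cv_mult[OF bH] bn_add[symmetric])
  ultimately show "Sum_any (%s. cv (bn k) (S2 j s) n) = sc ((-1) ^ j * bc q j) (RR (al (int j) u) v w m n (k - int q - int j - 1))"
   by (simp only: RR_def H_def[abs_def])
 qed
 finally show ?thesis by (simp only: add_ac diff_conv_add_uminus)
qed

text \<open>With x = y + z, an oscillator at x has to be re-expanded at y: the creation parts
  combine along antidiagonals, the annihilation parts for each fixed mode \<alpha>(t). The
  nonnegative modes that act on v inside the iterate give the contractions.\<close>

lemma LL_ustep:
 assumes J: "!!j. j >= J ==> al (int j) v = 0"
 shows "LL (al (- int q - 1) u) v w m n k =
  Sum_any (%s. sc (bc q s) (al (- int q - 1 - int s) (LL u v w (m + int s) n k)))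
  + Sum_any (%s. sc (bc q s * (-1) ^ q) (LL u v (al (int s) w) (m - int s - int q - 1) n k))
  + (\<Sum>j<J. sc ((-1) ^ q * bc q j) (LL u (al (int j) v) w m n (k - int q - int j - 1)))"
proof -
 define d where "d = m + n + k"
 define L where "L D c = md (md u c v) (D - c) w" for D c
 define K where "K t c = md (md u c v) (d - int t - int q - 1 - c) (al (int t) w)" for t c
 define P where "P r c = sc (bc q r) (al (- int q - 1 - int r) (cv (bp (int r)) (L (d + int r)) c))" for r c
 define S1 where "S1 t c = sc (bc q t * (-1) ^ q) (cv (bp (- int (q + t) - 1)) (K t) c)" for t c
 define S2 where "S2 j c = sc ((-1) ^ q * bc q j) (md (md u (c - int j - int q - 1) (al (int j) v)) (d - c) w)" for j c
 have bL: "bdd (L D)" for D unfolding L_def by (rule bdd_LL)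
 have bK: "bdd (K t)" for t unfolding K_def by (rule bdd_LL)
 from bdd_md[of u v] obtain N where N: "!!c. c >= N ==> md u c v = 0" by (metis bddE)
 from heis_evz[of 0 w] obtain I where I: "!!i. i >= I ==> al (int i) w = 0" by (auto simp: evz_def)
 have unif: "\<exists>M. \<forall>c s. c >= M --> md (md u (b + int s) v) c w = 0" for b
 proof -
  have "\<forall>s. \<exists>M. ALL c>=M. md (md u (b + int s) v) c w = 0" using bdd_md by (auto simp: bdd_def)
  then obtain M where M: "!!s c. c >= M s ==> md (md u (b + int s) v) c w = 0" by metis
  have "md (md u (b + int s) v) c w = 0" if "c >= Max (insert 0 (M ` {..<nat (N - b)}))" for s c
  proof (cases "s < nat (N - b)")
   case True
   then have "M s \<le> Max (insert 0 (M ` {..<nat (N - b)}))" by (intro Max_ge) auto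
   then show ?thesis using that by (intro M) (rule order_trans)
  qed (simp add: N md_lin)
  then show ?thesis by blast
 qed
 have famP: "fam P"
  unfolding fam_def
 proof (intro conjI allI)
  have "L D c = 0" if "c >= N" for D c by (simp add: L_def N that md_lin)
  then have "P r c = 0" if "c >= N" for r c using that by (simp add: P_def cv_def heis_lin)
  then show "\<exists>N. ALL c>=N. \<forall>r. P r c = 0" by blast
  fix c
  from unif[of c] obtain M where M: "!!b s. b >= M ==> md (md u (c + int s) v) b w = 0" by metis
  have "P r c = 0" if r: "r >= nat (M - d + c) + 2 * nat (N - c)" for r
  proof -
   have "sc (fps_nth (bp (int r)) s) (L (d + int r) (c + int s)) = 0" for s
   proof (cases "s >= nat (N - c)")
    case True then show ?thesis by (simp add: L_def N md_lin)
   next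
    case False
    then show ?thesis using r by (simp add: L_def M)
   qed
   then have "cv (bp (int r)) (L (d + int r)) c = 0" by (simp only: cv_def Sum_any.neutral)
   then show ?thesis by (simp add: P_def heis_lin)
  qed
  then show "evz (%r. P r c)" by (rule evzI)
 qed
 have famS1: "fam S1"
  unfolding fam_def
 proof (intro conjI allI)
  have "K t c = 0" if "c >= N" for t c by (simp add: K_def N that md_lin)
  then have "S1 r c = 0" if "c >= N" for r c using that by (simp add: S1_def cv_def)
  then show "\<exists>N. ALL c>=N. \<forall>r. S1 r c = 0" by blast
  show "evz (%s. S1 s b)" for b by (intro evzI[of I]) (simp add: S1_def K_def cv_def I md_lin)
 qed
 have bS2: "bdd (S2 j)" for j
 proof -
  from bdd_md[of u "al (int j) v"] obtain M where "!!c. c >= M ==> md u c (al (int j) v) = 0" by (metis bddE)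
  then show ?thesis by (intro bddI[of "M + int j + int q + 1"]) (simp add: S2_def md_lin)
 qed
 have G: "md (md (al (- int q - 1) u) c v) (d - c) w
  = Sum_any (%s. P s c) + (Sum_any (%s. S1 s c) + (\<Sum>j<J. S2 j c))" for c
 proof -
  define A where "A s t = sc (bc q s * bc (q + s) t) (al (- int q - 1 - int s - int t) (md (md u (c + int s) v) (d - c + int t) w))" for s t
  define B where "B s t = sc (bc q s * bc (q + s) t * (-1) ^ (q + s)) (md (md u (c + int s) v) (d - c - int t - int (q + s) - 1) (al (int t) w))" for s t
  from unif[of c] obtain M where M: "!!b s. b >= M ==> md (md u (c + int s) v) b w = 0" by metis
  have evA: "evz (A s)" for s
   by (intro evzI[of "nat (M - d + c)"]) (simp add: A_def M heis_lin)
  have evB: "evz (B s)" for s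
   by (intro evzI[of I]) (simp add: B_def I md_lin)
  have zA: "A s t = 0" if "s >= nat (N - c)" for s t using that by (simp add: A_def N md_lin heis_lin)
  have zB: "B s t = 0" if "s >= nat (N - c)" for s t using that by (simp add: B_def N md_lin)
  have e1: "evz (%s. sc (bc q s) (al (- int q - 1 - int s) (md u (c + int s) v)))"
   by (rule evz_fscale[OF nop_evz1[OF fld_md]])
  have 1: "md (sc (bc q s) (al (- int q - 1 - int s) (md u (c + int s) v))) (d - c) w = Sum_any (A s) + Sum_any (B s)" for s
  proof -
   have e: "- int q - 1 - int s = - int (q + s) - 1" by simp
   have ev1: "evz (%t. sc (bc (q + s) t) (al (- int (q + s) - 1 - int t) (md (md u (c + int s) v) (d - c + int t) w)))"
    by (rule evz_fscale[OF nop_evz1[OF fld_md]])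
   have ev2: "evz (%t. sc (bc (q + s) t * (-1) ^ (q + s)) (md (md u (c + int s) v) (d - c - int t - int (q + s) - 1) (al (int t) w)))"
    by (intro evzI[of I]) (simp add: I md_lin)
   show ?thesis
    unfolding e flin_scale[OF flin_md1] md_heis nop_split[OF fld_md] sc_add
     Sum_any_fscale[OF ev1, symmetric] Sum_any_fscale[OF ev2, symmetric]
    by (simp add: A_def B_def algebra_simps cong: Sum_any.cong)
  qed
  have "md (md (al (- int q - 1) u) c v) (d - c) w =
    Sum_any (%s. Sum_any (A s) + Sum_any (B s)) + (\<Sum>j<J. S2 j c)"
  proof -
   have "Sum_any (%j. sc (bc q j * (-1) ^ q) (md u (c - int j - int q - 1) (al (int j) v)))
    = (\<Sum>j<J. sc (bc q j * (-1) ^ q) (md u (c - int j - int q - 1) (al (int j) v)))"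
    by (rule Sum_any_nat) (simp add: J md_lin)
   then show ?thesis
    unfolding md_heis[of q u c v] nop_split[OF fld_md] flin_add[OF flin_md1] Sum_any_flin[OF e1 flin_md1] 1
    by (simp add: flin_sum[OF flin_md1] flin_scale[OF flin_md1] S2_def mult.commute)
  qed
  also have "Sum_any (%s. Sum_any (A s) + Sum_any (B s)) = Sum_any (%s. Sum_any (A s)) + Sum_any (%s. Sum_any (B s))"
   by (rule Sum_any_add; rule evzI[of "nat (N - c)"]) (simp_all add: zA zB)
  also have "Sum_any (%s. Sum_any (A s)) = Sum_any (%r. \<Sum>s\<le>r. A s (r - s))"
   by (rule Sum_any_antidiag[of "nat (N - c) + nat (M - d + c)"]) (auto simp: zA, simp add: A_def M heis_lin)
  also have "(%r. \<Sum>s\<le>r. A s (r - s)) = (%r. P r c)"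
  proof
   fix r
   have "cv (bp (int r)) (L (d + int r)) c = (\<Sum>s<Suc r. sc (fps_nth (bp (int r)) s) (L (d + int r) (c + int s)))"
    unfolding cv_def by (rule Sum_any_nat) (simp flip: binomial_gbinomial)
   then have "P r c = (\<Sum>s\<le>r. sc (bc q r * of_nat (r choose s)) (al (- int q - 1 - int r) (L (d + int r) (c + int s))))"
    by (simp add: P_def flin_sum[OF flin_heis] flin_scale[OF flin_heis] sc_sum lessThan_Suc_atMost binomial_gbinomial)
   also have "... = (\<Sum>s\<le>r. A s (r - s))"
   proof (rule sum.cong[OF refl])
    fix s assume "s \<in> {..r}"
    then have s: "s \<le> r" by simp
    then have "bc q r * of_nat (r choose s) = bc q s * bc (q + s) (r - s)"
     using bc_assoc'[of q s "r - s"] by simp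
    moreover have "- int q - 1 - int s - int (r - s) = - int q - 1 - int r"
     "d - c + int (r - s) = d + int r - (c + int s)" using s by (simp_all add: of_nat_diff)
    ultimately show "sc (bc q r * of_nat (r choose s)) (al (- int q - 1 - int r) (L (d + int r) (c + int s))) = A s (r - s)"
     unfolding A_def L_def by (simp only:)
   qed
   finally show "(\<Sum>s\<le>r. A s (r - s)) = P r c" ..
  qed
  also have "Sum_any (%s. Sum_any (B s)) = Sum_any (%t. Sum_any (%s. B s t))"
   by (rule Sum_any_swap_nat[OF zB evB])
  also have "(%t. Sum_any (%s. B s t)) = (%t. S1 t c)"
  proof
   fix t
   have "B s t = sc (bc q t * (-1) ^ q) (sc (fps_nth (bp (- int (q + t) - 1)) s) (K t (c + int s)))" for s
   proof -
    have "bc q s * bc (q + s) t * (-1) ^ (q + s) = bc q t * (-1) ^ q * ((-1) ^ s * bc (q + t) s)"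
     unfolding bc_swap[of q s t] by (simp add: power_add mult_ac)
    moreover have "d - c - int t - int (q + s) - 1 = d - int t - int q - 1 - (c + int s)" by simp
    ultimately show ?thesis unfolding bp_neg_bc B_def K_def by (simp only: sc_sc)
   qed
   then show "Sum_any (%s. B s t) = S1 t c"
    unfolding S1_def cv_def by (simp only: Sum_any_fscale[OF bdd_cv_evz[OF bK]])
  qed
  finally show ?thesis by (simp only: add.assoc)
 qed
 have "LL (al (- int q - 1) u) v w m n k = cv (bp m) (%c. Sum_any (%s. P s c) + (Sum_any (%s. S1 s c) + (\<Sum>j<J. S2 j c))) k"
  unfolding LL_def d_def[symmetric] G ..
 also have "... = Sum_any (%s. cv (bp m) (P s) k) + (Sum_any (%s. cv (bp m) (S1 s) k) + (\<Sum>j<J. cv (bp m) (S2 j) k))"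
  by (simp add: cv_add cv_sum cv_Sum_any bdd_add bdd_sum fam_bdd_Sum famP famS1 bS2)
 also have "(%s. cv (bp m) (P s) k) = (%s. sc (bc q s) (al (- int q - 1 - int s) (LL u v w (m + int s) n k)))"
 proof
  fix s
  have "d + int s = m + int s + n + k" by (simp add: d_def)
  then show "cv (bp m) (P s) k = sc (bc q s) (al (- int q - 1 - int s) (LL u v w (m + int s) n k))"
   unfolding P_def cv_scale[OF bdd_flin[OF bdd_cv[OF bL] flin_heis]] cv_flin[OF bdd_cv[OF bL] flin_heis, symmetric]
     cv_mult'[OF bL] bp_add[symmetric] by (simp only: L_def[abs_def] LL_def)
 qed
 also have "(%s. cv (bp m) (S1 s) k) = (%s. sc (bc q s * (-1) ^ q) (LL u v (al (int s) w) (m - int s - int q - 1) n k))"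
 proof
  fix s
  have "d - int s - int q - 1 = m - int s - int q - 1 + n + k" "m + (- int (q + s) - 1) = m - int s - int q - 1"
   by (simp_all add: d_def)
  then show "cv (bp m) (S1 s) k = sc (bc q s * (-1) ^ q) (LL u v (al (int s) w) (m - int s - int q - 1) n k)"
   unfolding S1_def cv_scale[OF bdd_cv[OF bK]] cv_mult'[OF bK] bp_add[symmetric]
   by (simp only: K_def[abs_def] LL_def)
 qed
 also have "(%j. cv (bp m) (S2 j) k) = (%j. sc ((-1) ^ q * bc q j) (LL u (al (int j) v) w m n (k - int q - int j - 1)))"
 proof
  fix j
  let ?r = "- int q - int j - 1"
  let ?G = "%c. md (md u c (al (int j) v)) (m + n + (k - int q - int j - 1) - c) w"
  have "S2 j = (%c. sc ((-1) ^ q * bc q j) (?G (c + ?r)))"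
   by (rule ext) (simp add: S2_def d_def algebra_simps)
  moreover have "cv (bp m) (%c. ?G (c + ?r)) k = cv (bp m) ?G (k + ?r)"
   by (rule cv_shift)
  moreover have "k + ?r = k - int q - int j - 1" by simp
  ultimately show "cv (bp m) (S2 j) k = sc ((-1) ^ q * bc q j) (LL u (al (int j) v) w m n (k - int q - int j - 1))"
   unfolding LL_def by (simp only: cv_scale[OF bdd_shift[OF bdd_LL]])
 qed
 finally show ?thesis by (simp only: add.assoc)
qed

text \<open>The oscillator of v sits at y. It is taken out of u_c (\<alpha>(-q-1) v) by
  \<open>heis_md_finite\<close>, whose commutator is the contraction sum, and then
  \<open>md_heis\<close> applies to the outer field.\<close>

lemma LL_vstep:
 assumes J: "!!j. j >= J ==> al (int j) u = 0"
 shows "LL u (al (- int q - 1) v) w m n k =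
  Sum_any (%s. sc (bc q s) (al (- int q - 1 - int s) (LL u v w m (n + int s) k)))
  + Sum_any (%s. sc (bc q s * (-1) ^ q) (LL u v (al (int s) w) m (n - int s - int q - 1) k))
  - (\<Sum>j<J. sc ((-1) ^ j * bc q j) (LL (al (int j) u) v w m n (k - int q - int j - 1)))"
proof -
 define d where "d = m + n + k"
 define P where "P s c = sc (bc q s) (al (- int q - 1 - int s) (md (md u c v) (d - c + int s) w))" for s c
 define S1 where "S1 s c = sc (bc q s * (-1) ^ q) (md (md u c v) (d - c - int s - int q - 1) (al (int s) w))" for s c
 define S2 where "S2 j c = sc ((-1) ^ j * bc q j) (md (md (al (int j) u) (c - int q - 1 - int j) v) (d - c) w)" for j c
 from bdd_md[of u v] obtain N where N: "!!c. c >= N ==> md u c v = 0" by (metis bddE)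
 from heis_evz[of 0 w] obtain I where I: "!!i. i >= I ==> al (int i) w = 0" by (auto simp: evz_def)
 have famP: "fam P"
  unfolding fam_def
 proof (intro conjI allI)
  show "\<exists>N. ALL b>=N. \<forall>s. P s b = 0" by (intro exI[of _ N]) (simp add: P_def N md_lin heis_lin)
  fix c
  from bdd_md[of "md u c v" w] obtain K where "!!b. b >= K ==> md (md u c v) b w = 0" by (metis bddE)
  then show "evz (%s. P s c)" by (intro evzI[of "nat (K - d + c)"]) (simp add: P_def heis_lin)
 qed
 have famS1: "fam S1"
  unfolding fam_def
 proof (intro conjI allI)
  show "\<exists>N. ALL b>=N. \<forall>s. S1 s b = 0" by (intro exI[of _ N]) (simp add: S1_def N md_lin)
  show "evz (%s. S1 s b)" for b by (intro evzI[of I]) (simp add: S1_def I md_lin)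
 qed
 have bS2: "bdd (S2 j)" for j
 proof -
  from bdd_md[of "al (int j) u" v] obtain M where "!!c. c >= M ==> md (al (int j) u) c v = 0" by (metis bddE)
  then show ?thesis by (intro bddI[of "M + int j + int q + 1"]) (simp add: S2_def md_lin)
 qed
 have G: "md (md u c (al (- int q - 1) v)) (d - c) w
  = Sum_any (%s. P s c) + Sum_any (%s. S1 s c) - (\<Sum>j<J. S2 j c)" for c
 proof -
  have "(of_int (- int q - 1) gchoose j :: complex) = (-1) ^ j * bc q j" for j
   by (simp only: gbinomial_neg_nat bc_eq)
  then have "al (- int q - 1) (md u c v) = md u c (al (- int q - 1) v)
   + (\<Sum>j<J. sc ((-1) ^ j * bc q j) (md (al (int j) u) (c - int q - 1 - int j) v))"
   using heis_md_finite[OF J, where r = "- int q - 1" and n = c and w = v] by (simp add: algebra_simps)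
  then have "md u c (al (- int q - 1) v) = al (- int q - 1) (md u c v)
   - (\<Sum>j<J. sc ((-1) ^ j * bc q j) (md (al (int j) u) (c - int q - 1 - int j) v))"
   by simp
  then have "md (md u c (al (- int q - 1) v)) (d - c) w = md (al (- int q - 1) (md u c v)) (d - c) w - (\<Sum>j<J. S2 j c)"
   by (simp add: flin_diff[OF flin_md1] flin_sum[OF flin_md1] flin_scale[OF flin_md1] S2_def)
  then show ?thesis unfolding md_heis nop_split[OF fld_md] P_def S1_def by simp
 qed
 have "LL u (al (- int q - 1) v) w m n k = cv (bp m) (%c. Sum_any (%s. P s c) + Sum_any (%s. S1 s c) - (\<Sum>j<J. S2 j c)) k"
  unfolding LL_def d_def[symmetric] G ..
 also have "... = Sum_any (%s. cv (bp m) (P s) k) + Sum_any (%s. cv (bp m) (S1 s) k) - (\<Sum>j<J. cv (bp m) (S2 j) k)"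
  by (simp add: cv_add cv_diff cv_sum cv_Sum_any bdd_add bdd_sum fam_bdd_Sum famP famS1 bS2)
 also have "(%s. cv (bp m) (P s) k) = (%s. sc (bc q s) (al (- int q - 1 - int s) (LL u v w m (n + int s) k)))"
 proof
  fix s
  have "P s = (%c. sc (bc q s) (al (- int q - 1 - int s) (md (md u c v) (m + (n + int s) + k - c) w)))"
   by (rule ext) (simp add: P_def d_def algebra_simps)
  then show "cv (bp m) (P s) k = sc (bc q s) (al (- int q - 1 - int s) (LL u v w m (n + int s) k))"
   unfolding LL_def by (simp only: cv_scale[OF bdd_flin[OF bdd_LL flin_heis]] cv_flin[OF bdd_LL flin_heis])
 qed
 also have "(%s. cv (bp m) (S1 s) k) = (%s. sc (bc q s * (-1) ^ q) (LL u v (al (int s) w) m (n - int s - int q - 1) k))"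
 proof
  fix s
  have "S1 s = (%c. sc (bc q s * (-1) ^ q) (md (md u c v) (m + (n - int s - int q - 1) + k - c) (al (int s) w)))"
   by (rule ext) (simp add: S1_def d_def algebra_simps)
  then show "cv (bp m) (S1 s) k = sc (bc q s * (-1) ^ q) (LL u v (al (int s) w) m (n - int s - int q - 1) k)"
   unfolding LL_def by (simp only: cv_scale[OF bdd_LL])
 qed
 also have "(%j. cv (bp m) (S2 j) k) = (%j. sc ((-1) ^ j * bc q j) (LL (al (int j) u) v w m n (k - int q - int j - 1)))"
 proof
  fix j
  let ?r = "- int q - int j - 1"
  let ?G = "%c. md (md (al (int j) u) c v) (m + n + (k - int q - int j - 1) - c) w"
  have "S2 j = (%c. sc ((-1) ^ j * bc q j) (?G (c + ?r)))"
   by (rule ext) (simp add: S2_def d_def algebra_simps)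
  moreover have "cv (bp m) (%c. ?G (c + ?r)) k = cv (bp m) ?G (k + ?r)"
   by (rule cv_shift)
  moreover have "k + ?r = k - int q - int j - 1" by simp
  ultimately show "cv (bp m) (S2 j) k = sc ((-1) ^ j * bc q j) (LL (al (int j) u) v w m n (k - int q - int j - 1))"
   unfolding LL_def by (simp only: cv_scale[OF bdd_shift[OF bdd_LL]])
 qed
 finally show ?thesis .
qed

end

text \<open>The recurrence is (1 - Y) f' = - \<open>ka\<close> f with f(0) = 1, whose solution is (1
  - Y)^\<open>ka\<close>.\<close>

lemma gbinomial_recurrence:
 fixes h :: "nat => complex"
 assumes "h 0 = 1" "!!i. i > 0 ==> of_nat i * h i = - ka * (\<Sum>n = 1..i. h (i - n))"
 shows "h i = (-1) ^ i * (ka gchoose i)"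
proof (induction i rule: less_induct)
 case (less i)
 show ?case
 proof (cases i)
  case 0 then show ?thesis by (simp add: assms(1))
 next
  case (Suc i')
  have "(\<Sum>n = 1..i. h (i - n)) = (\<Sum>n\<le>i'. h n)"
   by (rule sum.reindex_bij_witness[where i = "%m. i - m" and j = "%n. i - n"]) (use Suc in auto)
  also have "... = (\<Sum>n\<le>i'. (ka gchoose n) * (-1) ^ n)"
   by (rule sum.cong) (use Suc less in auto)
  also have "... = (-1) ^ i' * (ka - 1 gchoose i')" by (rule gbinomial_sum_lower_neg)
  finally have "of_nat (Suc i') * h i = (-1) ^ i * (ka * (ka - 1 gchoose i'))"
   using assms(2)[of i] Suc by simp
  also have "... = of_nat (Suc i') * ((-1) ^ i * (ka gchoose i))"
   using gbinomial_absorption[of i' ka] Suc by simp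
  finally show ?thesis by (simp del: of_nat_Suc)
 qed
qed

text \<open>The substitution Y \<rightarrow> -Y in the preceding recurrence: (1 + Y) f' = e f with
  f(0) = 1.\<close>

lemma gbinomial_recurrence':
 fixes f :: "nat => complex"
 assumes "f 0 = 1" "!!i. i > 0 ==> of_nat i * f i = e * (\<Sum>n = 1..i. (-1) ^ (n - 1) * f (i - n))"
 shows "f i = e gchoose i"
proof -
 have "(-1) ^ i * f i = (-1) ^ i * (e gchoose i)"
 proof (rule gbinomial_recurrence[where h = "%i. (-1) ^ i * f i"])
  fix i :: nat assume i: "i > 0"
  have "of_nat i * ((-1) ^ i * f i) = (-1) ^ i * (e * (\<Sum>n = 1..i. (-1) ^ (n - 1) * f (i - n)))"
   using assms(2)[OF i] by (simp add: mult_ac)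
  also have "... = - e * (\<Sum>n = 1..i. (-1) ^ (i - n) * f (i - n))"
   unfolding sum_distrib_left
  proof (rule sum.cong[OF refl])
   fix n assume n: "n \<in> {1..i}"
   obtain n' where "n = Suc n'" using n by (cases n) auto
   moreover obtain j where "i = n + j" using n by (metis atLeastAtMost_iff le_Suc_ex)
   ultimately show "(-1) ^ i * (e * ((-1) ^ (n - 1) * f (i - n))) = - e * ((-1) ^ (i - n) * f (i - n))"
    by (simp add: power_add mult_ac)
  qed
  finally show "of_nat i * ((-1) ^ i * f i) = - e * (\<Sum>n = 1..i. (-1) ^ (i - n) * f (i - n))" .
 qed (simp add: assms(1))
 then show ?thesis by simp
qed

lemma Sum_any_fps_conv:
 fixes X Y :: "complex fps"
 shows "Sum_any (%s. fps_nth X s * (if K - int s >= 0 then fps_nth Y (nat (K - int s)) else 0))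
  = (if K >= 0 then fps_nth (X * Y) (nat K) else 0)"
proof (cases "K >= 0")
 case True
 have "Sum_any (%s. fps_nth X s * (if K - int s >= 0 then fps_nth Y (nat (K - int s)) else 0))
  = (\<Sum>s<Suc (nat K). fps_nth X s * (if K - int s >= 0 then fps_nth Y (nat (K - int s)) else 0))"
  by (rule Sum_any_nat) auto
 also have "... = (\<Sum>s = 0..nat K. fps_nth X s * fps_nth Y (nat K - s))"
  using True by (intro sum.cong) (auto simp: nat_diff_distrib)
 finally show ?thesis using True by (simp add: fps_mult_nth)
qed simp

text \<open>The residue identity behind the Jacobi identity, for the monomial \<open>x\<^sup>m y\<^sup>n (x - y)\<^sup>k\<close>.\<close>

lemma residue_identity:
 assumes "m + n + k = -2"
 shows "(if -1 - k >= 0 then fps_nth (bp m) (nat (-1 - k)) else 0)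
  = (if -1 - n >= 0 then fps_nth (bn k) (nat (-1 - n)) else 0)
   - sg k * (if -1 - m >= 0 then fps_nth (bn k) (nat (-1 - m)) else 0)"
proof -
 consider (nn) "k >= 0" "n < 0" "m < 0" | (n) "k >= 0" "n >= 0" | (m) "k >= 0" "m >= 0"
  | (A) "k < 0" "n < 0" | (B) "k < 0" "n >= 0" "m < 0" | (C) "k < 0" "n >= 0" "m >= 0" by linarith
 then show ?thesis
 proof cases
  case nn
  obtain a b where ab: "n = -1 - int a" "m = -1 - int b" "k = int (a + b)"
  proof (rule that[of "nat (-1 - n)" "nat (-1 - m)"])
  qed (use nn assms in auto)
  have "(of_nat (a + b) gchoose a :: complex) = of_nat (a + b) gchoose b"
   unfolding binomial_gbinomial[symmetric] by (subst binomial_symmetric) auto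
  then show ?thesis by (simp add: ab sg_nat[of "a + b", simplified] power_add)
 next
  case n
  obtain k' b where "k = int k'" "m = -1 - int b"
   by (rule that[of "nat k" "nat (-1 - m)"]) (use n assms in auto)
  moreover have "(of_nat k' gchoose b :: complex) = 0"
   unfolding binomial_gbinomial[symmetric] using calculation n assms by simp
  ultimately show ?thesis using n by simp
 next
  case m
  obtain k' b where "k = int k'" "n = -1 - int b"
   by (rule that[of "nat k" "nat (-1 - n)"]) (use m assms in auto)
  moreover have "(of_nat k' gchoose b :: complex) = 0"
   unfolding binomial_gbinomial[symmetric] using calculation m assms by simp
  ultimately show ?thesis using m by simp
 next
  case A
  obtain K a where ka: "k = - int K - 1" "n = - int a - 1"
   by (rule that[of "nat (-1 - k)" "nat (-1 - n)"]) (use A in auto)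
  then have m: "m = int (K + a)" using assms by simp
  have "fps_nth (bn k) a = of_nat ((K + a) choose a)"
   unfolding ka by (rule bn_neg_nth)
  moreover have "fps_nth (bp m) K = of_nat ((K + a) choose a)"
   unfolding bp_nth m of_int_of_nat_eq binomial_gbinomial[symmetric] by (subst binomial_symmetric) auto
  ultimately show ?thesis using m by (simp add: ka)
 next
  case B
  obtain K b where kb: "k = - int K - 1" "m = - int b - 1"
   by (rule that[of "nat (-1 - k)" "nat (-1 - m)"]) (use B in auto)
  have "fps_nth (bn k) b = of_nat ((K + b) choose b)"
   unfolding kb by (rule bn_neg_nth)
  moreover have "fps_nth (bp m) K = (-1) ^ K * of_nat ((K + b) choose b)"
   unfolding kb bp_nth gbinomial_neg_nat by (subst binomial_symmetric) (auto simp: add.commute)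
  moreover have "sg k = - ((-1) ^ K)"
   unfolding kb sg_diff sg_minus sg_nat using sg_nat[of 1] by simp
  ultimately show ?thesis using B by (simp add: kb)
 next
  case C
  obtain K m' where km: "k = -1 - int K" "m = int m'"
   by (rule that[of "nat (-1 - k)" "nat m"]) (use C in auto)
  moreover have "(of_nat m' gchoose K :: complex) = 0"
   unfolding binomial_gbinomial[symmetric] using km C assms by simp
  ultimately show ?thesis using C by simp
 qed
qed

section \<open>Vacuum coefficients and the reduction to exponentials\<close>

lemma lookup_Sum_any:
 fixes f :: "nat => fock"
 assumes "evz f"
 shows "lookup (Sum_any f) z = Sum_any (%i. lookup (f i) z)"
proof -
 from assms obtain N where N: "!!i. i >= N ==> f i = 0" by (metis evzE)
 then show ?thesis
  by (subst (1 2) Sum_any_nat[of N]) (simp_all add: lookup_fsum)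
qed

lemma lookup_cv: "bdd G ==> lookup (cv ka G b) z = Sum_any (%s. fps_nth ka s * lookup (G (b + int s)) z)"
 by (simp add: cv_def lookup_Sum_any bdd_cv_evz)

context rank_one begin

lemma lookup_heis_pos:
 assumes "r > 0"
 shows "lookup (al r v) (\<nu>, l)
  = 2 * of_nat p * of_int r * of_nat (count \<nu> (nat (r - 1)) + 1) * lookup v (add_mset (nat (r - 1)) \<nu>, l)"
  (is "_ = ?c * _")
proof -
 let ?q = "nat (r - 1)"
 have *: "lookup (al r (single b 1)) (\<nu>, l) = (if b = (add_mset ?q \<nu>, l) then ?c else 0)" for b
 proof -
  obtain mu k where b: "b = (mu, k)" by (cases b)
  show ?thesis
  proof (cases "?q \<in># mu")
   case True
   then obtain mu' where "mu = add_mset ?q mu'" by (metis multi_member_split)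
   then show ?thesis using assms by (auto simp: b heis_single lookup_single when_def)
  next
   case False
   then have "mu ~= add_mset ?q \<nu>" by auto
   with False show ?thesis using assms by (simp add: b heis_single not_in_iff)
  qed
 qed
 have "al r v = (\<Sum>b\<in>keys v. sc (lookup v b) (al r (single b 1)))"
  using arg_cong[OF fock_expand[of v], of "al r"]
  by (simp add: flin_sum[OF flin_heis] flin_scale[OF flin_heis] del: fscale_single)
 then have "lookup (al r v) (\<nu>, l) = (\<Sum>b\<in>keys v. lookup v b * (if b = (add_mset ?q \<nu>, l) then ?c else 0))"
  by (simp add: lookup_fsum *)
 also have "... = (\<Sum>b\<in>keys v. if b = (add_mset ?q \<nu>, l) then lookup v b * ?c else 0)"
  by (rule sum.cong) auto
 also have "... = ?c * lookup v (add_mset ?q \<nu>, l)"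
  by (simp add: in_keys_iff)
 finally show ?thesis .
qed

text \<open>\<alpha>(q+1) differentiates with respect to the oscillator of index q, so a nonzero
  coefficient at a nonempty monomial survives in one derivative; positive level excludes the empty
  monomial.\<close>

lemma vacuum_vector_eq_0:
 assumes "v \<in> grd k N" "N > 0" "!!r. r > 0 ==> al r v = 0"
 shows "v = 0"
proof (rule fock_eq_0I)
 fix b
 show "b \<notin> keys v"
 proof
  assume b: "b \<in> keys v"
  obtain mu l where [simp]: "b = (mu, l)" by (cases b)
  have "lev mu = N" using grd_keys[OF assms(1) b] by simp
  with assms(2) obtain q \<nu> where q: "mu = add_mset q \<nu>" by (cases mu) auto
  have "lookup (al (int q + 1) v) (\<nu>, l) = 2 * of_nat p * of_int (int q + 1) * of_nat (count \<nu> q + 1) * lookup v b"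
   using lookup_heis_pos[of "int q + 1" v \<nu> l] by (simp add: q)
  moreover have "(2 * of_nat p * of_int (int q + 1) * of_nat (count \<nu> q + 1) :: complex) ~= 0"
  proof -
   have "(of_int (int q + 1) :: complex) = of_nat (Suc q)" by simp
   then show ?thesis using p0 by (simp del: of_nat_Suc of_int_add)
  qed
  ultimately have "lookup v b = 0"
   using assms(3)[of "int q + 1"] by (metis lookup_zero mult_eq_0_iff zero_less_one add_nonneg_pos of_nat_0_le_iff)
  with b show False by (simp add: in_keys_iff)
 qed
qed

lemma lookup_heis_neg_vacuum: "n > 0 ==> lookup (al (- int n) x) ({#}, l) = 0"
proof -
 assume n: "n > 0"
 have "x \<in> supp UNIV" by (simp add: supp_def)
 then have "al (- int n) x \<in> supp {b. fst b ~= {#}}"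
  by (rule supp_flin[OF flin_heis, rotated]) (use n in \<open>auto simp: heis_single intro!: supp_single\<close>)
 then show ?thesis by (auto simp: supp_def in_keys_iff)
qed

lemma ekc_lat_exp: "ekc k e n (xp l) = crez k (- n - 1 - e) (xp (k + l))"
proof -
 have "Sum_any (%j. crez k (int j - n - 1 - e) (ann k j (xp (k + l))))
  = Sum_any (%j. if j = (0::nat) then crez k (- n - 1 - e) (xp (k + l)) else 0)"
  by (rule Sum_any.cong) (auto simp: ann_lat_exp flin_zero[OF flin_crez])
 then show ?thesis by (simp add: ekc_def lat_exp_mult)
qed

lemma lat_exp_chs [intro]: "xp k \<in> chs {k}"
 by (rule grd_chs[OF lat_exp_grd])

lemma ek_lat_exp:
 assumes "k * l = tp * e"
 shows "ek k n (xp l) = crez k (- n - 1 - e) (xp (k + l))"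
proof -
 have "k * l div tp = e" unfolding assms using p2 by simp
 moreover have "tp dvd k * l" unfolding assms by simp
 ultimately show ?thesis by (simp only: ek_chs[OF lat_exp_chs] ekc_lat_exp if_True)
qed

text \<open>The two-point factor (1 - y/x)^(kl/2p) of two exponentials. By \<open>cre_deriv\<close>
  each coefficient is a sum over a creation mode; commuted to the left it has no vacuum coefficient,
  and the commutators from \<open>heis_ek\<close> leave the binomial recurrence.\<close>

lemma vacuum_expectation_ek:
 assumes "k * l = tp * ka" "k * c = tp * e"
 shows "lookup (ek k (int i - 1 - ka - e) (cre l i (xp (l + c)))) ({#}, k + l + c)
  = fps_nth (bn ka) i"
 unfolding bn_nth
proof (rule gbinomial_recurrence[where h = "%i. lookup (ek k (int i - 1 - ka - e) (cre l i (xp (l + c)))) ({#}, k + l + c)"])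
 have "k * (l + c) = tp * (ka + e)" using assms by (simp add: algebra_simps)
 then have "ek k (int 0 - 1 - ka - e) (cre l 0 (xp (l + c))) = xp (k + l + c)"
  by (simp only: cre_0 ek_lat_exp) (simp add: crez_def add.assoc)
 then show "lookup (ek k (int 0 - 1 - ka - e) (cre l 0 (xp (l + c)))) ({#}, k + l + c) = 1"
  by (simp only:) (simp add: lat_exp_def)
next
 fix i :: nat assume "i > 0"
 let ?x = "%i. cre l i (xp (l + c))"
 have "sc (of_nat i) (ek k (int i - 1 - ka - e) (?x i)) = ek k (int i - 1 - ka - e)
  (\<Sum>n = 1..i. sc (of_int l / of_nat (2 * p)) (al (- int n) (?x (i - n))))"
  unfolding flin_scale[OF flin_ek, symmetric] cre_deriv ..
 also have "... = (\<Sum>n = 1..i. sc (of_int l / of_nat (2 * p)) (al (- int n) (ek k (int i - 1 - ka - e) (?x (i - n)))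
   - sc (of_int k) (ek k (int (i - n) - 1 - ka - e) (?x (i - n)))))"
  unfolding flin_sum[OF flin_ek] flin_scale[OF flin_ek]
 proof (rule sum.cong[OF refl])
  fix n assume n: "n \<in> {1..i}"
  have "ek k (int i - 1 - ka - e) (al (- int n) (?x (i - n))) = al (- int n) (ek k (int i - 1 - ka - e) (?x (i - n)))
   - sc (of_int k) (ek k (int (i - n) - 1 - ka - e) (?x (i - n)))"
   using heis_ek[of "- int n" k "int i - 1 - ka - e" "?x (i - n)"] n by (simp add: of_nat_diff algebra_simps)
  then show "sc (of_int l / of_nat (2 * p)) (ek k (int i - 1 - ka - e) (al (- int n) (?x (i - n)))) =
   sc (of_int l / of_nat (2 * p)) (al (- int n) (ek k (int i - 1 - ka - e) (?x (i - n)))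
   - sc (of_int k) (ek k (int (i - n) - 1 - ka - e) (?x (i - n))))" by simp
 qed
 finally have "of_nat i * lookup (ek k (int i - 1 - ka - e) (?x i)) ({#}, k + l + c)
  = (\<Sum>n = 1..i. of_int l / of_nat (2 * p) * (- (of_int k * lookup (ek k (int (i - n) - 1 - ka - e) (?x (i - n))) ({#}, k + l + c))))"
  by (subst lookup_fscale[symmetric]) (simp add: lookup_fsum lookup_minus lookup_heis_neg_vacuum)
 also have "... = - of_int ka * (\<Sum>n = 1..i. lookup (ek k (int (i - n) - 1 - ka - e) (?x (i - n))) ({#}, k + l + c))"
 proof -
  have "of_int (k * l) = (of_int (tp * ka) :: complex)" by (simp only: assms)
  then have "(of_int l / of_nat (2 * p) * of_int k :: complex) = of_int ka"
   using p0 by (simp add: field_simps)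
  then show ?thesis unfolding sum_distrib_left
   by (intro sum.cong) (simp_all only: mult_minus_right mult_minus_left mult.assoc[symmetric])
 qed
 finally show "of_nat i * lookup (ek k (int i - 1 - ka - e) (?x i)) ({#}, k + l + c)
  = - of_int ka * (\<Sum>n = 1..i. lookup (ek k (int (i - n) - 1 - ka - e) (?x (i - n))) ({#}, k + l + c))" .
qed

lemma vacuum_expectation_md_heis:
 assumes n: "n > 0"
 shows "lookup (md (al (- int n) x) r (xp c)) ({#}, l)
  = (-1) ^ (n - 1) * of_int c * lookup (md x (r - int n) (xp c)) ({#}, l)"
proof -
 obtain q where q: "n = Suc q" using n by (cases n) auto
 have e: "- int n = - int q - 1" by (simp add: q)
 have ev: "evz (%j. sc (bc q j * (-1) ^ q) (md x (r - int j - int q - 1) (al (int j) (xp c))))"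
  by (rule evzI[of 1]) (simp add: md_lin)
 have "lookup (md (al (- int n) x) r (xp c)) ({#}, l)
  = Sum_any (%j. bc q j * lookup (al (- int (q + 1 + j)) (md x (r + int j) (xp c))) ({#}, l))
   + Sum_any (%j. bc q j * (-1) ^ q * lookup (md x (r - int j - int q - 1) (al (int j) (xp c))) ({#}, l))"
 proof -
  have e': "- int q - 1 - int j = - int (q + 1 + j)" for j by simp
  show ?thesis
   unfolding e md_heis nop_split[OF fld_md] lookup_add lookup_Sum_any[OF evz_fscale[OF nop_evz1[OF fld_md]]] lookup_Sum_any[OF ev]
    lookup_fscale by (simp only: e')
 qed
 also have "Sum_any (%j. bc q j * lookup (al (- int (q + 1 + j)) (md x (r + int j) (xp c))) ({#}, l)) = 0"
  by (subst lookup_heis_neg_vacuum) auto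
 also have "Sum_any (%j. bc q j * (-1) ^ q * lookup (md x (r - int j - int q - 1) (al (int j) (xp c))) ({#}, l))
  = Sum_any (%j. if j = (0::nat) then (-1) ^ q * of_int c * lookup (md x (r - int n) (xp c)) ({#}, l) else 0)"
  by (rule Sum_any.cong) (auto simp: md_lin heis_zero[OF lat_exp_chs] bc_def q algebra_simps)
 finally show ?thesis by (simp add: q)
qed

text \<open>The counterpart for the iterate: the factor is (1 + z/y)^(kc/2p), and the recurrence
  comes from the action of the oscillators inside the state on the exponential
  \<open>xp c\<close>.\<close>

lemma vacuum_expectation_cre:
 assumes "k * c = tp * e" "l * c = tp * e'"
 shows "lookup (md (cre k i (xp l)) (int i - 1 - e') (xp c)) ({#}, l + c)
  = fps_nth (bp e) i"
 unfolding bp_nth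
proof (rule gbinomial_recurrence'[where f = "%i. lookup (md (cre k i (xp l)) (int i - 1 - e') (xp c)) ({#}, l + c)"])
 have "md (cre k 0 (xp l)) (int 0 - 1 - e') (xp c) = xp (l + c)"
  by (simp only: cre_0 md_lat_exp ek_lat_exp[OF assms(2)]) (simp add: crez_def)
 then show "lookup (md (cre k 0 (xp l)) (int 0 - 1 - e') (xp c)) ({#}, l + c) = 1"
  by (simp only:) (simp add: lat_exp_def)
next
 fix i :: nat assume "i > 0"
 let ?x = "%i. cre k i (xp l)"
 let ?v = "%v. lookup v ({#}, l + c)"
 have "sc (of_nat i) (md (?x i) (int i - 1 - e') (xp c)) =
  (\<Sum>n = 1..i. sc (of_int k / of_nat (2 * p)) (md (al (- int n) (?x (i - n))) (int i - 1 - e') (xp c)))"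
  unfolding flin_scale[OF flin_md1, symmetric] cre_deriv by (simp add: flin_sum[OF flin_md1] md_lin)
 then have "of_nat i * ?v (md (?x i) (int i - 1 - e') (xp c)) = 
  (\<Sum>n = 1..i. of_int k / of_nat (2 * p) * ?v (md (al (- int n) (?x (i - n))) (int i - 1 - e') (xp c)))"
  by (subst lookup_fscale[symmetric]) (simp add: lookup_fsum)
 also have "... = (\<Sum>n = 1..i. of_int e * ((-1) ^ (n - 1) * ?v (md (?x (i - n)) (int (i - n) - 1 - e') (xp c))))"
 proof (rule sum.cong[OF refl])
  fix n assume n: "n \<in> {1..i}"
  have "of_int (k * c) = (of_int (tp * e) :: complex)" by (simp only: assms)
  then have "(of_int k / of_nat (2 * p) * of_int c :: complex) = of_int e"
   using p0 by (simp add: field_simps)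
  then have A: "of_int k / of_nat (2 * p) * (a * of_int c * b) = of_int e * (a * b)" for a b :: complex
   by (metis mult.assoc mult.commute)
  have B: "int i - 1 - e' - int n = int (i - n) - 1 - e'" using n by (simp add: of_nat_diff)
  have C: "n > 0" using n by simp
  show "of_int k / of_nat (2 * p) * ?v (md (al (- int n) (?x (i - n))) (int i - 1 - e') (xp c))
   = of_int e * ((-1) ^ (n - 1) * ?v (md (?x (i - n)) (int (i - n) - 1 - e') (xp c)))"
   unfolding vacuum_expectation_md_heis[OF C] A B ..
 qed
 finally show "of_nat i * ?v (md (?x i) (int i - 1 - e') (xp c)) =
  of_int e * (\<Sum>n = 1..i. (-1) ^ (n - 1) * ?v (md (?x (i - n)) (int (i - n) - 1 - e') (xp c)))"
  by (simp only: sum_distrib_left)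
qed

lemma flin_cv:
 assumes "!!b. flin (G b)" "!!x. bdd (%b. G b x)"
 shows "flin (%x. cv ka (%b. G b x) n)"
 by (rule flinI) (simp_all add: flin_add[OF assms(1)] flin_scale[OF assms(1)] cv_add cv_scale assms(2))

lemma flin_LL1: "flin (%u. LL u v w m n k)" and flin_LL2: "flin (%v. LL u v w m n k)"
 and flin_LL3: "flin (%w. LL u v w m n k)"
 unfolding LL_def
 by (rule flin_cv[OF _ bdd_LL];
   rule flin_md2 flin_comp[OF flin_md1 flin_md1] flin_comp[OF flin_md1 flin_md2])+

lemma flin_RR1: "flin (%u. RR u v w m n k)" and flin_RR2: "flin (%v. RR u v w m n k)"
 and flin_RR3: "flin (%w. RR u v w m n k)"
 unfolding RR_def
 by (rule flin_cv[OF _ bdd_RR];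
   rule flin_md1 flin_comp[OF flin_md2 flin_md1] flin_comp[OF flin_md2 flin_md2])+

lemmas LR_lin = flin_add[OF flin_LL1] flin_add[OF flin_LL2] flin_add[OF flin_LL3]
 flin_add[OF flin_RR1] flin_add[OF flin_RR2] flin_add[OF flin_RR3]
 flin_scale[OF flin_LL1] flin_scale[OF flin_LL2] flin_scale[OF flin_LL3]
 flin_scale[OF flin_RR1] flin_scale[OF flin_RR2] flin_scale[OF flin_RR3]
 flin_zero[OF flin_LL1] flin_zero[OF flin_LL2] flin_zero[OF flin_LL3]
 flin_zero[OF flin_RR1] flin_zero[OF flin_RR2] flin_zero[OF flin_RR3]

lemma Jac_add1: "Jac u v w ==> Jac u' v w ==> Jac (u + u') v w"
 and Jac_add2: "Jac u v w ==> Jac u v' w ==> Jac u (v + v') w"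
 and Jac_add3: "Jac u v w ==> Jac u v w' ==> Jac u v (w + w')"
 and Jac_scale1: "Jac u v w ==> Jac (sc a u) v w"
 and Jac_scale2: "Jac u v w ==> Jac u (sc a v) w"
 and Jac_scale3: "Jac u v w ==> Jac u v (sc a w)"
 and Jac_01: "Jac 0 v w" and Jac_02: "Jac u 0 w" and Jac_03: "Jac u v 0"
 by (simp_all add: Jac_def LR_lin sc_add sc_diff mult.commute)

lemma RR_evz_m: "evz (%s. RR u v w (m + int s) n k)"
 unfolding RR_def
proof (rule fam_cv_evz)
 show "fam (%s b. md u (m + int s + n + k - b) (md v b w))"
  unfolding fam_def
 proof (intro conjI allI)
  from bdd_md[of v w] obtain N where N: "!!b. b >= N ==> md v b w = 0" by (metis bddE)
  show "\<exists>N. ALL b>=N. \<forall>s. md u (m + int s + n + k - b) (md v b w) = 0"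
   by (intro exI[of _ N]) (simp add: N md_lin)
  fix b
  from bdd_md[of u "md v b w"] obtain K where "!!c. c >= K ==> md u c (md v b w) = 0" by (metis bddE)
  then show "evz (%s. md u (m + int s + n + k - b) (md v b w))"
   by (intro evzI[of "nat (K - m - n - k + b)"]) simp
 qed
qed

lemma RR_evz_n: "evz (%s. RR u v w m (n + int s) k)"
proof -
 from bdd_md[of v w] obtain N where N: "!!b. b >= N ==> md v b w = 0" by (metis bddE)
 then show ?thesis
  by (intro evzI[of "nat (N - n)"]) (simp add: RR_def cv_def md_lin)
qed

lemma evz_heis3: "(!!s. flin (L s)) ==> evz (%s. sc (c s) (L s (al (int s) w)))"
proof -
 assume L: "!!s. flin (L s)"
 from heis_evz[of 0 w] obtain I where I: "!!i. i >= I ==> al (int i) w = 0" by (auto simp: evz_def)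
 then show ?thesis by (intro evzI[of I]) (simp add: flin_zero[OF L])
qed

lemma evz_fscale_heis: "evz f ==> evz (%s. sc (c s) (al (r s) (f s)))"
 unfolding evz_def by (metis fock.scale_zero_right flin_zero[OF flin_heis])

lemma Sum_any_comb:
 fixes f g h :: "nat => fock"
 assumes "evz g" "evz h" "!!s. f s = g s - sc a (h s)"
 shows "Sum_any f = Sum_any g - sc a (Sum_any h)"
 by (simp add: assms Sum_any_diff evz_fscale Sum_any_fscale cong: Sum_any.cong)

lemma sg_shift: "sg (k - int q - int j - 1) = - ((-1) ^ q * (-1) ^ j * sg k)"
 by (simp add: sg_diff sg_nat sg_minus) (use sg_nat[of 1] in simp)

text \<open>The three terms are expanded by the step formulas and agree sum by sum. The contraction
  sums of \<open>RR_ustep\<close> and \<open>RR_vstep\<close> differ by the sign that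
  \<open>sg_shift\<close> extracts from the lowered power of x - y.\<close>

lemma Jac_ustep:
 assumes "Jac u v w" "!!s. Jac u v (al (int s) w)" "!!j. Jac u (al (int j) v) w"
 shows "Jac (al (- int q - 1) u) v w"
 unfolding Jac_def
proof (intro allI)
 fix m n k
 from heis_evz[of 0 v] obtain J where J: "!!i. i >= J ==> al (int i) v = 0" by (auto simp: evz_def)
 note j = assms[unfolded Jac_def, rule_format]
 have A: "Sum_any (%s. sc (bc q s) (al (- int q - 1 - int s) (LL u v w (m + int s) n k)))
  = Sum_any (%s. sc (bc q s) (al (- int q - 1 - int s) (RR u v w (m + int s) n k)))
   - sc (sg k) (Sum_any (%s. sc (bc q s) (al (- int q - 1 - int s) (RR v u w n (m + int s) k))))"
  by (rule Sum_any_comb)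
   (simp_all add: j(1) flin_diff[OF flin_heis] heis_lin sc_diff mult.commute
    evz_fscale_heis RR_evz_m RR_evz_n)
 have B: "Sum_any (%s. sc (bc q s * (-1) ^ q) (LL u v (al (int s) w) (m - int s - int q - 1) n k))
  = Sum_any (%s. sc (bc q s * (-1) ^ q) (RR u v (al (int s) w) (m - int s - int q - 1) n k))
   - sc (sg k) (Sum_any (%s. sc (bc q s * (-1) ^ q) (RR v u (al (int s) w) n (m - int s - int q - 1) k)))"
  by (rule Sum_any_comb)
   (simp_all add: j(2) sc_diff mult_ac evz_heis3[OF flin_RR3])
 have C: "(\<Sum>j<J. sc ((-1) ^ q * bc q j) (LL u (al (int j) v) w m n (k - int q - int j - 1)))
  = (\<Sum>j<J. sc ((-1) ^ q * bc q j) (RR u (al (int j) v) w m n (k - int q - int j - 1)))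
   + sc (sg k) (\<Sum>j<J. sc ((-1) ^ j * bc q j) (RR (al (int j) v) u w n m (k - int q - int j - 1)))"
  unfolding j(3) sc_sum sum.distrib[symmetric]
  by (rule sum.cong, simp, cases "even q"; cases "odd j")
   (simp_all add: sg_shift sc_diff sc_add mult_ac)
 show "LL (al (- int q - 1) u) v w m n k
  = RR (al (- int q - 1) u) v w m n k - sc (sg k) (RR v (al (- int q - 1) u) w n m k)"
  apply (subst LL_ustep[where J = J], erule J)
  apply (subst RR_ustep[where J = J], erule J)
  apply (subst RR_vstep[where J = J], erule J)
  unfolding A B C by (simp add: sc_diff sc_add)
qed

lemma Jac_vstep:
 assumes "Jac u v w" "!!s. Jac u v (al (int s) w)" "!!j. Jac (al (int j) u) v w"
 shows "Jac u (al (- int q - 1) v) w"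
 unfolding Jac_def
proof (intro allI)
 fix m n k
 from heis_evz[of 0 u] obtain J where J: "!!i. i >= J ==> al (int i) u = 0" by (auto simp: evz_def)
 note j = assms[unfolded Jac_def, rule_format]
 have A: "Sum_any (%s. sc (bc q s) (al (- int q - 1 - int s) (LL u v w m (n + int s) k)))
  = Sum_any (%s. sc (bc q s) (al (- int q - 1 - int s) (RR u v w m (n + int s) k)))
   - sc (sg k) (Sum_any (%s. sc (bc q s) (al (- int q - 1 - int s) (RR v u w (n + int s) m k))))"
  by (rule Sum_any_comb)
   (simp_all add: j(1) flin_diff[OF flin_heis] heis_lin sc_diff mult.commute
    evz_fscale_heis RR_evz_m RR_evz_n)
 have B: "Sum_any (%s. sc (bc q s * (-1) ^ q) (LL u v (al (int s) w) m (n - int s - int q - 1) k))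
  = Sum_any (%s. sc (bc q s * (-1) ^ q) (RR u v (al (int s) w) m (n - int s - int q - 1) k))
   - sc (sg k) (Sum_any (%s. sc (bc q s * (-1) ^ q) (RR v u (al (int s) w) (n - int s - int q - 1) m k)))"
  by (rule Sum_any_comb)
   (simp_all add: j(2) sc_diff mult_ac evz_heis3[OF flin_RR3])
 have C: "(\<Sum>j<J. sc ((-1) ^ j * bc q j) (LL (al (int j) u) v w m n (k - int q - int j - 1)))
  = (\<Sum>j<J. sc ((-1) ^ j * bc q j) (RR (al (int j) u) v w m n (k - int q - int j - 1)))
   + sc (sg k) (\<Sum>j<J. sc ((-1) ^ q * bc q j) (RR v (al (int j) u) w n m (k - int q - int j - 1)))"
  unfolding j(3) sc_sum sum.distrib[symmetric]
  by (rule sum.cong, simp, cases "even q"; cases "odd j")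
   (simp_all add: sg_shift sc_diff sc_add mult_ac)
 show "LL u (al (- int q - 1) v) w m n k
  = RR u (al (- int q - 1) v) w m n k - sc (sg k) (RR (al (- int q - 1) v) u w n m k)"
  apply (subst LL_vstep[where J = J], erule J)
  apply (subst RR_vstep[where J = J], erule J)
  apply (subst RR_ustep[where J = J], erule J)
  unfolding A B C by (simp add: sc_diff sc_add)
qed

lemma cv_comb:
 assumes "bdd f" "bdd g" "bdd h"
 shows "cv ka (%b. f b + sc x (g b) + sc y (h b)) n = cv ka f n + sc x (cv ka g n) + sc y (cv ka h n)"
proof -
 have b: "bdd (%b. sc z (g' b))" if "bdd g'" for z g' using bdd_flin[OF that flin_fscale[OF flin_id]] .
 show ?thesis
  by (simp only: cv_add[OF bdd_add[OF assms(1) b[OF assms(2)]] b[OF assms(3)]] cv_add[OF assms(1) b[OF assms(2)]]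
    cv_scale[OF assms(2)] cv_scale[OF assms(3)])
qed

text \<open>Commuting \<alpha>(r) through both exponentials multiplies the integrand by k x^r + l
  y^r. \<open>heis_LL_exp\<close> has the same form, so the defect of the Jacobi identity obeys this
  rule as well.\<close>

lemma heis_RR_exp:
 "al r (RR (xp k) (xp l) w m n kk) = RR (xp k) (xp l) (al r w) m n kk
  + sc (of_int k) (RR (xp k) (xp l) w (m + r) n kk)
  + sc (of_int l) (RR (xp k) (xp l) w m (n + r) kk)"
proof -
 let ?u = "xp k" and ?v = "xp l"
 let ?G = "%d b. md ?u (d - b) (md ?v b w)"
 define d where "d = m + n + kk"
 have 1: "al r (md ?u (d - b) (md ?v b w)) = md ?u (d - b) (md ?v b (al r w))
  + sc (of_int k) (?G (d + r) b) + sc (of_int l) (?G (d + r) (b + r))" for b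
  unfolding md_lat_exp heis_ek by (simp add: flin_add[OF flin_ek] flin_scale[OF flin_ek] algebra_simps)
 have "al r (RR ?u ?v w m n kk) = cv (bn kk) (%b. md ?u (d - b) (md ?v b (al r w))
  + sc (of_int k) (?G (d + r) b) + sc (of_int l) (?G (d + r) (b + r))) n"
  unfolding RR_def cv_flin[OF bdd_RR flin_heis] d_def[symmetric] 1 ..
 also have "... = cv (bn kk) (%b. md ?u (d - b) (md ?v b (al r w))) n
  + sc (of_int k) (cv (bn kk) (?G (d + r)) n) + sc (of_int l) (cv (bn kk) (%b. ?G (d + r) (b + r)) n)"
 proof (rule cv_comb)
  show "bdd (%b. ?G (d + r) (b + r))" by (rule bdd_shift[OF bdd_RR])
 qed (rule bdd_RR)+
 also have "cv (bn kk) (%b. ?G (d + r) (b + r)) n = cv (bn kk) (?G (d + r)) (n + r)"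
  by (rule cv_shift)
 finally show ?thesis by (simp add: RR_def d_def algebra_simps)
qed

lemma heis_LL_exp:
 "al r (LL (xp k) (xp l) w m n kk) = LL (xp k) (xp l) (al r w) m n kk
  + sc (of_int k) (LL (xp k) (xp l) w (m + r) n kk)
  + sc (of_int l) (LL (xp k) (xp l) w m (n + r) kk)"
proof -
 let ?u = "xp k" and ?v = "xp l"
 let ?G = "%d c. md (md ?u c ?v) (d - c) w"
 define d where "d = m + n + kk"
 have 1: "al r (md (md ?u c ?v) (d - c) w) = md (md ?u c ?v) (d - c) (al r w)
  + sc (of_int k) (cv (bp r) (?G (d + r)) c) + sc (of_int l) (?G (d + r) c)" for c
 proof -
  have h: "al (int j) (md ?u c ?v) = (if j = 0 then sc (of_int l) (md ?u c ?v) else 0) + sc (of_int k) (md ?u (c + int j) ?v)" for j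
   unfolding md_lat_exp heis_ek
   by (auto simp: heis_zero[OF lat_exp_chs] flin_scale[OF flin_ek] flin_zero[OF flin_ek])
  have f: "(%i. sc (of_int r gchoose i) (md (al (int i) (md ?u c ?v)) (d - c + r - int i) w))
   = (%i. (if i = 0 then sc (of_int l) (?G (d + r) c) else 0)
     + sc (of_int k) (sc (fps_nth (bp r) i) (?G (d + r) (c + int i))))"
   by (rule ext, unfold h) (auto simp: md_lin sc_add algebra_simps)
  have e1: "evz (%i::nat. if i = 0 then sc (of_int l) (?G (d + r) c) else 0)"
   by (rule evzI[of 1]) auto
  have e2: "evz (%i. sc (of_int k) (sc (fps_nth (bp r) i) (?G (d + r) (c + int i))))"
   by (intro evz_fscale bdd_cv_evz bdd_LL)
  have e3: "Sum_any (%i. sc (of_int k) (sc (fps_nth (bp r) i) (?G (d + r) (c + int i)))) = sc (of_int k) (cv (bp r) (?G (d + r)) c)"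
   by (subst Sum_any_fscale[OF bdd_cv_evz[OF bdd_LL]]) (simp only: cv_def)
  show ?thesis
   unfolding heis_md[of r "md ?u c ?v"] f Sum_any_add[OF e1 e2] e3 Sum_any.delta by (simp only: add_ac)
 qed
 have "al r (LL ?u ?v w m n kk) = cv (bp m) (%c. md (md ?u c ?v) (d - c) (al r w)
  + sc (of_int k) (cv (bp r) (?G (d + r)) c) + sc (of_int l) (?G (d + r) c)) kk"
  unfolding LL_def cv_flin[OF bdd_LL flin_heis] d_def[symmetric] 1 ..
 also have "... = cv (bp m) (%c. md (md ?u c ?v) (d - c) (al r w)) kk
  + sc (of_int k) (cv (bp m) (cv (bp r) (?G (d + r))) kk) + sc (of_int l) (cv (bp m) (?G (d + r)) kk)"
  by (rule cv_comb[OF bdd_LL bdd_cv[OF bdd_LL] bdd_LL])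
 \<comment> \<open>This is x^m x^r = x^(m+r), both factors being expanded in y + z.\<close>
 also have "cv (bp m) (cv (bp r) (?G (d + r))) kk = cv (bp (m + r)) (?G (d + r)) kk"
  by (simp only: cv_mult[OF bdd_LL] bp_add)
 finally show ?thesis by (simp add: LL_def d_def algebra_simps)
qed

lemma cv_grd: "(!!s. G (b + int s) \<in> grd k N) ==> cv ka G b \<in> grd k N"
 by (auto simp: cv_def)

text \<open>The defect \<open>D\<close> is homogeneous, and a positive Heisenberg mode turns it into
  defects of smaller level. By induction on the level all positive modes annihilate it, so it
  vanishes at positive level by \<open>vacuum_vector_eq_0\<close>; at level 0 its single coefficient
  vanishes by \<open>residue_identity\<close>.\<close>

lemma Jac_exp:
 assumes kl: "k * l = tp * ka" "even ka" and kc: "k * c = tp * e1" and lc: "l * c = tp * e2"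
 shows "Jac (xp k) (xp l) (xp c)"
proof -
 let ?u = "xp k" and ?v = "xp l" and ?w = "xp c"
 define D where "D m n kk = LL ?u ?v ?w m n kk - (RR ?u ?v ?w m n kk - sc (sg kk) (RR ?v ?u ?w n m kk))" for m n kk
 have p: "tp ~= 0" using p2 by simp
 have dv': "a div tp = b" if "a = tp * b" for a b using that p2 by simp
 have dv: "k * l div tp = ka" "l * k div tp = ka" "k * c div tp = e1" "l * c div tp = e2"
  "(k + l) * c div tp = e1 + e2" "k * (l + c) div tp = ka + e1" "l * (k + c) div tp = ka + e2"
  by (rule dv'; use kl kc lc in \<open>simp add: algebra_simps\<close>)+
 have gD: "D m n kk \<in> grd (k + l + c) (- 2 - (m + n + kk) - ka - e1 - e2)" for m n kk
  unfolding D_def grd_def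
 proof (intro supp_diff supp_scale; fold grd_def)
  show "LL ?u ?v ?w m n kk \<in> grd (k + l + c) (- 2 - (m + n + kk) - ka - e1 - e2)"
   unfolding LL_def
   by (rule cv_grd, rule grd_cong[OF md_grd[OF md_grd[OF lat_exp_grd lat_exp_grd] lat_exp_grd]]) (unfold dv, simp_all)
  show "RR ?u ?v ?w m n kk \<in> grd (k + l + c) (- 2 - (m + n + kk) - ka - e1 - e2)"
   unfolding RR_def
   by (rule cv_grd, rule grd_cong[OF md_grd[OF lat_exp_grd md_grd[OF lat_exp_grd lat_exp_grd]]]) (unfold dv, simp_all)
  show "RR ?v ?u ?w n m kk \<in> grd (k + l + c) (- 2 - (m + n + kk) - ka - e1 - e2)"
   unfolding RR_def
   by (rule cv_grd, rule grd_cong[OF md_grd[OF lat_exp_grd md_grd[OF lat_exp_grd lat_exp_grd]]]) (unfold dv, simp_all)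
 qed
 have hD: "al r (D m n kk) = sc (of_int k) (D (m + r) n kk) + sc (of_int l) (D m (n + r) kk)" if "r > 0" for r m n kk
  using that unfolding D_def flin_diff[OF flin_heis] heis_lin heis_LL_exp heis_RR_exp heis_lat_exp[OF that] LR_lin
  by (simp add: sc_add sc_diff mult.commute)
 have vac: "lookup (D m n kk) ({#}, k + l + c) = 0" if N: "- 2 - (m + n + kk) - ka - e1 - e2 = 0" for m n kk
 proof -
  let ?\<epsilon> = "%x. lookup x ({#}, k + l + c)"
  define m' n' k' where d: "m' = m + e1" "n' = n + e2" "k' = kk + ka"
  have s: "m' + n' + k' = -2" using N by (simp add: d)
  have RRv: "lookup (RR (xp k) (xp l) ?w m n kk) ({#}, k + l + c)
   = (if -1 - (n + e2) >= 0 then fps_nth (bn (kk + ka)) (nat (-1 - (n + e2))) else 0)"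
   if kl: "k * l = tp * ka" and kc: "k * c = tp * e1" and lc: "l * c = tp * e2"
    and N: "- 2 - (m + n + kk) - ka - e1 - e2 = 0" for k l m n e1 e2
  proof -
   have t: "lookup (md (xp k) (m + n + kk - (n + int s)) (md (xp l) (n + int s) ?w)) ({#}, k + l + c)
    = (if -1 - (n + e2) - int s >= 0 then fps_nth (bn ka) (nat (-1 - (n + e2) - int s)) else 0)" for s
   proof (cases "-1 - (n + e2) - int s >= 0")
    case True
    define i where "i = nat (-1 - (n + e2) - int s)"
    have i: "int i = -1 - (n + e2) - int s" using True by (simp add: i_def)
    have "- (n + int s) - 1 - e2 = int i" using i by simp
    then have "md (xp l) (n + int s) ?w = cre l i (xp (l + c))"
     by (simp only: md_lat_exp ek_lat_exp[OF lc]) (simp add: crez_def)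
    moreover have "m + n + kk - (n + int s) = int i - 1 - ka - e1" using i N by simp
    ultimately show ?thesis using True
     by (simp only: md_lat_exp vacuum_expectation_ek[OF kl kc]) (simp add: i_def)
   next
    case False
    then have "md (xp l) (n + int s) ?w = 0"
     unfolding md_lat_exp ek_lat_exp[OF lc] crez_def by auto
    then show ?thesis using False by (simp add: md_lin)
   qed
   show ?thesis
    unfolding RR_def lookup_cv[OF bdd_RR] t Sum_any_fps_conv bn_add ..
  qed
  have 1: "?\<epsilon> (LL ?u ?v ?w m n kk) = (if -1 - k' >= 0 then fps_nth (bp m') (nat (-1 - k')) else 0)"
  proof -
   have lc': "(k + l) * c = tp * (e1 + e2)" using kc lc by (simp add: algebra_simps)
   have t: "?\<epsilon> (md (md ?u (kk + int s) ?v) (m + n + kk - (kk + int s)) ?w)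
    = (if -1 - k' - int s >= 0 then fps_nth (bp e1) (nat (-1 - k' - int s)) else 0)" for s
   proof (cases "-1 - k' - int s >= 0")
    case True
    define i where "i = nat (-1 - k' - int s)"
    have i: "int i = -1 - k' - int s" using True by (simp add: i_def)
    have "- (kk + int s) - 1 - ka = int i" using i by (simp add: d)
    then have "md ?u (kk + int s) ?v = cre k i (xp (k + l))"
     by (simp only: md_lat_exp ek_lat_exp[OF kl(1)]) (simp add: crez_def)
    moreover have "m + n + kk - (kk + int s) = int i - 1 - (e1 + e2)" using i N by (simp add: d)
    ultimately show ?thesis using True
     by (simp only: vacuum_expectation_cre[OF kc lc']) (simp add: i_def)
   next
    case False
    then have "md ?u (kk + int s) ?v = 0"
     unfolding md_lat_exp ek_lat_exp[OF kl(1)] crez_def d by auto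
    then show ?thesis using False by (simp add: md_lin)
   qed
   show ?thesis
    unfolding LL_def lookup_cv[OF bdd_LL] t Sum_any_fps_conv d bp_add ..
  qed
  have 2: "?\<epsilon> (RR ?u ?v ?w m n kk) = (if -1 - n' >= 0 then fps_nth (bn k') (nat (-1 - n')) else 0)"
   unfolding d by (rule RRv[OF kl(1) kc lc N])
  have 3: "?\<epsilon> (RR ?v ?u ?w n m kk) = (if -1 - m' >= 0 then fps_nth (bn k') (nat (-1 - m')) else 0)"
  proof -
   have "l * k = tp * ka" using kl by (simp add: mult.commute)
   from RRv[OF this lc kc, of n m] N show ?thesis by (simp add: d algebra_simps)
  qed
  \<comment> \<open>Evenness of the pairing kl/(2p) makes the two orders of the exponentials agree
    without a sign, as the trivial cocycle requires.\<close>
  have "sg k' = sg kk" using kl(2) by (simp add: d sg_add sg_even)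
  then show ?thesis unfolding D_def lookup_minus lookup_fscale 1 2 3
   using residue_identity[OF s] by simp
 qed
 have "D m n kk = 0" for m n kk
 proof (induction "nat (- 2 - (m + n + kk) - ka - e1 - e2)" arbitrary: m n rule: less_induct)
  case less
  let ?N = "- 2 - (m + n + kk) - ka - e1 - e2"
  consider "?N < 0" | "?N = 0" | "?N > 0" by linarith
  then show ?case
  proof cases
   case 1 then show ?thesis using grd_neg[OF _ gD] by blast
  next
   case 2
   then have "D m n kk \<in> grd (k + l + c) 0" using gD[of m n kk] by simp
   from grd_0_eq[OF this] vac[OF 2] show ?thesis by simp
  next
   case 3
   have "al r (D m n kk) = 0" if "r > 0" for r
    unfolding hD[OF that] using 3 that by (subst (1 2) less) auto
   with vacuum_vector_eq_0[OF gD 3] show ?thesis by blast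
  qed
 qed
 then show ?thesis by (auto simp: Jac_def D_def)
qed

text \<open>The commutation rules are solved for the terms containing \<alpha>(r) w; what remains is
  the identity for w at shifted exponents.\<close>

lemma Jac_exp_wstep:
 assumes "Jac (xp k) (xp l) w"
 shows "Jac (xp k) (xp l) (al r w)"
 unfolding Jac_def
proof (intro allI)
 fix m n kk
 let ?u = "xp k" and ?v = "xp l"
 note J = assms[unfolded Jac_def, rule_format]
 have "LL ?u ?v (al r w) m n kk = al r (LL ?u ?v w m n kk) - sc (of_int k) (LL ?u ?v w (m + r) n kk)
   - sc (of_int l) (LL ?u ?v w m (n + r) kk)" by (simp add: heis_LL_exp)
 moreover have "RR ?u ?v (al r w) m n kk = al r (RR ?u ?v w m n kk) - sc (of_int k) (RR ?u ?v w (m + r) n kk)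
   - sc (of_int l) (RR ?u ?v w m (n + r) kk)" by (simp add: heis_RR_exp)
 moreover have "RR ?v ?u (al r w) n m kk = al r (RR ?v ?u w n m kk) - sc (of_int k) (RR ?v ?u w n (m + r) kk)
   - sc (of_int l) (RR ?v ?u w (n + r) m kk)" by (simp add: heis_RR_exp)
 ultimately show "LL ?u ?v (al r w) m n kk = RR ?u ?v (al r w) m n kk - sc (sg kk) (RR ?v ?u (al r w) n m kk)"
  by (simp add: J flin_diff[OF flin_heis] heis_lin sc_diff mult.commute[of "sg kk"])
qed

text \<open>An even pairing of k and l gives locality without signs; integral pairings with c give
  integral powers of x and y on vectors of charge c.\<close>

definition triple_ok :: "int => int => int => bool" where
 "triple_ok k l c \<longleftrightarrow> (\<exists>ka. even ka \<and> k * l = tp * ka) \<and> tp dvd k * c \<and> tp dvd l * c"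

text \<open>Three nested inductions, u outermost. The step for u also calls for the vectors
  \<alpha>(s) w and \<alpha>(j) v, which keep their charges; the step for v calls for \<alpha>(j) on
  the exponential u, which is a scalar multiple of u for j = 0 and 0 for j > 0.\<close>

theorem Jacobi:
 assumes ok: "!!k l c. k \<in> A ==> l \<in> B ==> c \<in> C ==> triple_ok k l c"
  and "u \<in> chs A" "v \<in> chs B" "w \<in> chs C"
 shows "Jac u v w"
 using assms(2,3,4)
proof (induction u arbitrary: v w rule: fock_induct)
 case (exp k)
 from exp(2,3) show ?case
 proof (induction v arbitrary: w rule: fock_induct)
  case (exp l)
  from exp(2) show ?case
  proof (induction w rule: fock_induct)
   case (exp c)
   have ok': "triple_ok k l c" using ok \<open>k \<in> A\<close> \<open>l \<in> B\<close> exp by blast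
   then obtain ka where "k * l = tp * ka" "even ka" by (auto simp only: triple_ok_def)
   moreover from ok' obtain e1 e2 where "k * c = tp * e1" "l * c = tp * e2"
    unfolding triple_ok_def by (elim conjE dvdE)
   ultimately show ?case by (rule Jac_exp)
  next
   case (heis q w c) show ?case by (rule Jac_exp_wstep[OF heis.IH])
  next
   case zero show ?case by (rule Jac_03)
  next
   case (add v w) show ?case by (rule Jac_add3[OF add.IH])
  next
   case (scale v c) show ?case by (rule Jac_scale3[OF scale.IH])
  qed
 next
  case (heis q v l)
  have v: "!!s. al (int s) w \<in> chs C" using heis.prems heis_chs by blast
  have "Jac (al (int j) (xp k)) v w" for j
   using heis.IH[OF heis.prems] by (cases "j = 0") (auto simp: heis_zero[OF lat_exp_chs] Jac_scale1 Jac_01)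
  then show ?case using heis.IH heis.prems v by (intro Jac_vstep) auto
 qed (auto intro: Jac_add2 Jac_scale2 Jac_02)
next
 case (heis q u k)
 then show ?case by (intro Jac_ustep heis.IH heis_chs) auto
qed (auto intro: Jac_add1 Jac_scale1 Jac_01)

end

lemma lookup_two_times: "lookup (2 * x :: fock) b = 2 * lookup x b"
 by (simp only: mult_2 lookup_add)

context rank_one begin

section \<open>The vacuum and the conformal vector\<close>

lemma opser_exp_zero: "opser_exp (%n v. 0) i v = (if i = 0 then v else 0)"
proof -
 have "opser_power (%n v. 0) j i v = (if j = 0 \<and> i = 0 then v else 0)" for j by (cases j) auto
 then show ?thesis by (simp add: opser_exp_def if_distrib sum.delta cong: if_cong)
qed

lemma cre_zero: "cre 0 i v = (if i = 0 then v else 0)" and ann_zero: "ann 0 i v = (if i = 0 then v else 0)"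
 by (simp_all add: exp_creation_def exp_annihilation_def opser_exp_zero)

lemma md_one: "md 1 n w = (if n = -1 then w else 0)"
proof (rule flin_eqI[where f = "md 1 n" and g = "%w. if n = -1 then w else 0"])
 fix b :: "nat multiset \<times> int"
 obtain mu c where [simp]: "b = (mu, c)" by (cases b)
 let ?w = "single b (1::complex)"
 have "md 1 n ?w = ekc 0 0 n ?w"
  by (simp add: one_eq_lat_exp md_lat_exp ek_chs[OF grd_chs[OF grd_single]])
 also have "... = Sum_any (%j. if j = (0::nat) then crez 0 (- n - 1) ?w else 0)"
  unfolding ekc_def by (rule Sum_any.cong) (auto simp: ann_zero flin_zero[OF flin_crez] one_eq_lat_exp[symmetric])
 also have "... = (if n = -1 then ?w else 0)" by (auto simp: crez_def cre_zero)
 finally show "md 1 n ?w = (if n = -1 then ?w else 0)" .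
qed (auto simp: flin_md2 intro: flinI)

lemma md_chs: assumes "u \<in> chs A" "v \<in> chs B" shows "md u n v \<in> chs {a + b | a b. a \<in> A \<and> b \<in> B}"
 unfolding chs_def
proof (rule supp_flin[OF flin_md1 _ assms(1)[unfolded chs_def]])
 fix x :: "nat multiset \<times> int" assume x: "x \<in> {b. snd b \<in> A}"
 show "md (single x 1) n v \<in> supp {b. snd b \<in> {a + b | a b. a \<in> A \<and> b \<in> B}}"
 proof (rule supp_flin[OF flin_md2 _ assms(2)[unfolded chs_def]])
  fix y :: "nat multiset \<times> int" assume y: "y \<in> {b. snd b \<in> B}"
  have "md (single (fst x, snd x) 1) n (single (fst y, snd y) 1) \<in> chs {snd x + snd y}"
   by (rule grd_chs[OF md_grd[OF grd_single grd_single]])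
  then have "md (single x 1) n (single y 1) \<in> chs {snd x + snd y}" by simp
  moreover have "{snd x + snd y} \<subseteq> {a + b | a b. a \<in> A \<and> b \<in> B}" using x y by blast
  ultimately show "md (single x 1) n (single y 1) \<in> supp {b. snd b \<in> {a + b | a b. a \<in> A \<and> b \<in> B}}"
   using chs_mono unfolding chs_def by blast
 qed
qed

lemma md_right_one_aux:
 "(ALL n>=0. md u n 1 = 0) \<and> md u (-1) 1 = u"
proof (induction u rule: fock_induct_UNIV)
 case (exp k)
 have "ek k n 1 = crez k (- n - 1) (xp k)" for n
  unfolding one_eq_lat_exp using ek_lat_exp[of k 0 0 n] by simp
 then show ?case by (auto simp: md_lat_exp crez_def)
next
 case (heis q u k)
 have z: "al (int j) 1 = 0" for j
  by (cases "j = 0") (simp_all add: one_eq_lat_exp heis_zero[OF lat_exp_chs])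
 have "md (al (- int q - 1) u) n 1 = Sum_any (%j. sc (bc q j) (al (- int q - 1 - int j) (md u (n + int j) 1)))" for n
  unfolding md_heis nop_def by (simp add: z md_lin)
 moreover have "(%j. sc (bc q j) (al (- int q - 1 - int j) (md u (-1 + int j) 1)))
  = (%j. if j = 0 then al (- int q - 1) u else 0)"
  by (rule ext) (use heis in \<open>auto simp: heis_lin bc_def\<close>)
 then have "Sum_any (%j. sc (bc q j) (al (- int q - 1 - int j) (md u (-1 + int j) 1))) = al (- int q - 1) u"
  by (simp only:) simp
 ultimately show ?case using heis(2) by (simp add: heis_lin)
qed (auto simp: md_lin)

lemma md_right_one: "n >= 0 ==> md u n 1 = 0" "md u (-1) 1 = u"
 using md_right_one_aux by auto

lemma heis_one: "al (int j) 1 = 0"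
 by (cases "j = 0") (simp_all add: one_eq_lat_exp heis_zero[OF lat_exp_chs])

lemma heis_one': "r >= 0 ==> al r 1 = 0"
 using heis_one[of "nat r"] by simp

definition T :: "fock => fock" where "T u = md u (-2) 1"

lemma flin_T: "flin T" unfolding T_def by (rule flin_md1)

lemma T_lat_exp: "T (xp k) = sc (of_int k / of_nat (2 * p)) (al (-1) (xp k))"
proof -
 have "T (xp k) = crez k 1 (xp k)"
  unfolding one_eq_lat_exp T_def md_lat_exp using ek_lat_exp[of k 0 0 "-2"] by simp
 then show ?thesis using cre_deriv[of 1 k "xp k"] by (simp add: crez_def)
qed

lemma T_heis: "T (al (- int q - 1) u) = al (- int q - 1) (T u) + sc (of_nat (q + 1)) (al (- int q - 2) u)"
proof -
 have "T (al (- int q - 1) u) = Sum_any (%j. sc (bc q j) (al (- int q - 1 - int j) (md u (-2 + int j) 1)))"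
  unfolding md_heis nop_def T_def by (simp add: heis_one md_lin)
 also have "... = (\<Sum>j<2. sc (bc q j) (al (- int q - 1 - int j) (md u (-2 + int j) 1)))"
  by (rule Sum_any_nat) (simp add: md_right_one heis_lin)
 also have "... = al (- int q - 1) (T u) + sc (of_nat (q + 1)) (al (- int q - 2) u)"
  by (simp add: T_def numeral_2_eq_2 md_right_one(2) bc_def add.commute)
 finally show ?thesis .
qed

abbreviation "om \<equiv> lattice_conf p"

definition L :: "int => fock => fock" where "L m = md om (m + 1)"

lemma flin_L: "flin (L m)" unfolding L_def by (rule flin_md2)

lemma md_current: "md (al (-1) 1) n w = al n w"
proof -
 have "md (al (- int 0 - 1) 1) n w
  = Sum_any (%j. sc (bc 0 j) (al (- int 0 - 1 - int j) (md 1 (n + int j) w)))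
  + Sum_any (%j. sc (bc 0 j * (-1) ^ 0) (md 1 (n - int j - int 0 - 1) (al (int j) w)))"
  unfolding md_heis nop_split[OF fld_md] ..
 also have "(%j. sc (bc 0 j) (al (- int 0 - 1 - int j) (md 1 (n + int j) w)))
  = (%j. if j = nat (- n - 1) then (if n < 0 then al n w else 0) else 0)"
  by (rule ext) (auto simp: md_one bc_def heis_lin)
 also have "(%j. sc (bc 0 j * (-1) ^ 0) (md 1 (n - int j - int 0 - 1) (al (int j) w)))
  = (%j. if j = nat n then (if n >= 0 then al n w else 0) else 0)"
  by (rule ext) (auto simp: md_one bc_def)
 finally show ?thesis by (cases "n < 0") auto
qed

lemma conf_heis: "al 0 om = 0" "al 1 om = al (-1) 1" "al 2 om = sc (2 * of_nat (p - 1)) 1" "j >= 3 ==> al (int j) om = 0"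
proof -
 have g: "al r om = sc (1 / of_nat (4 * p)) (sc (if r = 1 then 4 * of_nat p else 0) (al (-1) 1))
   + sc (of_nat (p - 1) / of_nat (2 * p)) (sc (if r = 2 then 4 * of_nat p else 0) 1)" if "r >= 0" for r
  using that unfolding lattice_conf_def heis_lin heis_comm[of r "-1"] heis_comm[of r "-2"]
  by (auto simp: heis_one' heis_lin sc_add_left[symmetric])
 show "al 0 om = 0" "al 1 om = al (-1) 1" "al 2 om = sc (2 * of_nat (p - 1)) 1" "j >= 3 ==> al (int j) om = 0"
  using p0 by (simp_all add: g)
qed

text \<open>The scalar term is the anomaly caused by the \<alpha>(-2) summand of the conformal
  vector, read off from \<open>conf_heis\<close>.\<close>

lemma heis_L:
 "al r (L m w) = L m (al r w) + sc (of_int r) (al (m + r) w)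
  + (if m + r = 0 then sc (of_int (r * (r - 1)) * of_nat (p - 1)) w else 0)"
proof -
 have "al r (L m w) = L m (al r w) + (\<Sum>j<3. sc (of_int r gchoose j) (md (al (int j) om) (m + 1 + r - int j) w))"
  unfolding L_def by (rule heis_md_finite) (rule conf_heis)
 also have "(\<Sum>j<3. sc (of_int r gchoose j) (md (al (int j) om) (m + 1 + r - int j) w))
  = sc (of_int r) (al (m + r) w) + sc ((of_int r gchoose 2) * (2 * of_nat (p - 1))) (md 1 (m + r - 1) w)"
  by (simp add: numeral_3_eq_3 conf_heis md_lin md_current) (simp add: conf_heis(3)[simplified] numeral_2_eq_2[symmetric] conf_heis md_lin)
 also have "(of_int r gchoose 2) * (2 * of_nat (p - 1)) = (of_int (r * (r - 1)) * of_nat (p - 1) :: complex)"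
  by (simp add: gbinomial_prod_rev numeral_2_eq_2 field_simps)
 finally show ?thesis by (auto simp: md_one add.assoc)
qed

section \<open>The Virasoro operators on exponentials, cosets of charges, primary vectors\<close>

lemma L_formula:
 "L m w = sc (1 / of_nat (4 * p)) (Sum_any (%j. al (- 1 - int j) (al (m + 1 + int j) w)) + Sum_any (%j. al (m - int j) (al (int j) w)))
  - sc (of_nat (p - 1) / of_nat (2 * p) * of_int (m + 1)) (al m w)"
proof -
 have 1: "md (al (-1) (al (-1) 1)) n w = Sum_any (%j. al (- 1 - int j) (al (n + int j) w)) + Sum_any (%j. al (n - int j - 1) (al (int j) w))" for n
  using md_heis[of 0 "al (-1) 1" n w] by (simp add: nop_split[OF fld_md] md_current bc_def)
 have 2: "md (al (-2) 1) n w = sc (- of_int n) (al (n - 1) w)" for n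
 proof -
  have "md (al (-2) 1) n w
   = Sum_any (%j. sc (bc 1 j) (al (- 2 - int j) (md 1 (n + int j) w)))
   + Sum_any (%j. sc (- bc 1 j) (md 1 (n - int j - 2) (al (int j) w)))"
   using md_heis[of 1 1 n w] by (simp add: nop_split[OF fld_md] diff_diff_eq add.commute)
  also have "(%j. sc (bc 1 j) (al (- 2 - int j) (md 1 (n + int j) w)))
   = (%j. if j = nat (- n - 1) then (if n < 0 then sc (- of_int n) (al (n - 1) w) else 0) else 0)"
   by (rule ext) (auto simp: md_one bc_def heis_lin of_nat_nat)
  also have "(%j. sc (- bc 1 j) (md 1 (n - int j - 2) (al (int j) w)))
   = (%j. if j = nat (n - 1) then (if n > 0 then sc (- of_int n) (al (n - 1) w) else 0) else 0)"
   by (rule ext) (auto simp: md_one bc_def of_nat_nat)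
  finally show ?thesis by (cases "n = 0"; cases "n < 0") auto
 qed
 show ?thesis unfolding L_def lattice_conf_def md_lin 1 2
  using p0 by (intro poly_mapping_eqI) (simp add: lookup_add lookup_minus field_simps)
qed

text \<open>The conformal weight of exp(k\<alpha>/(2p)). It equals h_{k+1,1} and is invariant under
  the reflection of k to 2p - 2 - k.\<close>

definition hh :: "int => complex" where "hh k = of_int (k * (k - 2 * int p + 2)) / of_nat (4 * p)"

lemma L_lat_exp: "m > 0 ==> L m (xp k) = 0"
 and L0_lat_exp: "L 0 (xp k) = sc (hh k) (xp k)"
 and Lm1_lat_exp: "L (-1) (xp k) = sc (of_int k / of_nat (2 * p)) (al (-1) (xp k))"
 and Lm2_lat_exp: "L (-2) (xp k) = sc (1 / of_nat (4 * p)) (al (-1) (al (-1) (xp k)))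
  + sc ((of_int k + of_nat (p - 1)) / of_nat (2 * p)) (al (-2) (xp k))"
 and Lm3_lat_exp: "L (-3) (xp k) = sc (1 / of_nat (2 * p)) (al (-1) (al (-2) (xp k)))
  + sc ((of_int k + 2 * of_nat (p - 1)) / of_nat (2 * p)) (al (-3) (xp k))"
proof -
 let ?e = "xp k"
 have z: "al (int j) ?e = (if j = 0 then sc (of_int k) ?e else 0)" for j
  by (auto simp: heis_zero[OF lat_exp_chs])
 have s2: "Sum_any (%j. al (m - int j) (al (int j) ?e)) = sc (of_int k) (al m ?e)" for m
 proof -
  have "(%j. al (m - int j) (al (int j) ?e)) = (%j. if j = 0 then sc (of_int k) (al m ?e) else 0)"
   unfolding z by (auto simp: heis_lin)
  then show ?thesis by (simp only:) simp
 qed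
 have s1: "Sum_any (%j. al (- 1 - int j) (al (m + 1 + int j) ?e)) = (\<Sum>j<nat (- m). al (- 1 - int j) (al (m + 1 + int j) ?e))" for m
  by (rule Sum_any_nat) (simp add: heis_lin)
 have f: "L m ?e = sc (1 / of_nat (4 * p)) ((\<Sum>j<nat (- m). al (- 1 - int j) (al (m + 1 + int j) ?e)) + sc (of_int k) (al m ?e))
  - sc (of_nat (p - 1) / of_nat (2 * p) * of_int (m + 1)) (al m ?e)" for m
  unfolding L_formula s1 s2 ..
 have n2: "{..<nat (- (- 2))} = {0, 1}" and n3: "{..<nat (- (- 3))} = {0, 1, 2}" by auto
 show "L m ?e = 0" if "m > 0" using that by (simp add: f)
 show "L 0 ?e = sc (hh k) ?e"
  unfolding f heis_zero[OF lat_exp_chs] using p0 p2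
  by (simp add: hh_def sc_diff_left[symmetric] field_simps of_nat_diff)
 show "L (-1) ?e = sc (of_int k / of_nat (2 * p)) (al (-1) ?e)"
  unfolding f using p0 by (simp add: heis_zero[OF lat_exp_chs] heis_lin sc_add_left[symmetric] field_simps)
 have c: "al (-2) (al (-1) ?e) = al (-1) (al (-2) ?e)" by (simp add: heis_comm[of "-2" "-1"])
 show "L (-2) ?e = sc (1 / of_nat (4 * p)) (al (-1) (al (-1) (xp k)))
  + sc ((of_int k + of_nat (p - 1)) / of_nat (2 * p)) (al (-2) (xp k))"
  unfolding f n2 using p0
  by (intro poly_mapping_eqI) (simp add: heis_zero[OF lat_exp_chs] heis_lin lookup_add lookup_minus lookup_two_times, simp add: field_simps)
 show "L (-3) ?e = sc (1 / of_nat (2 * p)) (al (-1) (al (-2) (xp k)))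
  + sc ((of_int k + 2 * of_nat (p - 1)) / of_nat (2 * p)) (al (-3) (xp k))"
  unfolding f n3 using p0
  by (intro poly_mapping_eqI) (simp add: heis_zero[OF lat_exp_chs] heis_lin lookup_add lookup_minus c lookup_two_times, simp add: field_simps)
qed

lemma L0_grd: "v \<in> grd k N ==> L 0 v = sc (hh k + of_int N) v"
proof -
 have *: "L 0 (single (mu, k) 1) = sc (hh k + of_int (lev mu)) (single (mu, k) 1)" for mu k
 proof (induction mu)
  case empty then show ?case using L0_lat_exp[of k] by (simp add: lat_exp_def)
 next
  case (add q mu)
  let ?v = "single (mu, k) (1::complex)"
  have "al (- int q - 1) (L 0 ?v) = L 0 (al (- int q - 1) ?v) + sc (of_int (- int q - 1)) (al (- int q - 1) ?v)"
   using heis_L[of "- int q - 1" 0 ?v] by simp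
  then have "L 0 (al (- int q - 1) ?v) = sc (hh k + of_int (lev mu) + of_nat q + 1) (al (- int q - 1) ?v)"
   unfolding add heis_lin sc_add_left by (simp add: fock.scale_minus_left sc_diff_left algebra_simps)
  then show ?case by (simp add: heis_single algebra_simps)
 qed
 assume v: "v \<in> grd k N"
 show ?thesis
 proof (rule flin_eqI[where f = "L 0" and g = "sc (hh k + of_int N)" and v = v])
  fix b assume "b \<in> keys v"
  with grd_keys[OF v this] obtain mu where "b = (mu, k)" "lev mu = N" by (cases b) auto
  then show "L 0 (single b 1) = sc (hh k + of_int N) (single b 1)"
   using *[of mu k] by simp
 qed (auto intro: flin_L)
qed

lemma L_minus_one: "L (-1) v = T v"
proof (induction v rule: fock_induct_UNIV)
 case (exp k) show ?case by (simp only: Lm1_lat_exp T_lat_exp)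
next
 case (heis q u k)
 have "L (-1) (al (- int q - 1) u) = al (- int q - 1) (L (-1) u) + sc (of_nat (q + 1)) (al (- int q - 2) u)"
  using heis_L[of "- int q - 1" "-1" u] by (simp add: algebra_simps)
 then show ?case by (simp only: T_heis heis)
qed (simp_all add: flin_add[OF flin_L] flin_zero[OF flin_L] flin_scale[OF flin_L] flin_add[OF flin_T] flin_zero[OF flin_T] flin_scale[OF flin_T])

text \<open>The space V of the coset L + r\<alpha>/(2p).\<close>

definition VV :: "int => fock set" where "VV r = chs {k. tp dvd k - r}"
text \<open>The charges on which the modes of exp(-\<alpha>/p) have integral index.\<close>

definition PP :: "fock set" where "PP = chs {k. int p dvd k}"

lemma VV_closed [intro]: "u \<in> VV r ==> v \<in> VV r ==> u + v \<in> VV r" "u \<in> VV r ==> sc c u \<in> VV r" "0 \<in> VV r"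
  "(!!i. i \<in> A ==> f i \<in> VV r) ==> sum f A \<in> VV r" "(!!i. g i \<in> VV r) ==> Sum_any g \<in> VV r"
 unfolding VV_def by (auto intro: chs_add chs_scale chs_0 chs_sum chs_Sum_any)

lemma VV_0_PP: "u \<in> VV 0 ==> u \<in> PP" and VV_p_PP: "u \<in> VV (int p) ==> u \<in> PP"
 unfolding VV_def PP_def by (erule chs_mono[rotated], auto elim!: dvdE simp: algebra_simps)+

lemma md_VV: assumes "u \<in> VV r" "v \<in> VV s" shows "md u n v \<in> VV (r + s)"
 unfolding VV_def
 by (rule chs_mono[OF _ md_chs[OF assms[unfolded VV_def]]]) (auto elim!: dvdE simp: algebra_simps simp flip: distrib_left)

lemma md_VL: "u \<in> VV 0 ==> v \<in> VV s ==> md u n v \<in> VV s"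
 using md_VV[of u 0 v s n] by simp

lemma one_VV: "1 \<in> VV 0" and conf_VV: "om \<in> VV 0"
proof -
 show 1: "1 \<in> VV 0" unfolding one_eq_lat_exp VV_def by (rule chs_mono[OF _ lat_exp_chs]) auto
 then show "om \<in> VV 0" unfolding lattice_conf_def VV_def by (intro chs_add chs_scale heis_chs)
qed

lemma L_VV: "v \<in> VV s ==> L m v \<in> VV s"
 unfolding L_def by (rule md_VL[OF conf_VV])

lemma Jac_VL: assumes "u \<in> VV 0" "v \<in> VV 0" shows "Jac u v w"
proof (rule Jacobi[OF _ assms[unfolded VV_def]])
 show "w \<in> chs UNIV" by (simp add: chs_def supp_def)
 fix k l c assume "k \<in> {k. tp dvd k - 0}" "l \<in> {k. tp dvd k - 0}"
 then obtain a b where "k = tp * a" "l = tp * b" by (auto elim!: dvdE)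
 then have "k * l = tp * (tp * (a * b))" "tp dvd k * c" "tp dvd l * c" "even (tp * (a * b))"
  by (auto simp: algebra_simps)
 then show "triple_ok k l c" unfolding triple_ok_def by blast
qed

lemma triple_ok_screening:
 assumes "tp dvd k - -2" "tp dvd l - 0" "int p dvd c"
 shows "triple_ok k l c" "triple_ok l k c"
proof -
 from assms obtain a b d where e: "k = tp * a - 2" "l = tp * b" "c = int p * d"
  by (metis dvdE diff_minus_eq_add add_diff_cancel_right' diff_0_right)
 have "k * l = tp * (b * (tp * a - 2))" "l * k = tp * (b * (tp * a - 2))" 
   "even (b * (tp * a - 2))" unfolding e by (auto simp: algebra_simps)
 moreover have "k * c = tp * (a * d * int p - d)" "l * c = tp * (b * c)" unfolding e by (auto simp: algebra_simps)
 then have "tp dvd k * c" "tp dvd l * c" by (metis dvd_triv_left)+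
 ultimately show "triple_ok k l c" "triple_ok l k c" unfolding triple_ok_def by blast+
qed

lemma Jac_scr: assumes "u \<in> VV (-2)" "v \<in> VV 0" "w \<in> PP" shows "Jac u v w" "Jac v u w"
 by (rule Jacobi[OF _ assms[unfolded VV_def PP_def]], rule triple_ok_screening; simp)
   (rule Jacobi[OF _ assms(2,1,3)[unfolded VV_def PP_def]], rule triple_ok_screening; simp)

lemma Jac_commutator:
 assumes "Jac u v w"
 shows "md u m (md v n w) - md v n (md u m w) = Sum_any (%i. sc (of_int m gchoose i) (md (md u (int i) v) (m + n - int i) w))"
 using assms[unfolded Jac_def LL_def RR_def, rule_format, of m n 0, unfolded bn_0 cv_one] by (simp add: cv_def)

lemma Jac_iterate:
 assumes "Jac u v w"
 shows "md (md u k v) n w = Sum_any (%i. sc ((-1) ^ i * (of_int k gchoose i)) (md u (k - int i) (md v (n + int i) w)))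
  - sc (sg k) (Sum_any (%i. sc ((-1) ^ i * (of_int k gchoose i)) (md v (n + k - int i) (md u (int i) w))))"
 using assms[unfolded Jac_def LL_def RR_def, rule_format, of 0 n k, unfolded bp_0 cv_one] by (simp add: cv_def add.commute)

lemma Jac_zero_mode:
 assumes "Jac u v w"
 shows "md u 0 (md v n w) = md (md u 0 v) n w + md v n (md u 0 w)"
proof -
 have "Sum_any (%i. sc (of_int 0 gchoose i) (md (md u (int i) v) (0 + n - int i) w)) = (\<Sum>i<1. sc (of_int 0 gchoose i) (md (md u (int i) v) (0 + n - int i) w))"
  by (rule Sum_any_nat) (simp add: gbinomial_0_left)
 with Jac_commutator[OF assms, of 0 n] show ?thesis by (simp add: algebra_simps)
qed

lemma Jac_one: "u \<in> VV 0 ==> Jac u 1 w" "u \<in> VV (-2) ==> w \<in> PP ==> Jac u 1 w"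
 by (simp_all add: Jac_VL Jac_scr one_VV)

text \<open>The iterate formula with v = 1: the vacuum modes leave at most one index in each sum,
  the first sum serving n < 0 and the second n > 0.\<close>

lemma md_T: assumes "Jac u 1 w" shows "md (T u) n w = sc (- of_int n) (md u (n - 1) w)"
proof -
 have c: "(-1) ^ i * (of_int (-2) gchoose i) = (of_nat (i + 1) :: complex)" for i
  using gbinomial_neg_nat[of 1 i] by (simp flip: mult.assoc power_mult_distrib)
 have 1: "(%i. sc (of_nat (i + 1)) (md u (-2 - int i) (md 1 (n + int i) w)))
  = (%i. if i = nat (- n - 1) then (if n < 0 then sc (- of_int n) (md u (n - 1) w) else 0) else 0)"
  by (rule ext) (auto simp: md_one md_lin of_nat_nat)
 have 2: "(%i. sc (of_nat (i + 1)) (md 1 (n + -2 - int i) (md u (int i) w)))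
  = (%i. if i = nat (n - 1) then (if n > 0 then sc (of_int n) (md u (n - 1) w) else 0) else 0)"
  by (rule ext) (auto simp: md_one md_lin of_nat_nat)
 have "sg (-2) = 1" by (rule sg_even) simp
 then show ?thesis
  unfolding T_def Jac_iterate[OF assms] c 1 2 by (cases "n = 0"; cases "n < 0") auto
qed

definition ev :: "nat multiset \<times> int => complex" where "ev b = hh (snd b) + of_int (lev (fst b))"

lemma lookup_L0: "lookup (L 0 v) b = ev b * lookup v b"
proof -
 have "lookup v b = lookup v b" ..
 have *: "L 0 (single x 1) = sc (ev x) (single x 1)" for x
  using L0_grd[OF grd_single[of "fst x" "snd x" 1]] by (simp add: ev_def)
 have "L 0 v = (\<Sum>x\<in>keys v. sc (lookup v x * ev x) (single x 1))"
  by (subst fock_expand[of v], subst flin_sum[OF flin_L]) (simp only: flin_scale[OF flin_L] * sc_sc)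
 then show ?thesis
  by (auto simp: lookup_fsum lookup_single when_def sum.delta in_keys_iff mult.commute)
qed

lemma L0_eigen_iff: "L 0 v = sc c v \<longleftrightarrow> v \<in> supp {b. ev b = c}"
proof
 assume "L 0 v = sc c v"
 then have "ev b * lookup v b = c * lookup v b" for b
  by (metis lookup_L0 lookup_fscale)
 then show "v \<in> supp {b. ev b = c}" by (auto simp: supp_def in_keys_iff)
next
 assume "v \<in> supp {b. ev b = c}"
 then have "lookup v b ~= 0 ==> ev b = c" for b by (auto simp: supp_def in_keys_iff)
 then show "L 0 v = sc c v" by (intro poly_mapping_eqI) (auto simp: lookup_L0)
qed

definition res :: "(nat multiset \<times> int) set => fock => fock" where
 "res S = lin_ext (%b. if b \<in> S then single b 1 else 0)"

lemma flin_res: "flin (res S)" unfolding res_def by (rule flin_lin_ext)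

lemma res_single: "res S (single b 1) = (if b \<in> S then single b 1 else 0)"
 by (simp add: res_def)

lemma lookup_res: "lookup (res S v) b = (if b \<in> S then lookup v b else 0)"
proof -
 have "lookup (res S v) b = (\<Sum>x\<in>keys v. if b = x then (if b \<in> S then lookup v b else 0) else 0)"
  unfolding res_def lin_ext_def lookup_fsum by (rule sum.cong) (auto simp: lookup_single when_def)
 then show ?thesis by (auto simp: in_keys_iff)
qed

lemma res_supp: "res S v \<in> supp S"
 by (auto simp: supp_def in_keys_iff lookup_res split: if_splits)

lemma res_id: "v \<in> supp S ==> res S v = v"
 by (rule poly_mapping_eqI) (auto simp: lookup_res supp_def in_keys_iff)

lemma res_disj: "v \<in> supp S ==> S \<inter> S' = {} ==> res S' v = 0"
 by (rule poly_mapping_eqI) (auto simp: lookup_res supp_def in_keys_iff)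

lemma res_supp': "v \<in> supp S' ==> res S v \<in> supp S'"
 by (auto simp: supp_def in_keys_iff lookup_res split: if_splits)

lemma res_decomp: assumes "finite (f ` keys v)"
 shows "v = (\<Sum>x\<in>f ` keys v. res {b. f b = x} v)"
proof (rule poly_mapping_eqI)
 fix b
 have "(\<Sum>x\<in>f ` keys v. lookup (res {b. f b = x} v) b)
  = (\<Sum>x\<in>f ` keys v. if x = f b then lookup v b else 0)"
  by (rule sum.cong) (auto simp: lookup_res)
 then show "lookup v b = lookup (\<Sum>x\<in>f ` keys v. res {b. f b = x} v) b"
  by (auto simp: lookup_fsum in_keys_iff assms)
qed

lemma L1_conf: "L 1 om = 0" and L0_conf: "L 0 om = sc 2 om" and conf_grd: "om \<in> grd 0 2"
proof -
 show g: "om \<in> grd 0 2"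
  unfolding lattice_conf_def one_eq_lat_exp
  by (intro grd_add grd_scale) (rule heis_grd' heis_grd'[OF heis_grd'] lat_exp_grd refl | simp)+
 then show "L 0 om = sc 2 om" using L0_grd by (auto simp: hh_def)
 have g1: "L 1 om \<in> grd 0 1"
  unfolding L_def by (rule grd_cong[OF md_grd[OF g g]]) auto
 have e: "L 1 (al (-1) 1) = sc (- 2 * of_nat (p - 1)) 1"
 proof -
  have "L 1 (1::fock) = 0" by (simp add: one_eq_lat_exp L_lat_exp)
  then show ?thesis using heis_L[of "-1" 1 1] by (simp add: heis_lin heis_one' eq_neg_iff_add_eq_0)
 qed
 show "L 1 om = 0"
 proof (rule vacuum_vector_eq_0[OF g1])
  fix r :: int assume r: "r > 0"
  show "al r (L 1 om) = 0"
  proof (cases "r = 1")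
   case True
   then show ?thesis using heis_L[of 1 1 om] by (simp add: conf_heis e)
  next
   case False
   have "al r (L 1 om) \<in> grd 0 (1 - r)" by (rule heis_grd[OF g1])
   with False r show ?thesis by (intro grd_neg) auto
  qed
 qed simp
qed

lemma L_grd: "v \<in> grd k N ==> L m v \<in> grd k (N - m)"
 unfolding L_def by (rule grd_cong[OF md_grd[OF conf_grd]]) auto

lemma commutator_finite:
 assumes "Jac u v w" "!!i. i >= I ==> md u (int i) v = 0"
 shows "md u m (md v n w) = md v n (md u m w) + (\<Sum>i<I. sc (of_int m gchoose i) (md (md u (int i) v) (m + n - int i) w))"
proof -
 have "Sum_any (%i. sc (of_int m gchoose i) (md (md u (int i) v) (m + n - int i) w))
  = (\<Sum>i<I. sc (of_int m gchoose i) (md (md u (int i) v) (m + n - int i) w))"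
  by (rule Sum_any_nat) (simp add: assms(2) md_lin)
 then show ?thesis using Jac_commutator[OF assms(1), of m n] by (simp add: algebra_simps)
qed

lemma md_conf: "md om (int i) = L (int i - 1)" by (simp add: L_def)

definition primary :: "complex => fock => bool" where
 "primary h u \<longleftrightarrow> (\<forall>m>0. L m u = 0) \<and> L 0 u = sc h u"

text \<open>Only the products with L(-1) and L(0) of a primary vector survive in the commutator
  formula, and the L(-1) term is a derivative.\<close>

lemma primary_commutator:
 assumes "primary h u" "Jac om u w" "Jac u 1 w"
 shows "L m (md u n w) = md u n (L m w) + sc (of_int (m + 1) * (h - 1) - of_int n) (md u (m + n) w)"
proof -
 have "L m (md u n w) = md u n (L m w) + (\<Sum>i<2. sc (of_int (m + 1) gchoose i) (md (md om (int i) u) (m + 1 + n - int i) w))"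
  unfolding L_def by (rule commutator_finite[OF assms(2)]) (use assms(1) in \<open>simp add: primary_def md_conf\<close>)
 also have "(\<Sum>i<2. sc (of_int (m + 1) gchoose i) (md (md om (int i) u) (m + 1 + n - int i) w))
  = sc (of_int (m + 1) * (h - 1) - of_int n) (md u (m + n) w)"
 proof -
  have s: "{..<2::nat} = {0, 1}" by auto
  have "(\<Sum>i<2. sc (of_int (m + 1) gchoose i) (md (L (int i - 1) u) (m + 1 + n - int i) w))
   = sc (of_int (m + 1) gchoose 0) (md (T u) (m + 1 + n) w) + sc (of_int (m + 1) gchoose 1) (md (L 0 u) (m + n) w)"
   unfolding s by (simp add: L_minus_one)
  also have "L 0 u = sc h u" using assms(1) by (simp add: primary_def)
  also have "sc (of_int (m + 1) gchoose 0) (md (T u) (m + 1 + n) w) + sc (of_int (m + 1) gchoose 1) (md (sc h u) (m + n) w)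
   = sc (- of_int (m + 1 + n) + of_int (m + 1) * h) (md u (m + n) w)"
   unfolding md_T[OF assms(3)] md_lin sc_sc sc_add_left by simp
  also have "- of_int (m + 1 + n) + of_int (m + 1) * h = of_int (m + 1) * (h - 1) - (of_int n :: complex)"
   by (simp add: algebra_simps)
  finally show ?thesis unfolding md_conf .
 qed
 finally show ?thesis .
qed

lemma primary_lat_exp: "primary (hh k) (xp k)"
 by (simp add: primary_def L_lat_exp L0_lat_exp)

section \<open>The screening operators and the triplet algebra\<close>

definition Q :: "fock => fock" where "Q = md (xp (tp)) 0"
definition Qt :: "fock => fock" where "Qt = md (xp (-2)) 0"

lemma flin_Q: "flin Q" and flin_Qt: "flin Qt"
 by (simp_all only: Q_def Qt_def flin_md2)

lemmas Q_lin = flin_add[OF flin_Q] flin_scale[OF flin_Q] flin_zero[OF flin_Q] flin_diff[OF flin_Q]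
 and Qt_lin = flin_add[OF flin_Qt] flin_scale[OF flin_Qt] flin_zero[OF flin_Qt] flin_diff[OF flin_Qt]
 and L_lin = flin_add[OF flin_L] flin_scale[OF flin_L] flin_zero[OF flin_L] flin_diff[OF flin_L] flin_uminus[OF flin_L]

lemma lat_exp_VV: "tp dvd k - r ==> xp k \<in> VV r"
 unfolding VV_def by (rule chs_mono[OF _ lat_exp_chs]) auto

lemma screening_primary: "primary 1 (xp (tp))" "primary 1 (xp (-2))"
 using primary_lat_exp[of "tp"] primary_lat_exp[of "-2"] p0 by (simp_all add: hh_def)

lemma screening_VV: "xp (tp) \<in> VV 0" "xp (-2) \<in> VV (-2)"
 by (simp_all only: lat_exp_VV diff_0_right dvd_refl diff_self dvd_0_right)

text \<open>For weight 1 and mode index 0 the scalar in \<open>primary_commutator\<close> is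
  0.\<close>

lemma L_Q: "L m (Q w) = Q (L m w)"
 unfolding Q_def
 by (subst primary_commutator[OF screening_primary(1) Jac_VL[OF conf_VV screening_VV(1)] Jac_one(1)[OF screening_VV(1)]]) simp

lemma L_Qt: "w \<in> PP ==> L m (Qt w) = Qt (L m w)"
 unfolding Qt_def
 by (subst primary_commutator[OF screening_primary(2) Jac_scr(2)[OF screening_VV(2) conf_VV] Jac_one(2)[OF screening_VV(2)]]) simp_all

lemma Q_md: "v \<in> VV 0 ==> Q (md v n w) = md (Q v) n w + md v n (Q w)"
 unfolding Q_def by (rule Jac_zero_mode[OF Jac_VL[OF screening_VV(1)]])

lemma Qt_md: "v \<in> VV 0 ==> w \<in> PP ==> Qt (md v n w) = md (Qt v) n w + md v n (Qt w)"
 unfolding Qt_def by (rule Jac_zero_mode[OF Jac_scr(1)[OF screening_VV(2)]])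

text \<open>The commutator is the zeroth mode of Qt exp(\<alpha>). That vector is a multiple of a
  derivative, and derivatives have zeroth mode 0.\<close>

lemma Qt_Q: assumes "w \<in> PP" shows "Qt (Q w) = Q (Qt w)"
proof -
 have e: "-2 * tp = tp * -2" by simp
 have t: "T (xp (tp - 2)) = sc (of_int (tp - 2) / of_nat (2 * p)) (al (-1) (xp (tp - 2)))"
  by (rule T_lat_exp)
 have "Qt (xp (tp)) = cre (-2) 1 (xp (tp - 2))"
  unfolding Qt_def md_lat_exp ek_lat_exp[OF e] by (simp add: crez_def)
 also have "... = sc (-2 / of_nat (2 * p)) (al (-1) (xp (tp - 2)))"
  using cre_deriv[of 1 "-2"] by simp
 \<comment> \<open>The constant is the quotient of -2/(2p) by (2p-2)/(2p), the coefficients of the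
   same oscillator vector.\<close>
 also have "... = sc (-1 / of_nat (p - 1)) (T (xp (tp - 2)))"
  unfolding t sc_sc using p2 by (intro arg_cong[where f = "%c. sc c _"]) (simp add: field_simps of_nat_diff)
 finally have 1: "Qt (xp (tp)) = sc (-1 / of_nat (p - 1)) (T (xp (tp - 2)))" .
 have "xp (tp - 2) \<in> VV (-2)" by (rule lat_exp_VV) simp
 from md_T[OF Jac_one(2)[OF this assms], of 0] have "md (T (xp (tp - 2))) 0 w = 0" by simp
 then show ?thesis
  using Qt_md[OF screening_VV(1) assms, of 0] unfolding 1 Q_def[symmetric] md_lin by (simp add: md_lin)
qed

definition W :: "fock set" where "W = {v \<in> VV 0. Qt v = 0}"

lemma W_VV: "v \<in> W ==> v \<in> VV 0" and W_PP: "v \<in> W ==> v \<in> PP" and W_Qt: "v \<in> W ==> Qt v = 0"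
 using VV_0_PP by (auto simp: W_def)

lemma W_add [intro]: "u \<in> W ==> v \<in> W ==> u + v \<in> W"
 and W_scale [intro]: "u \<in> W ==> sc c u \<in> W"
 and W_0 [intro, simp]: "0 \<in> W"
 unfolding W_def by (auto simp: Qt_lin)

lemma W_uminus [intro]: "u \<in> W ==> - u \<in> W"
 using W_scale[of u "-1"] by simp

lemma W_diff [intro]: "u \<in> W ==> v \<in> W ==> u - v \<in> W"
 using W_add[of u "- v"] W_uminus[of v] by simp

lemma W_sum [intro]: "(!!i. i \<in> A ==> f i \<in> W) ==> sum f A \<in> W"
 by (induction A rule: infinite_finite_induct) auto

lemma W_Sum_any [intro]: "(!!i. f i \<in> W) ==> Sum_any f \<in> W"
 unfolding Sum_any.expand_set by auto

lemma W_cv [intro]: "(!!b. G b \<in> W) ==> cv ka G n \<in> W"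
 unfolding cv_def by (intro W_Sum_any W_scale)

lemma md_W [intro]: "u \<in> W ==> v \<in> W ==> md u n v \<in> W"
 unfolding W_def using VV_0_PP by (auto simp: Qt_md md_lin md_VL)

lemma one_W [intro, simp]: "1 \<in> W"
 unfolding W_def using one_VV by (auto simp: Qt_def md_right_one)

lemma conf_eq: "om = L (-2) 1"
 by (simp add: L_def md_right_one)

lemma conf_W [intro, simp]: "om \<in> W"
 unfolding W_def using L_Qt[OF VV_0_PP[OF one_VV], of "-2"] W_Qt[OF one_W] conf_VV by (auto simp: conf_eq L_lin)

lemma L_W [intro]: "v \<in> W ==> L m v \<in> W"
 unfolding L_def by (rule md_W) auto

lemma Q_W [intro]: "v \<in> W ==> Q v \<in> W"
 unfolding W_def using screening_VV(1) VV_0_PP by (auto simp: Qt_Q Q_lin) (auto simp: Q_def intro: md_VL)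

definition F :: fock where "F = xp (- tp)"
definition H :: fock where "H = Q F"
definition E :: fock where "E = Q H"

text \<open>Charge \<open>2pk\<close> and conformal weight \<open>n\<close>.\<close>

definition wq :: "int => int" where "wq k = k * (int p * k - int p + 1)"
definition hg :: "int => int => fock set" where "hg k n = grd (tp * k) (n - wq k)"

lemma hg_closed [intro]: "u \<in> hg k n ==> v \<in> hg k n ==> u + v \<in> hg k n" "u \<in> hg k n ==> sc c u \<in> hg k n" "0 \<in> hg k n"
  "(!!i. i \<in> A ==> f i \<in> hg k n) ==> sum f A \<in> hg k n" "(!!i. g i \<in> hg k n) ==> Sum_any g \<in> hg k n"
 unfolding hg_def by auto

lemma hg_cong: "v \<in> hg k n ==> k = k' ==> n = n' ==> v \<in> hg k' n'" by simp

lemma hg_VV: "v \<in> hg k n ==> v \<in> VV 0"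
 unfolding hg_def VV_def by (rule chs_mono[OF _ grd_chs]) auto

lemma md_hg: assumes "u \<in> hg a m" "v \<in> hg b n" shows "md u r v \<in> hg (a + b) (m + n - r - 1)"
proof -
 have d: "tp * a * (tp * b) div tp = tp * (a * b)"
  using p2 by (simp add: mult.assoc mult.left_commute)
 show ?thesis
  unfolding hg_def
  by (rule grd_cong[OF md_grd[OF assms[unfolded hg_def]]])
   (unfold d, simp_all add: wq_def algebra_simps)
qed

lemma hg_neg: "v \<in> hg k n ==> n < wq k ==> v = 0"
 unfolding hg_def by (rule grd_neg) auto

lemma hh_wq: "hh (tp * k) = of_int (wq k)"
proof -
 have e: "tp * k * (tp * k - 2 * int p + 2) = int (4 * p) * wq k" by (simp add: wq_def algebra_simps)
 show ?thesis unfolding hh_def e using p0 by simp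
qed

lemma L0_hg: "v \<in> hg k n ==> L 0 v = sc (of_int n) v"
 unfolding hg_def by (drule L0_grd) (simp add: hh_wq[simplified])

lemma L_hg: "v \<in> hg k n ==> L m v \<in> hg k (n - m)"
 unfolding hg_def by (drule L_grd[of _ _ _ m]) (simp add: algebra_simps)

lemma exp_hg: "xp (tp * k) \<in> hg k (wq k)"
 unfolding hg_def by (auto intro: lat_exp_grd)

lemma Q_hg: "v \<in> hg k n ==> Q v \<in> hg (k + 1) n"
 unfolding Q_def by (rule hg_cong[OF md_hg[of _ 1 1]]) (use exp_hg[of 1] in \<open>simp_all add: wq_def\<close>)

lemma one_hg: "1 \<in> hg 0 0" and conf_hg: "om \<in> hg 0 2"
 using exp_hg[of 0] conf_grd by (simp_all add: one_eq_lat_exp hg_def wq_def)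

text \<open>The minimal weights are 0 for charge 0, 1 for charge \<alpha> and 2p - 1 for charge
  -\<alpha>. Below weight 2p - 1 only the charges 0 and \<alpha> remain, which is what the
  generation argument exploits.\<close>

lemma wq_bounds: "wq k >= 0" "k ~= 0 ==> wq k >= 1" "k ~= 0 ==> k ~= 1 ==> wq k >= 2 * int p - 1"
proof -
 have 3: "wq k >= 2 * int p - 1" if "k ~= 0" "k ~= 1"
 proof (cases "k > 0")
  case True
  then have k: "k >= 2" using that by simp
  have "int p * k >= int p * 2" using k by (intro mult_left_mono) auto
  then have "2 * (int p + 1) \<le> k * (int p * k - int p + 1)" using k by (intro mult_mono) auto
  then show ?thesis by (simp add: wq_def)
 next
  case False
  then have k: "-k >= 1" using that by simp
  have "int p * 1 \<le> int p * (-k)" using k by (intro mult_left_mono) auto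
  then have "1 * (2 * int p - 1) \<le> (-k) * (int p * (-k) + int p - 1)" using k p2 by (intro mult_mono) auto
  then show ?thesis by (simp add: wq_def algebra_simps)
 qed
 show 1: "k ~= 0 ==> wq k >= 1" using 3 p2 by (cases "k = 1") (auto simp: wq_def)
 show "wq k >= 0" using 1 by (cases "k = 0") (auto simp: wq_def)
 show "k ~= 0 ==> k ~= 1 ==> wq k >= 2 * int p - 1" by (rule 3)
qed

lemma F_hg: "F \<in> hg (-1) (2 * int p - 1)" and H_hg: "H \<in> hg 0 (2 * int p - 1)" and E_hg: "E \<in> hg 1 (2 * int p - 1)"
proof -
 show F: "F \<in> hg (-1) (2 * int p - 1)" using exp_hg[of "-1"] by (simp add: F_def wq_def)
 from Q_hg[OF this] show H: "H \<in> hg 0 (2 * int p - 1)" by (simp add: H_def)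
 from Q_hg[OF this] show "E \<in> hg 1 (2 * int p - 1)" by (simp add: E_def)
qed

text \<open>Charge 2\<alpha> begins in weight 2p + 2, above the weight 2p - 1 of E.\<close>

lemma Q_E: "Q E = 0"
 using Q_hg[OF E_hg] by (rule hg_neg) (simp add: wq_def)

lemma F_W: "F \<in> W" and H_W: "H \<in> W" and E_W: "E \<in> W"
proof -
 have e: "-2 * (- tp) = tp * 2" by simp
 have "Qt F = 0" unfolding Qt_def F_def md_lat_exp ek_lat_exp[OF e] by (simp add: crez_def)
 then show F: "F \<in> W" unfolding W_def using hg_VV[OF F_hg] by simp
 then show "H \<in> W" unfolding H_def by (rule Q_W)
 then show "E \<in> W" unfolding E_def by (rule Q_W)
qed

lemma primary_Q: "primary h u ==> primary h (Q u)"
 unfolding primary_def by (simp add: L_Q Q_lin)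

lemma primary_F: "primary (of_int (2 * int p - 1)) F" and primary_H: "primary (of_int (2 * int p - 1)) H"
 and primary_E: "primary (of_int (2 * int p - 1)) E"
proof -
 show F: "primary (of_int (2 * int p - 1)) F"
  using primary_lat_exp[of "- tp"] hh_wq[of "-1"] by (simp add: F_def wq_def)
 then show H: "primary (of_int (2 * int p - 1)) H" unfolding H_def by (rule primary_Q)
 then show "primary (of_int (2 * int p - 1)) E" unfolding E_def by (rule primary_Q)
qed

text \<open>The screening operator is homogeneous in charge and level, with the level shift of
  \<open>md_grd\<close> at mode 0; so its kernel contains the homogeneous parts of its
  elements.\<close>

lemma Qt_res:
 assumes "v \<in> VV 0"
 shows "Qt (res {b. snd b = k \<and> lev (fst b) = N} v)
  = res {b. snd b = k - 2 \<and> lev (fst b) = N - 1 - (-2 * k) div tp} (Qt v)"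
proof (rule flin_eqI[OF flin_comp[OF flin_Qt flin_res] flin_comp[OF flin_res flin_Qt]])
 fix b assume "b \<in> keys v"
 obtain mu c where b: "b = (mu, c)" by (cases b)
 have g: "Qt (single b 1) \<in> grd (c - 2) (lev mu - 1 - (-2 * c) div tp)"
  unfolding Qt_def b by (rule grd_cong[OF md_grd[OF lat_exp_grd grd_single]]) simp_all
 show "Qt (res {b. snd b = k \<and> lev (fst b) = N} (single b 1))
  = res {b. snd b = k - 2 \<and> lev (fst b) = N - 1 - (-2 * k) div tp} (Qt (single b 1))"
 proof (cases "c = k \<and> lev mu = N")
  case True
  then show ?thesis using g by (auto simp: res_single b grd_def intro: res_id[symmetric])
 next
  case False
  then have "res {b. snd b = k \<and> lev (fst b) = N} (single b 1) = 0" by (auto simp: res_single b)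
  moreover have "res {b. snd b = k - 2 \<and> lev (fst b) = N - 1 - (-2 * k) div tp} (Qt (single b 1)) = 0"
   using g unfolding grd_def by (rule res_disj) (use False in auto)
  ultimately show ?thesis by (simp add: Qt_lin)
 qed
qed

lemma W_res: "v \<in> W ==> res {b. snd b = k \<and> lev (fst b) = N} v \<in> W"
 unfolding W_def VV_def by (auto simp: Qt_res[unfolded VV_def] flin_zero[OF flin_res] chs_def intro: res_supp')

lemma W_decomp:
 assumes "v \<in> W"
 obtains A and f :: "int \<times> int => fock" where "finite A" "v = sum f A" "!!k n. f (k, n) \<in> W \<inter> hg k n"
proof -
 define g :: "nat multiset \<times> int => int \<times> int" where "g b = (snd b div tp, lev (fst b) + wq (snd b div tp))" for b
 define f where "f x = res {b. snd b = tp * fst x \<and> lev (fst b) = snd x - wq (fst x)} v" for x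
 have "v = (\<Sum>x\<in>g ` keys v. res {b. g b = x} v)" by (rule res_decomp) simp
 also have "... = sum f (g ` keys v)"
 proof (rule sum.cong[OF refl])
  fix x
  show "res {b. g b = x} v = f x"
   unfolding f_def
  proof (rule poly_mapping_eqI)
   fix b
   show "lookup (res {b. g b = x} v) b
    = lookup (res {b. snd b = tp * fst x \<and> lev (fst b) = snd x - wq (fst x)} v) b"
   proof (cases "lookup v b = 0")
    case False
    then have "b \<in> keys v" by (simp add: in_keys_iff)
    with assms have "tp dvd snd b" unfolding W_def VV_def by (auto dest: chs_keys)
    then obtain a where a: "snd b = tp * a" by (auto elim: dvdE)
    have "snd b div tp = a" unfolding a using p2 by simp
    then have "g b = x \<longleftrightarrow> snd b = tp * fst x \<and> lev (fst b) = snd x - wq (fst x)"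
     using p2 unfolding g_def a by (cases x) auto
    then show ?thesis by (simp add: lookup_res)
   qed (simp add: lookup_res)
  qed
 qed
 finally have 1: "v = sum f (g ` keys v)" .
 have 2: "f (k, n) \<in> W \<inter> hg k n" for k n
  unfolding f_def hg_def grd_def using W_res[OF assms] res_supp by auto
 show thesis using that[OF _ 1 2] by simp
qed

section \<open>The logarithmic module\<close>

lemma vspace_triplet: "vspace (triplet p) = W" and vscale_triplet: "vscale (triplet p) = sc"
 and vmode_triplet: "vmode (triplet p) = md" and vac_triplet: "vac (triplet p) = 1" and conf_triplet: "conf (triplet p) = om"
proof -
 have "lattice_space p = VV 0" by (auto simp: lattice_space_def VV_def chs_def supp_def)
 moreover have "screening p = Qt" by (rule ext) (simp add: screening_def Qt_def md_def)
 ultimately show "vspace (triplet p) = W" by (simp add: triplet_def W_def)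
 show "vmode (triplet p) = md" by (intro ext) (simp add: triplet_def md_def)
qed (simp_all add: triplet_def)

lemmas triplet_simps = vspace_triplet vscale_triplet vmode_triplet vac_triplet conf_triplet

abbreviation "ee \<equiv> xp (-2)"

text \<open>The coefficients of \<open>ln (1 + x)\<close>.\<close>

definition lc :: "nat => complex" where "lc j = (if j = 0 then 0 else (-1) ^ (j - 1) / of_nat j)"

text \<open>The i-th divided derivative of ln(1 + x) is \<open>lc i\<close> times (1 +
  x)^(-i).\<close>

lemma lc_shift: assumes "i > 0" shows "lc (i + t) * of_nat ((i + t) choose i) = lc i * fps_nth (bp (- int i)) t"
proof -
 obtain q where q: "i = Suc q" using assms by (cases i) auto
 have "Suc (q + t) * ((q + t) choose q) = (Suc (q + t) choose Suc q) * Suc q" by (rule Suc_times_binomial_eq)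
 then have "of_nat (Suc (q + t)) * of_nat ((q + t) choose q) = (of_nat (Suc (q + t) choose Suc q) * of_nat (Suc q) :: complex)"
  by (metis of_nat_mult)
 moreover have "fps_nth (bp (- int i)) t = (-1) ^ t * of_nat ((q + t) choose q)"
  using bp_neg_bc[of q t] by (simp add: q bc_def binomial_symmetric[of q "q + t"] minus_diff_commute)
 moreover have "(of_nat (Suc (q + t)) :: complex) ~= 0" "(of_nat (Suc q) :: complex) ~= 0" by (simp_all del: of_nat_Suc)
 ultimately show ?thesis unfolding lc_def q by (simp add: power_add field_simps del: of_nat_Suc)
qed

text \<open>The part of the deforming exponential that is linear in the modes of the screening
  current.\<close>

definition act2 :: "fock => int => fock => fock" where
 "act2 u n w = Sum_any (%j. sc (lc j) (md (md ee (int j) u) (n - int j) w))"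

text \<open>Projection to the summand of L + \<alpha>/2, the one on which the current is allowed to
  act.\<close>

definition pr :: "fock => fock" where "pr = res {b. tp dvd snd b - int p}"

text \<open>
 Formally \<open>act u\<close> is \<open>Y(exp(\<Sum>j\<ge>1. (-1)\<^bsup>j-1\<^esup>/j e\<^sub>j x\<^bsup>-j\<^esup>) u, x)\<close>, where \<open>e\<close> is the screening current,
 on a module where products of two modes of \<open>e\<close> vanish.
\<close>

definition act :: "fock => int => fock => fock" where
 "act u n w = md u n w + act2 u n (pr w)"

definition M :: "fock set" where
 "M = chs {k. tp dvd k - int p \<or> tp dvd k - (int p - 2)}"

lemma act2_finite: "ALL j>=J. md ee (int j) u = 0 ==> act2 u n w = (\<Sum>j<J. sc (lc j) (md (md ee (int j) u) (n - int j) w))"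
 unfolding act2_def by (rule Sum_any_nat) (simp add: md_lin)

lemma md_ee_bound: "\<exists>J. ALL j>=J. md ee (int j) u = 0"
 using bdd_evz[OF bdd_md[of ee u], of 0] by (simp add: evz_def)

lemma evz_act2: "evz (%j. sc (c j) (md (md ee (int j) u) (m j) w))"
proof -
 obtain J where "ALL j>=J. md ee (int j) u = 0" using md_ee_bound by blast
 then show ?thesis by (intro evzI[of J]) (simp add: md_lin)
qed

lemma flin_act2: "flin (%u. act2 u n w)" "flin (act2 u n)"
 unfolding act2_def
 by (rule flinI; simp add: md_lin sc_add Sum_any_add[OF evz_act2 evz_act2] mult.commute flip: Sum_any_fscale[OF evz_act2])+

lemma bdd_act2: "bdd (%n. act2 u n w)"
proof -
 obtain J where J: "ALL j>=J. md ee (int j) u = 0" using md_ee_bound by blast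
 have "bdd (%n. \<Sum>j<J. sc (lc j) (md (md ee (int j) u) (n + (- int j)) w))"
  by (intro bdd_sum bdd_flin[where L = "sc _"] bdd_shift bdd_md flin_fscale flin_id)
 then show ?thesis by (subst act2_finite[OF J]) simp_all
qed

lemma W_ee: "u \<in> W ==> md ee n u \<in> VV (-2)"
 using md_VV[OF screening_VV(2) W_VV] by simp

lemma act2_VV: assumes "u \<in> W" "w \<in> VV s" shows "act2 u n w \<in> VV (-2 + s)"
 unfolding act2_def by (intro VV_closed md_VV[OF W_ee] assms)

lemma cv_act2_arg: "bdd (%b. md u (d - b) (act2 v b w))"
 and cv_act2_fun: "bdd (%b. act2 u (d - b) (md v b w))"
proof -
 obtain N where "!!b. b >= N ==> act2 v b w = 0" using bdd_act2[of v w] unfolding bdd_def by blast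
 then show "bdd (%b. md u (d - b) (act2 v b w))" by (intro bddI[of N]) (simp add: md_lin)
 obtain N where "!!b. b >= N ==> md v b w = 0" using bdd_md[of v w] unfolding bdd_def by blast
 then show "bdd (%b. act2 u (d - b) (md v b w))" by (intro bddI[of N]) (simp add: flin_zero[OF flin_act2(2)])
qed

lemma cv_RR_act2:
 assumes J: "ALL j>=J. md ee (int j) u = 0" "ALL j>=J. md ee (int j) v = 0"
 shows "cv (bn k) (%b. md u (m + n + k - b) (act2 v b w)) n = (\<Sum>j<J. sc (lc j) (RR u (md ee (int j) v) w m (n - int j) k))"
  and "cv (bn k) (%b. act2 u (m + n + k - b) (md v b w)) n = (\<Sum>j<J. sc (lc j) (RR (md ee (int j) u) v w (m - int j) n k))"
proof -
 let ?d = "m + n + k"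
 have s: "md u (?d - b) (md (md ee (int j) v) (b - int j) w)
  = (%b. md u (m + (n - int j) + k - b) (md (md ee (int j) v) b w)) (b + (- int j))" for b j
  by (simp add: algebra_simps)
 have b: "bdd (%b. md u (?d - b) (md (md ee (int j) v) (b - int j) w))" for j
  unfolding s by (rule bdd_shift[OF bdd_RR])
 have "cv (bn k) (%b. md u (?d - b) (act2 v b w)) n
  = cv (bn k) (%b. \<Sum>j<J. sc (lc j) (md u (?d - b) (md (md ee (int j) v) (b - int j) w))) n"
  by (simp only: act2_finite[OF J(2)] flin_sum[OF flin_md2] flin_scale[OF flin_md2])
 also have "... = (\<Sum>j<J. sc (lc j) (cv (bn k) (%b. md u (?d - b) (md (md ee (int j) v) (b - int j) w)) n))"
  by (subst cv_sum) (simp_all add: cv_scale[OF b] bdd_flin[OF b flin_fscale[OF flin_id]])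
 also have "... = (\<Sum>j<J. sc (lc j) (RR u (md ee (int j) v) w m (n - int j) k))"
  unfolding s RR_def by (subst cv_shift) simp
 finally show "cv (bn k) (%b. md u (m + n + k - b) (act2 v b w)) n = (\<Sum>j<J. sc (lc j) (RR u (md ee (int j) v) w m (n - int j) k))" .
 have e: "?d - b - int j = m - int j + n + k - b" for b j by simp
 have "cv (bn k) (%b. act2 u (?d - b) (md v b w)) n
  = cv (bn k) (%b. \<Sum>j<J. sc (lc j) (md (md ee (int j) u) (m - int j + n + k - b) (md v b w))) n"
  unfolding act2_finite[OF J(1)] e ..
 also have "... = (\<Sum>j<J. sc (lc j) (RR (md ee (int j) u) v w (m - int j) n k))"
  unfolding RR_def by (subst cv_sum) (simp_all add: cv_scale[OF bdd_RR] bdd_flin[OF bdd_RR flin_fscale[OF flin_id]])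
 finally show "cv (bn k) (%b. act2 u (m + n + k - b) (md v b w)) n = (\<Sum>j<J. sc (lc j) (RR (md ee (int j) u) v w (m - int j) n k))" .
qed

text \<open>Commuting e_j past the mode of u splits e_j (u_c v) into u_c (e_j v) and terms
  containing e_i u. By \<open>lc_shift\<close> the coefficients of the latter reassemble into (1 +
  Y)^(-i), which lowers the exponent m by i. The term i = 0 is 0 since e_0 annihilates u.\<close>

lemma cv_LL_act2:
 assumes J: "ALL j>=J. md ee (int j) u = 0" "ALL j>=J. md ee (int j) v = 0"
  and u: "u \<in> W" and v: "v \<in> W"
 shows "cv (bp m) (%c. act2 (md u c v) (m + n + k - c) w) k
  = (\<Sum>j<J. sc (lc j) (LL u (md ee (int j) v) w m (n - int j) k)) + (\<Sum>j<J. sc (lc j) (LL (md ee (int j) u) v w (m - int j) n k))"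
proof -
 let ?d = "m + n + k"
 define G where "G i c = md (md (md ee (int i) u) c v) (m - int i + n + k - c) w" for i :: nat and c
 have bG: "bdd (G i)" for i unfolding G_def by (rule bdd_LL)
 have c: "md ee (int j) (md u c v) = md u c (md ee (int j) v) + (\<Sum>i<J. sc (of_int (int j) gchoose i) (md (md ee (int i) u) (int j + c - int i) v))" for j c
  by (rule commutator_finite[OF Jac_scr(1)[OF screening_VV(2) W_VV[OF u] W_PP[OF v]] J(1)[rule_format]])
 have ev1: "evz (%j. sc (lc j) (md (md u c (md ee (int j) v)) (?d - c - int j) w))" for c
  by (rule evzI[of J]) (simp add: J md_lin)
 have ev2: "evz (%j. sc (lc j * of_nat (j choose i)) (G i (c + int j - int i)))" for c i
  using bdd_cv_evz[OF bdd_shift[OF bG[of i], of "- int i"], of _ c] by (simp add: algebra_simps)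
 have "act2 (md u c v) (?d - c) w = Sum_any (%j. sc (lc j) (md (md u c (md ee (int j) v)) (?d - c - int j) w)
   + (\<Sum>i<J. sc (lc j * of_nat (j choose i)) (G i (c + int j - int i))))" for c
  unfolding act2_def c G_def md_lin flin_sum[OF flin_md1] sc_add sc_sum sc_sc
  by (simp add: binomial_gbinomial algebra_simps)
 then have A: "act2 (md u c v) (?d - c) w = (\<Sum>j<J. sc (lc j) (md (md u c (md ee (int j) v)) (m + (n - int j) + k - c) w))
   + (\<Sum>i<J. Sum_any (%j. sc (lc j * of_nat (j choose i)) (G i (c + int j - int i))))" for c
  by (simp only: Sum_any_add[OF ev1 evz_sum[OF ev2]] Sum_any_sum[OF ev2])
    (subst Sum_any_nat[of J], simp_all add: J md_lin algebra_simps)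
 have B: "Sum_any (%j. sc (lc j * of_nat (j choose i)) (G i (c + int j - int i))) = sc (lc i) (cv (bp (- int i)) (G i) c)" for i c
 proof (cases "i = 0")
  case True
  have "G 0 = (%c. 0)" using W_Qt[OF u] by (auto simp: G_def Qt_def md_lin)
  then show ?thesis using True by (simp add: cv_def)
 next
  case False
  have "Sum_any (%j. sc (lc j * of_nat (j choose i)) (G i (c + int j - int i)))
   = Sum_any (%t. sc (lc (t + i) * of_nat ((t + i) choose i)) (G i (c + int (t + i) - int i)))"
   by (rule Sum_any_shift) simp
  also have "... = Sum_any (%t. sc (lc i) (sc (fps_nth (bp (- int i)) t) (G i (c + int t))))"
   using lc_shift[of i] False by (intro Sum_any.cong) (simp add: add.commute)
  finally show ?thesis unfolding cv_def Sum_any_fscale[OF bdd_cv_evz[OF bG]] .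
 qed
 have "cv (bp m) (%c. act2 (md u c v) (?d - c) w) k
  = cv (bp m) (%c. \<Sum>j<J. sc (lc j) (md (md u c (md ee (int j) v)) (m + (n - int j) + k - c) w)) k
   + cv (bp m) (%c. \<Sum>i<J. sc (lc i) (cv (bp (- int i)) (G i) c)) k"
  unfolding A B
  by (intro cv_add bdd_sum bdd_flin[where L = "sc _"] bdd_LL bdd_cv bG flin_fscale flin_id)
 also have "cv (bp m) (%c. \<Sum>j<J. sc (lc j) (md (md u c (md ee (int j) v)) (m + (n - int j) + k - c) w)) k
  = (\<Sum>j<J. sc (lc j) (LL u (md ee (int j) v) w m (n - int j) k))"
  unfolding LL_def by (subst cv_sum) (simp_all add: cv_scale[OF bdd_LL] bdd_flin[OF bdd_LL flin_fscale[OF flin_id]])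
 also have "cv (bp m) (%c. \<Sum>i<J. sc (lc i) (cv (bp (- int i)) (G i) c)) k
  = (\<Sum>i<J. sc (lc i) (cv (bp m) (cv (bp (- int i)) (G i)) k))"
  by (subst cv_sum) (simp_all add: cv_scale[OF bdd_cv[OF bG]] bdd_flin[OF bdd_cv[OF bG] flin_fscale[OF flin_id]])
 also have "... = (\<Sum>j<J. sc (lc j) (LL (md ee (int j) u) v w (m - int j) n k))"
  unfolding cv_mult[OF bG] bp_add[symmetric] by (simp add: LL_def G_def[abs_def])
 finally show ?thesis .
qed

text \<open>The part linear in the current is the sum of the Jacobi identities for the pairs (e_j u,
  v) and (u, e_j v), all acting on the summand where these modes have integral index.\<close>

lemma act2_Jacobi:
 assumes u: "u \<in> W" and v: "v \<in> W" and w: "w \<in> VV (int p)"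
 shows "cv (bp m) (%c. act2 (md u c v) (m + n + k - c) w) k
  = cv (bn k) (%b. md u (m + n + k - b) (act2 v b w) + act2 u (m + n + k - b) (md v b w)) n
  - sc (sg k) (cv (bn k) (%b. md v (m + n + k - b) (act2 u b w) + act2 v (m + n + k - b) (md u b w)) m)"
proof -
 obtain J1 where J1: "ALL j>=J1. md ee (int j) u = 0" using md_ee_bound by blast
 obtain J2 where J2: "ALL j>=J2. md ee (int j) v = 0" using md_ee_bound by blast
 define J where "J = max J1 J2"
 have J: "ALL j>=J. md ee (int j) u = 0" "ALL j>=J. md ee (int j) v = 0"
  using J1 J2 by (auto simp: J_def)
 have e: "m + n + k = n + m + k" by simp
 have 1: "LL u (md ee (int j) v) w m (n - int j) k = RR u (md ee (int j) v) w m (n - int j) k - sc (sg k) (RR (md ee (int j) v) u w (n - int j) m k)" for j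
  using Jac_scr(2)[OF W_ee[OF v] W_VV[OF u] VV_p_PP[OF w]] by (simp add: Jac_def)
 have 2: "LL (md ee (int j) u) v w (m - int j) n k = RR (md ee (int j) u) v w (m - int j) n k - sc (sg k) (RR v (md ee (int j) u) w n (m - int j) k)" for j
  using Jac_scr(1)[OF W_ee[OF u] W_VV[OF v] VV_p_PP[OF w]] by (simp add: Jac_def)
 have "cv (bn k) (%b. md v (m + n + k - b) (act2 u b w) + act2 v (m + n + k - b) (md u b w)) m
  = (\<Sum>j<J. sc (lc j) (RR v (md ee (int j) u) w n (m - int j) k)) + (\<Sum>j<J. sc (lc j) (RR (md ee (int j) v) u w (n - int j) m k))"
  unfolding cv_add[OF cv_act2_arg cv_act2_fun] unfolding e cv_RR_act2[OF J(2,1)] ..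
 then show ?thesis
  unfolding cv_LL_act2[OF J u v] cv_add[OF cv_act2_arg cv_act2_fun] cv_RR_act2[OF J] 1 2
  by (simp add: sc_add sc_diff sum_subtractf sc_sum mult.commute)
qed

lemma flin_pr: "flin pr" unfolding pr_def by (rule flin_res)

lemma pr_VV: "pr w \<in> VV (int p)"
 unfolding pr_def VV_def chs_def using res_supp by simp

lemma pr_id: "w \<in> VV (int p) ==> pr w = w"
 unfolding pr_def VV_def chs_def by (rule res_id) simp

text \<open>The two classes of charges are disjoint because 2p does not divide 2.\<close>

lemma pr_0: "w \<in> VV (int p - 2) ==> pr w = 0"
proof -
 have "\<not> (tp dvd k - (int p - 2) \<and> tp dvd k - int p)" for k
 proof
  assume "tp dvd k - (int p - 2) \<and> tp dvd k - int p"
  then have "tp dvd (k - (int p - 2)) - (k - int p)" by (elim conjE dvd_diff)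
  then have "tp dvd 2" by simp
  then have "tp \<le> 2" by (rule zdvd_imp_le) simp
  then show False using p2 by simp
 qed
 then show "w \<in> VV (int p - 2) ==> pr w = 0"
  unfolding pr_def VV_def chs_def by (erule_tac res_disj) auto
qed

lemma M_decomp: "w \<in> M \<longleftrightarrow> (\<exists>w1\<in>VV (int p). \<exists>w2\<in>VV (int p - 2). w = w1 + w2)"
proof
 assume w: "w \<in> M"
 have "w - pr w \<in> VV (int p - 2)"
  using w unfolding M_def VV_def chs_def supp_def pr_def by (auto simp: in_keys_iff lookup_minus lookup_res split: if_splits)
 then show "\<exists>w1\<in>VV (int p). \<exists>w2\<in>VV (int p - 2). w = w1 + w2"
  by (intro bexI[of _ "pr w"] bexI[of _ "w - pr w"]) (auto intro: pr_VV)
next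
 assume "\<exists>w1\<in>VV (int p). \<exists>w2\<in>VV (int p - 2). w = w1 + w2"
 then obtain w1 w2 where w: "w = w1 + w2" "w1 \<in> VV (int p)" "w2 \<in> VV (int p - 2)" by blast
 have "w1 \<in> M" "w2 \<in> M" using w(2,3) unfolding M_def VV_def by (auto elim: chs_mono[rotated])
 then show "w \<in> M" unfolding w M_def by (rule chs_add)
qed

lemma M_parts: assumes "w \<in> M" shows "w - pr w \<in> VV (int p - 2)"
proof -
 from assms obtain w1 w2 where w: "w = w1 + w2" "w1 \<in> VV (int p)" "w2 \<in> VV (int p - 2)" by (auto simp: M_decomp)
 then show ?thesis by (simp add: flin_add[OF flin_pr] pr_id pr_0)
qed

lemma md_M: assumes "u \<in> VV 0" "w \<in> M" shows "md u n w \<in> M" "pr (md u n w) = md u n (pr w)"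
proof -
 have e: "md u n w = md u n (pr w) + md u n (w - pr w)" by (simp add: md_lin flip: flin_add[OF flin_md2])
 have 1: "md u n (pr w) \<in> VV (int p)" and 2: "md u n (w - pr w) \<in> VV (int p - 2)"
  by (rule md_VL[OF assms(1)] pr_VV M_parts[OF assms(2)])+
 then show "md u n w \<in> M" unfolding e M_decomp by blast
 show "pr (md u n w) = md u n (pr w)" unfolding e by (simp add: flin_add[OF flin_pr] pr_id[OF 1] pr_0[OF 2])
qed

lemma act2_pr: assumes "u \<in> W" shows "act2 u n (pr w) \<in> VV (int p - 2)" "act2 u n (pr w) \<in> M" "pr (act2 u n (pr w)) = 0"
proof -
 show 1: "act2 u n (pr w) \<in> VV (int p - 2)" using act2_VV[OF assms pr_VV, of n w] by simp
 then show "pr (act2 u n (pr w)) = 0" by (rule pr_0)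
 show "act2 u n (pr w) \<in> M" unfolding M_decomp
  by (rule bexI[of _ 0], rule bexI[OF _ 1]) (auto intro: VV_closed)
qed

lemma M_closed: "u \<in> M ==> v \<in> M ==> u + v \<in> M" "u \<in> M ==> sc c u \<in> M" "0 \<in> M"
 unfolding M_def by auto

lemma act_M: "u \<in> W ==> w \<in> M ==> act u n w \<in> M"
 and pr_act: "u \<in> W ==> w \<in> M ==> pr (act u n w) = md u n (pr w)"
 unfolding act_def by (auto intro!: M_closed md_M act2_pr W_VV simp: flin_add[OF flin_pr] md_M act2_pr)

lemma flin_act: "flin (%u. act u n w)" "flin (act u n)"
 unfolding act_def
 by (intro flin_plus flin_md1 flin_md2 flin_act2 flin_comp[OF flin_act2(2) flin_pr])+

lemma bdd_act: "bdd (%n. act u n w)"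
 unfolding act_def by (intro bdd_add bdd_md bdd_act2)

text \<open>A term with two factors \<open>act2\<close> is absent, since \<open>act2\<close> takes
  values where \<open>pr\<close> is 0; the Jacobi identity therefore only has to be checked up to
  first order.\<close>

lemma act_act: "u \<in> W ==> v \<in> W ==> w \<in> M ==>
 act u m (act v n w) = md u m (md v n w) + (md u m (act2 v n (pr w)) + act2 u m (md v n (pr w)))"
 unfolding act_def[of u] by (simp add: pr_act) (simp add: act_def md_lin)

lemma act_Jacobi:
 assumes u: "u \<in> W" and v: "v \<in> W" and w: "w \<in> M"
 shows "cv (bp m) (%c. act (md u c v) (m + n + k - c) w) k
  = cv (bn k) (%b. act u (m + n + k - b) (act v b w)) n
  - sc (sg k) (cv (bn k) (%b. act v (m + n + k - b) (act u b w)) m)"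
proof -
 have b: "bdd (%c. act2 (md u c v) (m + n + k - c) w)" for w
 proof -
  obtain N where "!!b. b >= N ==> md u b v = 0" using bdd_md[of u v] unfolding bdd_def by blast
  then show ?thesis by (intro bddI[of N]) (simp add: flin_zero[OF flin_act2(1)])
 qed
 have e: "m + n + k = n + m + k" by simp
 have J: "cv (bp m) (%c. md (md u c v) (m + n + k - c) w) k
  = cv (bn k) (%b. md u (m + n + k - b) (md v b w)) n
  - sc (sg k) (cv (bn k) (%b. md v (m + n + k - b) (md u b w)) m)"
  using Jac_VL[OF W_VV[OF u] W_VV[OF v], of w, unfolded Jac_def LL_def RR_def, rule_format, of m n k] unfolding e .
 show ?thesis
  unfolding act_act[OF u v w] act_act[OF v u w] cv_add[OF bdd_RR bdd_add[OF cv_act2_arg cv_act2_fun]]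
  unfolding act_def cv_add[OF bdd_LL b] J act2_Jacobi[OF u v pr_VV] sc_add by simp
qed

lemma weak_module_Jacobi:
 assumes u: "u \<in> W" and v: "v \<in> W" and w: "w \<in> M"
 shows "Sum_any (%i :: nat. sc (of_int m gchoose i) (act (md u (k + int i) v) (m + n - int i) w))
    = Sum_any (%i :: nat. sc ((- 1) ^ i * (of_int k gchoose i))
      (act u (m + k - int i) (act v (n + int i) w)
       - sc ((- 1) powi k) (act v (n + k - int i) (act u (m + int i) w))))"
proof -
 have b: "bdd (%b. act u (d - b) (act v b w))" for d u v
 proof -
  obtain N where "!!b. b >= N ==> act v b w = 0" using bdd_act[of v w] unfolding bdd_def by blast
  then show ?thesis by (intro bddI[of N]) (simp add: flin_zero[OF flin_act(2)])
 qed
 have "Sum_any (%i :: nat. sc ((- 1) ^ i * (of_int k gchoose i))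
      (act u (m + k - int i) (act v (n + int i) w)
       - sc ((- 1) powi k) (act v (n + k - int i) (act u (m + int i) w))))
  = cv (bn k) (%b. act u (m + n + k - b) (act v b w)) n
  - sc (sg k) (cv (bn k) (%b. act v (m + n + k - b) (act u b w)) m)"
 proof -
  have 1: "act u (m + k - int i) x = act u (m + n + k - (n + int i)) x"
   and 2: "sc ((- 1) ^ i * (of_int k gchoose i)) (sc (sg k) (act v (n + k - int i) x))
   = sc (sg k) (sc ((- 1) ^ i * (of_int k gchoose i)) (act v (m + n + k - (m + int i)) x))" for i x
   by (simp_all add: algebra_simps)
  show ?thesis
   unfolding cv_def bn_nth sg_def[symmetric] sc_diff 1 2
   by (subst Sum_any_diff[OF bdd_cv_evz[OF b] evz_fscale[OF bdd_cv_evz[OF b]]], subst Sum_any_fscale[OF bdd_cv_evz[OF b]]) (rule refl)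
 qed
 moreover have "(%i. sc (of_int m gchoose i) (act (md u (k + int i) v) (m + n - int i) w))
  = (%i. sc (of_int m gchoose i) (act (md u (k + int i) v) (m + n + k - (k + int i)) w))"
  by (simp add: algebra_simps)
 ultimately show ?thesis using act_Jacobi[OF u v w, of m n k] by (simp only: cv_def[of "bp m"] bp_nth)
qed

lemma act_one: "act 1 n w = (if n = -1 then w else 0)"
 by (simp add: act_def md_one act2_def md_right_one md_lin)

text \<open>The current e has weight one, so e_1 \<omega> = e and e_j \<omega> = 0 for j > 1. With
  \<open>lc 1 = 1\<close> the correction is the zeroth mode of e.\<close>

lemma act_conf: "act om 1 w = L 0 w + Qt (pr w)"
proof -
 have z: "md ee (int j) om = (if j = 1 then ee else 0)" if "j >= 1" for j
 proof -
  have "1 \<in> PP" using VV_0_PP[OF one_VV] .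
  then have "L (-2) (md ee (int j) 1) = md ee (int j) (L (-2) 1) + sc (- of_int (int j)) (md ee (-2 + int j) 1)"
   using primary_commutator[OF screening_primary(2) Jac_scr(2)[OF screening_VV(2) conf_VV] Jac_one(2)[OF screening_VV(2)], of 1 "-2" "int j"] by simp
  then have "md ee (int j) om = sc (of_nat j) (md ee (int j - 2) 1)"
   by (simp add: md_right_one L_lin conf_eq eq_neg_iff_add_eq_0)
  then show ?thesis using that by (auto simp: md_right_one)
 qed
 have "act2 om 1 x = (\<Sum>j<2. sc (lc j) (md (md ee (int j) om) (1 - int j) x))" for x
  by (rule act2_finite) (simp add: z)
 moreover have "{..<2::nat} = {0, 1}" by auto
 ultimately show ?thesis by (simp add: act_def lc_def z[of 1, simplified] L_def Qt_def)
qed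

lemma supp_M: "M = supp {b. tp dvd snd b - int p \<or> tp dvd snd b - (int p - 2)}"
 by (simp add: M_def chs_def)

abbreviation "gws \<equiv> gen_weight_space (triplet p) sc M act"

lemma gws_eq: "gws h = {w \<in> M. \<exists>k. ((%w'. act om 1 w' - sc h w') ^^ k) w = 0}"
 by (simp add: gen_weight_space_def triplet_simps)

lemma L0_single: "L 0 (single b 1) = sc (ev b) (single b 1)"
 by (subst L0_eigen_iff) (rule supp_single, simp)

text \<open>The nilpotent part of the new L(0) maps the first summand to the second and kills the
  second, and it commutes with the old L(0); two applications suffice.\<close>

lemma single_gws: assumes "single b 1 \<in> M" shows "single b 1 \<in> gws (ev b)"
proof -
 let ?w = "single b (1::complex)"
 let ?A = "%w'. act om 1 w' - sc (ev b) w'"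
 have 1: "?A ?w = Qt (pr ?w)" by (simp only: act_conf L0_single) simp
 have 2: "L 0 (Qt (pr ?w)) = sc (ev b) (Qt (pr ?w))"
 proof -
  have "L 0 (pr ?w) = sc (ev b) (pr ?w)"
   by (auto simp: L0_eigen_iff pr_def intro: res_supp' supp_single)
  then show ?thesis by (simp add: L_Qt VV_p_PP[OF pr_VV] Qt_lin)
 qed
 have "Qt (pr ?w) \<in> VV (int p - 2)"
  unfolding Qt_def using md_VV[OF screening_VV(2) pr_VV[of ?w], of 0] by simp
 then have "pr (Qt (pr ?w)) = 0" by (rule pr_0)
 then have "?A (?A ?w) = 0" unfolding 1 by (simp add: act_conf 2 Qt_lin)
 then have "(?A ^^ 2) ?w = 0" by (simp add: numeral_2_eq_2)
 with assms show ?thesis unfolding gws_eq by blast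
qed

text \<open>The charges p + 2pa and p - 2 + 2pa have weights exceeding \<open>hh (int p)\<close> by
  a(pa + 1) and a(pa - 1), and both products are nonnegative for every integer a.\<close>

lemma ev_M: assumes "b \<in> {b. tp dvd snd b - int p \<or> tp dvd snd b - (int p - 2)}"
 shows "\<exists>n :: nat. ev b = hh (int p) + of_nat n"
proof -
 have p4: "(of_nat (4 * p) :: complex) ~= 0" using p2 by simp
 have "EX a>=0. hh (snd b) = hh (int p) + of_int a"
 proof -
  from assms consider a where "snd b = int p + tp * a" | a where "snd b = int p - 2 + tp * a"
   by (auto simp only: mem_Collect_eq elim!: dvdE) (metis add_diff_cancel_left' diff_add_cancel add.commute)+
  then show ?thesis
  proof cases
   case (1 a)
   have "snd b * (snd b - 2 * int p + 2) = int p * (int p - 2 * int p + 2) + int (4 * p) * (a * (int p * a + 1))"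
    unfolding 1 by (simp add: algebra_simps)
   then have "hh (snd b) = hh (int p) + of_int (a * (int p * a + 1))"
    unfolding hh_def using p4 by (simp only: of_int_add of_int_mult[of "int (4 * p)"] of_int_of_nat_eq add_divide_distrib) simp
   moreover have "a * (int p * a + 1) >= 0"
   proof (cases "a >= 0")
    case False
    then have "int p * (-a) >= 1 * 1" using p2 by (intro mult_mono) auto
    then show ?thesis using False by (intro mult_nonpos_nonpos) auto
   qed simp
   ultimately show ?thesis by blast
  next
   case (2 a)
   have "snd b * (snd b - 2 * int p + 2) = int p * (int p - 2 * int p + 2) + int (4 * p) * (a * (int p * a - 1))"
    unfolding 2 by (simp add: algebra_simps)
   then have "hh (snd b) = hh (int p) + of_int (a * (int p * a - 1))"
    unfolding hh_def using p4 by (simp only: of_int_add of_int_mult[of "int (4 * p)"] of_int_of_nat_eq add_divide_distrib) simp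
   moreover have "a * (int p * a - 1) >= 0"
   proof (cases "a > 0")
    case True
    then have "int p * a >= 1 * 1" using p2 by (intro mult_mono) auto
    then show ?thesis using True by (intro mult_nonneg_nonneg) auto
   next
    case False
    then have "int p * a \<le> 0" by (simp add: mult_nonneg_nonpos)
    then show ?thesis using False by (intro mult_nonpos_nonpos) auto
   qed
   ultimately show ?thesis by blast
  qed
 qed
 then obtain a where a: "a >= 0" "hh (snd b) = hh (int p) + of_int a" by blast
 have "ev b = hh (int p) + of_nat (nat (a + lev (fst b)))"
  using a lev_nonneg[of "fst b"] by (simp add: ev_def)
 then show ?thesis by blast
qed

text \<open>An eigenvector of the new L(0) projects under \<open>pr\<close> to an eigenvector of the
  old one with the same eigenvalue; if that projection is 0, the vector itself is an eigenvector of
  the old L(0). So no new eigenvalues arise.\<close>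

lemma gws_eigenvalue:
 assumes "gws h ~= {0}"
 shows "\<exists>b \<in> {b. tp dvd snd b - int p \<or> tp dvd snd b - (int p - 2)}. h = ev b"
proof (rule ccontr)
 assume n: "\<not> ?thesis"
 let ?A = "%w'. act om 1 w' - sc h w'"
 have inj0: "w = 0" if w: "w \<in> M" "L 0 w = sc h w" for w
 proof (rule fock_eq_0I)
  fix b show "b \<notin> keys w"
   using that n unfolding L0_eigen_iff supp_M supp_def by blast
 qed
 have inj: "w = 0" if w: "w \<in> M" "?A w = 0" for w
 proof -
  have "L 0 (pr w) = pr (act om 1 w)" using pr_act[OF conf_W w(1), of 1] by (simp add: L_def)
  also have "... = sc h (pr w)" using w(2) by (simp add: flin_scale[OF flin_pr])
  finally have "L 0 (pr w) = sc h (pr w)" .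
  moreover have "pr w \<in> M" using w(1) unfolding M_decomp using pr_VV VV_closed(3) by (metis add.right_neutral)
  ultimately have "pr w = 0" using inj0 by blast
  then have "L 0 w = sc h w" using w(2) by (simp add: act_conf Qt_lin)
  then show "w = 0" using inj0 w(1) by blast
 qed
 have "w = 0" if "w \<in> M" "(?A ^^ k) w = 0" for w k
  using that
 proof (induction k arbitrary: w)
  case (Suc k)
  have "?A w \<in> M" using Suc.prems(1) act_M[OF conf_W] M_closed(1,2)[of _ "- _"]
   by (metis M_closed(1,2) diff_conv_add_uminus fock.scale_minus_left)
  moreover have "(?A ^^ k) (?A w) = 0" using Suc.prems(2) unfolding funpow_Suc_right by simp
  ultimately have "?A w = 0" by (rule Suc.IH)
  then show ?case by (rule inj[OF Suc.prems(1)])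
 qed simp
 moreover have "0 \<in> gws h" unfolding gws_eq using M_closed(3) by (auto intro!: exI[of _ 0])
 ultimately have "gws h = {0}" unfolding gws_eq by blast
 with assms show False by blast
qed

lemma M_subspace: "fock.subspace M"
 unfolding fock.subspace_def using M_closed by blast

lemma weak_module_M: "weak_module (triplet p) sc M act"
 unfolding weak_module_def triplet_simps
proof (intro conjI)
 show "\<forall>u\<in>W. \<forall>w\<in>M. \<exists>N. ALL n>=N. act u n w = 0"
  using bdd_act unfolding bdd_def by blast
 show "\<forall>u\<in>W. \<forall>v\<in>W. \<forall>w\<in>M. \<forall>k m n.
  Sum_any (%i :: nat. sc (of_int m gchoose i) (act (md u (k + int i) v) (m + n - int i) w))
    = Sum_any (%i :: nat. sc ((- 1) ^ i * (of_int k gchoose i))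
      (act u (m + k - int i) (act v (n + int i) w)
       - sc ((- 1) powi k) (act v (n + k - int i) (act u (m + int i) w))))"
  using weak_module_Jacobi by blast
qed (auto simp: vector_space_fscale M_subspace act_M act_one flin_add[OF flin_act(1)] flin_add[OF flin_act(2)]
 flin_scale[OF flin_act(1)] flin_scale[OF flin_act(2)])

lemma lat_exp_p_M: "xp (int p) \<in> M"
 unfolding M_def by (rule chs_mono[OF _ lat_exp_chs]) simp

lemma Qt_exp_p: "Qt (xp (int p)) = xp (int p - 2)"
proof -
 have e: "-2 * int p = tp * -1" by simp
 show ?thesis unfolding Qt_def md_lat_exp ek_lat_exp[OF e] by (simp add: crez_def)
qed

lemma pr_exp_p: "pr (xp (int p)) = xp (int p)" "pr (xp (int p - 2)) = 0"
 using pr_id[OF lat_exp_VV[of "int p" "int p"]] pr_0[OF lat_exp_VV[of "int p - 2" "int p - 2"]] by simp_all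

lemma lat_exp_inj: "xp k = xp l \<longleftrightarrow> k = l" "xp k ~= 0"
proof -
 show "xp k = xp l \<longleftrightarrow> k = l"
  using arg_cong[of "xp k" "xp l" "%x. lookup x ({#}, k)"]
  unfolding lat_exp_def lookup_single when_def by (metis prod.inject zero_neq_one)
 show "xp k ~= 0"
  unfolding lat_exp_def by (metis lookup_single_eq lookup_zero zero_neq_one)
qed

theorem logarithmic_M: "logarithmic_module (triplet p) sc M act"
 unfolding logarithmic_module_def triplet_simps
proof (intro conjI)
 show "weak_module (triplet p) sc M act" by (rule weak_module_M)
 show "M = fock.span (\<Union>h. gws h)"
 proof
  show "M \<subseteq> fock.span (\<Union>h. gws h)"
  proof
   fix w assume w: "w \<in> M"
   show "w \<in> fock.span (\<Union>h. gws h)"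
   proof (subst fock_expand, rule fock.span_sum, rule fock.span_scale, rule fock.span_base)
    fix b assume "b \<in> keys w"
    with w have "single b 1 \<in> M" unfolding supp_M supp_def by auto
    then show "single b 1 \<in> (\<Union>h. gws h)" using single_gws by blast
   qed
  qed
  show "fock.span (\<Union>h. gws h) \<subseteq> M"
   by (rule fock.span_minimal[OF _ M_subspace]) (auto simp: gws_eq)
 qed
 have "xp (int p) \<in> gws (ev ({#}, int p))"
  using single_gws[of "({#}, int p)"] lat_exp_p_M by (simp add: lat_exp_def)
 moreover have "act om 1 (xp (int p)) = sc (ev ({#}, int p)) (xp (int p)) + xp (int p - 2)"
  by (simp add: act_conf pr_exp_p Qt_exp_p L0_lat_exp ev_def)
 ultimately show "\<exists>h. \<exists>w\<in>gws h. act om 1 w ~= sc h w"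
  using lat_exp_inj(2)[of "int p - 2"] by (metis add_cancel_left_right)
qed

lemma hw_eq: "hw p (p - 1) = hh (int p)"
 using p2 by (simp add: hw_def hh_def of_nat_diff field_simps)

theorem lowest_M: "lowest_gen_weight (triplet p) sc M act (hw p (p - 1))"
 unfolding lowest_gen_weight_def hw_eq
proof (intro conjI allI impI)
 have "xp (int p) \<in> gws (hh (int p))"
  using single_gws[of "({#}, int p)"] lat_exp_p_M by (simp add: lat_exp_def ev_def)
 then show "gws (hh (int p)) ~= {0}" using lat_exp_inj(2) by blast
 fix h' assume "gws h' ~= {0}"
 from gws_eigenvalue[OF this] ev_M show "\<exists>n :: nat. h' = hh (int p) + of_nat n" by blast
qed

end

section \<open>Zhu's algebra\<close>

lemma Sum_any_triple:
 fixes t :: "nat => nat => nat => 'a::comm_monoid_add"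
 assumes "!!i j k. i >= K \<or> j >= K \<or> k >= K ==> t i j k = 0"
 shows "Sum_any (%i. Sum_any (%j. Sum_any (%k. t i j k))) = (\<Sum>i<K. \<Sum>j<K. \<Sum>k<K. t i j k)"
proof -
 have "Sum_any (%k. t i j k) = (\<Sum>k<K. t i j k)" for i j
  by (rule Sum_any_nat) (simp add: assms)
 moreover have "Sum_any (%j. \<Sum>k<K. t i j k) = (\<Sum>j<K. \<Sum>k<K. t i j k)" for i
  by (rule Sum_any_nat) (simp add: assms)
 moreover have "Sum_any (%i. \<Sum>j<K. \<Sum>k<K. t i j k) = (\<Sum>i<K. \<Sum>j<K. \<Sum>k<K. t i j k)"
  by (rule Sum_any_nat) (simp add: assms)
 ultimately show ?thesis by simp
qed

lemma gbinomial_1_eq_0: "i >= 2 ==> (1 :: complex) gchoose i = 0"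
 using binomial_gbinomial[of 1 i, where 'a = complex] by (simp add: binomial_eq_0)

context rank_one begin

text \<open>The residue of \<open>Y(a, x) (1+x)\<^sup>w x\<^sup>n b\<close>.\<close>

definition X :: "int => fock => int => fock => fock" where
 "X w a n b = cv (bp w) (%c. md a c b) n"

lemma flin_X: "flin (%a. X w a n b)" "flin (X w a n)"
 unfolding X_def by (intro flin_cv flin_md1 flin_md2 bdd_md)+

lemmas X_lin = flin_add[OF flin_X(1)] flin_scale[OF flin_X(1)] flin_zero[OF flin_X(1)] flin_diff[OF flin_X(1)]
 flin_add[OF flin_X(2)] flin_scale[OF flin_X(2)] flin_zero[OF flin_X(2)] flin_diff[OF flin_X(2)]

lemma X_W [intro]: "a \<in> W ==> b \<in> W ==> X w a n b \<in> W"
 unfolding X_def by auto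

lemma X_Suc: "X (w + 1) a n b = X w a n b + X w a (n + 1) b"
proof -
 have "X (w + 1) a n b = cv (bp 1) (cv (bp w) (%c. md a c b)) n"
  unfolding X_def cv_mult[OF bdd_md] bp_add[symmetric] by (simp add: add.commute)
 also have "... = (\<Sum>s<2. sc (of_int 1 gchoose s) (cv (bp w) (%c. md a c b) (n + int s)))"
  unfolding cv_def[of "bp 1"] bp_nth by (rule Sum_any_nat) (simp add: gbinomial_1_eq_0)
 finally show ?thesis by (simp add: X_def numeral_2_eq_2)
qed

lemma zhu_residue_eq: "zhu_residue (triplet p) r n a b = X n a (- int r) b"
 by (simp add: zhu_residue_def triplet_simps X_def cv_def)

definition WS :: "int => fock set" where "WS n = {a \<in> W. L 0 a = sc (of_int n) a}"

lemma weight_space_eq: "weight_space (triplet p) n = WS n"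
 by (simp add: weight_space_def triplet_simps WS_def L_def)

lemma WS_W: "a \<in> WS n ==> a \<in> W" and WS_L0: "a \<in> WS n ==> L 0 a = sc (of_int n) a"
 by (auto simp: WS_def)

lemma WS_closed [intro]: "u \<in> WS n ==> v \<in> WS n ==> u + v \<in> WS n" "u \<in> WS n ==> sc c u \<in> WS n" "0 \<in> WS n"
 by (auto simp: WS_def L_lin sc_add mult.commute)

lemma W_hg_WS: "a \<in> W \<inter> hg k n ==> a \<in> WS n"
 by (auto simp: WS_def L0_hg)

lemma L0_md:
 assumes "Jac om x w" "Jac x 1 w" "L 0 x = sc a x" "L 0 w = sc b w"
 shows "L 0 (md x r w) = sc (a + b - of_int r - 1) (md x r w)"
proof -
 have "Sum_any (%i. sc (of_int 1 gchoose i) (md (md om (int i) x) (1 + r - int i) w))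
  = (\<Sum>i<2. sc (of_int 1 gchoose i) (md (md om (int i) x) (1 + r - int i) w))"
  by (rule Sum_any_nat) (simp add: gbinomial_1_eq_0)
 also have "... = md (T x) (1 + r) w + md (L 0 x) r w"
  by (simp add: numeral_2_eq_2 md_conf L_minus_one[symmetric])
 finally have "L 0 (md x r w) = md x r (L 0 w) + (md (T x) (1 + r) w + md (L 0 x) r w)"
  using Jac_commutator[OF assms(1), of 1 r] by (simp add: L_def algebra_simps)
 then have "L 0 (md x r w) = sc (b + (- of_int (1 + r) + a)) (md x r w)"
  unfolding assms(3,4) md_lin md_T[OF assms(2)] sc_add_left by simp
 then show ?thesis by (simp add: algebra_simps)
qed

lemma md_WS: assumes "a \<in> WS m" "b \<in> WS n" shows "md a r b \<in> WS (m + n - r - 1)"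
 using L0_md[OF Jac_VL[OF conf_VV W_VV[OF WS_W[OF assms(1)]]] Jac_one(1)[OF W_VV[OF WS_W[OF assms(1)]]] WS_L0[OF assms(1)] WS_L0[OF assms(2)], of r] assms
 by (auto simp: WS_def)

lemma T_WS: "a \<in> WS n ==> T a \<in> WS (n + 1)"
proof -
 have "1 \<in> WS 0" using one_hg one_W W_hg_WS by blast
 then show "a \<in> WS n ==> T a \<in> WS (n + 1)" unfolding T_def using md_WS[of a n 1 0 "-2"] by (simp add: add.commute)
qed

lemma W_induct [consumes 1, case_names hom add]:
 assumes "a \<in> W" "!!n a k. a \<in> W \<inter> hg k n ==> P a" "!!a b. a \<in> W ==> b \<in> W ==> P a ==> P b ==> P (a + b)"
 shows "P a"
proof -
 obtain A and f :: "int \<times> int => fock" where A: "finite A" "a = sum f A" and f: "!!k n. f (k, n) \<in> W \<inter> hg k n"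
  by (rule W_decomp[OF assms(1)]) (rule that)
 have f': "f x \<in> W" "P (f x)" for x using f[of "fst x" "snd x"] assms(2) by auto
 have z: "P 0" using assms(2)[of 0 0 0] by (auto intro: hg_closed)
 have "sum f B \<in> W \<and> P (sum f B)" if "finite B" for B
  using that by (induction B rule: finite_induct) (auto simp: z f' assms(3))
 then show ?thesis using A by blast
qed

text \<open>A concrete projection to an L(0)-eigenspace; \<open>hom_comp_eq\<close> identifies it
  with the family that \<open>hom_comp\<close> describes by \<open>THE\<close>.\<close>

definition hc :: "int => fock => fock" where "hc n = res {b. ev b = of_int n}"

lemma flin_hc: "flin (hc n)" unfolding hc_def by (rule flin_res)

lemma hc_hom: "a \<in> WS n ==> hc m a = (if m = n then a else 0)"
proof -
 assume "a \<in> WS n"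
 then have a: "a \<in> supp {b. ev b = of_int n}" by (simp add: WS_def L0_eigen_iff)
 show ?thesis
 proof (cases "m = n")
  case True then show ?thesis using res_id[OF a] by (simp add: hc_def)
 next
  case False
  then have "{b. ev b = of_int n} \<inter> {b. ev b = of_int m} = {}" by auto
  with False show ?thesis using res_disj[OF a] by (simp add: hc_def)
 qed
qed

lemma hc_props:
 assumes "a \<in> W"
 shows "(\<forall>n. hc n a \<in> WS n) \<and> finite {n. hc n a ~= 0} \<and> Sum_any (%n. hc n a) = a"
 using assms
proof (induction a rule: W_induct)
 case (hom n a k)
 have n: "a \<in> WS n" using W_hg_WS hom .
 show ?case
 proof (intro conjI allI)
  show "hc m a \<in> WS m" for m unfolding hc_hom[OF n] using n WS_closed(3) by simp
  show "finite {m. hc m a ~= 0}" by (rule finite_subset[of _ "{n}"]) (auto simp: hc_hom[OF n])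
  show "Sum_any (%m. hc m a) = a" unfolding hc_hom[OF n] by simp
 qed
next
 case (add a b)
 have "{n. hc n a + hc n b ~= 0} \<subseteq> {n. hc n a ~= 0} \<union> {n. hc n b ~= 0}" by auto
 moreover have "finite ({n. hc n a ~= 0} \<union> {n. hc n b ~= 0})" using add.IH by (intro finite_UnI) blast+
 ultimately have "finite {n. hc n a + hc n b ~= 0}" by (rule finite_subset)
 moreover have "\<forall>n. hc n a + hc n b \<in> WS n" using add WS_closed(1) by blast
 moreover have "Sum_any (%n. hc n a + hc n b) = a + b"
 proof -
  have "Sum_any (%n. hc n a + hc n b) = Sum_any (%n. hc n a) + Sum_any (%n. hc n b)"
   by (rule Sum_any.distrib) (use add.IH in blast)+
  then show ?thesis using add.IH by (simp only:)
 qed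
 ultimately show ?case unfolding flin_add[OF flin_hc] by (intro conjI)
qed

lemma hom_comp_eq: assumes "a \<in> W" shows "hom_comp (triplet p) a = (%n. hc n a)"
 unfolding hom_comp_def weight_space_eq
proof (rule the_equality)
 show "(\<forall>n. hc n a \<in> WS n) \<and> finite {n. hc n a ~= 0} \<and> Sum_any (%n. hc n a) = a" using hc_props[OF assms] .
 fix f assume f: "(\<forall>n. f n \<in> WS n) \<and> finite {n. f n ~= 0} \<and> Sum_any f = a"
 show "f = (%n. hc n a)"
 proof
  fix m
  have "hc m a = hc m (\<Sum>n | f n ~= 0. f n)" using f by (metis Sum_any.expand_set)
  also have "... = (\<Sum>n | f n ~= 0. if m = n then f n else 0)"
   unfolding flin_sum[OF flin_hc] using f by (intro sum.cong) (auto simp: hc_hom)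
  also have "... = f m" using f by simp
  finally show "f m = hc m a" ..
 qed
qed

text \<open>The bilinear extension of \<open>X w a (-r) b\<close>, \<open>w\<close> the weight of \<open>a\<close>.\<close>

definition zb :: "int => fock => fock => fock" where
 "zb r a b = Sum_any (%n. X n (hc n a) (- r) b)"

abbreviation star (infixl "**" 70) where "a ** b \<equiv> zb 1 a b"

lemma zhu_star_eq: "a \<in> W ==> zhu_star (triplet p) a b = a ** b"
 by (simp add: zhu_star_def hom_comp_eq zhu_residue_eq zb_def)

lemma zb_hom: "a \<in> WS n ==> zb r a b = X n a (- r) b"
proof -
 assume a: "a \<in> WS n"
 have e: "X m (hc m a) (- r) b = (if m = n then X n a (- r) b else 0)" for m
  by (simp add: hc_hom[OF a] X_lin)
 show ?thesis unfolding zb_def e by simp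
qed

lemma finite_zb: "a \<in> W ==> finite {n. X n (hc n a) m b ~= 0}"
 by (rule finite_subset[of _ "{n. hc n a ~= 0}"]) (auto simp: hc_props X_lin)

lemma zb_add: "a \<in> W ==> a' \<in> W ==> zb r (a + a') b = zb r a b + zb r a' b"
 by (simp add: zb_def flin_add[OF flin_hc] X_lin Sum_any.distrib[OF finite_zb finite_zb])

lemma zb_scale: "a \<in> W ==> zb r (sc c a) b = sc c (zb r a b)"
proof (induction a rule: W_induct)
 case (hom n a k)
 then have "a \<in> WS n" "sc c a \<in> WS n" using W_hg_WS by auto
 then show ?case by (simp add: zb_hom X_lin)
next
 case (add a a')
 then show ?case by (simp add: zb_add W_scale sc_add)
qed

lemma zb_W [intro]: "a \<in> W ==> b \<in> W ==> zb r a b \<in> W"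
 unfolding zb_def using hc_props WS_W by (intro W_Sum_any X_W) blast+

lemma zb_add2: "a \<in> W ==> zb r a (b + b') = zb r a b + zb r a b'"
 by (simp add: zb_def X_lin Sum_any.distrib[OF finite_zb finite_zb])

lemma zb_scale2: "a \<in> W ==> zb r a (sc c b) = sc c (zb r a b)"
proof (induction a rule: W_induct)
 case (hom n a k)
 then have "a \<in> WS n" using W_hg_WS by auto
 then show ?case by (simp add: zb_hom X_lin)
qed (simp add: zb_add sc_add)

lemma zb_0: "zb r 0 b = 0" "a \<in> W ==> zb r a 0 = 0"
 using zb_scale[of 0 r 0 b] zb_scale2[of a r 0 0] by simp_all

lemma zb_sum: "(!!i. i \<in> A ==> f i \<in> W) ==> zb r (sum f A) b = (\<Sum>i\<in>A. zb r (f i) b)"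
 by (induction A rule: infinite_finite_induct) (auto simp: zb_0 zb_add W_sum)

definition ZO :: "fock set" where "ZO = zhu_O (triplet p)"

lemma ZO_span: "ZO = fock.span {X n a (-2) b | n a b. a \<in> WS n \<and> b \<in> W}"
 by (simp add: ZO_def zhu_O_def triplet_simps zhu_residue_eq weight_space_eq)

lemma ZO_add [intro]: "x \<in> ZO ==> y \<in> ZO ==> x + y \<in> ZO"
 and ZO_scale [intro]: "x \<in> ZO ==> sc c x \<in> ZO"
 and ZO_diff [intro]: "x \<in> ZO ==> y \<in> ZO ==> x - y \<in> ZO"
 and ZO_uminus [intro]: "x \<in> ZO ==> - x \<in> ZO"
 and ZO_0 [intro, simp]: "0 \<in> ZO"
 unfolding ZO_span by (auto intro: fock.span_add fock.span_scale fock.span_diff fock.span_neg fock.span_zero)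

lemma ZO_sum [intro]: "(!!i. i \<in> A ==> f i \<in> ZO) ==> sum f A \<in> ZO"
 by (induction A rule: infinite_finite_induct) auto

lemma ZO_Sum_any [intro]: "(!!i. f i \<in> ZO) ==> Sum_any f \<in> ZO"
 unfolding Sum_any.expand_set by auto

lemma ZO_W: "ZO \<subseteq> W"
 unfolding ZO_span by (rule fock.span_minimal) (auto simp: fock.subspace_def dest: WS_W)

text \<open>Integration by parts: the derivative is moved to (1 + x)^(w+1) x^(-r), and
  \<open>X_Suc\<close> brings the result back to the exponent w.\<close>

lemma X_T:
 assumes "a \<in> W"
 shows "X (w + 1) (T a) (- r) b = sc (of_int r) (X w a (- r - 1) b) + sc (of_int (r - w - 1)) (X w a (- r) b)"
proof -
 have "X (w + 1) (T a) (- r) b = Sum_any (%i. sc ((of_int (w + 1) gchoose i) * (of_int r - of_nat i)) (md a (- r - 1 + int i) b))"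
  unfolding X_def cv_def md_T[OF Jac_one(1)[OF W_VV[OF assms]]] bp_nth
  by (intro Sum_any.cong) (simp add: algebra_simps)
 also have "... = Sum_any (%i. sc (of_int r) (sc (of_int (w + 1) gchoose i) (md a (- r - 1 + int i) b))
   - sc (of_nat i * (of_int (w + 1) gchoose i)) (md a (- r - 1 + int i) b))"
  by (intro Sum_any.cong) (simp add: sc_diff_left algebra_simps)
 also have "... = sc (of_int r) (X (w + 1) a (- r - 1) b)
   - Sum_any (%i. sc (of_nat i * (of_int (w + 1) gchoose i)) (md a (- r - 1 + int i) b))"
  by (subst Sum_any_diff[OF evz_fscale[OF bdd_cv_evz[OF bdd_md]] bdd_cv_evz[OF bdd_md]],
    subst Sum_any_fscale[OF bdd_cv_evz[OF bdd_md]]) (simp add: X_def cv_def)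
 also have "Sum_any (%i. sc (of_nat i * (of_int (w + 1) gchoose i)) (md a (- r - 1 + int i) b))
  = Sum_any (%i. sc (of_nat (i + 1) * (of_int (w + 1) gchoose (i + 1))) (md a (- r - 1 + int (i + 1)) b))"
  by (rule Sum_any_shift) simp
 also have "... = Sum_any (%i. sc (of_int (w + 1)) (sc (of_int w gchoose i) (md a (- r + int i) b)))"
 proof (rule Sum_any.cong)
  fix i
  have "(of_nat (i + 1) * (of_int (w + 1) gchoose (i + 1)) :: complex) = of_int (w + 1) * (of_int w gchoose i)"
   using Suc_times_gbinomial[of i "of_int w :: complex"] by (simp add: add.commute)
  then show "sc (of_nat (i + 1) * (of_int (w + 1) gchoose (i + 1))) (md a (- r - 1 + int (i + 1)) b)
   = sc (of_int (w + 1)) (sc (of_int w gchoose i) (md a (- r + int i) b))"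
   by (simp only: sc_sc) (simp add: algebra_simps)
 qed
 also have "... = sc (of_int (w + 1)) (X w a (- r) b)"
  by (subst Sum_any_fscale[OF bdd_cv_evz[OF bdd_md]]) (simp add: X_def cv_def)
 finally show ?thesis
  unfolding X_Suc by (simp add: sc_add sc_diff_left sc_add_left algebra_simps)
qed

text \<open>Since T a has weight w + 1, \<open>X_T\<close> expresses pole order r + 1 for a through
  pole order r for T a and for a. The induction starts at the defining order 2.\<close>

lemma X_ZO: assumes "a \<in> WS w" "b \<in> W" "r >= 2" shows "X w a (- r) b \<in> ZO"
proof -
 have "X w a (- int (k + 2)) b \<in> ZO" if "a \<in> WS w" for k w a
  using that
 proof (induction k arbitrary: w a)
  case 0
  then show ?case unfolding ZO_span using assms(2) by (intro fock.span_base) auto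
 next
  case (Suc k)
  have "sc (of_int (int (k + 2))) (X w a (- int (k + 2) - 1) b)
   = X (w + 1) (T a) (- int (k + 2)) b - sc (of_int (int (k + 2) - w - 1)) (X w a (- int (k + 2)) b)"
   using X_T[OF WS_W[OF Suc.prems], of w "int (k + 2)" b] by simp
  also have "... \<in> ZO"
   by (intro ZO_diff ZO_scale) (rule Suc.IH[OF T_WS[OF Suc.prems]], rule Suc.IH[OF Suc.prems])
  finally have "sc (1 / of_int (int (k + 2))) (sc (of_int (int (k + 2))) (X w a (- int (k + 2) - 1) b)) \<in> ZO" by blast
  moreover have "(of_int (int (k + 2)) :: complex) ~= 0" unfolding of_int_of_nat_eq of_nat_eq_0_iff by simp
  ultimately have "X w a (- int (k + 2) - 1) b \<in> ZO" by simp
  then show ?case by (simp add: algebra_simps)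
 qed
 from this[OF assms(1), of "nat (r - 2)"] assms(3) show ?thesis by simp
qed

lemma zhu_iterate_left:
 fixes wa w' n m :: int and a b c :: fock
 shows "\<exists>K0. ALL K>=K0. (\<Sum>N<K. \<Sum>M<K. sc ((of_int w' gchoose N) * (of_int wa gchoose M)) (LL a b c (int M) (n + int N) m))
  = Sum_any (%i. sc (of_int wa gchoose i) (X (wa + w' - int i) (md a (m + int i) b) n c))"
proof -
 define Y where "Y s d = md (md a (m + int s) b) d c" for s :: nat and d
 have bY: "bdd (Y s)" for s unfolding Y_def by (rule bdd_md)
 define t where "t N M s = sc ((of_int w' gchoose N) * (of_int wa gchoose M) * (of_int (int M) gchoose s)) (Y s (int M + (n + int N) - int s))" for N M s :: nat
 obtain B0 where B0: "!!j. j >= B0 ==> md a j b = 0" using bdd_md[of a b] unfolding bdd_def by blast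
 obtain B where B: "!!s d. d >= B s ==> Y s d = 0" using bY unfolding bdd_def by metis
 define K0 where "K0 = nat (\<bar>B0 - m\<bar> + \<bar>n\<bar> + (\<Sum>s<nat (B0 - m). \<bar>B s\<bar>) + \<bar>B0 - m\<bar>)"
 have K0: "t N M s = 0" if "N >= K0 \<or> M >= K0 \<or> s >= K0" for N M s
 proof (cases "int s >= B0 - m")
  case True
  then show ?thesis by (simp add: t_def Y_def B0 md_lin)
 next
  case False
  then have s: "s < nat (B0 - m)" by simp
  have "B s \<le> (\<Sum>s<nat (B0 - m). \<bar>B s\<bar>)"
   using s member_le_sum[of s "{..<nat (B0 - m)}" "%s. \<bar>B s\<bar>"] by auto
  then have "int M + (n + int N) - int s >= B s" using that False unfolding K0_def by linarith
  then show ?thesis by (simp add: t_def B)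
 qed
 show ?thesis
 proof (intro exI[of _ K0] allI impI)
 fix K assume "K >= K0"
 then have K: "t N M s = 0" if "N >= K \<or> M >= K \<or> s >= K" for N M s
  using K0[of N M s] that by (meson order_trans)
 have 1: "sc ((of_int w' gchoose N) * (of_int wa gchoose M)) (LL a b c (int M) (n + int N) m) = Sum_any (t N M)" for N M
  unfolding LL_def cv_def bp_nth
  by (subst Sum_any_fscale[symmetric, OF bdd_cv_evz[OF bdd_LL]]) (simp add: t_def Y_def algebra_simps)
 have "(\<Sum>N<K. \<Sum>M<K. sc ((of_int w' gchoose N) * (of_int wa gchoose M)) (LL a b c (int M) (n + int N) m))
  = (\<Sum>N<K. \<Sum>M<K. \<Sum>s<K. t N M s)" unfolding 1 by (intro sum.cong refl Sum_any_nat) (simp add: K)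
 also have "... = (\<Sum>s<K. \<Sum>M<K. \<Sum>N<K. t N M s)"
  by (subst sum.swap[of _ "{..<K}"], subst (2) sum.swap, subst sum.swap, rule refl)
 also have "... = Sum_any (%s. Sum_any (%M. Sum_any (%N. t N M s)))"
  by (rule Sum_any_triple[symmetric]) (use K in blast)
 also have "... = Sum_any (%s. sc (of_int wa gchoose s) (X (wa + w' - int s) (md a (m + int s) b) n c))"
 proof (rule Sum_any.cong)
  fix s
  have N: "Sum_any (%N. t N M s) = sc ((of_int wa gchoose M) * (of_int (int M) gchoose s)) (cv (bp w') (Y s) (n + int M - int s))" for M
   unfolding cv_def bp_nth
   by (subst Sum_any_fscale[symmetric, OF bdd_cv_evz[OF bY]]) (simp add: t_def algebra_simps)
  have "Sum_any (%M. Sum_any (%N. t N M s)) = Sum_any (%M. Sum_any (%N. t N (M + s) s))"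
   unfolding N by (rule Sum_any_shift) (simp add: binomial_gbinomial[symmetric] binomial_eq_0)
  also have "... = Sum_any (%M. sc (of_int wa gchoose s) (sc (of_int (wa - int s) gchoose M) (cv (bp w') (Y s) (n + int M))))"
  proof (rule Sum_any.cong)
   fix M
   have "(of_int wa gchoose (M + s)) * (of_int (int (M + s)) gchoose s) = ((of_int wa gchoose s) * (of_int (wa - int s) gchoose M) :: complex)"
    using gbinomial_trinomial_revision[of s "M + s" "of_int wa :: complex"] by (simp add: binomial_gbinomial)
   then show "Sum_any (%N. t N (M + s) s) = sc (of_int wa gchoose s) (sc (of_int (wa - int s) gchoose M) (cv (bp w') (Y s) (n + int M)))"
    unfolding N by simp
  qed
  also have "... = sc (of_int wa gchoose s) (cv (bp (wa - int s)) (cv (bp w') (Y s)) n)"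
   by (subst Sum_any_fscale[OF bdd_cv_evz[OF bdd_cv[OF bY]]]) (simp add: cv_def[of "bp (wa - int s)"])
  also have "cv (bp (wa - int s)) (cv (bp w') (Y s)) n = X (wa + w' - int s) (md a (m + int s) b) n c"
   unfolding cv_mult[OF bY] bp_add[symmetric] X_def Y_def by (simp add: algebra_simps)
  finally show "Sum_any (%M. Sum_any (%N. t N M s)) = sc (of_int wa gchoose s) (X (wa + w' - int s) (md a (m + int s) b) n c)" .
 qed
 finally show "(\<Sum>N<K. \<Sum>M<K. sc ((of_int w' gchoose N) * (of_int wa gchoose M)) (LL a b c (int M) (n + int N) m))
  = Sum_any (%i. sc (of_int wa gchoose i) (X (wa + w' - int i) (md a (m + int i) b) n c))" .
 qed
qed

lemma zhu_iterate_right: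
 fixes wa w' n n' m :: int and a b c :: fock
 shows "\<exists>K0. ALL K>=K0. (\<Sum>N<K. \<Sum>M<K. sc ((of_int w' gchoose N) * (of_int wa gchoose M)) (RR a b c (n' + int M) (n + int N) m))
  = Sum_any (%s. sc (fps_nth (bn m) s) (X wa a (n' + m - int s) (X w' b (n + int s) c)))"
proof -
 define t where "t N M s = sc ((of_int w' gchoose N) * (of_int wa gchoose M) * fps_nth (bn m) s) (md a (n' + m + int M - int s) (md b (n + int N + int s) c))" for N M s :: nat
 obtain B0 where B0: "!!j. j >= B0 ==> md b j c = 0" using bdd_md[of b c] unfolding bdd_def by blast
 have "\<exists>B. ALL d>=B. md a d (md b j c) = 0" for j using bdd_md[of a "md b j c"] unfolding bdd_def .
 then obtain B where B: "!!j d. d >= B j ==> md a d (md b j c) = 0" by metis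
 define K0 where "K0 = nat (\<bar>B0 - n\<bar> + (\<Sum>j<nat (B0 - n). \<bar>B (n + int j)\<bar>) + \<bar>n' + m\<bar> + \<bar>B0 - n\<bar>)"
 have K0: "t N M s = 0" if "N >= K0 \<or> M >= K0 \<or> s >= K0" for N M s
 proof (cases "int N + int s >= B0 - n")
  case True
  then have "n + int N + int s >= B0" by simp
  then show ?thesis by (simp add: t_def B0 md_lin)
 next
  case False
  then have s: "N + s < nat (B0 - n)" by simp
  have "B (n + int (N + s)) \<le> (\<Sum>j<nat (B0 - n). \<bar>B (n + int j)\<bar>)"
   using s member_le_sum[of "N + s" "{..<nat (B0 - n)}" "%j. \<bar>B (n + int j)\<bar>"] by auto
  moreover have S: "0 \<le> (\<Sum>j<nat (B0 - n). \<bar>B (n + int j)\<bar>)" by (rule sum_nonneg) simp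
  have "M >= K0" using that False S unfolding K0_def by linarith
  moreover note S
  ultimately have "n' + m + int M - int s >= B (n + int (N + s))" using False unfolding K0_def by linarith
  then show ?thesis using B[of "n + int (N + s)" "n' + m + int M - int s"] by (simp add: t_def add.assoc)
 qed
 show ?thesis
 proof (intro exI[of _ K0] allI impI)
 fix K assume "K >= K0"
 then have K: "t N M s = 0" if "N >= K \<or> M >= K \<or> s >= K" for N M s
  using K0[of N M s] that by (meson order_trans)
 have 1: "sc ((of_int w' gchoose N) * (of_int wa gchoose M)) (RR a b c (n' + int M) (n + int N) m) = Sum_any (t N M)" for N M
  unfolding RR_def cv_def
  by (subst Sum_any_fscale[symmetric, OF bdd_cv_evz[OF bdd_RR]]) (simp add: t_def algebra_simps)
 have "(\<Sum>N<K. \<Sum>M<K. sc ((of_int w' gchoose N) * (of_int wa gchoose M)) (RR a b c (n' + int M) (n + int N) m))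
  = (\<Sum>N<K. \<Sum>M<K. \<Sum>s<K. t N M s)" unfolding 1 by (intro sum.cong refl Sum_any_nat) (simp add: K)
 also have "... = (\<Sum>s<K. \<Sum>M<K. \<Sum>N<K. t N M s)"
  by (subst sum.swap[of _ "{..<K}"], subst (2) sum.swap, subst sum.swap, rule refl)
 also have "... = Sum_any (%s. Sum_any (%M. Sum_any (%N. t N M s)))"
  by (rule Sum_any_triple[symmetric]) (use K in blast)
 also have "... = Sum_any (%s. sc (fps_nth (bn m) s) (X wa a (n' + m - int s) (X w' b (n + int s) c)))"
 proof (rule Sum_any.cong)
  fix s
  have "Sum_any (%N. t N M s) = sc (of_int wa gchoose M) (sc (fps_nth (bn m) s) (md a (n' + m - int s + int M) (X w' b (n + int s) c)))" for M
  proof -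
   have b: "bdd (%j. md a d (md b j c))" for d by (rule bdd_flin[OF bdd_md flin_md2])
   have x: "md a d (X w' b j c) = Sum_any (%N. sc (of_int w' gchoose N) (md a d (md b (j + int N) c)))" for d j
    unfolding X_def cv_flin[OF bdd_md flin_md2] by (simp only: cv_def bp_nth)
   show ?thesis
    unfolding x sc_sc by (subst Sum_any_fscale[symmetric, OF bdd_cv_evz[OF b]]) (simp add: t_def algebra_simps)
  qed
  then have "Sum_any (%M. Sum_any (%N. t N M s)) = Sum_any (%M. sc (fps_nth (bn m) s) (sc (of_int wa gchoose M) (md a (n' + m - int s + int M) (X w' b (n + int s) c))))"
   by (simp add: mult.commute)
  then show "Sum_any (%M. Sum_any (%N. t N M s)) = sc (fps_nth (bn m) s) (X wa a (n' + m - int s) (X w' b (n + int s) c))"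
   by (simp only: Sum_any_fscale[OF bdd_cv_evz[OF bdd_md]] X_def[of wa] cv_def[of "bp wa"] bp_nth)
 qed
 finally show "(\<Sum>N<K. \<Sum>M<K. sc ((of_int w' gchoose N) * (of_int wa gchoose M)) (RR a b c (n' + int M) (n + int N) m))
  = Sum_any (%s. sc (fps_nth (bn m) s) (X wa a (n' + m - int s) (X w' b (n + int s) c)))" .
 qed
qed

lemma zhu_iterate:
 assumes "Jac a b c"
 shows "Sum_any (%i. sc (of_int wa gchoose i) (X (wa + w' - int i) (md a (m + int i) b) n c))
  = Sum_any (%s. sc (fps_nth (bn m) s) (X wa a (m - int s) (X w' b (n + int s) c)))
  - sc (sg m) (Sum_any (%s. sc (fps_nth (bn m) s) (X w' b (n + m - int s) (X wa a (int s) c))))"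
proof -
 obtain K1 where K1: "ALL K>=K1. (\<Sum>N<K. \<Sum>M<K. sc ((of_int w' gchoose N) * (of_int wa gchoose M)) (LL a b c (int M) (n + int N) m))
  = Sum_any (%i. sc (of_int wa gchoose i) (X (wa + w' - int i) (md a (m + int i) b) n c))"
  using zhu_iterate_left by blast
 obtain K2 where K2: "ALL K>=K2. (\<Sum>N<K. \<Sum>M<K. sc ((of_int w' gchoose N) * (of_int wa gchoose M)) (RR a b c (0 + int M) (n + int N) m))
  = Sum_any (%s. sc (fps_nth (bn m) s) (X wa a (0 + m - int s) (X w' b (n + int s) c)))"
  using zhu_iterate_right by blast
 obtain K3 where K3: "ALL K>=K3. (\<Sum>N<K. \<Sum>M<K. sc ((of_int wa gchoose N) * (of_int w' gchoose M)) (RR b a c (n + int M) (0 + int N) m))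
  = Sum_any (%s. sc (fps_nth (bn m) s) (X w' b (n + m - int s) (X wa a (0 + int s) c)))"
  using zhu_iterate_right by blast
 define K where "K = max K1 (max K2 K3)"
 have e: "K >= K1" "K >= K2" "K >= K3" by (auto simp: K_def)
 have "Sum_any (%i. sc (of_int wa gchoose i) (X (wa + w' - int i) (md a (m + int i) b) n c))
  = (\<Sum>N<K. \<Sum>M<K. sc ((of_int w' gchoose N) * (of_int wa gchoose M)) (LL a b c (int M) (n + int N) m))"
  using K1 e by simp
 also have "... = (\<Sum>N<K. \<Sum>M<K. sc ((of_int w' gchoose N) * (of_int wa gchoose M)) (RR a b c (0 + int M) (n + int N) m))
  - sc (sg m) (\<Sum>N<K. \<Sum>M<K. sc ((of_int w' gchoose N) * (of_int wa gchoose M)) (RR b a c (n + int N) (0 + int M) m))"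
  using assms by (simp add: Jac_def sc_diff sum_subtractf sc_sum mult_ac)
 also have "(\<Sum>N<K. \<Sum>M<K. sc ((of_int w' gchoose N) * (of_int wa gchoose M)) (RR b a c (n + int N) (0 + int M) m))
  = (\<Sum>N<K. \<Sum>M<K. sc ((of_int wa gchoose N) * (of_int w' gchoose M)) (RR b a c (n + int M) (0 + int N) m))"
  by (subst sum.swap) (simp only: mult.commute)
 finally show ?thesis unfolding K2[rule_format, OF e(2)] K3[rule_format, OF e(3)] by simp
qed

text \<open>The exponent w' = wb - m - 1 makes wa + w' - i the weight of a_{m+i} b, so every summand
  is the residue that \<open>zb\<close> prescribes.\<close>

lemma zb_iterate:
 assumes a: "a \<in> WS wa" and b: "b \<in> WS wb" and c: "c \<in> W"
 shows "zb r (X wa a m b) c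
  = Sum_any (%s. sc (fps_nth (bn m) s) (X wa a (m - int s) (X (wb - m - 1) b (- r + int s) c)))
  - sc (sg m) (Sum_any (%s. sc (fps_nth (bn m) s) (X (wb - m - 1) b (- r + m - int s) (X wa a (int s) c))))"
proof -
 have h: "md a (m + int i) b \<in> WS (wa + (wb - m - 1) - int i)" for i
  using md_WS[OF a b, of "m + int i"] by (simp add: algebra_simps)
 obtain I where I: "!!i. i >= I ==> md a (m + int i) b = 0"
  using bdd_evz[OF bdd_md[of a b], of m] unfolding evz_def by blast
 have "X wa a m b = (\<Sum>i<I. sc (of_int wa gchoose i) (md a (m + int i) b))"
  unfolding X_def cv_def bp_nth by (rule Sum_any_nat) (simp add: I)
 then have "zb r (X wa a m b) c = (\<Sum>i<I. zb r (sc (of_int wa gchoose i) (md a (m + int i) b)) c)"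
  by (simp only:) (rule zb_sum, rule W_scale, rule WS_W[OF h])
 also have "... = (\<Sum>i<I. sc (of_int wa gchoose i) (X (wa + (wb - m - 1) - int i) (md a (m + int i) b) (- r) c))"
  by (intro sum.cong refl) (simp only: zb_scale[OF WS_W[OF h]] zb_hom[OF h])
 also have "... = Sum_any (%i. sc (of_int wa gchoose i) (X (wa + (wb - m - 1) - int i) (md a (m + int i) b) (- r) c))"
  by (rule Sum_any_nat[symmetric]) (simp add: I X_lin)
 finally show ?thesis
  using zhu_iterate[OF Jac_VL[OF W_VV[OF WS_W[OF a]] W_VV[OF WS_W[OF b]]], of wa "wb - m - 1" m "- r" c] by simp
qed

lemma zb_ZO: assumes "x \<in> W" "c \<in> W" "r >= 2" shows "zb r x c \<in> ZO"
 using assms(1)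
proof (induction x rule: W_induct)
 case (hom n a k)
 then have "a \<in> WS n" by (rule W_hg_WS)
 then show ?case unfolding zb_hom[OF \<open>a \<in> WS n\<close>] by (rule X_ZO[OF _ assms(2,3)])
next
 case (add a b)
 then show ?case unfolding zb_add[OF add(1,2)] by (intro ZO_add)
qed

text \<open>In the expansion at m = -1 every summand has an outer pole of order at least 2 and lies
  in O(V), except the summand s = 0 of the first sum, which is the product on the right.\<close>

lemma zb_head_hom:
 assumes a: "a \<in> WS wa" and b: "b \<in> WS wb" and c: "c \<in> W" and r: "r >= 1"
 shows "zb r (a ** b) c - a ** zb r b c \<in> ZO"
proof -
 let ?f = "%s. X wa a (-1 - int s) (X wb b (- r + int s) c)"
 let ?g = "%s. if s = (0::nat) then a ** zb r b c else 0"
 have bn1: "fps_nth (bn (-1)) s = 1" for s using bn_neg_nth[of 0 s] by simp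
 have e: "zb r (a ** b) c = Sum_any ?f + Sum_any (%s. X wb b (- r - 1 - int s) (X wa a (int s) c))"
  using zb_iterate[OF a b c, of r "-1"] unfolding bn1 by (simp add: zb_hom[OF a])
 have "evz ?f"
 proof -
  obtain N where "!!j. j >= N ==> X wb b j c = 0"
   using bdd_cv[OF bdd_md[of b c], of "bp wb"] unfolding X_def bdd_def by blast
  then show ?thesis by (intro evzI[of "nat (N + r)"]) (simp add: X_lin)
 qed
 moreover have "evz ?g" by (rule evzI[of 1]) simp
 ultimately have "Sum_any (%s. ?f s - ?g s) = Sum_any ?f - Sum_any ?g" by (rule Sum_any_diff)
 then have "zb r (a ** b) c - a ** zb r b c
  = Sum_any (%s. ?f s - ?g s) + Sum_any (%s. X wb b (- r - 1 - int s) (X wa a (int s) c))"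
  unfolding e by simp
 also have "... \<in> ZO"
 proof (intro ZO_add ZO_Sum_any)
  fix s :: nat
  have "X wb b (- (r + 1 + int s)) (X wa a (int s) c) \<in> ZO"
   by (rule X_ZO[OF b X_W[OF WS_W[OF a] c]]) (use r in simp)
  moreover have "- r - 1 - int s = - (r + 1 + int s)" by simp
  ultimately show "X wb b (- r - 1 - int s) (X wa a (int s) c) \<in> ZO" by (simp only:)
  show "?f s - ?g s \<in> ZO"
  proof (cases "s = 0")
   case True then show ?thesis by (simp add: zb_hom[OF a] zb_hom[OF b])
  next
   case False
   have "X wa a (- (1 + int s)) (X wb b (- r + int s) c) \<in> ZO"
    by (rule X_ZO[OF a X_W[OF WS_W[OF b] c]]) (use False in simp)
   then show ?thesis using False by simp
  qed
 qed
 finally show ?thesis .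
qed

lemma zb_head:
 assumes "a \<in> W" "b \<in> W" and c: "c \<in> W" and r: "r >= 1"
 shows "zb r (a ** b) c - a ** zb r b c \<in> ZO"
 using assms(1,2)
proof (induction a rule: W_induct)
 case (hom n a k)
 then have a: "a \<in> WS n" by (intro W_hg_WS)
 from hom(2) show ?case
 proof (induction b rule: W_induct)
  case (hom m b l) show ?case by (rule zb_head_hom[OF a W_hg_WS[OF hom] c r])
 next
  case (add b b')
  have "zb r (a ** (b + b')) c - a ** zb r (b + b') c = (zb r (a ** b) c - a ** zb r b c) + (zb r (a ** b') c - a ** zb r b' c)"
   using WS_W[OF a] add(1,2) by (simp add: zb_add zb_add2 zb_W)
  then show ?case using add(3,4) by (simp only:) (rule ZO_add)
 qed
next
 case (add a a')
 have "zb r ((a + a') ** b) c - (a + a') ** zb r b c = (zb r (a ** b) c - a ** zb r b c) + (zb r (a' ** b) c - a' ** zb r b c)"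
  using add(1,2,5) by (simp add: zb_add zb_add2 zb_W)
 then show ?case using add(3,4)[OF add(5)] by (simp only:) (rule ZO_add)
qed

lemma star_assoc: "a \<in> W ==> b \<in> W ==> c \<in> W ==> (a ** b) ** c - a ** (b ** c) \<in> ZO"
 by (rule zb_head) auto

lemma ZO_induct [consumes 1, case_names base add scale]:
 assumes "x \<in> ZO" "!!wa a b. a \<in> WS wa ==> b \<in> W ==> P (zb 2 a b)"
  "!!x y. x \<in> ZO ==> y \<in> ZO ==> P x ==> P y ==> P (x + y)" "!!c x. x \<in> ZO ==> P x ==> P (sc c x)"
 shows "P x"
proof -
 have "x \<in> ZO \<and> P x"
  using assms(1) unfolding ZO_span
 proof (induction rule: fock.span_induct_alt)
  case base
  have "P (zb 2 1 0)" by (rule assms(2)[of _ 0]) (use one_hg W_hg_WS in auto)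
  then show ?case by (simp add: zb_0 fock.span_zero)
 next
  case (step c x y)
  then obtain n b d where x: "x = X n b (-2) d" "b \<in> WS n" "d \<in> W" by blast
  have "x = zb 2 b d" by (simp add: x zb_hom[OF x(2)])
  then have "P x" "x \<in> ZO" using assms(2)[OF x(2,3)] zb_ZO[OF WS_W[OF x(2)] x(3), of 2] by auto
  then show ?case using step(2) assms(3,4) unfolding ZO_span[symmetric] by (metis ZO_add ZO_scale)
 qed
 then show ?thesis ..
qed

text \<open>\<open>zb_head\<close> at r = 2 compares a * (b \<circ> c) with (a * b) \<circ> c, and
  the latter lies in O(V).\<close>

lemma ZO_left: assumes "a \<in> W" "x \<in> ZO" shows "a ** x \<in> ZO"
 using assms(2)
proof (induction rule: ZO_induct)
 case (base wb b c)
 have 1: "zb 2 (a ** b) c - a ** zb 2 b c \<in> ZO" by (rule zb_head[OF assms(1) WS_W[OF base(1)] base(2)]) simp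
 have 2: "zb 2 (a ** b) c \<in> ZO" by (rule zb_ZO[OF zb_W[OF assms(1) WS_W[OF base(1)]] base(2)]) simp
 have "a ** zb 2 b c = zb 2 (a ** b) c - (zb 2 (a ** b) c - a ** zb 2 b c)" by simp
 also have "... \<in> ZO" by (rule ZO_diff[OF 2 1])
 finally show ?case .
qed (simp_all only: zb_add2[OF assms(1)] zb_scale2[OF assms(1)] ZO_add ZO_scale)

text \<open>The expansion at m = -2, where w' = wb + 1. In the first sum the outer pole has order at
  least 2; in the second, \<open>X_Suc\<close> reduces the exponent to wb and pole order at least 2
  is kept.\<close>

lemma ZO_right: assumes "c \<in> W" "x \<in> ZO" shows "x ** c \<in> ZO"
proof -
 have hom: "zb 2 a b ** c \<in> ZO" if a: "a \<in> WS wa" and b: "b \<in> WS wb" for a wa b wb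
 proof -
  have "zb 2 a b ** c = Sum_any (%s. sc (fps_nth (bn (-2)) s) (X wa a (-2 - int s) (X (wb + 1) b (-1 + int s) c)))
   - sc (sg (-2)) (Sum_any (%s. sc (fps_nth (bn (-2)) s) (X (wb + 1) b (-3 - int s) (X wa a (int s) c))))"
   using zb_iterate[OF a b assms(1), of 1 "-2"] by (simp add: zb_hom[OF a] add.commute)
  also have "... \<in> ZO"
  proof (intro ZO_diff ZO_scale ZO_Sum_any)
   fix s :: nat
   have "X wa a (- (2 + int s)) (X (wb + 1) b (-1 + int s) c) \<in> ZO"
    by (rule X_ZO[OF a X_W[OF WS_W[OF b] assms(1)]]) simp
   then show "X wa a (-2 - int s) (X (wb + 1) b (-1 + int s) c) \<in> ZO" by simp
   have "X wb b (- (3 + int s)) (X wa a (int s) c) + X wb b (- (2 + int s)) (X wa a (int s) c) \<in> ZO"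
    by (rule ZO_add; rule X_ZO[OF b X_W[OF WS_W[OF a] assms(1)]]; simp)
   then show "X (wb + 1) b (-3 - int s) (X wa a (int s) c) \<in> ZO" by (simp add: X_Suc)
  qed
  finally show ?thesis .
 qed
 show ?thesis
  using assms(2)
 proof (induction rule: ZO_induct)
  case (base wa a b)
  from base(2) show ?case
  proof (induction b rule: W_induct)
   case prems: (hom n b k) show ?case by (rule hom[OF base(1) W_hg_WS[OF prems]])
  next
   case (add b b')
   then show ?case using WS_W[OF base(1)] by (simp add: zb_add2 zb_add zb_W ZO_add)
  qed
 next
  case (add x y)
  then show ?case using ZO_W by (simp add: zb_add subset_iff ZO_add)
 next
  case (scale d x)
  then show ?case using ZO_W by (simp add: zb_scale subset_iff ZO_scale)
 qed
qed

lemma one_WS: "1 \<in> WS 0"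
 using one_hg one_W W_hg_WS by blast

lemma one_star: "1 ** a = a"
 by (simp add: zb_hom[OF one_WS] X_def md_one)

lemma star_one: "a \<in> W ==> a ** 1 = a"
proof (induction a rule: W_induct)
 case (hom n a k)
 have "X n a (-1) 1 = (\<Sum>i<1. sc (of_int n gchoose i) (md a (-1 + int i) 1))"
  unfolding X_def cv_def bp_nth by (rule Sum_any_nat) (simp add: md_right_one)
 then show ?case by (simp add: zb_hom[OF W_hg_WS[OF hom]] md_right_one)
qed (simp add: zb_add)

section \<open>The quotient as a ring\<close>

abbreviation "A \<equiv> zhu_algebra (triplet p)"
definition cls :: "fock => fock set" where "cls a = {b \<in> W. b - a \<in> ZO}"

lemma zhu_class_eq: "zhu_class (triplet p) a = cls a"
 by (simp add: zhu_class_def cls_def triplet_simps ZO_def)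

lemma cls_eq_iff: "a \<in> W ==> b \<in> W ==> cls a = cls b \<longleftrightarrow> a - b \<in> ZO"
proof
 assume ab: "a \<in> W" "b \<in> W"
 { assume "cls a = cls b" moreover have "a \<in> cls a" using ab by (simp add: cls_def)
  ultimately show "a - b \<in> ZO" by (simp add: cls_def) }
 assume d: "a - b \<in> ZO"
 have "x - b = (x - a) + (a - b)" "x - a = (x - b) - (a - b)" for x by simp_all
 with d show "cls a = cls b" unfolding cls_def by (metis ZO_add ZO_diff)
qed

lemma cls_coset: assumes "a \<in> W" shows "cls a = (\<Union>h\<in>ZO. {h + a})"
proof (rule equalityI; rule subsetI)
 fix x assume "x \<in> cls a"
 then have "x - a \<in> ZO" "x = (x - a) + a" by (auto simp: cls_def)
 then show "x \<in> (\<Union>h\<in>ZO. {h + a})" by blast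
next
 fix x assume "x \<in> (\<Union>h\<in>ZO. {h + a})"
 then obtain h where "h \<in> ZO" "x = h + a" by blast
 then show "x \<in> cls a" using assms ZO_W by (auto simp: cls_def)
qed

text \<open>The record under \<open>Quot\<close> is not a ring, so the general theory of factor
  rings does not apply, and the operations are computed from cosets. Independence of representatives
  is the stability of O(V) under multiplication from both sides.\<close>

lemma A_carrier: "carrier A = cls ` W"
 and A_one: "\<one>\<^bsub>A\<^esub> = cls 1" and A_zero: "\<zero>\<^bsub>A\<^esub> = cls 0"
 and A_mult: "a \<in> W ==> b \<in> W ==> cls a \<otimes>\<^bsub>A\<^esub> cls b = cls (a ** b)"
 and A_add: "a \<in> W ==> b \<in> W ==> cls a \<oplus>\<^bsub>A\<^esub> cls b = cls (a + b)"
proof -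
 let ?R = "\<lparr> carrier = W, monoid.mult = zhu_star (triplet p), one = 1, zero = 0, add = (+) \<rparr> :: fock ring"
 have R: "A = ?R Quot ZO" by (simp add: zhu_algebra_def triplet_simps ZO_def)
 have co: "ZO +>\<^bsub>?R\<^esub> a = cls a" if "a \<in> W" for a
  unfolding a_r_coset_def' cls_coset[OF that] by simp
 show "carrier A = cls ` W"
  unfolding R FactRing_def A_RCOSETS_def' using co by auto
 show "\<one>\<^bsub>A\<^esub> = cls 1" unfolding R FactRing_def using co[OF one_W] by simp
 have "ZO = cls 0" using ZO_W by (auto simp: cls_def)
 then show "\<zero>\<^bsub>A\<^esub> = cls 0" unfolding R FactRing_def by simp
 assume ab: "a \<in> W" "b \<in> W"
 have in_cls: "x \<in> W" "x - c \<in> ZO" if "x \<in> cls c" for x c using that by (auto simp: cls_def)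
 show "cls a \<otimes>\<^bsub>A\<^esub> cls b = cls (a ** b)"
 proof -
  have 1: "cls (x ** y) = cls (a ** b)" if "x \<in> cls a" "y \<in> cls b" for x y
  proof -
   have "x ** y - a ** b = (x - a) ** y + a ** (y - b)"
    using zb_add[of "x - a" a 1 y] zb_add2[OF ab(1), of 1 "y - b" b] W_diff[OF in_cls(1)[OF that(1)] ab(1)] ab(1) by simp
   also have "... \<in> ZO"
    by (intro ZO_add ZO_left[OF ab(1) in_cls(2)[OF that(2)]] ZO_right[OF in_cls(1)[OF that(2)] in_cls(2)[OF that(1)]])
   finally show ?thesis
    unfolding cls_eq_iff[OF zb_W[OF in_cls(1)[OF that(1)] in_cls(1)[OF that(2)]] zb_W[OF ab]] .
  qed
  have "cls a \<otimes>\<^bsub>A\<^esub> cls b = (\<Union>x\<in>cls a. \<Union>y\<in>cls b. ZO +>\<^bsub>?R\<^esub> zhu_star (triplet p) x y)"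
   unfolding R FactRing_def by (simp add: rcoset_mult_def)
  also have "... = (\<Union>x\<in>cls a. \<Union>y\<in>cls b. cls (a ** b))"
  proof (intro SUP_cong refl)
   fix x y assume xy: "x \<in> cls a" "y \<in> cls b"
   show "ZO +>\<^bsub>?R\<^esub> zhu_star (triplet p) x y = cls (a ** b)"
    unfolding zhu_star_eq[OF in_cls(1)[OF xy(1)]] co[OF zb_W[OF in_cls(1)[OF xy(1)] in_cls(1)[OF xy(2)]]] by (rule 1[OF xy])
  qed
  also have "... = cls (a ** b)"
  proof -
   have "a \<in> cls a" "b \<in> cls b" using ab by (simp_all add: cls_def)
   then show ?thesis by blast
  qed
  finally show ?thesis .
 qed
 show "cls a \<oplus>\<^bsub>A\<^esub> cls b = cls (a + b)"
 proof -
  have "cls a \<oplus>\<^bsub>A\<^esub> cls b = (\<Union>x\<in>cls a. \<Union>y\<in>cls b. {x + y})"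
   unfolding R FactRing_def by (simp add: set_add_def')
  also have "... = cls (a + b)"
   unfolding cls_coset[OF ab(1)] cls_coset[OF ab(2)] cls_coset[OF W_add[OF ab]]
  proof (rule equalityI; rule subsetI)
   fix z assume "z \<in> (\<Union>x\<in>\<Union>h\<in>ZO. {h + a}. \<Union>y\<in>\<Union>h\<in>ZO. {h + b}. {x + y})"
   then obtain h h' where h: "h \<in> ZO" "h' \<in> ZO" "z = (h + a) + (h' + b)" by blast
   then have "z = (h + h') + (a + b)" "h + h' \<in> ZO" by (auto simp: algebra_simps)
   then show "z \<in> (\<Union>h\<in>ZO. {h + (a + b)})" by blast
  next
   fix z assume "z \<in> (\<Union>h\<in>ZO. {h + (a + b)})"
   then obtain h where "h \<in> ZO" "z = h + (a + b)" by blast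
   then have "z = (h + a) + (0 + b)" "h \<in> ZO" by (auto simp: algebra_simps)
   then show "z \<in> (\<Union>x\<in>\<Union>h\<in>ZO. {h + a}. \<Union>y\<in>\<Union>h\<in>ZO. {h + b}. {x + y})" using ZO_0 by blast
  qed
  finally show ?thesis .
 qed
qed

lemma ring_A: "ring A"
proof (rule ringI)
 show "abelian_group A"
 proof (rule abelian_groupI)
  fix x assume "x \<in> carrier A"
  then obtain a where a: "x = cls a" "a \<in> W" by (auto simp: A_carrier)
  show "\<exists>y\<in>carrier A. y \<oplus>\<^bsub>A\<^esub> x = \<zero>\<^bsub>A\<^esub>"
   by (rule bexI[of _ "cls (- a)"]) (use a in \<open>auto simp: A_add A_zero A_carrier W_uminus\<close>)
 next
  fix x y z assume "x \<in> carrier A" "y \<in> carrier A" "z \<in> carrier A"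
  then obtain a b c where "x = cls a" "y = cls b" "z = cls c" "a \<in> W" "b \<in> W" "c \<in> W" by (auto simp: A_carrier)
  then show "x \<oplus>\<^bsub>A\<^esub> y \<oplus>\<^bsub>A\<^esub> z = x \<oplus>\<^bsub>A\<^esub> (y \<oplus>\<^bsub>A\<^esub> z)" by (simp add: A_add W_add add.assoc)
 next
  fix x y assume "x \<in> carrier A" "y \<in> carrier A"
  then obtain a b where "x = cls a" "y = cls b" "a \<in> W" "b \<in> W" by (auto simp: A_carrier)
  then show "x \<oplus>\<^bsub>A\<^esub> y = y \<oplus>\<^bsub>A\<^esub> x" "x \<oplus>\<^bsub>A\<^esub> y \<in> carrier A" by (simp_all add: A_add add.commute A_carrier W_add)
 qed (auto simp: A_carrier A_zero A_add)
 show "monoid A"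
 proof (rule monoidI)
  fix x y z assume "x \<in> carrier A" "y \<in> carrier A" "z \<in> carrier A"
  then obtain a b c where "x = cls a" "y = cls b" "z = cls c" "a \<in> W" "b \<in> W" "c \<in> W" by (auto simp: A_carrier)
  then show "x \<otimes>\<^bsub>A\<^esub> y \<otimes>\<^bsub>A\<^esub> z = x \<otimes>\<^bsub>A\<^esub> (y \<otimes>\<^bsub>A\<^esub> z)"
   by (simp add: A_mult zb_W cls_eq_iff star_assoc)
 qed (auto simp: A_carrier A_one A_mult one_star star_one)
qed (auto simp: A_carrier A_mult A_add zb_W W_add zb_add zb_add2)

end

section \<open>Descendants\<close>

lemma lookup_numeral_times: "lookup (numeral n * x :: fock) b = numeral n * lookup x b"
proof -
 have "numeral n * x = sc (numeral n) x" unfolding fscale_eq_mult by (simp add: single_numeral)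
 then show ?thesis by simp
qed

definition pol :: "(fock => fock) => complex poly => fock => fock" where
 "pol f P y = (\<Sum>k\<le>degree P. sc (coeff P k) ((f ^^ k) y))"

lemma pol_upto: "degree P \<le> N ==> pol f P y = (\<Sum>k\<le>N. sc (coeff P k) ((f ^^ k) y))"
 unfolding pol_def by (rule sum.mono_neutral_left) (auto simp: Polynomial.coeff_eq_0)

lemma pol_0 [simp]: "pol f 0 y = 0" by (simp add: pol_def)

lemma pol_pCons: assumes "flin f" shows "pol f (pCons a P) y = sc a y + f (pol f P y)"
proof -
 have "pol f (pCons a P) y = (\<Sum>k\<le>Suc (degree P). sc (coeff (pCons a P) k) ((f ^^ k) y))"
  by (rule pol_upto) (rule degree_pCons_le)
 also have "... = sc a y + (\<Sum>k\<le>degree P. sc (coeff P k) (f ((f ^^ k) y)))"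
  by (subst sum.atMost_Suc_shift) (simp del: sum.atMost_Suc)
 finally show ?thesis by (simp add: pol_def flin_sum[OF assms] flin_scale[OF assms])
qed

lemma pol_1: "flin f ==> pol f 1 y = y"
 by (simp add: one_pCons pol_pCons flin_zero)

lemma pol_add: "pol f (P + R) y = pol f P y + pol f R y"
proof -
 let ?N = "max (degree P) (degree R)"
 have "degree (P + R) \<le> ?N" by (rule degree_add_le_max)
 then show ?thesis
  by (simp add: pol_upto[of _ ?N] sc_add_left sum.distrib)
qed

lemma pol_smult: "pol f (smult c P) y = sc c (pol f P y)"
 by (simp add: pol_upto[OF Polynomial.degree_smult_le] pol_def sc_sum)

lemma flin_funpow: "flin f ==> flin (f ^^ k)"
 by (induction k) (auto simp: flin_def)

lemma flin_pol: assumes "flin f" shows "flin (pol f P)"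
 unfolding pol_def by (intro flin_setsum flin_fscale flin_funpow assms)

lemma pol_mult: assumes "flin f" shows "pol f (P * R) y = pol f P (pol f R y)"
proof (induction P)
 case (pCons a P)
 then show ?case
  by (simp add: pol_add pol_smult pol_pCons[OF assms])
qed simp

lemma pol_commute: "flin f ==> pol f P (pol f R y) = pol f R (pol f P y)"
 by (metis pol_mult mult.commute)

lemma pol_closed:
 assumes "y \<in> S" "!!y. y \<in> S ==> f y \<in> S" "fock.subspace S" shows "pol f P y \<in> S"
proof -
 have "(f ^^ k) y \<in> S" for k by (induction k) (auto simp: assms)
 then show ?thesis unfolding pol_def using assms(3) by (intro fock.subspace_sum fock.subspace_scale)
qed

context rank_one begin

definition Om :: "fock => fock" where "Om y = om ** y"

lemma conf_WS: "om \<in> WS 2" using conf_hg conf_W W_hg_WS by blast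

lemma X_conf: "X 2 om n y = L (n - 1) y + sc 2 (L n y) + L (n + 1) y"
proof -
 have "X 2 om n y = X (0 + 1 + 1) om n y" by simp
 also have "... = L (n - 1) y + sc 2 (L n y) + L (n + 1) y"
  unfolding X_Suc by (rule poly_mapping_eqI) (simp add: X_def L_def lookup_add lookup_numeral_times add.assoc)
 finally show ?thesis .
qed

lemma flin_Om: "flin Om"
 unfolding Om_def zb_hom[OF conf_WS] by (rule flin_X)

lemmas Om_lin = flin_add[OF flin_Om] flin_scale[OF flin_Om] flin_zero[OF flin_Om] flin_diff[OF flin_Om]

lemma Om_W [intro]: "y \<in> W ==> Om y \<in> W" and Om_ZO: "y \<in> ZO ==> Om y \<in> ZO"
 unfolding Om_def by (auto intro: ZO_left)

lemma subspace_W: "fock.subspace W" and subspace_ZO: "fock.subspace ZO"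
 by (auto simp: fock.subspace_def)

lemma pol_W [intro]: "y \<in> W ==> pol Om P y \<in> W" and pol_ZO: "y \<in> ZO ==> pol Om P y \<in> ZO"
 by (auto intro: pol_closed subspace_W subspace_ZO Om_ZO)

text \<open>For j \<ge> 2 the residue L(-j-1) + 2 L(-j) + L(-j+1) of \<omega> lies in O(V). This is
  a three-term recursion with characteristic polynomial (t + 1)^2, so the classes are a sign times a
  linear function of j; L(-1) and the definition of \<omega> * y give the two initial
  values.\<close>

lemma L_mod_ZO:
 assumes y: "y \<in> WS w"
 shows "L (- int (Suc j)) y - sc ((-1) ^ Suc j) (sc (of_int w) y + sc (of_nat j) (Om y)) \<in> ZO"
proof -
 have W: "y \<in> W" by (rule WS_W[OF y])
 have L0: "L 0 y = sc (of_int w) y" by (rule WS_L0[OF y])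
 have 1: "L (-1) y + sc (of_int w) y \<in> ZO"
 proof -
  have "X w y (-2) 1 = (\<Sum>i<2. sc (of_int w gchoose i) (md y (-2 + int i) 1))"
   unfolding X_def cv_def bp_nth by (rule Sum_any_nat) (simp add: md_right_one)
  also have "... = L (-1) y + sc (of_int w) y"
   by (simp add: numeral_2_eq_2 L_minus_one T_def md_right_one)
  finally show ?thesis using X_ZO[OF y one_W, of 2] by simp
 qed
 have O: "Om y = L (-2) y + sc 2 (L (-1) y) + sc (of_int w) y"
  unfolding Om_def zb_hom[OF conf_WS] X_conf using L0 by simp
 show ?thesis
 proof (induction j rule: less_induct)
  case (less j)
  consider "j = 0" | "j = 1" | i where "j = Suc (Suc i)" by (metis One_nat_def not0_implies_Suc)
  then show ?case
  proof cases
   case 1 then show ?thesis using \<open>L (-1) y + sc (of_int w) y \<in> ZO\<close> by simp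
  next
   case 2
   have "L (- int (Suc j)) y - sc ((-1) ^ Suc j) (sc (of_int w) y + sc (of_nat j) (Om y))
    = sc (-2) (L (-1) y + sc (of_int w) y)"
    by (rule poly_mapping_eqI) (simp add: 2 O lookup_add lookup_minus lookup_numeral_times, (simp add: algebra_simps)?)
   then show ?thesis using 1 by (simp only:) (rule ZO_scale)
  next
   case (3 i)
   have z: "X 2 om (- int j) y \<in> ZO" by (rule X_ZO[OF conf_WS W]) (simp add: 3)
   have a: "L (- int (Suc (Suc i))) y - sc ((-1) ^ Suc (Suc i)) (sc (of_int w) y + sc (of_nat (Suc i)) (Om y)) \<in> ZO"
    and b: "L (- int (Suc i)) y - sc ((-1) ^ Suc i) (sc (of_int w) y + sc (of_nat i) (Om y)) \<in> ZO"
    by (rule less; simp add: 3)+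
   have e: "L (- int (Suc j)) y - sc ((-1) ^ Suc j) (sc (of_int w) y + sc (of_nat j) (Om y))
    = X 2 om (- int j) y
     - sc 2 (L (- int (Suc (Suc i))) y - sc ((-1) ^ Suc (Suc i)) (sc (of_int w) y + sc (of_nat (Suc i)) (Om y)))
     - (L (- int (Suc i)) y - sc ((-1) ^ Suc i) (sc (of_int w) y + sc (of_nat i) (Om y)))"
    unfolding X_conf by (rule poly_mapping_eqI) (simp add: 3 lookup_add lookup_minus algebra_simps)
   show ?thesis unfolding e by (rule ZO_diff[OF ZO_diff[OF z ZO_scale[OF a]] b])
  qed
 qed
qed

text \<open>
 \<open>UL h0 w0 N x P\<close>: the vector \<open>x\<close> is a combination of descendants of level \<open>N\<close> of the vector \<open>w0\<close>
 of weight \<open>h0\<close>, and \<open>P\<close> is the polynomial with \<open>[x] = P([\<omega>]) * [w0]\<close> in Zhu's algebra.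
\<close>

inductive UL :: "int => fock => nat => fock => complex poly => bool" for h0 :: int and w0 :: fock where
 UL_base: "UL h0 w0 0 w0 1"
| UL_step: "UL h0 w0 N x P ==>
  UL h0 w0 (N + Suc j) (L (- int (Suc j)) x) (smult ((-1) ^ Suc j) ([:of_int (h0 + int N), of_nat j:] * P))"
| UL_zero: "UL h0 w0 N 0 0"
| UL_add: "UL h0 w0 N x P ==> UL h0 w0 N y R ==> UL h0 w0 N (x + y) (P + R)"
| UL_scale: "UL h0 w0 N x P ==> UL h0 w0 N (sc c x) (smult c P)"

definition UU :: "int => fock => nat => fock set" where
 "UU h0 w0 N = {x. \<exists>P. UL h0 w0 N x P}"

lemma UU_subspace: "fock.subspace (UU h0 w0 N)"
 unfolding fock.subspace_def UU_def using UL_zero UL_add UL_scale by blast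

lemma UU_L: assumes "x \<in> UU h0 w0 N" "j >= 1" shows "L (- int j) x \<in> UU h0 w0 (N + j)"
proof -
 obtain i where "j = Suc i" using assms(2) by (cases j) auto
 then show ?thesis using assms(1) UL_step unfolding UU_def by blast
qed

text \<open>L(-1) contributes a constant factor and L(-j-1) with j \<ge> 1 a linear one, so each
  degree costs at least two levels.\<close>

lemma UL_degree: "UL h0 w0 N x P ==> 2 * degree P \<le> N"
proof (induction rule: UL.induct)
 case (UL_step N x P j)
 have "degree (smult ((-1) ^ Suc j) ([:of_int (h0 + int N), of_nat j:] * P)) \<le> degree [:of_int (h0 + int N), of_nat j :: complex:] + degree P"
  by (rule order_trans[OF Polynomial.degree_smult_le degree_mult_le])
 moreover have "2 * degree [:of_int (h0 + int N), of_nat j :: complex:] \<le> Suc j" by (cases j) auto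
 ultimately show ?case using UL_step.IH by linarith
next
 case (UL_add N x P y R)
 then show ?case using degree_add_le_max[of P R] by linarith
next
 case (UL_scale N x P c)
 then show ?case using degree_smult_le[of c P] by linarith
qed auto

lemma L_WS: "x \<in> WS n ==> L m x \<in> WS (n - m)"
 unfolding L_def using md_WS[OF conf_WS, of x n "m + 1"] by (simp add: algebra_simps)

lemma UL_WS: "UL h0 w0 N x P ==> w0 \<in> WS h0 ==> x \<in> WS (h0 + int N)"
proof (induction rule: UL.induct)
 case (UL_step N x P j)
 then show ?case using L_WS[of x "h0 + int N" "- int (Suc j)"] by (simp add: algebra_simps)
qed (auto intro: WS_closed)

lemma UL_Q: "UL h0 w0 N x P ==> UL h0 (Q w0) N (Q x) P"
 by (induction rule: UL.induct) (simp_all only: L_Q[symmetric] Q_lin UL.intros)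

lemma UL_Zhu:
 assumes "UL h0 w0 N x P" and w0: "w0 \<in> WS h0"
 shows "x - pol Om P w0 \<in> ZO"
 using assms(1)
proof (induction rule: UL.induct)
 case UL_base then show ?case by (simp add: pol_1[OF flin_Om])
next
 case (UL_step N x P j)
 let ?P = "[:of_int (h0 + int N), of_nat j :: complex:]"
 have x: "x \<in> WS (h0 + int N)" by (rule UL_WS[OF UL_step.hyps w0])
 have "pol Om ?P y = sc (of_int (h0 + int N)) y + sc (of_nat j) (Om y)" for y
  by (simp add: pol_pCons[OF flin_Om] Om_lin)
 then have "L (- int (Suc j)) x - pol Om (smult ((-1) ^ Suc j) (?P * P)) w0
  = (L (- int (Suc j)) x - sc ((-1) ^ Suc j) (sc (of_int (h0 + int N)) x + sc (of_nat j) (Om x)))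
   + sc ((-1) ^ Suc j) (pol Om ?P (x - pol Om P w0))"
  unfolding pol_smult pol_mult[OF flin_Om] flin_diff[OF flin_pol[OF flin_Om]] sc_diff by simp
 also have "... \<in> ZO" using UL_step.IH L_mod_ZO[OF x] by (intro ZO_add ZO_scale pol_ZO)
 finally show ?case .
next
 case (UL_add N x P y R)
 then have "(x - pol Om P w0) + (y - pol Om R w0) \<in> ZO" by (intro ZO_add)
 then show ?case by (simp add: pol_add algebra_simps)
next
 case (UL_scale N x P c)
 then have "sc c (x - pol Om P w0) \<in> ZO" by (intro ZO_scale)
 then show ?case by (simp add: pol_smult sc_diff)
qed simp

lemma subspace_Sum_any:
 assumes "fock.subspace S" "!!i. f i \<in> S" shows "Sum_any f \<in> S"
 unfolding Sum_any.expand_set using assms by (auto intro: fock.subspace_sum)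

lemma md_L_minus_one:
 assumes "x \<in> VV 0" shows "md x m (L (-1) t) = L (-1) (md x m t) + sc (of_int m) (md x (m - 1) t)"
proof -
 have "L (-1) (md x m t) = md (L (-1) x) m t + md x m (L (-1) t)"
  using Jac_zero_mode[OF Jac_VL[OF conf_VV assms], of m t] by (simp add: L_def)
 also have "md (L (-1) x) m t = - sc (of_int m) (md x (m - 1) t)"
  unfolding L_minus_one md_T[OF Jac_one(1)[OF assms]] by simp
 finally show ?thesis by simp
qed

text \<open>The zero mode of L(-j-1) x on t is expanded by the iterate formula. Terms that lower t
  below its weight and raise it again (\<open>H1\<close>), or apply a positive Virasoro mode to t
  first (\<open>H2\<close>), fall into \<open>S\<close>; what is left multiplies by the same linear
  factor as \<open>L_mod_ZO\<close>. \<open>S\<close> is 0 for lowest weight vectors and a larger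
  space in the proof of strong generation.\<close>

lemma UL_zero_mode:
 fixes n :: complex
 assumes "UL h0 w0 N x P" and w0: "w0 \<in> WS h0" and t: "L 0 t = sc n t" and S: "fock.subspace S"
  and H1: "!!N x P s r. UL h0 w0 N x P ==> s >= 0 ==> r >= 1 ==> L (- r) (md x (h0 + int N + s) t) \<in> S"
  and H2: "!!N x P s. UL h0 w0 N x P ==> s >= 1 ==> md x (h0 + int N - 1 - s) (L s t) \<in> S"
 shows "md x (h0 + int N - 1) t - sc (poly P n) (md w0 (h0 - 1) t) \<in> S"
 using assms(1)
proof (induction rule: UL.induct)
 case UL_base then show ?case by (simp add: fock.subspace_0[OF S])
next
 case (UL_step N x P j)
 have xV: "x \<in> VV 0" using W_VV[OF WS_W[OF UL_WS[OF UL_step.hyps w0]]] .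
 let ?q = "h0 + int N + int j"
 let ?c = "%i. (-1) ^ i * (of_int (- int j) gchoose i) :: complex"
 let ?f = "%i. sc (?c i) (md x (h0 + int N - int i) (L (int i - 1) t))"
 have sg: "sg (- int j) = (-1) ^ j" by (simp add: sg_minus sg_nat)
 have "md (L (- int (Suc j)) x) ?q t = md (md om (- int j) x) ?q t" by (simp add: L_def)
 also have "... = Sum_any (%i. sc (?c i) (L (- (int j + int i + 1)) (md x (h0 + int N + (int j + int i)) t)))
   - sc ((-1) ^ j) (Sum_any ?f)"
 proof -
  have e1: "L (- (int j + int i + 1)) y = md om (- int j - int i) y" for i y
   unfolding L_def by (rule arg_cong[where f = "%m. md om m y"]) simp
  have e2: "?q + - int j - int i = h0 + int N - int i" "?q + int i = h0 + int N + (int j + int i)" for i by simp_all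
  have e3: "L (int i - 1) t = md om (int i) t" for i by (simp add: L_def)
  show ?thesis unfolding Jac_iterate[OF Jac_VL[OF conf_VV xV]] sg e1 e2 e3 ..
 qed
 finally have 1: "md (L (- int (Suc j)) x) ?q t = Sum_any (%i. sc (?c i) (L (- (int j + int i + 1)) (md x (h0 + int N + (int j + int i)) t)))
   - sc ((-1) ^ j) (Sum_any ?f)" .
 have A: "Sum_any (%i. sc (?c i) (L (- (int j + int i + 1)) (md x (h0 + int N + (int j + int i)) t))) \<in> S"
  by (intro subspace_Sum_any[OF S] fock.subspace_scale[OF S] H1[OF UL_step.hyps]) auto
 have evf: "evz ?f"
 proof -
  obtain I where "!!i. i >= I ==> md om i t = 0" using bdd_md[of om t] unfolding bdd_def by blast
  then show ?thesis by (intro evzI[of "nat I"]) (simp add: L_def md_lin)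
 qed
 let ?g = "%i. if i = (0::nat) then ?f 0 else 0" and ?h = "%i. if i = (1::nat) then ?f 1 else 0"
 have ev: "evz ?g" "evz ?h" by (rule evzI[of 2]; simp)+
 have "Sum_any (%i. ?f i - ?g i - ?h i) = Sum_any ?f - ?f 0 - ?f 1"
 proof -
  have "evz (%i. ?f i - ?g i)" using evz_add[OF evf evz_flin[OF ev(1) flin_fscale[OF flin_id], of "-1"]] by simp
  from Sum_any_diff[OF this ev(2)] Sum_any_diff[OF evf ev(1)] show ?thesis by simp
 qed
 \<comment> \<open>The terms i = 0 and i = 1 involve L(-1) t and L(0) t and yield the polynomial
   factor; all later ones apply a positive Virasoro mode to t.\<close>
 then have "Sum_any ?f - ?f 0 - ?f 1 = Sum_any (%i. ?f i - ?g i - ?h i)" by (rule sym)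
 also have "... \<in> S"
 proof (rule subspace_Sum_any[OF S])
  fix i :: nat
  consider "i = 0" | "i = 1" | "i >= 2" by linarith
  then show "?f i - ?g i - ?h i \<in> S"
  proof cases
   case 3
   have "md x (h0 + int N - 1 - (int i - 1)) (L (int i - 1) t) \<in> S" using 3 by (intro H2[OF UL_step.hyps]) simp
   moreover have "h0 + int N - 1 - (int i - 1) = h0 + int N - int i" by simp
   ultimately have "md x (h0 + int N - int i) (L (int i - 1) t) \<in> S" by (simp only:)
   then have "?f i \<in> S" by (rule fock.subspace_scale[OF S])
   then show ?thesis using 3 by simp
  qed (simp_all add: fock.subspace_0[OF S])
 qed
 finally have B: "Sum_any ?f - ?f 0 - ?f 1 \<in> S" .
 have f0: "?f 0 = L (-1) (md x (h0 + int N) t) + sc (of_int (h0 + int N)) (md x (h0 + int N - 1) t)"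
  using md_L_minus_one[OF xV, of "h0 + int N" t] by simp
 have f1: "?f 1 = sc (of_nat j * n) (md x (h0 + int N - 1) t)"
  by (simp add: t md_lin)
 have C: "L (-1) (md x (h0 + int N) t) \<in> S" using H1[OF UL_step.hyps, of 0 1] by simp
 let ?o = "md x (h0 + int N - 1) t" and ?w = "md w0 (h0 - 1) t"
 have "md (L (- int (Suc j)) x) ?q t - sc (poly (smult ((-1) ^ Suc j) ([:of_int (h0 + int N), of_nat j:] * P)) n) ?w
  = Sum_any (%i. sc (?c i) (L (- (int j + int i + 1)) (md x (h0 + int N + (int j + int i)) t)))
   - sc ((-1) ^ j) (Sum_any ?f - ?f 0 - ?f 1) - sc ((-1) ^ j) (L (-1) (md x (h0 + int N) t))
   + sc ((-1) ^ Suc j * (of_int (h0 + int N) + of_nat j * n)) (?o - sc (poly P n) ?w)"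
  unfolding 1 f0 f1 by (rule poly_mapping_eqI) (simp add: lookup_add lookup_minus algebra_simps)
 also have "... \<in> S"
  by (intro fock.subspace_add[OF S] fock.subspace_diff[OF S] fock.subspace_scale[OF S] A B C UL_step.IH)
 finally show ?case by (simp add: algebra_simps)
next
 case (UL_add N x P y R)
 let ?w = "md w0 (h0 - 1) t"
 have "md (x + y) (h0 + int N - 1) t - sc (poly (P + R) n) ?w
  = (md x (h0 + int N - 1) t - sc (poly P n) ?w) + (md y (h0 + int N - 1) t - sc (poly R n) ?w)"
  by (simp add: md_lin sc_add_left)
 then show ?case using UL_add.IH by (simp only:) (rule fock.subspace_add[OF S])
next
 case (UL_scale N x P c)
 let ?w = "md w0 (h0 - 1) t"
 have "md (sc c x) (h0 + int N - 1) t - sc (poly (smult c P) n) ?w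
  = sc c (md x (h0 + int N - 1) t - sc (poly P n) ?w)"
  by (simp add: md_lin sc_diff)
 then show ?case using UL_scale.IH by (simp only:) (rule fock.subspace_scale[OF S])
qed (simp add: md_lin fock.subspace_0[OF S])

section \<open>The singular vector of weight 2p+2\<close>

lemma L_heis: "m + r ~= 0 ==> L m (al r w) = al r (L m w) - sc (of_int r) (al (m + r) w)"
 by (simp add: heis_L)

text \<open>The singular vector of level three in the Verma module of weight 2p - 1, which vanishes
  on the exponential; both sides are written out in oscillators. Since Q commutes with the Virasoro
  operators, the same relation holds for H.\<close>

lemma BPZ_F: "L (-1) (L (-1) (L (-1) F)) - sc (4 * of_nat p) (L (-2) (L (-1) F))
  + sc (4 * (of_nat p)\<^sup>2 - 2 * of_nat p) (L (-3) F) = 0"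
proof -
 have c: "al (-2) (al (-1) x) = al (-1) (al (-2) x)" for x by (simp add: heis_comm[of "-2" "-1"])
 have "L (-1) F = sc (-1) (al (-1) F)"
  unfolding F_def Lm1_lat_exp using p0 by simp
 then have 1: "L (-1) F = - al (-1) F" by simp
 have 2: "L (-2) F = sc (1 / of_nat (4 * p)) (al (-1) (al (-1) F)) - sc ((of_nat p + 1) / of_nat (2 * p)) (al (-2) F)"
  unfolding F_def Lm2_lat_exp using p0 p2 by (intro poly_mapping_eqI) (simp add: lookup_add lookup_minus of_nat_diff field_simps)
 have 3: "L (-3) F = sc (1 / of_nat (2 * p)) (al (-1) (al (-2) F)) - sc (1 / of_nat p) (al (-3) F)"
  unfolding F_def Lm3_lat_exp using p0 p2 by (intro poly_mapping_eqI) (simp add: lookup_add lookup_minus of_nat_diff field_simps)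
 show ?thesis
  unfolding 1 L_lin
  by (simp add: L_heis L_lin 1 2 3 heis_lin flin_diff[OF flin_heis] flin_uminus[OF flin_heis] c)
   (rule poly_mapping_eqI, use p0 in \<open>simp add: lookup_add lookup_minus lookup_numeral_times field_simps power2_eq_square\<close>)
qed

lemma BPZ_H: "L (-1) (L (-1) (L (-1) H)) - sc (4 * of_nat p) (L (-2) (L (-1) H))
  + sc (4 * (of_nat p)\<^sup>2 - 2 * of_nat p) (L (-3) H) = 0"
 using arg_cong[OF BPZ_F, of Q] by (simp add: Q_lin L_Q[symmetric] H_def)

lemma Sum_any_single2:
 assumes "evz f"
 shows "Sum_any f = f 0 + f 1 + Sum_any (%i. f (i + 2) :: fock)"
proof -
 obtain N where N: "!!i. i >= N ==> f i = 0" using assms unfolding evz_def by blast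
 have "Sum_any f = sum f {..<N + 2}" by (rule Sum_any_nat) (simp add: N)
 also have "... = f 0 + f 1 + (\<Sum>i<N. f (i + 2))" by (simp add: sum.lessThan_Suc_shift numeral_2_eq_2 add.assoc del: sum.lessThan_Suc)
 also have "(\<Sum>i<N. f (i + 2)) = Sum_any (%i. f (i + 2))" by (rule Sum_any_nat[symmetric]) (simp add: N)
 finally show ?thesis .
qed

text \<open>For primary w the second sum of the iterate formula stops after L(-1) w and L(0) w; the
  first sum consists of descendants.\<close>

lemma md_L_desc:
 assumes x: "x \<in> VV 0" and w: "\<forall>m>0. L m w = 0" "L 0 w = sc h w"
 shows "md (L (-2) x) n w = Sum_any (%i. L (- 2 - int i) (md x (n + int i) w)) + md x (n - 1) (L (-1) w) + sc h (md x (n - 2) w)"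
  and "md (L (-3) x) n w = Sum_any (%i. sc (of_nat (i + 1)) (L (- 3 - int i) (md x (n + int i) w)))
   - md x (n - 2) (L (-1) w) - sc (2 * h) (md x (n - 3) w)"
proof -
 have z: "md om (int (i + 2)) w = 0" for i using w(1)[rule_format, of "int i + 1"] by (simp add: L_def add.commute)
 have w1: "md om (int 0) w = L (-1) w" "md om (int 1) w = sc h w" using w(2) by (simp_all add: L_def)
 have ev: "evz (%i. sc (c i) (md x (m i) (md om (int i) w)))" for c m
 proof (rule evzI[of 2])
  fix i :: nat assume "i >= 2"
  then obtain k where "i = k + 2" by (metis le_add_diff_inverse2)
  then show "sc (c i) (md x (m i) (md om (int i) w)) = 0" using z[of k] by (simp add: md_lin)
 qed
 have s: "Sum_any (%i. sc (c i) (md x (m i) (md om (int i) w))) = sc (c 0) (md x (m 0) (L (-1) w)) + sc (c 1 * h) (md x (m 1) w)" for c m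
  unfolding Sum_any_single2[OF ev] w1 z by (simp add: md_lin)
 have c1: "(-1) ^ i * (of_int (-1) gchoose i) = (1 :: complex)" for i using bn_neg_nth[of 0 i] by simp
 have c2: "(-1) ^ i * (of_int (-2) gchoose i) = (of_nat (i + 1) :: complex)" for i using bn_neg_nth[of 1 i] by simp
 have m2: "md (L (-2) x) = md (md om (-1) x)" and m3: "md (L (-3) x) = md (md om (-2) x)" by (simp_all add: L_def)
 have e: "md om (-1 - int i) y = L (-2 - int i) y" "md om (-2 - int i) y = L (-3 - int i) y" for i y by (simp_all add: L_def)
 show "md (L (-2) x) n w = Sum_any (%i. L (- 2 - int i) (md x (n + int i) w)) + md x (n - 1) (L (-1) w) + sc h (md x (n - 2) w)"
  unfolding m2 Jac_iterate[OF Jac_VL[OF conf_VV x]] c1 s e by (simp add: md_lin)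
 have "sg (-2) = 1" by (rule sg_even) simp
 then show "md (L (-3) x) n w = Sum_any (%i. sc (of_nat (i + 1)) (L (- 3 - int i) (md x (n + int i) w)))
   - md x (n - 2) (L (-1) w) - sc (2 * h) (md x (n - 3) w)"
  unfolding m3 Jac_iterate[OF Jac_VL[OF conf_VV x]] c2 s e by (simp add: md_lin)
qed

text \<open>The null relation, taken as a mode acting on the primary vector w. After L(-1) w is
  removed by \<open>md_L_minus_one\<close>, a scalar multiple of H_m w equals a combination of
  descendants of the vectors H_{m+j} w with j \<ge> 1.\<close>

lemma BPZ_recursion:
 assumes w: "primary (of_int (2 * int p - 1)) w" and S: "fock.subspace S"
  and desc: "!!j. j >= 1 ==> L (- int j) (md H (m + int j) w) \<in> S"
  and m: "m >= -2 * int p" "m ~= 4 * int p - 3" "m ~= 2 * int p - 2"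
 shows "md H m w \<in> S"
proof -
 define n where "n = m + 3"
 let ?h = "of_int (2 * int p - 1) :: complex"
 have HV: "H \<in> VV 0" by (rule hg_VV[OF H_hg])
 have w': "\<forall>m>0. L m w = 0" "L 0 w = sc ?h w" using w by (auto simp: primary_def)
 have T1: "md (L (-1) x) r y = sc (- of_int r) (md x (r - 1) y)" if "x \<in> VV 0" for x r y
  unfolding L_minus_one by (rule md_T[OF Jac_one(1)[OF that]])
 define s1 where "s1 = Sum_any (%i. L (- 2 - int i) (md (L (-1) H) (n + int i) w))"
 define s2 where "s2 = Sum_any (%i. sc (of_nat (i + 1)) (L (- 3 - int i) (md H (n + int i) w)))"
 define e where "e = L (-1) (md H (n - 2) w)"
 have d: "L (- int j) (md H r w) \<in> S" if "j >= 1" "r = n - 3 + int j" for j r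
  using desc[OF that(1)] by (simp add: that(2) n_def algebra_simps)
 have s1: "s1 \<in> S"
  unfolding s1_def T1[OF HV] L_lin
 proof (intro subspace_Sum_any[OF S] fock.subspace_scale[OF S])
  fix i
  have "- 2 - int i = - int (i + 2)" by simp
  then show "L (- 2 - int i) (md H (n + int i - 1) w) \<in> S" using d[of "i + 2" "n + int i - 1"] by (simp only:) simp
 qed
 have s2: "s2 \<in> S"
  unfolding s2_def
 proof (intro subspace_Sum_any[OF S] fock.subspace_scale[OF S])
  fix i
  have "- 3 - int i = - int (i + 3)" by simp
  then show "L (- 3 - int i) (md H (n + int i) w) \<in> S" using d[of "i + 3" "n + int i"] by (simp only:) simp
 qed
 have e: "e \<in> S" unfolding e_def using d[of 1 "n - 2"] by simp
 have x: "md H (n - 2) (L (-1) w) = e + sc (of_int (n - 2)) (md H (n - 3) w)"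
  unfolding e_def using md_L_minus_one[OF HV, of "n - 2" w] by simp
 \<comment> \<open>The indicial polynomial. Its zeros m = 4p - 3, 2p - 2 and -2p - 1 are the indices
   for which H_m w has weight 0, 2p - 1 and 6p - 2, the weights allowed by fusion; the lower bound
   on m excludes the last one.\<close>
 define \<chi> where "\<chi> = - (of_int ((n - 4 * int p) * (n - 2 * int p - 1) * (n + 2 * int p - 2)) :: complex)"
 have 0: "md (L (-1) (L (-1) (L (-1) H))) n w - sc (4 * of_nat p) (md (L (-2) (L (-1) H)) n w)
   + sc (4 * (of_nat p)\<^sup>2 - 2 * of_nat p) (md (L (-3) H) n w) = 0"
  using arg_cong[OF BPZ_H, of "%x. md x n w"] by (simp add: md_lin flin_diff[OF flin_md1])
 have LH: "L (-1) H \<in> VV 0" "L (-1) (L (-1) H) \<in> VV 0" using L_VV HV by blast+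
 let ?Y = "md H (n - 3) w"
 have a1: "md (L (-1) (L (-1) (L (-1) H))) n w = sc (- (of_int n * (of_int n - 1) * (of_int n - 2))) ?Y"
  unfolding T1[OF HV] T1[OF LH(1)] T1[OF LH(2)] sc_sc
  by (rule arg_cong2[where f = sc]) (simp_all add: algebra_simps)
 have a2: "md (L (-2) (L (-1) H)) n w = s1 - sc (of_int n - 1) (e + sc (of_int n - 2) ?Y) - sc (?h * (of_int n - 2)) ?Y"
 proof -
  have "n - 1 - 1 = n - 2" "n - 2 - 1 = n - 3" by simp_all
  then have "md (L (-2) (L (-1) H)) n w = s1 + sc (- of_int (n - 1)) (e + sc (of_int (n - 2)) ?Y) + sc ?h (sc (- of_int (n - 2)) ?Y)"
   unfolding md_L_desc[OF LH(1) w'] s1_def[symmetric] unfolding T1[OF HV] by (simp only: x)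
  then show ?thesis
   unfolding fock.scale_minus_left fock.scale_minus_right sc_sc of_int_diff of_int_1 of_int_numeral
   by (simp only: diff_conv_add_uminus)
 qed
 have a3: "md (L (-3) H) n w = s2 - (e + sc (of_int n - 2) ?Y) - sc (2 * ?h) ?Y"
  unfolding md_L_desc[OF HV w'] s2_def[symmetric] x by simp
 have "sc \<chi> ?Y + (- sc (4 * of_nat p) s1 + sc (4 * of_nat p * of_int (n - 1)) e
   + sc (4 * (of_nat p)\<^sup>2 - 2 * of_nat p) (s2 - e))
  = sc (- (of_int n * (of_int n - 1) * (of_int n - 2))) ?Y
   - sc (4 * of_nat p) (s1 - sc (of_int n - 1) (e + sc (of_int n - 2) ?Y) - sc (?h * (of_int n - 2)) ?Y)
   + sc (4 * (of_nat p)\<^sup>2 - 2 * of_nat p) (s2 - (e + sc (of_int n - 2) ?Y) - sc (2 * ?h) ?Y)"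
  by (rule poly_mapping_eqI) (simp add: lookup_add lookup_minus \<chi>_def, simp add: algebra_simps power2_eq_square)
 also have "... = 0" using 0 unfolding a1 a2 a3 .
 finally have "sc \<chi> ?Y + (- sc (4 * of_nat p) s1 + sc (4 * of_nat p * of_int (n - 1)) e
   + sc (4 * (of_nat p)\<^sup>2 - 2 * of_nat p) (s2 - e)) = 0" .
 then have "sc \<chi> (md H (n - 3) w) = - (- sc (4 * of_nat p) s1 + sc (4 * of_nat p * of_int (n - 1)) e
   + sc (4 * (of_nat p)\<^sup>2 - 2 * of_nat p) (s2 - e))" by (rule eq_neg_iff_add_eq_0[THEN iffD2])
 also have "... \<in> S"
  by (intro fock.subspace_neg[OF S] fock.subspace_add[OF S] fock.subspace_diff[OF S] fock.subspace_scale[OF S] s1 s2 e)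
 finally have "sc (1 / \<chi>) (sc \<chi> (md H (n - 3) w)) \<in> S" by (rule fock.subspace_scale[OF S])
 moreover have "\<chi> ~= 0"
 proof -
  have "n - 4 * int p ~= 0" "n - 2 * int p - 1 ~= 0" "n + 2 * int p - 2 ~= 0" using m by (auto simp: n_def)
  then show ?thesis unfolding \<chi>_def neg_equal_0_iff_equal of_int_eq_0_iff by simp
 qed
 ultimately show ?thesis by (simp add: n_def)
qed

lemma hg_min: assumes "v \<in> hg k (wq k)" shows "\<exists>c. v = sc c (xp (tp * k))"
 using grd_0_eq[of v "tp * k"] assms by (auto simp: hg_def simp del: of_nat_mult)

lemma UU_0: "0 \<in> UU h0 w0 N" by (rule fock.subspace_0[OF UU_subspace])

lemma md_HF_hg: "md H m F \<in> hg (-1) (4 * int p - 3 - m)" and md_HH_hg: "md H m H \<in> hg 0 (4 * int p - 3 - m)"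
 by (rule hg_cong[OF md_hg[OF H_hg F_hg]] hg_cong[OF md_hg[OF H_hg H_hg]]; simp)+

text \<open>Downward recursion from m = 2p - 2, where charge and weight leave only multiples of F;
  for larger m the product is 0.\<close>

lemma HF_UU: assumes "m >= -2 * int p" "m \<le> 2 * int p - 2" shows "md H m F \<in> UU (2 * int p - 1) F (nat (2 * int p - 2 - m))"
 using assms
proof (induction "nat (2 * int p - 2 - m)" arbitrary: m rule: less_induct)
 case less
 let ?N = "nat (2 * int p - 2 - m)"
 show ?case
 proof (cases "m = 2 * int p - 2")
  case True
  then have "md H m F \<in> hg (-1) (wq (-1))" using md_HF_hg[of m] by (simp add: wq_def)
  from hg_min[OF this] obtain c where "md H m F = sc c F" by (auto simp: F_def)
  then show ?thesis using UL_scale[OF UL_base] True unfolding UU_def by auto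
 next
  case False
  show ?thesis
  proof (rule BPZ_recursion[OF primary_F UU_subspace])
   fix j :: nat assume j: "j >= 1"
   show "L (- int j) (md H (m + int j) F) \<in> UU (2 * int p - 1) F ?N"
   proof (cases "m + int j \<le> 2 * int p - 2")
    case True
    have "md H (m + int j) F \<in> UU (2 * int p - 1) F (nat (2 * int p - 2 - (m + int j)))"
     by (rule less.hyps) (use True j less.prems in auto)
    from UU_L[OF this j] have "L (- int j) (md H (m + int j) F) \<in> UU (2 * int p - 1) F (nat (2 * int p - 2 - (m + int j)) + j)" .
    moreover have "nat (2 * int p - 2 - (m + int j)) + j = ?N" using True by simp
    ultimately show ?thesis by (simp only:)
   next
    case False
    have "md H (m + int j) F = 0" by (rule hg_neg[OF md_HF_hg]) (use False in \<open>simp add: wq_def\<close>)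
    then show ?thesis by (simp add: L_lin UU_0)
   qed
  qed (use less.prems False p2 in auto)
 qed
qed

text \<open>Skew-symmetry: the Jacobi identity on the vacuum with exponents -1, 0, k, where one
  order of the product vanishes and the other reduces to u_{-1} 1 = u.\<close>

lemma Jac_skew:
 assumes "Jac u v 1"
 shows "md v k u = sc (- sg k) (Sum_any (%s. sc ((-1) ^ s) (md (md u (k + int s) v) (-1 - int s) 1)))"
proof -
 have c: "of_int (-1) gchoose s = ((-1) ^ s :: complex)" for s using gbinomial_neg_nat[of 0 s] by simp
 have "RR u v 1 (-1) 0 k = 0" by (simp add: RR_def cv_def md_right_one md_lin)
 moreover have "RR v u 1 0 (-1) k = (\<Sum>s<1. sc (fps_nth (bn k) s) (md v (0 + -1 + k - (-1 + int s)) (md u (-1 + int s) 1)))"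
  unfolding RR_def cv_def by (rule Sum_any_nat) (simp add: md_right_one md_lin)
 moreover have "LL u v 1 (-1) 0 k = Sum_any (%s. sc ((-1) ^ s) (md (md u (k + int s) v) (-1 - int s) 1))"
  unfolding LL_def cv_def bp_nth c by (simp add: algebra_simps)
 ultimately have "Sum_any (%s. sc ((-1) ^ s) (md (md u (k + int s) v) (-1 - int s) 1)) = - sc (sg k) (md v k u)"
  using assms[unfolded Jac_def, rule_format, of "-1" 0 k] by (simp add: md_right_one)
 then show ?thesis by simp
qed

lemma UU_creative: "x \<in> UU 0 1 N ==> md x (-1 - int s) 1 \<in> UU 0 1 (N + s)"
proof (induction s arbitrary: x N)
 case 0 then show ?case by (simp add: md_right_one)
next
 case (Suc s)
 then obtain P where "UL 0 1 N x P" by (auto simp: UU_def)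
 then have x: "x \<in> VV 0" using UL_WS one_WS WS_W W_VV by blast
 have "L (- int 1) x \<in> UU 0 1 (N + 1)" by (rule UU_L[OF Suc.prems]) simp
 from Suc.IH[OF this] have "md (T x) (-1 - int s) 1 \<in> UU 0 1 (N + Suc s)" by (simp add: L_minus_one)
 moreover have "md (T x) (-1 - int s) 1 = sc (of_nat (Suc s)) (md x (-1 - int (Suc s)) 1)"
  unfolding md_T[OF Jac_one(1)[OF x]] by (simp add: algebra_simps)
 ultimately have "sc (1 / of_nat (Suc s)) (sc (of_nat (Suc s)) (md x (-1 - int (Suc s)) 1)) \<in> UU 0 1 (N + Suc s)"
  using fock.subspace_scale[OF UU_subspace] by metis
 then show ?case by (simp del: of_nat_Suc)
qed

lemma HH_0: "m > 4 * int p - 3 ==> md H m H = 0"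
 by (rule hg_neg[OF md_HH_hg]) (simp add: wq_def)

lemma HH_UU: assumes "m >= -2 * int p" "m \<le> 4 * int p - 3" shows "md H m H \<in> UU 0 1 (nat (4 * int p - 3 - m))"
 using assms
proof (induction "nat (4 * int p - 3 - m)" arbitrary: m rule: less_induct)
 case less
 let ?N = "nat (4 * int p - 3 - m)"
 have IH: "md H (m + int j) H \<in> UU 0 1 (nat (4 * int p - 3 - (m + int j)))" if "j >= 1" "m + int j \<le> 4 * int p - 3" for j
  by (rule less.hyps) (use that less.prems in auto)
 consider "m = 4 * int p - 3" | "m = 2 * int p - 2" | "m ~= 4 * int p - 3" "m ~= 2 * int p - 2" by blast
 then show ?case
 proof cases
  case 1
  then have "md H m H \<in> hg 0 (wq 0)" using md_HH_hg[of m] by (simp add: wq_def)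
  from hg_min[OF this] obtain c where "md H m H = sc c 1" by (auto simp: one_eq_lat_exp)
  then show ?thesis using UL_scale[OF UL_base[of 0 1]] 1 unfolding UU_def by auto
 next
  \<comment> \<open>The recursion breaks down at m = 2p - 2, where H_m H has the weight of H. As m
    is even, skew-symmetry gives H_m H = - H_m H up to derivatives of the vectors H_{m+s} H with s
    \<ge> 1, which are already known to be descendants of 1.\<close>
  case 2
  let ?f = "%s. sc ((-1) ^ s) (md (md H (m + int s) H) (-1 - int s) 1)"
  have f: "?f (Suc s) \<in> UU 0 1 ?N" for s
  proof (cases "m + int (Suc s) \<le> 4 * int p - 3")
   case True
   from UU_creative[OF IH[OF _ True], of "Suc s"] have "md (md H (m + int (Suc s)) H) (-1 - int (Suc s)) 1 \<in> UU 0 1 (nat (4 * int p - 3 - (m + int (Suc s))) + Suc s)" by simp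
   moreover have "nat (4 * int p - 3 - (m + int (Suc s))) + Suc s = ?N" using True by simp
   ultimately show ?thesis by (simp only: fock.subspace_scale[OF UU_subspace])
  next
   case False
   then show ?thesis by (simp add: HH_0 md_lin UU_0 del: of_nat_Suc)
  qed
  have "evz ?f" by (rule evzI[of "nat (4 * int p - 2 - m)"]) (simp add: HH_0 md_lin)
  then obtain K where K: "!!i. i >= K ==> ?f i = 0" unfolding evz_def by blast
  have "Sum_any ?f = sum ?f {..<Suc K}" by (rule Sum_any_nat) (rule K, simp)
  also have "... = md H m H + (\<Sum>s<K. ?f (Suc s))" by (subst sum.lessThan_Suc_shift) (simp add: md_right_one del: of_nat_Suc)
  finally have S: "Sum_any ?f = md H m H + (\<Sum>s<K. ?f (Suc s))" .
  have "even m" using 2 by simp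
  then have "md H m H = - Sum_any ?f"
   using Jac_skew[OF Jac_VL[OF hg_VV[OF H_hg] hg_VV[OF H_hg]], of m] by (simp add: sg_even)
  moreover have "sc 2 x = - r" if "x = - (x + r)" for x r :: fock
  proof -
   have "sc 2 x = x + x" using sc_add_left[of 1 1 x] by simp
   moreover have "x + x = - r" using that by (metis add.inverse_inverse add.left_inverse add_eq_0_iff minus_add_distrib uminus_add_conv_diff diff_add_cancel)
   ultimately show ?thesis by simp
  qed
  ultimately have "sc 2 (md H m H) = - (\<Sum>s<K. ?f (Suc s))" unfolding S by blast
  also have "... \<in> UU 0 1 ?N" by (intro fock.subspace_neg[OF UU_subspace] fock.subspace_sum[OF UU_subspace] f)
  finally have "sc (1 / 2) (sc 2 (md H m H)) \<in> UU 0 1 ?N" by (rule fock.subspace_scale[OF UU_subspace])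
  then show ?thesis by simp
 next
  case 3
  show ?thesis
  proof (rule BPZ_recursion[OF primary_H UU_subspace])
   fix j :: nat assume j: "j >= 1"
   show "L (- int j) (md H (m + int j) H) \<in> UU 0 1 ?N"
   proof (cases "m + int j \<le> 4 * int p - 3")
    case True
    from UU_L[OF IH[OF j True] j] have "L (- int j) (md H (m + int j) H) \<in> UU 0 1 (nat (4 * int p - 3 - (m + int j)) + j)" .
    moreover have "nat (4 * int p - 3 - (m + int j)) + j = ?N" using True by simp
    ultimately show ?thesis by (simp only:)
   next
    case False
    then show ?thesis by (simp add: HH_0 L_lin UU_0)
   qed
  qed (use less.prems 3 in auto)
 qed
qed

section \<open>Products of the generators\<close>

definition GG :: "fock set" where
 "GG = fock.span (\<Union>N. UU 0 1 N \<union> UU (2 * int p - 1) F N \<union> UU (2 * int p - 1) H N \<union> UU (2 * int p - 1) E N)"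

lemma Q_one: "Q 1 = 0" by (simp add: Q_def md_right_one)

lemma Q_GG: assumes "x \<in> GG" shows "Q x \<in> GG"
proof -
 have z: "x = 0" if "UL h0 0 N x P" for h0 N x P
  using that by (induction rule: UL.induct) (simp_all add: L_lin)
 have "Q x \<in> GG" if "x \<in> UU 0 1 N \<union> UU (2 * int p - 1) F N \<union> UU (2 * int p - 1) H N \<union> UU (2 * int p - 1) E N" for x N
 proof -
  have "Q x = 0 \<or> Q x \<in> UU (2 * int p - 1) H N \<or> Q x \<in> UU (2 * int p - 1) E N"
   using that UL_Q[of 0 1 N x] UL_Q[of "2 * int p - 1" F N x] UL_Q[of "2 * int p - 1" H N x] UL_Q[of "2 * int p - 1" E N x] z
   unfolding UU_def Q_one Q_E H_def[symmetric] E_def[symmetric] by blast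
  then show ?thesis unfolding GG_def by (auto intro: fock.span_zero fock.span_base)
 qed
 note gen = this
 from assms show ?thesis
  unfolding GG_def
 proof (induction x rule: fock.span_induct_alt)
  case base then show ?case by (simp add: Q_lin fock.span_zero)
 next
  case (step c x y)
  then show ?case using gen unfolding Q_lin GG_def by (intro fock.span_add fock.span_scale) blast+
 qed
qed

lemma GG_closed: "x \<in> GG ==> y \<in> GG ==> x + y \<in> GG" "x \<in> GG ==> y \<in> GG ==> x - y \<in> GG" "x \<in> GG ==> - x \<in> GG" "0 \<in> GG"
 unfolding GG_def by (auto intro: fock.span_add fock.span_diff fock.span_neg fock.span_zero)

text \<open>Q is a derivation with F \<rightarrow> H \<rightarrow> E \<rightarrow> 0 that preserves
  \<open>GG\<close>, so all products follow from H_i F and H_i H. F_i F vanishes because charge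
  -2\<alpha> starts in weight 6p - 2.\<close>

lemma gen_products:
 assumes "u \<in> {F, H, E}" "v \<in> {F, H, E}" "i >= 0" shows "md u i v \<in> GG"
proof -
 have V: "F \<in> VV 0" "H \<in> VV 0" "E \<in> VV 0" by (rule hg_VV[OF F_hg] hg_VV[OF H_hg] hg_VV[OF E_hg])+
 have HF: "md H i F \<in> GG"
 proof (cases "i \<le> 2 * int p - 2")
  case True
  then show ?thesis using HF_UU[of i] assms(3) unfolding GG_def by (intro fock.span_base) auto
 next
  case False
  have "md H i F = 0" by (rule hg_neg[OF md_HF_hg]) (use False in \<open>simp add: wq_def\<close>)
  then show ?thesis by (simp add: GG_closed)
 qed
 have HH: "md H i H \<in> GG"
 proof (cases "i \<le> 4 * int p - 3")
  case True
  then show ?thesis using HH_UU[of i] assms(3) unfolding GG_def by (intro fock.span_base) auto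
 next
  case False
  then show ?thesis by (simp add: HH_0 GG_closed)
 qed
 have FF: "md F i F = 0" by (rule hg_neg[OF md_hg[OF F_hg F_hg]]) (use assms(3) in \<open>simp add: wq_def\<close>)
 have "Q (md F i F) = md H i F + md F i H" by (simp add: Q_md V H_def)
 then have "md F i H = - md H i F" by (simp add: FF Q_lin eq_neg_iff_add_eq_0 add.commute)
 then have FH: "md F i H \<in> GG" using HF GG_closed by simp
 have "md F i E = Q (md F i H) - md H i H" by (simp add: Q_md V H_def E_def)
 then have FE: "md F i E \<in> GG" using Q_GG[OF FH] HH GG_closed by simp
 have "md E i F = Q (md H i F) - md H i H" by (simp add: Q_md V H_def[symmetric] E_def[symmetric])
 then have EF: "md E i F \<in> GG" using Q_GG[OF HF] HH GG_closed by simp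
 have "md E i H = Q (md E i F)" by (simp add: Q_md V H_def[symmetric] Q_E md_lin)
 then have EH: "md E i H \<in> GG" using Q_GG[OF EF] by simp
 have "md H i E = Q (md H i H) - md E i H" by (simp add: Q_md V E_def[symmetric])
 then have HE: "md H i E \<in> GG" using Q_GG[OF HH] EH GG_closed by simp
 have "md E i E = Q (md H i E)" by (simp add: Q_md V E_def[symmetric] Q_E md_lin)
 then have EE: "md E i E \<in> GG" using Q_GG[OF HE] by simp
 show ?thesis using assms(1,2) HF HH FF FH FE EF EH HE EE GG_closed(4) by auto
qed

end

section \<open>The relations between the generators\<close>

context rank_one begin

lemma UL_hg: "UL h0 w0 N x P ==> w0 \<in> hg a h0 ==> x \<in> hg a (h0 + int N)"
proof (induction rule: UL.induct)
 case (UL_step N x P j)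
 then show ?case using L_hg[of x a "h0 + int N" "- int (Suc j)"] by (simp add: algebra_simps)
qed (auto intro: hg_closed)

lemma ZO_cancel: "x - y \<in> ZO ==> x \<in> ZO ==> y \<in> ZO"
 using ZO_diff[of x "x - y"] by simp

lemma zero_mode_star:
 assumes "Jac a b t"
 shows "Sum_any (%i. sc (of_int wa gchoose i) (md (md a (int i - 1) b) (wa + wb - 1 - int i) t))
  = Sum_any (%i. md a (wa - 1 - int i) (md b (wb - 1 + int i) t)) + Sum_any (%i. md b (wb - 2 - int i) (md a (wa + int i) t))"
proof -
 have c: "fps_nth (bn (-1)) i = 1" for i using bn_neg_nth[of 0 i] by simp
 have i: "-1 + int s = int s - 1" "wa + (wb - 1) + -1 - (int s - 1) = wa + wb - 1 - int s"
  "wa + (wb - 1) + -1 - (wb - 1 + int s) = wa - 1 - int s" "(wb - 1) + wa + -1 - (wa + int s) = wb - 2 - int s" for s by simp_all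
 show ?thesis
  using assms[unfolded Jac_def, rule_format, of wa "wb - 1" "-1", unfolded LL_def RR_def cv_def] unfolding c bp_nth
  unfolding i by (simp only: fock.scale_one sg_m1 fock.scale_minus_left diff_minus_eq_add)
qed

lemma zero_mode_circ:
 assumes "Jac a b t"
 shows "Sum_any (%i. sc (of_int wa gchoose i) (md (md a (int i - 2) b) (wa + wb - int i) t))
  = Sum_any (%i. sc (of_nat (i + 1)) (md a (wa - 2 - int i) (md b (wb + int i) t)))
  - Sum_any (%i. sc (of_nat (i + 1)) (md b (wb - 2 - int i) (md a (wa + int i) t)))"
proof -
 have c: "fps_nth (bn (-2)) i = of_nat (i + 1)" for i using bn_neg_nth[of 1 i] by simp
 have s: "sg (-2) = 1" by (rule sg_even) simp
 have i: "-2 + int s = int s - 2" "wa + wb + -2 - (int s - 2) = wa + wb - int s"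
  "wa + wb + -2 - (wb + int s) = wa - 2 - int s" "wb + wa + -2 - (wa + int s) = wb - 2 - int s" for s by simp_all
 show ?thesis
  using assms[unfolded Jac_def, rule_format, of wa wb "-2", unfolded LL_def RR_def cv_def] unfolding c bp_nth s
  unfolding i by (simp only: fock.scale_one)
qed

definition wX :: int where "wX = 2 * int p - 1"

text \<open>Chosen rather than computed: \<open>HH_UU\<close> and \<open>HF_UU\<close> provide
  existence only. The sums \<open>P0\<close> and \<open>P1\<close> are identified afterwards by
  their values.\<close>

definition PH :: "nat => complex poly" where "PH i = (SOME P. UL 0 1 (4 * p - 2 - i) (md H (int i - 1) H) P)"
definition PF :: "nat => complex poly" where "PF i = (SOME P. UL wX F (2 * p - i) (md H (int i - 2) F) P)"
definition P0 :: "complex poly" where "P0 = (\<Sum>i<2 * p. smult (of_int wX gchoose i) (PH i))"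
definition P1 :: "complex poly" where "P1 = (\<Sum>i<2 * p. smult (of_int wX gchoose i) (PF i))"

lemma PH: "i < 2 * p ==> UL 0 1 (4 * p - 2 - i) (md H (int i - 1) H) (PH i)"
proof -
 assume i: "i < 2 * p"
 have "nat (4 * int p - 3 - (int i - 1)) = 4 * p - 2 - i" by simp
 then have "md H (int i - 1) H \<in> UU 0 1 (4 * p - 2 - i)" using HH_UU[of "int i - 1"] i p2 by simp
 then show ?thesis unfolding PH_def UU_def mem_Collect_eq by (rule someI_ex)
qed

lemma PF: "i < 2 * p ==> UL wX F (2 * p - i) (md H (int i - 2) F) (PF i)"
proof -
 assume i: "i < 2 * p"
 have "nat (2 * int p - 2 - (int i - 2)) = 2 * p - i" by simp
 then have "md H (int i - 2) F \<in> UU wX F (2 * p - i)" using HF_UU[of "int i - 2"] i p2 by (simp add: wX_def)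
 then show ?thesis unfolding PF_def UU_def mem_Collect_eq by (rule someI_ex)
qed

lemma gbinomial_wX: "i >= 2 * p ==> (of_int wX gchoose i :: complex) = 0"
proof -
 assume "i >= 2 * p"
 then have "(2 * p - 1) choose i = 0" using p2 by (simp add: binomial_eq_0)
 moreover have "of_int wX = (of_nat (2 * p - 1) :: complex)" using p2 by (simp add: wX_def of_nat_diff)
 ultimately show ?thesis by (metis binomial_gbinomial of_nat_0)
qed

lemma Sum_any_wX: "Sum_any (%i. sc (of_int wX gchoose i) (f i)) = (\<Sum>i<2 * p. sc (of_int wX gchoose i) (f i))"
 by (rule Sum_any_nat) (simp add: gbinomial_wX)

text \<open>The terms of H \<circ> F have level at most 2p over F, and \<open>UL_degree\<close>
  halves this.\<close>

lemma degree_P1: "degree P1 \<le> p"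
 unfolding P1_def
proof (rule Polynomial.degree_sum_le)
 fix i assume "i \<in> {..<2 * p}"
 then have "2 * degree (PF i) \<le> 2 * p - i" using UL_degree[OF PF] by simp
 then show "degree (smult (of_int wX gchoose i) (PF i)) \<le> p"
  using Polynomial.degree_smult_le[of "of_int wX gchoose i" "PF i"] by linarith
qed simp

lemma pol_sum: "pol f (\<Sum>i\<in>I. P i) y = (\<Sum>i\<in>I. pol f (P i) y)"
 by (induction I rule: infinite_finite_induct) (simp_all add: pol_add)

lemma UL_sum_Zhu:
 assumes "w0 \<in> WS h0" "!!i. i \<in> I ==> UL h0 w0 (N i) (x i) (P i)"
 shows "(\<Sum>i\<in>I. sc (c i) (x i)) - pol Om (\<Sum>i\<in>I. smult (c i) (P i)) w0 \<in> ZO"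
proof -
 have "(\<Sum>i\<in>I. sc (c i) (x i)) - pol Om (\<Sum>i\<in>I. smult (c i) (P i)) w0
  = (\<Sum>i\<in>I. sc (c i) (x i - pol Om (P i) w0))"
  by (simp add: pol_sum pol_smult sum_subtractf sc_diff)
 also have "... \<in> ZO" by (intro ZO_sum ZO_scale UL_Zhu[OF assms(2,1)])
 finally show ?thesis .
qed

text \<open>The conditions \<open>H1\<close> and \<open>H2\<close> of \<open>UL_zero_mode\<close>
  for a fixed vector t, together with closure of \<open>S\<close>.\<close>

definition low :: "fock set => fock => int => fock => bool" where
 "low S t h0 w0 \<longleftrightarrow> fock.subspace S \<and>
  (\<forall>N x P s r. UL h0 w0 N x P --> s >= 0 --> r >= 1 --> L (- r) (md x (h0 + int N + s) t) \<in> S) \<and>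
  (\<forall>N x P s. UL h0 w0 N x P --> s >= 1 --> md x (h0 + int N - 1 - s) (L s t) \<in> S)"

lemma UL_sum_zero_mode:
 assumes "w0 \<in> WS h0" "!!i. i \<in> I ==> UL h0 w0 (N i) (x i) (P i)" "L 0 t = sc n t" "low S t h0 w0"
 shows "(\<Sum>i\<in>I. sc (c i) (md (x i) (h0 + int (N i) - 1) t))
  - sc (poly (\<Sum>i\<in>I. smult (c i) (P i)) n) (md w0 (h0 - 1) t) \<in> S"
proof -
 have S: "fock.subspace S" using assms(4) by (simp add: low_def)
 have "(\<Sum>i\<in>I. sc (c i) (md (x i) (h0 + int (N i) - 1) t))
  - sc (poly (\<Sum>i\<in>I. smult (c i) (P i)) n) (md w0 (h0 - 1) t)
  = (\<Sum>i\<in>I. sc (c i) (md (x i) (h0 + int (N i) - 1) t - sc (poly (P i) n) (md w0 (h0 - 1) t)))"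
  by (simp add: poly_sum sum_subtractf sc_diff fock.scale_sum_left)
 also have "... \<in> S"
 proof (intro fock.subspace_sum[OF S] fock.subspace_scale[OF S])
  fix i assume "i \<in> I"
  from UL_zero_mode[OF assms(2)[OF this] assms(1,3) S] assms(4)
  show "md (x i) (h0 + int (N i) - 1) t - sc (poly (P i) n) (md w0 (h0 - 1) t) \<in> S"
   unfolding low_def by blast
 qed
 finally show ?thesis .
qed

lemma F_WS: "F \<in> WS wX" and H_WS: "H \<in> WS wX" and E_WS: "E \<in> WS wX"
 using W_hg_WS F_hg H_hg E_hg F_W H_W E_W unfolding wX_def by blast+

lemma X_wX: "X wX a (- r) b = (\<Sum>i<2 * p. sc (of_int wX gchoose i) (md a (int i - r) b))"
 unfolding X_def cv_def bp_nth Sum_any_wX by simp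

lemma HH_Zhu: "H ** H - pol Om P0 1 \<in> ZO"
 unfolding zb_hom[OF H_WS] X_wX P0_def by (rule UL_sum_Zhu[OF one_WS PH]) simp

lemma F_Zhu: "pol Om P1 F \<in> ZO"
proof -
 have "X wX H (- 2) F - pol Om P1 F \<in> ZO"
  unfolding X_wX P1_def by (rule UL_sum_Zhu[OF F_WS PF]) simp
 then show ?thesis by (rule ZO_cancel) (rule X_ZO[OF H_WS F_W], simp)
qed

lemma HH_zero_mode:
 assumes t: "L 0 t = sc n t" and S: "low S t 0 1"
 shows "Sum_any (%i. md H (wX - 1 - int i) (md H (wX - 1 + int i) t)) + Sum_any (%i. md H (wX - 2 - int i) (md H (wX + int i) t))
  - sc (poly P0 n) t \<in> S"
proof -
 have "(\<Sum>i<2 * p. sc (of_int wX gchoose i) (md (md H (int i - 1) H) (0 + int (4 * p - 2 - i) - 1) t))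
  - sc (poly P0 n) (md 1 (0 - 1) t) \<in> S"
  unfolding P0_def by (rule UL_sum_zero_mode[OF one_WS PH t S]) simp
 also have "(\<Sum>i<2 * p. sc (of_int wX gchoose i) (md (md H (int i - 1) H) (0 + int (4 * p - 2 - i) - 1) t))
  = (\<Sum>i<2 * p. sc (of_int wX gchoose i) (md (md H (int i - 1) H) (wX + wX - 1 - int i) t))"
  by (rule sum.cong) (use p2 in \<open>auto simp: wX_def of_nat_diff algebra_simps\<close>)
 finally show ?thesis
  unfolding Sum_any_wX[symmetric] zero_mode_star[OF Jac_VL[OF hg_VV[OF H_hg] hg_VV[OF H_hg]]] by (simp add: md_one)
qed

lemma HF_zero_mode:
 assumes t: "L 0 t = sc n t" and S: "low S t wX F"
 shows "Sum_any (%i. sc (of_nat (i + 1)) (md H (wX - 2 - int i) (md F (wX + int i) t)))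
  - Sum_any (%i. sc (of_nat (i + 1)) (md F (wX - 2 - int i) (md H (wX + int i) t)))
  - sc (poly P1 n) (md F (wX - 1) t) \<in> S"
proof -
 have "(\<Sum>i<2 * p. sc (of_int wX gchoose i) (md (md H (int i - 2) F) (wX + int (2 * p - i) - 1) t))
  - sc (poly P1 n) (md F (wX - 1) t) \<in> S"
  unfolding P1_def by (rule UL_sum_zero_mode[OF F_WS PF t S]) simp
 also have "(\<Sum>i<2 * p. sc (of_int wX gchoose i) (md (md H (int i - 2) F) (wX + int (2 * p - i) - 1) t))
  = (\<Sum>i<2 * p. sc (of_int wX gchoose i) (md (md H (int i - 2) F) (wX + wX - int i) t))"
  by (rule sum.cong) (use p2 in \<open>auto simp: wX_def of_nat_diff algebra_simps\<close>)
 finally show ?thesis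
  unfolding Sum_any_wX[symmetric] zero_mode_circ[OF Jac_VL[OF hg_VV[OF H_hg] hg_VV[OF F_hg]]] .
qed

text \<open>Q carries the relation from H \<circ> F, of charge -\<alpha>, to charge 0, where the
  zero mode of the remaining generator H acts on an exponential by a scalar. The polynomial is
  unchanged because Q commutes with the Virasoro operators.\<close>

lemma Q_HF_zero_mode:
 assumes t: "L 0 t = sc n t" and S: "low S t wX H"
 shows "Sum_any (%i. sc (of_nat (i + 1)) (md E (wX - 2 - int i) (md F (wX + int i) t)))
  - Sum_any (%i. sc (of_nat (i + 1)) (md F (wX - 2 - int i) (md E (wX + int i) t)))
  + (Sum_any (%i. sc (of_nat (i + 1)) (md H (wX - 2 - int i) (md H (wX + int i) t)))
  - Sum_any (%i. sc (of_nat (i + 1)) (md H (wX - 2 - int i) (md H (wX + int i) t))))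
  - sc (poly P1 n) (md H (wX - 1) t) \<in> S"
proof -
 have V: "F \<in> VV 0" "H \<in> VV 0" "E \<in> VV 0" by (rule hg_VV[OF F_hg] hg_VV[OF H_hg] hg_VV[OF E_hg])+
 have UH: "UL wX H (2 * p - i) (Q (md H (int i - 2) F)) (PF i)" if "i \<in> {..<2 * p}" for i
  unfolding H_def[of] using UL_Q[OF PF, of i] that by (simp add: H_def[symmetric])
 have "(\<Sum>i<2 * p. sc (of_int wX gchoose i) (md (Q (md H (int i - 2) F)) (wX + int (2 * p - i) - 1) t))
  - sc (poly P1 n) (md H (wX - 1) t) \<in> S"
  unfolding P1_def by (rule UL_sum_zero_mode[OF H_WS UH t S])
 also have "(\<Sum>i<2 * p. sc (of_int wX gchoose i) (md (Q (md H (int i - 2) F)) (wX + int (2 * p - i) - 1) t))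
  = (\<Sum>i<2 * p. sc (of_int wX gchoose i) (md (md E (int i - 2) F) (wX + wX - int i) t))
   + (\<Sum>i<2 * p. sc (of_int wX gchoose i) (md (md H (int i - 2) H) (wX + wX - int i) t))"
  unfolding sum.distrib[symmetric]
 proof (rule sum.cong[OF refl])
  fix i assume "i \<in> {..<2 * p}"
  then have "wX + int (2 * p - i) - 1 = wX + wX - int i" by (simp add: wX_def of_nat_diff)
  then show "sc (of_int wX gchoose i) (md (Q (md H (int i - 2) F)) (wX + int (2 * p - i) - 1) t)
   = sc (of_int wX gchoose i) (md (md E (int i - 2) F) (wX + wX - int i) t)
    + sc (of_int wX gchoose i) (md (md H (int i - 2) H) (wX + wX - int i) t)"
   by (simp only:) (simp add: Q_md V H_def[symmetric] E_def[symmetric] md_lin sc_add)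
 qed
 finally show ?thesis
  unfolding Sum_any_wX[symmetric] zero_mode_circ[OF Jac_VL[OF V(3,1)]] zero_mode_circ[OF Jac_VL[OF V(2,2)]] .
qed

text \<open>Evaluation on the vectors \<open>exp(k\<alpha>/(2p))\<close> with \<open>k \<ge> 0\<close> determines the two polynomials.\<close>

lemma exp_exp_coeff:
 assumes "int i = - n - 1 - b * k" "m = int i - 1 - tp * (a * b) - a * k"
 shows "lookup (md (xp (tp * a)) m (md (xp (tp * b)) n (xp k))) ({#}, tp * a + tp * b + k)
  = fps_nth (bn (tp * (a * b))) i"
proof -
 have 1: "tp * a * (tp * b) = tp * (tp * (a * b))" by (simp only: mult_ac)
 have 2: "tp * a * k = tp * (a * k)" "tp * b * k = tp * (b * k)" by (simp_all only: mult_ac)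
 have "md (xp (tp * b)) n (xp k) = cre (tp * b) i (xp (tp * b + k))"
  unfolding md_lat_exp ek_lat_exp[OF 2(2)] assms(1)[symmetric] by (simp add: crez_def)
 then show ?thesis unfolding md_lat_exp assms(2) using vacuum_expectation_ek[OF 1 2(1), of i] by (simp only:)
qed

lemma exp_exp_zero: "- n - 1 - b * k < 0 ==> md (xp (tp * b)) n (xp k) = 0"
proof -
 have 2: "tp * b * k = tp * (b * k)" by (simp only: mult_ac)
 show "- n - 1 - b * k < 0 ==> md (xp (tp * b)) n (xp k) = 0"
  unfolding md_lat_exp ek_lat_exp[OF 2] by (simp add: crez_def)
qed

lemma F_exp: "F = xp (tp * -1)" and Q_exp: "Q = md (xp (tp * 1)) 0"
 by (simp_all add: F_def Q_def)

lemma Q_exp_nat: "Q (xp (int k)) = 0"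
 unfolding Q_exp by (rule exp_exp_zero) simp

text \<open>For k \<ge> 0 the vector exp(k\<alpha>/(2p)) is annihilated by Q, so the derivation rule
  leaves a single term.\<close>

lemma H_exp: "md H n (xp (int k)) = Q (md F n (xp (int k)))"
 and E_exp: "md E n (xp (int k)) = Q (md H n (xp (int k)))"
 using hg_VV[OF F_hg] hg_VV[OF H_hg] by (simp_all add: Q_md Q_exp_nat md_lin H_def[symmetric] E_def[symmetric])

lemma hg0_exp_zero: "x \<in> hg 0 N ==> r >= N ==> md x r (xp k) = 0"
proof -
 assume "x \<in> hg 0 N" "r >= N"
 then have "md x r (xp k) \<in> grd (0 + k) (N + 0 - r - 1 - 0 * k div tp)"
  by (intro md_grd) (auto simp: hg_def wq_def)
 then show ?thesis using \<open>r >= N\<close> by (intro grd_neg) auto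
qed

text \<open>F lowers the charge and Q restores it; the coefficient is that of (1 - Y)^(-2p) in
  degree k - (2p - 1). For smaller k already F gives 0.\<close>

lemma H_eigenvalue: "md H (wX - 1) (xp (int k)) = sc (of_nat (k choose (2 * p - 1))) (xp (int k))"
proof -
 have g: "md H (wX - 1) (xp (int k)) \<in> grd (int k) 0"
  by (rule grd_cong[OF md_grd[OF H_hg[unfolded hg_def] lat_exp_grd]]) (simp_all add: wq_def wX_def)
 have "lookup (md H (wX - 1) (xp (int k))) ({#}, int k) = of_nat (k choose (2 * p - 1))"
 proof (cases "k >= 2 * p - 1")
  case True
  define i where "i = k - (2 * p - 1)"
  have i: "int i = int k - wX" using True p2 by (simp add: i_def wX_def of_nat_diff)
  have "lookup (md (xp (tp * 1)) 0 (md (xp (tp * -1)) (wX - 1) (xp (int k)))) ({#}, tp * 1 + tp * -1 + int k)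
   = fps_nth (bn (tp * (1 * -1))) i"
   by (rule exp_exp_coeff) (simp_all add: i wX_def)
  moreover have "tp * (1 * -1) = - int (2 * p - 1) - 1" using p2 by (simp add: of_nat_diff)
  moreover have "(2 * p - 1 + i) choose i = k choose (2 * p - 1)"
   using True binomial_symmetric[of "2 * p - 1" k] by (simp add: i_def)
  ultimately show ?thesis unfolding H_exp F_exp Q_exp using bn_neg_nth[of "2 * p - 1" i] by (simp del: of_nat_mult of_nat_diff bn_nth)
 next
  case False
  then have "md F (wX - 1) (xp (int k)) = 0" unfolding F_exp by (intro exp_exp_zero) (simp add: wX_def)
  then show ?thesis using False by (simp add: H_exp Q_lin binomial_eq_0)
 qed
 with grd_0_eq[OF g] show ?thesis by simp
qed

lemma low_exp: assumes "w0 \<in> hg 0 h0" shows "low {0} (xp (int k)) h0 w0"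
 unfolding low_def
proof (intro conjI allI impI)
 show "fock.subspace {0}" by (simp add: fock.subspace_def)
 fix N x P and s r :: int assume x: "UL h0 w0 N x P"
 { assume "s >= 0"
  have "md x (h0 + int N + s) (xp (int k)) = 0" by (rule hg0_exp_zero[OF UL_hg[OF x assms]]) (use \<open>s >= 0\<close> in simp)
  then show "L (- r) (md x (h0 + int N + s) (xp (int k))) \<in> {0}" by (simp add: L_lin) }
 { assume "s >= 1" then show "md x (h0 + int N - 1 - s) (L s (xp (int k))) \<in> {0}" by (simp add: L_lat_exp md_lin) }
qed

lemma H_exp_zero: "md H (wX + int i) (xp (int k)) = 0"
 by (rule hg0_exp_zero[OF H_hg]) (simp add: wX_def)

text \<open>On a lowest weight vector the relation for H * H reduces to the square of the zero mode
  of H.\<close>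

lemma P0_eval: "poly P0 (hh (int k)) = (of_nat (k choose (2 * p - 1)))\<^sup>2"
proof -
 let ?e = "xp (int k)"
 have s: "wX - 1 + int (Suc i) = wX + int i" for i by simp
 have 1: "Sum_any (%i. md H (wX - 1 - int i) (md H (wX - 1 + int i) ?e)) = (\<Sum>i<1. md H (wX - 1 - int i) (md H (wX - 1 + int i) ?e))"
 proof (rule Sum_any_nat)
  fix i :: nat assume "i >= 1"
  then obtain j where "i = Suc j" by (cases i) auto
  then show "md H (wX - 1 - int i) (md H (wX - 1 + int i) ?e) = 0" using H_exp_zero[of j k] s[of j] by (simp add: md_lin)
 qed
 have "Sum_any (%i. md H (wX - 1 - int i) (md H (wX - 1 + int i) ?e)) + Sum_any (%i. md H (wX - 2 - int i) (md H (wX + int i) ?e))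
  - sc (poly P0 (hh (int k))) ?e \<in> {0}"
  by (rule HH_zero_mode[OF L0_lat_exp low_exp[OF one_hg]])
 then have "sc ((of_nat (k choose (2 * p - 1)))\<^sup>2 - poly P0 (hh (int k))) ?e = 0"
  unfolding 1 H_exp_zero by (simp add: H_eigenvalue md_lin power2_eq_square sc_diff_left)
 then show ?thesis using lat_exp_inj(2) by simp
qed

text \<open>On a lowest weight vector only the products of E after F survive. Since Q also kills
  F_{wX+i} on the exponential, E can be replaced by Q Q F, and what remains is a product of two
  exponential modes whose level is explicit.\<close>

lemma P1_eval:
 "sc (poly P1 (hh (int k)) * of_nat (k choose (2 * p - 1))) (xp (int k))
  = Sum_any (%i. sc (of_nat (i + 1)) (Q (Q (md F (wX - 2 - int i) (md F (wX + int i) (xp (int k)))))))"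
proof -
 let ?e = "xp (int k)"
 have V: "F \<in> VV 0" "H \<in> VV 0" by (rule hg_VV[OF F_hg] hg_VV[OF H_hg])+
 have 1: "md E n (md F (wX + int i) ?e) = Q (Q (md F n (md F (wX + int i) ?e)))" for n i
 proof -
  have "Q (md F (wX + int i) ?e) = 0" using H_exp[of "wX + int i" k] by (simp add: H_exp_zero)
  then show ?thesis by (simp add: Q_md V H_def[symmetric] E_def[symmetric] md_lin Q_lin)
 qed
 have 2: "md E (wX + int i) ?e = 0" for i by (simp add: E_exp H_exp_zero Q_lin)
 have "Sum_any (%i. sc (of_nat (i + 1)) (md E (wX - 2 - int i) (md F (wX + int i) ?e)))
  - Sum_any (%i. sc (of_nat (i + 1)) (md F (wX - 2 - int i) (md E (wX + int i) ?e)))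
  + (Sum_any (%i. sc (of_nat (i + 1)) (md H (wX - 2 - int i) (md H (wX + int i) ?e)))
  - Sum_any (%i. sc (of_nat (i + 1)) (md H (wX - 2 - int i) (md H (wX + int i) ?e))))
  - sc (poly P1 (hh (int k))) (md H (wX - 1) ?e) \<in> {0}"
  by (rule Q_HF_zero_mode[OF L0_lat_exp low_exp]) (use H_hg in \<open>simp add: wX_def\<close>)
 then show ?thesis unfolding 1 2 H_exp_zero by (simp add: H_eigenvalue md_lin)
qed

lemma FF_grd: "md F (wX - 2 - int i) (md F (wX + int i) (xp k)) \<in> grd (k - int (4 * p)) (2 * k - 6 * int p + 2)"
proof -
 have F: "F \<in> grd (tp * -1) 0" unfolding F_exp by (rule lat_exp_grd)
 have d: "tp * -1 * k div tp = - k" "tp * -1 * (tp * -1 + k) div tp = tp - k"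
 proof -
  have "tp * -1 * k = tp * (- k)" "tp * -1 * (tp * -1 + k) = tp * (tp - k)" by (simp_all add: algebra_simps)
  moreover have "tp * z div tp = z" for z using p2 by simp
  ultimately show "tp * -1 * k div tp = - k" "tp * -1 * (tp * -1 + k) div tp = tp - k" by (simp_all only:)
 qed
 show ?thesis
  by (rule grd_cong[OF md_grd[OF F md_grd[OF F lat_exp_grd]]]) (unfold d, simp_all add: wX_def)
qed

text \<open>Two modes of F send the exponential to level 2k - 6p + 2, which is negative for k < 3p -
  1, while the eigenvalue of H is nonzero from k = 2p - 1 on.\<close>

lemma P1_roots: assumes "k \<in> {2 * p - 1..<3 * p - 1}" shows "poly P1 (hh (int k)) = 0"
proof -
 have "md F (wX - 2 - int i) (md F (wX + int i) (xp (int k))) = 0" for i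
  by (rule grd_neg[OF _ FF_grd]) (use assms in auto)
 then have "sc (poly P1 (hh (int k)) * of_nat (k choose (2 * p - 1))) (xp (int k)) = 0"
  unfolding P1_eval by (simp add: Q_lin)
 moreover have "k choose (2 * p - 1) ~= 0" using assms by (simp add: binomial_eq_0_iff)
 ultimately show ?thesis using lat_exp_inj(2) by simp
qed

lemma Q_Q_exp: "Q (Q (xp (- int p - 1))) = sc ((-1) ^ p * of_nat ((2 * p) choose p)) (xp (3 * int p - 1))"
proof -
 have E: "xp (tp * 1) \<in> grd (tp) 0" using lat_exp_grd by simp
 have d: "tp * k div tp = k" for k using p2 by simp
 have 1: "Q (xp (- int p - 1)) \<in> grd (int p - 1) (int p)"
  unfolding Q_exp by (rule grd_cong[OF md_grd[OF E lat_exp_grd]]) (unfold d, simp_all)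
 have 2: "Q (Q (xp (- int p - 1))) \<in> grd (3 * int p - 1) 0"
  unfolding Q_exp[THEN fun_cong, of "Q _"] by (rule grd_cong[OF md_grd[OF E 1]]) (unfold d, simp_all)
 have "lookup (md (xp (tp * 1)) 0 (md (xp (tp * 1)) 0 (xp (- int p - 1)))) ({#}, tp * 1 + tp * 1 + (- int p - 1))
  = fps_nth (bn (tp * (1 * 1))) p"
  by (rule exp_exp_coeff) simp_all
 moreover have "tp * 1 + tp * 1 + (- int p - 1) = 3 * int p - 1" by simp
 moreover have "fps_nth (bn (tp * (1 * 1))) p = (-1) ^ p * of_nat ((2 * p) choose p)"
  using binomial_gbinomial[of "2 * p" p, where 'a = complex] by simp
 ultimately have "lookup (Q (Q (xp (- int p - 1)))) ({#}, 3 * int p - 1) = (-1) ^ p * of_nat ((2 * p) choose p)"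
  unfolding Q_exp by (simp only:)
 with grd_0_eq[OF 2] show ?thesis by simp
qed

lemma FF_exp:
 "md F (wX - 2 - int i) (md F (wX + int i) (xp (3 * int p - 1)))
  = sc (if i < p then (-1) ^ (p - 1 - i) * of_nat ((2 * p) choose (p - 1 - i)) else 0) (xp (- int p - 1))"
proof (cases "i < p")
 case True
 have "md F (wX - 2 - int i) (md F (wX + int i) (xp (3 * int p - 1))) \<in> grd (- int p - 1) 0"
  by (rule grd_cong[OF FF_grd]) simp_all
 moreover have "lookup (md F (wX - 2 - int i) (md F (wX + int i) (xp (3 * int p - 1)))) ({#}, - int p - 1)
  = (-1) ^ (p - 1 - i) * of_nat ((2 * p) choose (p - 1 - i))"
 proof -
  have "lookup (md (xp (tp * -1)) (wX - 2 - int i) (md (xp (tp * -1)) (wX + int i) (xp (3 * int p - 1))))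
    ({#}, tp * -1 + tp * -1 + (3 * int p - 1)) = fps_nth (bn (tp * (-1 * -1))) (p - 1 - i)"
   by (rule exp_exp_coeff) (use True in \<open>simp_all add: wX_def of_nat_diff\<close>)
  moreover have "tp * -1 + tp * -1 + (3 * int p - 1) = - int p - 1" by simp
  moreover have "fps_nth (bn (tp * (-1 * -1))) (p - 1 - i) = (-1) ^ (p - 1 - i) * of_nat ((2 * p) choose (p - 1 - i))"
   using binomial_gbinomial[of "2 * p" "p - 1 - i", where 'a = complex] by simp
  ultimately show ?thesis unfolding F_exp by (simp only:)
 qed
 ultimately have "md F (wX - 2 - int i) (md F (wX + int i) (xp (3 * int p - 1)))
  = sc ((-1) ^ (p - 1 - i) * of_nat ((2 * p) choose (p - 1 - i))) (xp (- int p - 1))"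
  by (drule_tac grd_0_eq) (simp only:)
 with True show ?thesis by (simp only: if_True)
next
 case False
 then have "md F (wX + int i) (xp (3 * int p - 1)) = 0"
  unfolding F_exp by (intro exp_exp_zero) (simp add: wX_def)
 then show ?thesis using False by (simp add: md_lin)
qed

text \<open>k = 3p - 1 is the first value at which two modes of F reach level 0. The resulting sum
  is the coefficient of degree p - 1 in (1 - Y)^(-2) (1 - Y)^(2p) = (1 - Y)^(2p-2), a nonzero
  binomial coefficient up to sign.\<close>

lemma P1_nonzero: "poly P1 (hh (int (3 * p - 1))) ~= 0"
proof
 assume 0: "poly P1 (hh (int (3 * p - 1))) = 0"
 let ?c = "%i. (-1) ^ (p - 1 - i) * of_nat ((2 * p) choose (p - 1 - i)) :: complex"
 let ?q = "(-1) ^ p * of_nat ((2 * p) choose p) :: complex"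
 have k: "int (3 * p - 1) = 3 * int p - 1" using p2 by simp
 have "0 = Sum_any (%i. sc (of_nat (i + 1)) (Q (Q (md F (wX - 2 - int i) (md F (wX + int i) (xp (3 * int p - 1)))))))"
  using P1_eval[of "3 * p - 1"] 0 unfolding k by simp
 also have "... = (\<Sum>i<p. sc (of_nat (i + 1)) (Q (Q (md F (wX - 2 - int i) (md F (wX + int i) (xp (3 * int p - 1)))))))"
  by (rule Sum_any_nat) (simp add: FF_exp Q_lin)
 also have "... = (\<Sum>i<p. sc (of_nat (i + 1) * ?c i * ?q) (xp (3 * int p - 1)))"
 proof (rule sum.cong[OF refl])
  fix i assume "i \<in> {..<p}"
  then have e: "md F (wX - 2 - int i) (md F (wX + int i) (xp (3 * int p - 1))) = sc (?c i) (xp (- int p - 1))"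
   by (simp only: FF_exp lessThan_iff if_True)
  show "sc (of_nat (i + 1)) (Q (Q (md F (wX - 2 - int i) (md F (wX + int i) (xp (3 * int p - 1))))))
   = sc (of_nat (i + 1) * ?c i * ?q) (xp (3 * int p - 1))"
   unfolding e Q_lin Q_Q_exp sc_sc mult.assoc ..
 qed
 also have "... = sc ((\<Sum>i<p. of_nat (i + 1) * ?c i) * ?q) (xp (3 * int p - 1))"
  unfolding fock.scale_sum_left sum_distrib_right ..
 finally have "(\<Sum>i<p. of_nat (i + 1) * ?c i) * ?q = 0"
  using lat_exp_inj(2)[of "3 * int p - 1"] unfolding eq_commute[of "0 :: fock"] fock.scale_eq_0_iff by blast
 moreover have "(\<Sum>i<p. of_nat (i + 1) * ?c i) = (-1) ^ (p - 1) * of_nat ((2 * p - 2) choose (p - 1))"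
 proof -
  have e: "fps_nth (bn (int m)) i = (-1) ^ i * of_nat (m choose i)" for m i
   using binomial_gbinomial[of m i, where 'a = complex] by simp
  have "bn (-2) * bn (tp) = bn (int (2 * p - 2))"
   unfolding bn_add[symmetric] using p2 by (intro arg_cong[where f = bn]) (simp add: of_nat_diff)
  then have "fps_nth (bn (int (2 * p - 2))) (p - 1) = (\<Sum>i=0..p - 1. fps_nth (bn (-2)) i * fps_nth (bn (tp)) (p - 1 - i))"
   by (metis fps_mult_nth)
  also have "... = (\<Sum>i<p. of_nat (i + 1) * ?c i)"
  proof (rule sum.cong)
   show "{0..p - 1} = {..<p}" using p2 by auto
   show "fps_nth (bn (-2)) i * fps_nth (bn (tp)) (p - 1 - i) = of_nat (i + 1) * ?c i" for i
    unfolding e using bn_neg_nth[of 1 i] by simp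
  qed
  finally show ?thesis unfolding e by simp
 qed
 moreover have "(2 * p - 2) choose (p - 1) ~= 0" "(2 * p) choose p ~= 0" by (simp_all add: binomial_eq_0_iff)
 ultimately show False by simp
qed

section \<open>Identification of the two polynomials\<close>

definition R0 :: "complex poly" where "R0 = (\<Prod>j<2 * p - 1. [:- hh (int j), 1:])"
text \<open>As \<open>hh (int j)\<close> is h_{j+1,1}, the factors of \<open>R0\<close> and
  \<open>R1\<close> belong to the indices 1, ..., 2p - 1 and 2p, ..., 3p - 1.\<close>

definition R1 :: "complex poly" where "R1 = (\<Prod>j=2 * p - 1..<3 * p - 1. [:- hh (int j), 1:])"

lemma hh_diff: "hh k - hh l = of_int ((k - l) * (k + l - 2 * int p + 2)) / of_nat (4 * p)"
 unfolding hh_def by (simp add: diff_divide_distrib[symmetric] algebra_simps)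

lemma hh_eq_iff: "hh k = hh l \<longleftrightarrow> k = l \<or> k + l = 2 * int p - 2"
proof -
 have "hh k = hh l \<longleftrightarrow> hh k - hh l = 0" by simp
 also have "... \<longleftrightarrow> (k - l) * (k + l - 2 * int p + 2) = 0" unfolding hh_diff using p0 by (simp only: divide_eq_0_iff of_int_eq_0_iff of_nat_eq_0_iff) auto
 also have "... \<longleftrightarrow> k = l \<or> k + l = 2 * int p - 2" by auto
 finally show ?thesis .
qed

lemma inj_hh: "inj_on (%j. hh (int j)) {p - 1..}"
 by (rule inj_onI) (auto simp: hh_eq_iff)

text \<open>Interpolation at p + 1 points: p zeros and one nonzero value for a polynomial of degree
  at most p. The points are distinct since the weights are injective in k from p - 1 on.\<close>

lemma P1_eq: "\<exists>c. c ~= 0 \<and> P1 = smult c R1"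
proof -
 let ?z = "hh (int (3 * p - 1))"
 let ?A = "(%j. hh (int j)) ` {2 * p - 1..<3 * p}"
 have R1: "poly R1 x = (\<Prod>j=2 * p - 1..<3 * p - 1. x - hh (int j))" for x
  unfolding R1_def poly_prod by simp
 have nz: "poly R1 ?z ~= 0" unfolding R1 using p2 by (auto simp: hh_eq_iff)
 define c where "c = poly P1 ?z / poly R1 ?z"
 have "P1 = smult c R1"
 proof (rule poly_eqI_degree[where A = ?A])
  fix x assume "x \<in> ?A"
  then obtain j where j: "2 * p - 1 \<le> j" "j < 3 * p" "x = hh (int j)" by auto
  show "poly P1 x = poly (smult c R1) x"
  proof (cases "j = 3 * p - 1")
   case True then show ?thesis using nz by (simp add: j c_def)
  next
   case False
   then have "j \<in> {2 * p - 1..<3 * p - 1}" using j by auto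
   then show ?thesis using P1_roots[of j] by (auto simp: R1 j(3))
  qed
 next
  have "card ?A = card {2 * p - 1..<3 * p}" by (rule card_image) (rule inj_on_subset[OF inj_hh], auto)
  then have A: "card ?A > p" using p2 by simp
  then show "degree P1 < card ?A" using degree_P1 by simp
  have "degree R1 \<le> (\<Sum>j=2 * p - 1..<3 * p - 1. degree [:- hh (int j), 1:])"
   unfolding R1_def by (rule order_trans[OF degree_prod_sum_le]) (simp_all add: o_def)
  then have "degree R1 \<le> p" using p2 by simp
  then show "degree (smult c R1) < card ?A" using A Polynomial.degree_smult_le[of c R1] by linarith
 qed
 moreover have "c ~= 0" using nz P1_nonzero by (simp add: c_def)
 ultimately show ?thesis by blast
qed

text \<open>The difference of the weights for k and j is (k - j)(k - (2p - 2 - j))/(4p), so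
  reflection of j turns the value of \<open>R0\<close> into the square of a falling factorial.
  Agreement at infinitely many weights replaces a degree bound.\<close>

lemma P0_eq: "\<exists>c. c ~= 0 \<and> P0 = smult c R0"
proof -
 let ?n = "2 * p - 1"
 let ?a = "of_nat (4 * p) :: complex"
 have a: "?a ~= 0" using p0 by simp
 have R0: "poly R0 (hh (int k)) = (fact ?n)\<^sup>2 / ?a ^ ?n * (of_nat (k choose ?n))\<^sup>2" for k
 proof -
  have "poly R0 (hh (int k)) = (\<Prod>j<?n. hh (int k) - hh (int j))" unfolding R0_def poly_prod by simp
  also have "... = (\<Prod>j<?n. ((of_nat k - of_nat j) * (of_nat k - of_nat (?n - Suc j))) / ?a)"
   by (rule prod.cong) (auto simp: hh_diff of_nat_diff algebra_simps)
  also have "... = (\<Prod>j<?n. of_nat k - of_nat j) * (\<Prod>j<?n. of_nat k - of_nat (?n - Suc j)) / ?a ^ ?n"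
   by (simp add: prod_dividef prod.distrib)
  also have "(\<Prod>j<?n. of_nat k - of_nat (?n - Suc j)) = (\<Prod>j<?n. of_nat k - of_nat j :: complex)"
   by (rule prod.nat_diff_reindex)
  also have "(\<Prod>j<?n. of_nat k - of_nat j :: complex) = fact ?n * of_nat (k choose ?n)"
   unfolding binomial_gbinomial by (simp add: gbinomial_prod_rev atLeast0LessThan)
  finally show ?thesis by (simp add: power2_eq_square)
 qed
 define c where "c = ?a ^ ?n / (fact ?n)\<^sup>2"
 have c: "c ~= 0" using a by (simp add: c_def)
 have e: "poly (P0 - smult c R0) (hh (int k)) = 0" for k
  using a by (simp add: P0_eval R0 c_def)
 have "P0 - smult c R0 = 0"
 proof (rule ccontr)
  assume "P0 - smult c R0 ~= 0"
  then have "finite {x. poly (P0 - smult c R0) x = 0}" by (rule poly_roots_finite)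
  then have "finite ((%j. hh (int j)) ` {p - 1..})" by (rule finite_subset[rotated]) (use e in auto)
  then have "finite {p - 1..}" using inj_hh by (metis finite_imageD)
  then show False using infinite_Ici by blast
 qed
 then show ?thesis using c by auto
qed

lemma Q_X: "a \<in> VV 0 ==> Q (X w a n b) = X w (Q a) n b + X w a n (Q b)"
 unfolding X_def cv_flin[OF bdd_md flin_Q]
 by (simp only: Q_md) (rule cv_add[OF bdd_md bdd_md])

lemma Q_WS: "a \<in> WS n ==> Q a \<in> WS n"
 by (auto simp: WS_def L_Q Q_lin)

lemma Q_ZO: "x \<in> ZO ==> Q x \<in> ZO"
proof (induction rule: ZO_induct)
 case (base w a b)
 have "zb 2 a b = X w a (-2) b" using zb_hom[OF base(1)] by simp
 then show ?case
  using X_ZO[OF Q_WS[OF base(1)] base(2), of 2] X_ZO[OF base(1) Q_W[OF base(2)], of 2]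
  by (simp add: Q_X W_VV WS_W[OF base(1)] ZO_add)
qed (simp_all add: Q_lin ZO_add ZO_scale)

lemma Q_Om: "Q (Om y) = Om (Q y)"
 unfolding Om_def zb_hom[OF conf_WS] X_conf by (simp add: Q_lin L_Q)

lemma Q_pol: "Q (pol Om P y) = pol Om P (Q y)"
 by (induction P) (simp_all add: pol_pCons[OF flin_Om] Q_lin Q_Om)

text \<open>Q commutes with multiplication by \<omega> and preserves O(V), so the relation for F
  passes on to H and E.\<close>

lemma R1_gen: "u \<in> {F, H, E} ==> pol Om R1 u \<in> ZO"
proof -
 obtain c where c: "c ~= 0" "P1 = smult c R1" using P1_eq by blast
 have "sc (1 / c) (pol Om P1 F) \<in> ZO" by (intro ZO_scale F_Zhu)
 then have 1: "pol Om R1 F \<in> ZO" using c by (simp add: pol_smult)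
 have 2: "pol Om R1 H \<in> ZO" using Q_ZO[OF 1] by (simp add: Q_pol H_def)
 have 3: "pol Om R1 E \<in> ZO" using Q_ZO[OF 2] by (simp add: Q_pol E_def)
 from 1 2 3 show "u \<in> {F, H, E} ==> pol Om R1 u \<in> ZO" by auto
qed

lemma Om_star: "y \<in> W ==> z \<in> W ==> Om (y ** z) - Om y ** z \<in> ZO"
 unfolding Om_def using star_assoc[of om y z] ZO_uminus[of "(om ** y) ** z - om ** (y ** z)"] by simp

lemma pol_star: assumes "y \<in> W" "z \<in> W" shows "pol Om P (y ** z) - pol Om P y ** z \<in> ZO"
proof (induction P)
 case 0 then show ?case by (simp add: zb_0)
next
 case (pCons a P)
 have "pol Om (pCons a P) (y ** z) - pol Om (pCons a P) y ** z
  = Om (pol Om P (y ** z) - pol Om P y ** z) + (Om (pol Om P y ** z) - Om (pol Om P y) ** z)"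
  using assms by (simp add: pol_pCons[OF flin_Om] Om_lin zb_add zb_scale pol_W Om_W W_scale)
 also have "... \<in> ZO" using assms by (intro ZO_add Om_ZO pCons.IH Om_star pol_W)
 finally show ?case .
qed

text \<open>\<open>R1\<close> of [\<omega>] annihilates [H] and therefore its square, which is a
  multiple of \<open>R0\<close> of [\<omega>].\<close>

lemma R0_R1_one: "pol Om (R0 * R1) 1 \<in> ZO"
proof -
 obtain c where c: "c ~= 0" "P0 = smult c R0" using P0_eq by blast
 have 1: "pol Om R1 (H ** H) - pol Om R1 (pol Om P0 1) \<in> ZO"
  using pol_ZO[OF HH_Zhu] by (simp only: flin_diff[OF flin_pol[OF flin_Om]])
 have 2: "pol Om R1 (H ** H) - pol Om R1 H ** H \<in> ZO" by (rule pol_star[OF H_W H_W])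
 have 3: "pol Om R1 H ** H \<in> ZO" by (rule ZO_right[OF H_W R1_gen]) simp
 have "pol Om R1 (H ** H) \<in> ZO" using ZO_add[OF 2 3] by simp
 with 1 have "pol Om R1 (pol Om P0 1) \<in> ZO" by (rule ZO_cancel)
 then have "sc (1 / c) (pol Om R1 (pol Om P0 1)) \<in> ZO" by (rule ZO_scale)
 then have "pol Om R1 (pol Om R0 1) \<in> ZO" unfolding c(2) pol_smult flin_scale[OF flin_pol[OF flin_Om]] using c(1) by simp
 then show ?thesis by (simp add: pol_mult[OF flin_Om] pol_commute[OF flin_Om, of R0])
qed

end

section \<open>Generation of the triplet algebra\<close>

context rank_one begin

text \<open>x arises from 1 by Virasoro modes, so its modes cannot lead below the primary vector t;
  a mode of index q \<ge> N lowers the weight.\<close>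

lemma UL_lowering:
 assumes t: "\<forall>m>0. L m t = 0" "L 0 t = sc n t"
 shows "UL 0 1 N x P ==> q >= int N ==> md x q t = 0"
proof (induction arbitrary: q rule: UL.induct)
 case (UL_step N x P j)
 have x: "x \<in> VV 0" using UL_WS[OF UL_step.hyps one_WS] WS_W W_VV by blast
 have 1: "md om (- int j - int i) (md x (q + int i) t) = 0" for i
  using UL_step.IH[of "q + int i"] UL_step.prems by (simp add: md_lin)
 have 2: "md x (q + - int j - int i) (L (int i - 1) t) = 0" for i
 proof -
  consider "i = 0" | "i = 1" | "i >= 2" by linarith
  then show ?thesis
  proof cases
   case 1
   then show ?thesis using md_L_minus_one[OF x, of "q - int j" t] UL_step.IH UL_step.prems by (simp add: L_lin)
  next
   case 2
   then show ?thesis using UL_step.IH[of "q - int j - 1"] UL_step.prems by (simp add: t md_lin)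
  next
   case 3
   then show ?thesis using t(1) by (simp add: md_lin)
  qed
 qed
 have "md (L (- int (Suc j)) x) q t = md (md om (- int j) x) q t" by (simp add: L_def)
 then show ?case unfolding Jac_iterate[OF Jac_VL[OF conf_VV x]] 1 md_conf 2 by simp
qed (simp_all add: md_one md_lin)

lemma low_primary: assumes "\<forall>m>0. L m t = 0" "L 0 t = sc n t" shows "low {0} t 0 1"
 unfolding low_def
proof (intro conjI allI impI)
 show "fock.subspace {0}" by (simp add: fock.subspace_def)
 fix N x P and s r :: int assume x: "UL 0 1 N x P"
 { assume "s >= 0"
  then have "md x (0 + int N + s) t = 0" by (intro UL_lowering[OF assms x]) simp
  then show "L (- r) (md x (0 + int N + s) t) \<in> {0}" by (simp add: L_lin) }
 { assume "s >= 1" then show "md x (0 + int N - 1 - s) (L s t) \<in> {0}" using assms by (simp add: md_lin) }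
qed

text \<open>j(j - 2p + 2) is at most 0 for 0 \<le> j \<le> 2p - 2.\<close>

lemma R0_root: assumes "poly R0 (of_int n) = 0" shows "n \<le> 0"
proof -
 obtain j where j: "j < 2 * p - 1" "of_int n = hh (int j)" using assms by (auto simp: R0_def poly_prod)
 then have "of_int n * of_nat (4 * p) = (of_int (int j * (int j - 2 * int p + 2)) :: complex)" using p0 by (simp add: hh_def)
 then have "of_int (n * int (4 * p)) = (of_int (int j * (int j - 2 * int p + 2)) :: complex)" by simp
 then have e: "n * int (4 * p) = int j * (int j - 2 * int p + 2)" by (simp only: of_int_eq_iff)
 have "int j * (int j - 2 * int p + 2) \<le> 0" using j(1) by (intro mult_nonneg_nonpos) auto
 then show ?thesis using e p2 by (metis mult_pos_pos not_le of_nat_0_less_iff zero_less_mult_iff zero_less_numeral p0(1))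
qed

lemma R1_root: assumes "poly R1 (of_int n) = 0" shows "n < 2 * int p - 1"
proof -
 obtain j where j: "j < 3 * p - 1" "2 * p - 1 \<le> j" "of_int n = hh (int j)" using assms by (auto simp: R1_def poly_prod)
 then have "of_int n * of_nat (4 * p) = (of_int (int j * (int j - 2 * int p + 2)) :: complex)" using p0 by (simp add: hh_def)
 then have "of_int (n * int (4 * p)) = (of_int (int j * (int j - 2 * int p + 2)) :: complex)" by simp
 then have e: "n * int (4 * p) = int j * (int j - 2 * int p + 2)" by (simp only: of_int_eq_iff)
 have "int j * (int j - 2 * int p + 2) \<le> (3 * int p - 2) * int p" using j p2 by (intro mult_mono) auto
 also have "... < (2 * int p - 1) * int (4 * p)"
  using p2 mult_strict_right_mono[of "3 * int p - 2" "4 * (2 * int p - 1)" "int p"] by simp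
 finally show ?thesis using e p2 by (metis mult_less_cancel_right not_less of_nat_0_less_iff of_nat_0_le_iff)
qed

text \<open>Charge 0 and weight 1 leave only multiples of \<alpha>(-1) 1, and the screening operator
  sends this vector to twice exp(-\<alpha>/p).\<close>

lemma W_hg_0_1: assumes "y \<in> W \<inter> hg 0 1" shows "y = 0"
proof -
 have y: "y \<in> grd 0 1" using assms by (simp add: hg_def wq_def)
 have "al 1 y \<in> grd 0 0" using heis_grd[OF y, of 1] by simp
 then obtain c where c: "al 1 y = sc c 1" using grd_0_eq unfolding one_eq_lat_exp by blast
 define c' where "c' = c / of_nat (2 * p)"
 let ?z = "y - sc c' (al (-1) 1)"
 have a1: "al (-1) 1 \<in> grd 0 1" unfolding one_eq_lat_exp by (rule heis_grd'[OF lat_exp_grd]) simp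
 have z: "?z \<in> grd 0 1" using y a1 unfolding grd_def by (intro supp_diff supp_scale)
 have "?z = 0"
 proof (rule vacuum_vector_eq_0[OF z])
  fix r :: int assume r: "r > 0"
  show "al r ?z = 0"
  proof (cases "r = 1")
   case True
   have "al 1 (al (-1) 1) = sc (2 * of_nat p) 1" by (simp add: heis_comm[of 1 "-1"] heis_one' heis_lin)
   then show ?thesis using p0 by (simp add: True flin_diff[OF flin_heis] heis_lin c c'_def)
  next
   case False
   then show ?thesis using r by (intro grd_neg[OF _ heis_grd[OF z]]) simp
  qed
 qed simp
 then have y': "y = sc c' (al (-1) 1)" by simp
 have "al (-1) (Qt 1) = Qt (al (-1) 1) + sc (-2) (md ee (-1) 1)"
  using heis_ek[of "-1" "-2" 0 1] unfolding Qt_def md_lat_exp by simp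
 then have "Qt (al (-1) 1) = sc 2 ee" using W_Qt[OF one_W] by (simp add: md_right_one heis_lin)
 then have "sc (c' * 2) ee = 0" using W_Qt[of y] assms unfolding y' by (simp add: Qt_lin)
 then have "c' = 0" using lat_exp_inj(2)[of "-2"] by simp
 then show ?thesis using y' by simp
qed

text \<open>In F(x) u the creation factor starts with 1, so the last nonzero mode is read off from
  the largest \<open>j0\<close> whose annihilation coefficient is nonzero. The coefficient with j =
  0 is nonzero, which gives the bound on r.\<close>

lemma F_leading:
 assumes u: "u \<in> hg 1 n" "u ~= 0"
 shows "EX r>=2 * int p - 1. md F r u ~= 0 \<and> (\<forall>r'>r. md F r' u = 0)"
proof -
 let ?k = "- tp"
 define y where "y = xp ?k * u"
 have "xp (tp) * y = u"
  unfolding y_def mult.assoc[symmetric] lat_exp_mult by (simp add: one_eq_lat_exp[symmetric])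
 then have y: "y ~= 0" using u(2) by auto
 obtain I where I: "!!j. j >= I ==> ann ?k j y = 0" using ann_evz[of ?k y] unfolding evz_def by blast
 define j0 where "j0 = Max {j. ann ?k j y ~= 0}"
 have fin: "finite {j. ann ?k j y ~= 0}" by (rule finite_subset[of _ "{..<I}"]) (use I in \<open>auto simp: not_less[symmetric]\<close>)
 have ne: "0 \<in> {j. ann ?k j y ~= 0}" using y by simp
 have j0: "ann ?k j0 y ~= 0" using Max_in[OF fin] ne unfolding j0_def by blast
 have gt: "ann ?k j y = 0" if "j > j0" for j using Max_ge[OF fin, of j] that unfolding j0_def by fastforce
 have ch: "u \<in> chs {tp}" using grd_chs u(1) unfolding hg_def by (simp add: grd_chs)
 have d: "?k * tp div tp = ?k" by (rule nonzero_mult_div_cancel_right) (use p2 in simp)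
 have F: "md F r u = Sum_any (%j. crez ?k (int j - r - 1 + tp) (ann ?k j y))" for r
  unfolding F_def md_lat_exp ek_chs[OF ch] ekc_def d y_def[symmetric] by simp
 have "md F (int j0 + 2 * int p - 1) u = Sum_any (%j. if j = j0 then ann ?k j0 y else 0)"
  unfolding F
 proof (rule Sum_any.cong)
  fix j
  consider "j < j0" | "j = j0" | "j > j0" by linarith
  then show "crez ?k (int j - (int j0 + 2 * int p - 1) - 1 + tp) (ann ?k j y) = (if j = j0 then ann ?k j0 y else 0)"
  proof cases
   case 3 show ?thesis using 3 by (simp only: gt[OF 3] flin_zero[OF flin_crez] if_False less_imp_neq[THEN not_sym])
  qed (simp_all add: crez_def)
 qed
 then have "md F (int j0 + 2 * int p - 1) u ~= 0" using j0 by simp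
 moreover have "md F r u = 0" if "r > int j0 + 2 * int p - 1" for r
 proof -
  have "crez ?k (int j - r - 1 + tp) (ann ?k j y) = 0" for j
  proof (cases "j > j0")
   case False
   then show ?thesis using that by (simp add: crez_def)
  qed (simp only: gt flin_zero[OF flin_crez])
  then show ?thesis unfolding F by simp
 qed
 ultimately show ?thesis by (intro exI[of _ "int j0 + 2 * int p - 1"]) auto
qed

text \<open>A nonzero u of minimal weight is a lowest weight vector, and so is v, its last nonzero
  image under the modes of F, which has charge 0 and smaller weight m. The relation for H * H on v
  gives \<open>P0\<close>(m) = 0, hence m = 0, and this last case is excluded by L(1).\<close>

lemma W_charge_1: "u \<in> W \<inter> hg 1 n ==> n < 2 * int p - 1 ==> u = 0"
proof (induction "nat n" arbitrary: n u rule: less_induct)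
 case less
 have VF: "F \<in> VV 0" by (rule hg_VV[OF F_hg])
 show ?case
 proof (rule ccontr)
  assume u0: "u ~= 0"
  have u: "u \<in> W" "u \<in> hg 1 n" using less.prems by auto
  have n: "n >= 1" using hg_neg[OF u(2)] u0 by (fastforce simp: wq_def)
  have IH: "v = 0" if "v \<in> W" "v \<in> hg 1 m" "m < n" for v m
  proof (cases "m < 0")
   case True then show ?thesis using hg_neg[OF that(2)] by (simp add: wq_def)
  next
   case False then show ?thesis using less.hyps[of m v] that less.prems(2) by auto
  qed
  obtain r where r: "r >= 2 * int p - 1" "md F r u ~= 0" "!!r'. r' > r ==> md F r' u = 0" using F_leading[OF u(2) u0] by blast
  define v where "v = md F r u"
  define m where "m = n + 2 * int p - 2 - r"
  have v: "v \<in> W" "v \<in> hg 0 m" "v ~= 0"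
  proof -
   show "v \<in> W" unfolding v_def by (rule md_W[OF F_W u(1)])
   show "v \<in> hg 0 m" unfolding v_def m_def by (rule hg_cong[OF md_hg[OF F_hg u(2)]]) simp_all
   show "v ~= 0" unfolding v_def by (rule r(2))
  qed
  have m: "m < n" "m >= 0"
  proof -
   show "m < n" using r(1) by (simp add: m_def)
   have "\<not> m < wq 0" using hg_neg[OF v(2)] v(3) by blast
   then show "m >= 0" by (simp add: wq_def)
  qed
  have Lu: "L s u = 0" if "s > 0" for s
   by (rule IH[OF L_W[OF u(1)] L_hg[OF u(2)]]) (use that in simp)
  have com: "L s (md F q u) = md F q (L s u) + sc (of_int (s + 1) * (of_int wX - 1) - of_int q) (md F (s + q) u)" for s q
   unfolding wX_def by (rule primary_commutator[OF primary_F Jac_VL[OF conf_VV VF] Jac_one(1)[OF VF]])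
  have Lv: "\<forall>s>0. L s v = 0"
  proof (intro allI impI)
   fix s :: int assume s: "s > 0"
   show "L s v = 0" unfolding v_def com Lu[OF s] r(3)[of "s + r", simplified, OF s] by (simp add: md_lin)
  qed
  have Hv: "md H s v = 0" if "s >= 2 * int p - 2" for s
  proof -
   have "md F s v = 0" by (rule hg_neg[OF md_hg[OF F_hg v(2)]]) (use that m less.prems(2) in \<open>simp add: wq_def\<close>)
   moreover have "Q v = 0" by (rule IH[OF Q_W[OF v(1)] hg_cong[OF Q_hg[OF v(2)]] m(1)]) simp_all
   moreover have "Q (md F s v) = md H s v + md F s (Q v)" unfolding H_def by (rule Q_md[OF VF])
   ultimately show ?thesis by (simp add: Q_lin md_lin)
  qed
  have L0v: "L 0 v = sc (of_int m) v" by (rule L0_hg[OF v(2)])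
  have "md H (wX - 1 + int i) v = 0" "md H (wX + int i) v = 0" for i by (rule Hv; simp add: wX_def)+
  then have "sc (poly P0 (of_int m)) v = 0"
   using HH_zero_mode[OF L0v low_primary[OF Lv L0v]] by (simp add: md_lin)
  then have "poly P0 (of_int m) = 0" using v(3) by simp
  then have "poly R0 (of_int m) = 0" using P0_eq by auto
  then have m0: "m = 0" using R0_root[of m] m(2) by simp
  \<comment> \<open>There is no vector of charge 0 and weight 1, so applying L(1) to F_{r-1} u shows
    that a multiple of v is 0. The scalar 2(2p - 2) - (r - 1) equals 2p - 1 - n, which is
    positive.\<close>
  have "md F (r - 1) u \<in> hg 0 1" by (rule hg_cong[OF md_hg[OF F_hg u(2)]]) (use m0 in \<open>simp_all add: m_def\<close>)
  then have "md F (r - 1) u = 0" using md_W[OF F_W u(1)] by (intro W_hg_0_1 IntI)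
  then have "sc (of_int 2 * (of_int wX - 1) - of_int (r - 1)) v = 0"
   using com[of 1 "r - 1"] Lu[of 1] by (simp add: L_lin md_lin v_def)
  then have "of_int (2 * (wX - 1) - (r - 1)) = (0 :: complex)" using v(3) by simp
  then have "2 * (wX - 1) - (r - 1) = 0" by (simp only: of_int_eq_0_iff)
  then show False using m0 less.prems(2) by (simp add: m_def wX_def)
 qed
qed

section \<open>Strong generation by induction on the weight\<close>

definition gens :: "(int \<times> fock) set" where "gens = {(2, om), (wX, F), (wX, H), (wX, E)}"

lemma gens_WS: "(w, x) \<in> gens ==> x \<in> WS w" and gens_wt: "(w, x) \<in> gens ==> w >= 2"
 using conf_WS F_WS H_WS E_WS p2 by (auto simp: gens_def wX_def)

text \<open>\<open>CC n\<close> keeps track of weights, so that recursion to smaller weights is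
  possible. \<open>CU\<close> below admits arbitrary u and is easier to close under operations;
  \<open>hc_CU\<close> leads back from \<open>CU\<close> to \<open>CC\<close>.\<close>

definition CC :: "int => fock set" where
 "CC n = fock.span ({md x (-1 - int r) u | x r u w j. (w, x) \<in> gens \<and> u \<in> WS j \<and> w + j + int r = n} \<union> {v. v = 1 \<and> n = 0})"

definition CU :: "fock set" where
 "CU = fock.span ({md x (-1 - int r) u | x r u w. (w, x) \<in> gens \<and> u \<in> W} \<union> {1})"

lemma CU_gen: "(w, x) \<in> gens ==> u \<in> W ==> q < 0 ==> md x q u \<in> CU"
proof -
 assume a: "(w, x) \<in> gens" "u \<in> W" "q < 0"
 define r where "r = nat (- q - 1)"
 have q: "q = -1 - int r" using a(3) by (simp add: r_def)
 show ?thesis unfolding CU_def q by (rule fock.span_base) (use a in blast)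
qed

lemma CU_one: "1 \<in> CU" unfolding CU_def by (rule fock.span_base) simp

lemma CU_subspace: "fock.subspace CU" unfolding CU_def by (rule fock.subspace_span)

lemma CC_CU: "CC n \<subseteq> CU"
 unfolding CC_def CU_def by (rule fock.span_mono) (use WS_W in blast)

lemma CU_induct [consumes 1, case_names gen one zero add scale]:
 assumes "x \<in> CU" "!!w x r u. (w, x) \<in> gens ==> u \<in> W ==> Pr (md x (-1 - int r) u)" "Pr 1" "Pr 0"
  "!!x y. Pr x ==> Pr y ==> Pr (x + y)" "!!c x. Pr x ==> Pr (sc c x)"
 shows "Pr x"
 using assms(1) unfolding CU_def by (induction rule: fock.span_induct_alt) (use assms in blast)+

lemma hc_CU: "x \<in> CU ==> hc n x \<in> CC n"
proof (induction rule: CU_induct)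
 case (gen w x r u)
 from gen(2) show ?case
 proof (induction u rule: W_induct)
  case (hom m u k)
  then have u: "u \<in> WS m" by (rule W_hg_WS)
  have "md x (-1 - int r) u \<in> WS (w + m + int r)" using md_WS[OF gens_WS[OF gen(1)] u, of "-1 - int r"] by (simp add: algebra_simps)
  note e = hc_hom[OF this, of n]
  show ?case
  proof (cases "n = w + m + int r")
   case True
   then have "md x (-1 - int r) u \<in> CC n" unfolding CC_def by (intro fock.span_base) (use gen(1) u in blast)
   then show ?thesis unfolding e by (simp add: True)
  next
   case False
   then show ?thesis unfolding e by (simp add: CC_def fock.span_zero)
  qed
 next
  case (add a b)
  then show ?case unfolding CC_def by (simp add: md_lin flin_add[OF flin_hc] fock.span_add)
 qed
next
 case one
 show ?case unfolding hc_hom[OF one_WS] CC_def by (auto intro: fock.span_zero fock.span_base)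
qed (auto simp: flin_zero[OF flin_hc] flin_add[OF flin_hc] flin_scale[OF flin_hc] CC_def intro: fock.span_zero fock.span_add fock.span_scale)

text \<open>For r \<ge> 2 this is a negative mode of the generator \<omega>. L(-1) is its mode 0 and
  is moved through a generator mode as a derivation.\<close>

lemma L_minus_CU: assumes "x \<in> CU" "x \<in> W" "r >= 1" shows "L (- r) x \<in> CU"
proof (cases "r = 1")
 case False
 have "md om (1 - r) x \<in> CU" by (rule CU_gen[of 2]) (use assms False in \<open>auto simp: gens_def\<close>)
 then show ?thesis by (simp add: L_def)
next
 case True
 have "L (-1) x \<in> CU" using assms(1)
 proof (induction rule: CU_induct)
  case (gen w x r u)
  have "L (-1) (md x (-1 - int r) u) = md x (-1 - int r) (L (-1) u) - sc (of_int (-1 - int r)) (md x (-1 - int r - 1) u)"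
   using md_L_minus_one[OF W_VV[OF WS_W[OF gens_WS[OF gen(1)]]], of "-1 - int r" u] by (simp only: add_diff_cancel_right')
  also have "... \<in> CU"
   by (intro fock.subspace_diff[OF CU_subspace] fock.subspace_scale[OF CU_subspace] CU_gen[OF gen(1)] L_W gen(2)) simp_all
  finally show ?case .
 next
  case one
  show ?case using Lm1_lat_exp[of 0] by (simp add: one_eq_lat_exp fock.subspace_0[OF CU_subspace])
 qed (auto simp: L_lin intro: fock.subspace_add[OF CU_subspace] fock.subspace_scale[OF CU_subspace] fock.subspace_0[OF CU_subspace])
 with True show ?thesis by simp
qed

lemma GG_UL: "UL 0 1 N x P ==> x \<in> GG" "w0 \<in> {F, H, E} ==> UL (2 * int p - 1) w0 N x P ==> x \<in> GG"
 unfolding GG_def UU_def by (rule fock.span_base, blast)+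

text \<open>The nonnegative products that occur in commutators of generator modes; they stay within
  Virasoro descendants of 1, F, H, E, so reordering creates no new generators.\<close>

lemma gens_products: assumes "(w, x) \<in> gens" "(w', y) \<in> gens" shows "md x (int i) y \<in> GG"
proof -
 have prim: "primary (of_int wX) u" "u \<in> VV 0" if "u \<in> {F, H, E}" for u
  using that primary_F primary_H primary_E hg_VV[OF F_hg] hg_VV[OF H_hg] hg_VV[OF E_hg] unfolding wX_def by blast+
 have d: "L (-1) u \<in> GG" "sc c u \<in> GG" if "u \<in> {F, H, E}" for u c
  using GG_UL(2)[OF that UL_step[OF UL_base, of "2 * int p - 1" u 0]] GG_UL(2)[OF that UL_scale[OF UL_base, of "2 * int p - 1" u c]] by simp_all
 have s: "GG \<inter> {sc c v | c v. v \<in> GG} = {sc c v | c v. v \<in> GG}"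
  unfolding GG_def by (auto intro: fock.span_scale)
 then have sc: "sc c v \<in> GG" if "v \<in> GG" for c v using that by blast
 consider (a) "x = om" "y = om" | (b) "x = om" "y \<in> {F, H, E}" | (c) "x \<in> {F, H, E}" "y = om" | (d) "x \<in> {F, H, E}" "y \<in> {F, H, E}"
  using assms by (auto simp: gens_def)
 then show ?thesis
 proof cases
  case a
  have w: "UL 0 1 2 om (smult ((-1) ^ Suc 1) ([:of_int (0 + int 0), of_nat 1:] * 1))"
   using UL_step[OF UL_base[of 0 1], of 1] by (simp add: conf_eq numeral_2_eq_2)
  consider "i = 0" | "i = 1" | "i = 2" | "i = 3" | "i >= 4" by linarith
  then show ?thesis
  proof cases
   case 1 show ?thesis unfolding a md_conf 1 using GG_UL(1)[OF UL_step[OF w, of 0]] by simp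
  next
   case 2 show ?thesis unfolding a md_conf 2 using GG_UL(1)[OF UL_scale[OF w, of 2]] by (simp add: L0_conf)
  next
   case 3 show ?thesis unfolding a md_conf 3 by (simp add: L1_conf GG_closed)
  next
   case 4
   have "L 2 om \<in> grd 0 0" using L_grd[OF conf_grd, of 2] by simp
   then obtain c where "L 2 om = sc c 1" unfolding one_eq_lat_exp using grd_0_eq by blast
   then show ?thesis unfolding a md_conf 4 using GG_UL(1)[OF UL_scale[OF UL_base, of 0 1 c]] by simp
  next
   case 5
   have "md om (int i) om = 0" unfolding md_conf by (rule grd_neg[OF _ L_grd[OF conf_grd]]) (use 5 in simp)
   then show ?thesis by (simp add: a GG_closed)
  qed
 next
  case b
  consider "i = 0" | "i = 1" | "i >= 2" by linarith
  then show ?thesis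
  proof cases
   case 1 show ?thesis unfolding b(1) md_conf 1 using d(1)[OF b(2)] by simp
  next
   case 2
   have "L 0 y = sc (of_int wX) y" using prim(1)[OF b(2)] by (simp add: primary_def)
   then show ?thesis unfolding b(1) md_conf 2 using d(2)[OF b(2)] by simp
  next
   case 3
   then have "L (int i - 1) y = 0" using prim(1)[OF b(2)] by (simp add: primary_def)
   then show ?thesis unfolding b(1) md_conf by (simp add: GG_closed)
  qed
 next
  case c
  have "L (-2) (md x (int i) 1) = md x (int i) om + sc (of_int (-2 + 1) * (of_int wX - 1) - of_int (int i)) (md x (-2 + int i) 1)"
   unfolding conf_eq using primary_commutator[OF prim(1)[OF c(1)] Jac_VL[OF conf_VV prim(2)[OF c(1)]] Jac_one(1)[OF prim(2)[OF c(1)]]] by blast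
  then have e: "md x (int i) om = - sc (of_int (-2 + 1) * (of_int wX - 1) - of_int (int i)) (md x (-2 + int i) 1)"
   by (simp add: md_right_one L_lin eq_neg_iff_add_eq_0)
  consider "i = 0" | "i = 1" | "i >= 2" by linarith
  then have "md x (-2 + int i) 1 \<in> GG"
  proof cases
   case 1 then show ?thesis using d(1)[OF c(1)] by (simp add: L_minus_one T_def)
  next
   case 2 then show ?thesis using d(2)[OF c(1), of 1] by (simp add: md_right_one)
  next
   case 3 then show ?thesis by (simp add: md_right_one GG_closed)
  qed
  then show ?thesis unfolding c(2) e by (intro GG_closed(3) sc)
 next
  case d
  then show ?thesis by (intro gen_products) simp_all
 qed
qed

lemma WS_induct [consumes 1, case_names hom zero add]:
 assumes "a \<in> WS n" "!!k a. a \<in> W \<inter> hg k n ==> Pr a" "Pr 0" "!!a b. Pr a ==> Pr b ==> Pr (a + b)"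
 shows "Pr a"
proof -
 obtain A and f :: "int \<times> int => fock" where A: "finite A" "a = sum f A" and f: "!!k n. f (k, n) \<in> W \<inter> hg k n"
  by (rule W_decomp[OF WS_W[OF assms(1)]]) (rule that)
 have "hc n (f x) = (if snd x = n then f x else 0)" for x
  using hc_hom[OF W_hg_WS[OF f[of "fst x" "snd x"]], of n] by (simp add: eq_commute)
 then have P: "Pr (hc n (f x))" for x using f[of "fst x" "snd x"] assms(2,3) by auto
 have "Pr (\<Sum>x\<in>A. hc n (f x))" using A(1) by (induction A rule: finite_induct) (auto simp: assms(3) intro: assms(4) P)
 also have "(\<Sum>x\<in>A. hc n (f x)) = a" using hc_hom[OF assms(1), of n] by (simp add: A(2) flin_sum[OF flin_hc])
 finally show ?thesis .
qed

lemma WS_neg: "a \<in> WS n ==> n < 0 ==> a = 0"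
proof (induction rule: WS_induct)
 case (hom k a)
 then show ?case using hg_neg[of a k n] wq_bounds(1)[of k] by simp
qed simp_all

lemmas CU_add = fock.subspace_add[OF CU_subspace] and CU_scale = fock.subspace_scale[OF CU_subspace]
 and CU_diff = fock.subspace_diff[OF CU_subspace] and CU_0 = fock.subspace_0[OF CU_subspace]
 and CU_Sum_any = subspace_Sum_any[OF CU_subspace]

text \<open>A mode of a descendant is expanded by the iterate formula. Positive Virasoro modes only
  lower the weight of u, so the bound \<open>j < w\<close> is kept, and L(-1) u is removed by
  \<open>md_L_minus_one\<close>.\<close>

lemma UL_modes:
 assumes base: "!!j u q. j < w ==> u \<in> WS j ==> md w0 q u \<in> CU" and w0: "w0 \<in> WS h0"
 shows "UL h0 w0 N y P ==> j < w ==> u \<in> WS j ==> md y q u \<in> CU"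
proof (induction arbitrary: j u q rule: UL.induct)
 case UL_base then show ?case by (rule base)
next
 case (UL_step N y P i)
 have y: "y \<in> W" using UL_WS[OF UL_step.hyps w0] WS_W by blast
 have e: "md (L (- int (Suc i)) y) q u = md (md om (- int i) y) q u" by (simp add: L_def)
 have 1: "md om (- int i - int s) (md y (q + int s) u) \<in> CU" for s
 proof -
  have "L (- (int i + int s + 1)) (md y (q + int s) u) \<in> CU"
   by (rule L_minus_CU[OF UL_step.IH[OF UL_step.prems] md_W[OF y WS_W[OF UL_step.prems(2)]]]) simp
  moreover have "L (- (int i + int s + 1)) = md om (- int i - int s)" unfolding L_def by (rule arg_cong[where f = "md om"]) simp
  ultimately show ?thesis by (simp only:)
 qed
 have 2: "md y r (L (int s - 1) u) \<in> CU" for r s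
 proof -
  consider "s = 0" | "s = 1" | "s >= 2" by linarith
  then show ?thesis
  proof cases
   case 1
   have "L (- 1) (md y r u) \<in> CU"
    by (rule L_minus_CU[OF UL_step.IH[OF UL_step.prems] md_W[OF y WS_W[OF UL_step.prems(2)]]]) simp
   then have "md y r (L (-1) u) \<in> CU"
    unfolding md_L_minus_one[OF W_VV[OF y]] by (intro CU_add CU_scale UL_step.IH[OF UL_step.prems])
   then show ?thesis by (simp add: 1)
  next
   case 2
   then show ?thesis using CU_scale[OF UL_step.IH[OF UL_step.prems]] by (simp add: WS_L0[OF UL_step.prems(2)] md_lin)
  next
   case 3
   show ?thesis by (rule UL_step.IH[OF _ L_WS[OF UL_step.prems(2)]]) (use 3 UL_step.prems(1) in simp)
  qed
 qed
 show ?case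
  unfolding e Jac_iterate[OF Jac_VL[OF conf_VV W_VV[OF y]]] md_conf
  by (intro CU_diff CU_scale CU_Sum_any 1 2)
qed (simp_all add: md_lin CU_0 CU_add CU_scale)

lemma GG_modes:
 assumes base: "!!j u q w0. j < w ==> u \<in> WS j ==> w0 \<in> {1, F, H, E} ==> md w0 q u \<in> CU"
  and "x \<in> GG" "j < w" "u \<in> WS j"
 shows "md x q u \<in> CU"
 using assms(2) unfolding GG_def
proof (induction x rule: fock.span_induct_alt)
 case base then show ?case by (simp add: md_lin CU_0)
next
 case (step c y z)
 have "md y q u \<in> CU"
 proof -
  from step(1) obtain h0 w0 N P where "UL h0 w0 N y P" "w0 \<in> {1, F, H, E}" "w0 \<in> WS h0"
   using one_WS F_WS H_WS E_WS unfolding UU_def wX_def by blast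
  then show ?thesis using UL_modes[of w w0 h0 N y P j u q] base assms(3,4) by blast
 qed
 then show ?case using step(2) by (simp add: md_lin CU_add CU_scale)
qed

text \<open>A vector of weight w < n is a combination of vectors x'_{-1-r} u with u of smaller
  weight. Commuting x_q to the right leaves a negative mode of x' in front, and modes of elements of
  \<open>GG\<close> on u, which are covered by the induction on w.\<close>

lemma CU_modes:
 assumes IH: "!!m. m < n ==> WS m \<subseteq> CC m"
 shows "w < n ==> s \<in> WS w ==> (wx, x) \<in> gens ==> md x q s \<in> CU"
proof (induction "nat w" arbitrary: w s wx x q rule: less_induct)
 case less
 have x: "x \<in> W" using WS_W[OF gens_WS[OF less.prems(3)]] .
 have base: "md w0 q u \<in> CU" if "j < w" "u \<in> WS j" "w0 \<in> {1, F, H, E}" for j u q w0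
 proof (cases "w0 = 1 \<or> j < 0")
  case True
  have "u \<in> CU" using IH[of j] CC_CU that less.prems(1) by fastforce
  then show ?thesis using True WS_neg[OF that(2)] by (auto simp: md_one md_lin CU_0)
 next
  case False
  then have "\<exists>wy. (wy, w0) \<in> gens" using that(3) by (auto simp: gens_def)
  then show ?thesis using less.hyps[of j u _ w0 q] that False less.prems(1) by auto
 qed
 show ?case
 proof (cases "q < 0")
  case True then show ?thesis by (rule CU_gen[OF less.prems(3) WS_W[OF less.prems(2)]])
 next
  case False
  have "s \<in> CC w" using IH[OF less.prems(1)] less.prems(2) by blast
  then show ?thesis unfolding CC_def
  proof (induction rule: fock.span_induct_alt)
   case base show ?case by (simp add: md_lin CU_0)
  next
   case (step c y z)
   have "md x q y \<in> CU"
   proof (cases "y = 1")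
    case True then show ?thesis using False by (simp add: md_right_one CU_0)
   next
    case y1: False
    with step(1) obtain x' r u w' j where y: "y = md x' (-1 - int r) u" "(w', x') \<in> gens" "u \<in> WS j" "w' + j + int r = w" by blast
    have j: "j < w" using y(4) gens_wt[OF y(2)] by simp
    have x': "x' \<in> W" by (rule WS_W[OF gens_WS[OF y(2)]])
    have "md x q y = md x' (-1 - int r) (md x q u)
     + Sum_any (%i. sc (of_int q gchoose i) (md (md x (int i) x') (q + (-1 - int r) - int i) u))"
     unfolding y(1) using Jac_commutator[OF Jac_VL[OF W_VV[OF x] W_VV[OF x']], of q "-1 - int r" u] by (simp add: algebra_simps)
    also have "... \<in> CU"
     by (intro CU_add CU_Sum_any CU_scale CU_gen[OF y(2) md_W[OF x WS_W[OF y(3)]]]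
      GG_modes[OF base gens_products[OF less.prems(3) y(2)] j y(3)]) simp_all
    finally show ?thesis .
   qed
   then show ?case using step(2) by (simp add: md_lin CU_add CU_scale)
  qed
 qed
qed

lemma Q_CU: "x \<in> CU ==> Q x \<in> CU"
proof (induction rule: CU_induct)
 case (gen w x r u)
 have "Q om = 0" by (simp add: conf_eq L_Q[symmetric] Q_one L_lin)
 then have "Q x = 0 \<or> (\<exists>w'. (w', Q x) \<in> gens)" using gen(1) by (auto simp: gens_def H_def E_def Q_E[unfolded E_def H_def])
 then have "md (Q x) (-1 - int r) u \<in> CU"
  using CU_gen[OF _ gen(2)] by (auto simp: md_lin CU_0)
 moreover have "md x (-1 - int r) (Q u) \<in> CU" by (rule CU_gen[OF gen(1) Q_W[OF gen(2)]]) simp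
 ultimately show ?case unfolding Q_md[OF W_VV[OF WS_W[OF gens_WS[OF gen(1)]]]] by (rule CU_add)
qed (simp_all add: Q_one Q_lin CU_0 CU_add CU_scale)

text \<open>For t of weight n, every term of the zero-mode relations that first lowers t lies in
  \<open>CU\<close> by induction. The relation for H \<circ> F thus puts \<open>P1\<close>(n) times
  the zero mode of F on t into \<open>CU\<close>, and by Q the same for H; the relation for H * H
  gives H H t = \<open>P0\<close>(n) t modulo \<open>CU\<close>. Together \<open>P0\<close>(n)
  \<open>P1\<close>(n) t lies in \<open>CU\<close>. Where this scalar is 0, n < 2p - 1, and for t of
  charge 0 the zero modes of F and H vanish on t, so \<open>P0\<close>(n) t itself is in
  \<open>CU\<close>; the zeros of \<open>P0\<close> leave n \<le> 0.\<close>

theorem generation: "WS n \<subseteq> CC n"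
proof (induction "nat n" arbitrary: n rule: less_induct)
 case less
 have IH: "WS m \<subseteq> CC m" if "m < n" for m
 proof (cases "m < 0")
  case True
  have "x \<in> CC m" if "x \<in> WS m" for x
   unfolding WS_neg[OF that True] CC_def by (rule fock.span_zero)
  then show ?thesis by blast
 next
  case False then show ?thesis using less that by simp
 qed
 have modes: "md x q s \<in> CU" if "w < n" "s \<in> WS w" "(wx, x) \<in> gens" for w s wx x q
  by (rule CU_modes[OF _ that]) (rule IH)
 have gF: "(wX, F) \<in> gens" and gH: "(wX, H) \<in> gens" by (simp_all add: gens_def)
 have lowCU: "low CU t h0 w0" if t: "t \<in> WS n" and w0: "(h0, w0) \<in> {(0, 1), (wX, F)}" for t h0 w0
  unfolding low_def
 proof (intro conjI allI impI)
  show "fock.subspace CU" by (rule CU_subspace)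
  have w0': "w0 \<in> WS h0" using w0 one_WS F_WS by auto
  have base: "md w0 q u \<in> CU" if "j < n" "u \<in> WS j" for j u q
  proof (cases "w0 = 1")
   case True
   have "u \<in> CU" using IH[OF that(1)] CC_CU that(2) by blast
   then show ?thesis by (simp add: True md_one CU_0)
  next
   case False then show ?thesis using w0 modes[OF that(1,2) gF] by auto
  qed
  fix N x P and s r :: int assume x: "UL h0 w0 N x P"
  { assume sr: "s >= 0" "r >= 1"
   have x': "md x (h0 + int N + s) t \<in> WS (n - s - 1)"
    using md_WS[OF UL_WS[OF x w0'] t, of "h0 + int N + s"] by (simp add: algebra_simps)
   then have "md x (h0 + int N + s) t \<in> CU" using IH[of "n - s - 1"] CC_CU sr(1) by fastforce
   then show "L (- r) (md x (h0 + int N + s) t) \<in> CU" by (rule L_minus_CU[OF _ WS_W[OF x'] sr(2)]) }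
  { assume "s >= 1"
   then have s: "n - s < n" by linarith
   show "md x (h0 + int N - 1 - s) (L s t) \<in> CU"
    by (rule UL_modes[OF _ w0' x s L_WS[OF t]]) (rule base) }
 qed
 have lower: "md x (wX - 1 + int (Suc i)) t \<in> WS (n - int (Suc i))" if "t \<in> WS n" "x \<in> WS wX" for x t i
  using md_WS[OF that(2,1), of "wX - 1 + int (Suc i)"] by (simp add: algebra_simps)
 have idx: "wX - 1 + int (Suc i) = wX + int i" for i by simp
 have o: "md x (wX - 1) t \<in> WS n" if "t \<in> WS n" "x \<in> WS wX" for x t
  using md_WS[OF that(2,1), of "wX - 1"] by simp
 let ?n = "of_int n :: complex"
 have F0: "sc (poly P1 ?n) (md F (wX - 1) t) \<in> CU" if t: "t \<in> WS n" for t
 proof -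
  let ?S = "Sum_any (%i. sc (of_nat (i + 1)) (md H (wX - 2 - int i) (md F (wX + int i) t)))
   - Sum_any (%i. sc (of_nat (i + 1)) (md F (wX - 2 - int i) (md H (wX + int i) t)))"
  have "md H q (md F (wX + int i) t) \<in> CU" "md F q (md H (wX + int i) t) \<in> CU" for q i
   by (rule modes[OF _ lower[OF t F_WS, unfolded idx] gH] modes[OF _ lower[OF t H_WS, unfolded idx] gF]; simp)+
  then have "?S \<in> CU" by (intro CU_diff CU_Sum_any CU_scale)
  moreover have "?S - sc (poly P1 ?n) (md F (wX - 1) t) \<in> CU" by (rule HF_zero_mode[OF WS_L0[OF t] lowCU[OF t]]) simp
  ultimately have "?S - (?S - sc (poly P1 ?n) (md F (wX - 1) t)) \<in> CU" by (rule CU_diff)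
  then show ?thesis by simp
 qed
 have H0: "sc (poly P1 ?n) (md H (wX - 1) t) \<in> CU" if t: "t \<in> WS n" for t
 proof -
  have "Q (sc (poly P1 ?n) (md F (wX - 1) t)) - sc (poly P1 ?n) (md F (wX - 1) (Q t)) \<in> CU"
   by (intro CU_diff Q_CU F0 t Q_WS)
  then show ?thesis by (simp add: Q_lin Q_md hg_VV[OF F_hg] H_def[symmetric] sc_add)
 qed
 have HH: "md H (wX - 1) (md H (wX - 1) t) - sc (poly P0 ?n) t \<in> CU" if t: "t \<in> WS n" for t
 proof -
  let ?f = "%i. md H (wX - 1 - int i) (md H (wX - 1 + int i) t)"
  let ?g = "%i. if i = (0::nat) then ?f 0 else 0"
  have evf: "evz ?f"
  proof -
   obtain B where "!!b. b >= B ==> md H b t = 0" using bdd_md[of H t] unfolding bdd_def by blast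
   then show ?thesis by (intro evzI[of "nat (B - wX + 1)"]) (simp add: md_lin)
  qed
  have "?f i - ?g i \<in> CU" for i
  proof (cases i)
   case (Suc j)
   have "?f i \<in> CU" unfolding Suc by (rule modes[OF _ lower[OF t H_WS] gH]) simp
   then show ?thesis by (simp add: Suc)
  qed (simp add: CU_0)
  then have "Sum_any (%i. ?f i - ?g i) \<in> CU" by (rule CU_Sum_any)
  moreover have "Sum_any (%i. ?f i - ?g i) = Sum_any ?f - ?f 0"
   by (subst Sum_any_diff[OF evf]) (auto intro: evzI[of 1])
  ultimately have 1: "Sum_any ?f - ?f 0 \<in> CU" by simp
  have 2: "Sum_any (%i. md H (wX - 2 - int i) (md H (wX + int i) t)) \<in> CU"
   by (intro CU_Sum_any modes[OF _ lower[OF t H_WS, unfolded idx] gH]) simp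
  have "Sum_any ?f + Sum_any (%i. md H (wX - 2 - int i) (md H (wX + int i) t)) - sc (poly P0 ?n) t \<in> CU"
   by (rule HH_zero_mode[OF WS_L0[OF t] lowCU[OF t]]) simp
  from CU_diff[OF CU_diff[OF this 2] 1] show ?thesis by simp
 qed
 have main: "t \<in> CU" if t: "t \<in> W \<inter> hg k n" for t k
 proof -
  have tn: "t \<in> WS n" using W_hg_WS[OF t] .
  show ?thesis
  proof (cases "poly P0 ?n = 0 \<or> poly P1 ?n = 0")
   case False
   have "sc (poly P1 ?n) (md H (wX - 1) (md H (wX - 1) t))
    - sc (poly P1 ?n) (md H (wX - 1) (md H (wX - 1) t) - sc (poly P0 ?n) t) \<in> CU"
    by (intro CU_diff CU_scale HH[OF tn] H0[OF o[OF tn H_WS]])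
   then have "sc (poly P1 ?n * poly P0 ?n) t \<in> CU" by (simp add: sc_diff)
   then have "sc (1 / (poly P1 ?n * poly P0 ?n)) (sc (poly P1 ?n * poly P0 ?n) t) \<in> CU" by (rule CU_scale)
   then show ?thesis using False by simp
  next
   case True
   then have "poly R0 ?n = 0 \<or> poly R1 ?n = 0" using P0_eq P1_eq by auto
   then have n: "n < 2 * int p - 1" using R0_root[of n] R1_root[of n] p2 by auto
   \<comment> \<open>By \<open>wq_bounds\<close> the charges other than 0 and \<alpha> start in
     weight 2p - 1 or later, and \<open>W_charge_1\<close> disposes of charge \<alpha>.\<close>
   have Wk: "v = 0" if "v \<in> W \<inter> hg l n" "l ~= 0" for v l
    using that n W_charge_1[of v n] wq_bounds(3)[of l] hg_neg[of v l n] by (cases "l = 1") auto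
   show ?thesis
   proof (cases "k = 0")
    case False
    then show ?thesis using Wk[OF t] CU_0 by simp
   next
    case True
    have "md F (wX - 1) t = 0"
     by (rule Wk[of _ "-1"]) (use t True md_W[OF F_W, of t "wX - 1"] hg_cong[OF md_hg[OF F_hg, of t 0 n "wX - 1"], of "-1" n] in \<open>auto simp: wX_def\<close>)
    moreover have "Q t = 0" by (rule Wk[of _ 1]) (use t True Q_W Q_hg[of t 0 n] in auto)
    moreover have "Q (md F (wX - 1) t) = md H (wX - 1) t + md F (wX - 1) (Q t)"
     by (simp add: Q_md hg_VV[OF F_hg] H_def[symmetric])
    ultimately have "md H (wX - 1) t = 0" by (simp add: Q_lin md_lin)
    then have "sc (-1) (0 - sc (poly P0 ?n) t) \<in> CU" using CU_scale[OF HH[OF tn], of "-1"] by (simp add: md_lin)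
    then have 1: "sc (poly P0 ?n) t \<in> CU" by simp
    show ?thesis
    proof (cases "poly P0 ?n = 0")
     case False
     then show ?thesis using CU_scale[OF 1, of "1 / poly P0 ?n"] by simp
    next
     case True
     then have "n \<le> 0" using R0_root[of n] P0_eq by auto
     then consider "n < 0" | "n = 0" by linarith
     then show ?thesis
     proof cases
      case 1 then show ?thesis using WS_neg[OF tn] CU_0 by simp
     next
      case 2
      then have "t \<in> hg 0 (wq 0)" using t \<open>k = 0\<close> by (simp add: wq_def)
      from hg_min[OF this] show ?thesis using CU_scale[OF CU_one] by (auto simp: one_eq_lat_exp)
     qed
    qed
   qed
  qed
 qed
 show ?case
 proof
  fix t assume t: "t \<in> WS n"
  then have "t \<in> CU" by (induction rule: WS_induct) (auto intro: main CU_0 CU_add)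
  from hc_CU[OF this, of n] show "t \<in> CC n" using hc_hom[OF t, of n] by simp
 qed
qed

section \<open>The ideal\<close>

abbreviation "hp \<equiv> hh (int p)"
definition ff :: "complex poly" where "ff = zhu_f p (p - 1)"

lemma hw_hh: "j >= 1 ==> hw p j = hh (int j - 1)"
 by (simp add: hw_def hh_def of_nat_diff)

lemma hw_shift: "[:- hw p (Suc j), 1:] = [:- hh (int j), 1:]"
 by (simp add: hw_hh)

lemma R0_R1: "R0 * R1 = (\<Prod>j\<in>{1..3 * p - 1}. [:- hw p j, 1:])"
proof -
 have "R0 * R1 = (\<Prod>j<3 * p - 1. [:- hh (int j), 1:])"
  unfolding R0_def R1_def lessThan_atLeast0 by (rule prod.atLeastLessThan_concat) (use p2 in auto)
 also have "... = (\<Prod>j<3 * p - 1. [:- hw p (Suc j), 1:])" unfolding hw_shift ..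
 also have "... = (\<Prod>j\<in>{1..3 * p - 1}. [:- hw p j, 1:])"
  by (simp only: prod.atLeast1_atMost_eq One_nat_def)
 finally show ?thesis .
qed

lemma ff_eq: "ff = (\<Prod>j\<in>{1..3 * p - 1} - {p - 1} - {p + 1}. [:- hw p j, 1:])"
proof -
 have "2 * p - (p - 1) = p + 1" using p2 by simp
 then show ?thesis unfolding ff_def zhu_f_def by (intro prod.cong) auto
qed

text \<open>The weights with indices p - 1 and p + 1 coincide, so omitting only the first index
  keeps one factor x - h.\<close>

lemma ww_poly: "(\<Prod>j\<in>{1..3 * p - 1} - {p - 1}. [:- hw p j, 1:]) = [:- hp, 1:] * ff"
proof -
 have "p + 1 \<in> {1..3 * p - 1} - {p - 1}" using p2 by auto
 moreover have "hw p (p + 1) = hp" by (simp add: hw_hh)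
 ultimately show ?thesis unfolding ff_eq by (subst prod.remove[of _ "p + 1"]) auto
qed

lemma R0_R1_ff: "R0 * R1 = [:- hp, 1:] * ([:- hp, 1:] * ff)"
proof -
 have "p - 1 \<in> {1..3 * p - 1}" using p2 by auto
 then have "R0 * R1 = [:- hw p (p - 1), 1:] * (\<Prod>j\<in>{1..3 * p - 1} - {p - 1}. [:- hw p j, 1:])"
  unfolding R0_R1 by (intro prod.remove) auto
 then show ?thesis unfolding ww_poly hw_eq .
qed

text \<open>The indices of the factors of \<open>R1\<close> are at least 2p, beyond both omitted
  indices p - 1 and p + 1.\<close>

lemma R1_dvd_ff: "R1 dvd ff"
proof -
 have "R1 = (\<Prod>j=2 * p - 1..<3 * p - 1. [:- hw p (Suc j), 1:])" unfolding R1_def hw_shift ..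
 also have "... = (\<Prod>j=Suc (2 * p - 1)..<Suc (3 * p - 1). [:- hw p j, 1:])"
  by (rule prod.shift_bounds_Suc_ivl[symmetric])
 finally show ?thesis unfolding ff_eq using p2 by (simp only:) (rule prod_dvd_prod_subset, auto)
qed

lemma ff_hp: "poly ff hp ~= 0"
proof -
 have "hp - hw p j ~= 0" if j: "j \<in> {1..3 * p - 1} - {p - 1} - {p + 1}" for j
 proof -
  have "hw p j = hh (int j - 1)" using j by (intro hw_hh) simp
  moreover have "int p ~= int j - 1" "int p + (int j - 1) ~= 2 * int p - 2" using j by auto
  ultimately show ?thesis using hh_eq_iff[of "int p" "int j - 1"] by simp
 qed
 then show ?thesis unfolding ff_eq poly_prod by (simp add: prod_zero_iff)
qed

lemma primary_FHE: "u \<in> {F, H, E} ==> primary (of_int wX) u"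
 using primary_F primary_H primary_E by (auto simp: wX_def)

lemma FHE_WS: "u \<in> {F, H, E} ==> u \<in> WS wX"
 using F_WS H_WS E_WS by auto

text \<open>Commutation of [\<omega>] with the generators. As u is primary, the modes of u on
  \<omega> reduce to creation modes on the vacuum, and the vectors L(-1) u, L(-1) L(-1) u and L(-2)
  u that occur are rewritten by \<open>L_mod_ZO\<close>.\<close>

lemma star_conf: assumes "u \<in> {F, H, E}" shows "u ** om - Om u \<in> ZO"
proof -
 have u: "u \<in> WS wX" by (rule FHE_WS[OF assms])
 have V: "u \<in> VV 0" by (rule W_VV[OF WS_W[OF u]])
 have m: "md u n om = L (-2) (md u n 1) + sc (of_int (wX - 1 + n)) (md u (n - 2) 1)" for n
  using primary_commutator[OF primary_FHE[OF assms] Jac_VL[OF conf_VV V] Jac_one(1)[OF V], of "-2" n 1]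
  unfolding conf_eq by (simp add: sc_add_left sc_diff_left algebra_simps)
 have L1: "L (-1) u = md u (-2) 1" by (simp add: L_minus_one T_def)
 have "L (-1) (md u (-2) 1) = L (-1) (L (-1) (md u (-1) 1))" by (simp add: L1 md_right_one)
 have L11: "L (-1) (L (-1) u) = sc 2 (md u (-3) 1)"
  using primary_commutator[OF primary_FHE[OF assms] Jac_VL[OF conf_VV V] Jac_one(1)[OF V], of "-1" "-2" 1]
  unfolding L1 by (simp add: L_minus_one T_def md_one md_lin)
 let ?w = "of_int wX :: complex"
 have "{..<3::nat} = {0, 1, 2}" by auto
 moreover have "X wX u (-1) om = (\<Sum>i<3. sc (of_int wX gchoose i) (md u (-1 + int i) om))"
  unfolding X_def cv_def bp_nth by (rule Sum_any_nat) (simp add: m md_right_one L_lin)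
 ultimately have e: "X wX u (-1) om = L (-2) u + sc (?w - 2) (md u (-3) 1) + sc (?w * (?w - 1)) (md u (-2) 1) + sc ((?w gchoose 2) * ?w) u"
  by (simp add: m md_right_one L_lin)
 have c: "?w gchoose 2 = ?w * (?w - 1) / 2" by (simp add: gbinomial_Suc numeral_2_eq_2 atLeast0_lessThan_Suc)
 have a1: "L (-1) u - sc (-1) (sc ?w u) \<in> ZO" using L_mod_ZO[OF u, of 0] by simp
 have a2: "L (-1) (L (-1) u) - sc (-1) (sc (of_int (wX + 1)) (L (-1) u)) \<in> ZO" using L_mod_ZO[OF L_WS[OF u, of "-1"], of 0] by simp
 have a3: "L (-2) u - (sc ?w u + Om u) \<in> ZO" using L_mod_ZO[OF u, of 1] by simp
 have "u ** om - Om u = (L (-2) u - (sc ?w u + Om u)) + sc ((?w - 2) / 2) (L (-1) (L (-1) u) - sc (-1) (sc (of_int (wX + 1)) (L (-1) u)))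
  + sc (?w * (?w - 1) - (?w - 2) / 2 * (?w + 1)) (L (-1) u - sc (-1) (sc ?w u))"
  unfolding zb_hom[OF u] e L11 unfolding L1 c
  by (rule poly_mapping_eqI) (simp add: lookup_add lookup_minus, (simp add: field_simps)?)
 also have "... \<in> ZO" by (intro ZO_add ZO_scale a1 a2 a3)
 finally show ?thesis .
qed

text \<open>The preimage of the multiples of f([\<omega>]) by polynomials in [\<omega>]. In this
  form stability under multiplication is accessible; \<open>I0_eq\<close> relates it to the span of
  the two given elements.\<close>

definition I0 :: "fock set" where "I0 = {y \<in> W. \<exists>q. y - pol Om (q * ff) 1 \<in> ZO}"

lemma I0_W: "y \<in> I0 ==> y \<in> W" by (simp add: I0_def)

lemma I0_add: "y \<in> I0 ==> z \<in> I0 ==> y + z \<in> I0"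
proof -
 assume "y \<in> I0" "z \<in> I0"
 then obtain q r where *: "y \<in> W" "z \<in> W" "y - pol Om (q * ff) 1 \<in> ZO" "z - pol Om (r * ff) 1 \<in> ZO" by (auto simp: I0_def)
 have e: "y + z - pol Om ((q + r) * ff) 1 = (y - pol Om (q * ff) 1) + (z - pol Om (r * ff) 1)"
  by (simp add: distrib_right pol_add)
 have "y + z - pol Om ((q + r) * ff) 1 \<in> ZO" unfolding e by (rule ZO_add[OF *(3,4)])
 then show ?thesis using *(1,2) unfolding I0_def by blast
qed

lemma I0_scale: "y \<in> I0 ==> sc c y \<in> I0"
proof -
 assume "y \<in> I0"
 then obtain q where *: "y \<in> W" "y - pol Om (q * ff) 1 \<in> ZO" by (auto simp: I0_def)
 have e: "sc c y - pol Om (smult c q * ff) 1 = sc c (y - pol Om (q * ff) 1)"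
  by (simp add: pol_smult sc_diff)
 have "sc c y - pol Om (smult c q * ff) 1 \<in> ZO" unfolding e by (rule ZO_scale[OF *(2)])
 then show ?thesis using *(1) unfolding I0_def by blast
qed

lemma ZO_I0: "y \<in> ZO ==> y \<in> I0"
proof -
 assume y: "y \<in> ZO"
 have "y - pol Om (0 * ff) 1 \<in> ZO" using y by simp
 then show ?thesis using y ZO_W unfolding I0_def by blast
qed

lemma pol_I0: "pol Om (q * ff) 1 \<in> I0"
proof -
 have "pol Om (q * ff) 1 - pol Om (q * ff) 1 \<in> ZO" by simp
 then show ?thesis using pol_W[OF one_W] unfolding I0_def by blast
qed

lemma I0_cong: "y - z \<in> ZO ==> z \<in> I0 ==> y \<in> I0"
 using I0_add[OF ZO_I0, of "y - z" z] by simp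

text \<open>The two-sided multipliers of \<open>I0\<close>. They contain O(V) and are closed under
  the product, so membership of the generators is what has to be established.\<close>

definition BB :: "fock set" where
 "BB = {u \<in> W. \<forall>y\<in>I0. u ** y \<in> I0 \<and> y ** u \<in> I0}"

lemma BB_D: "u \<in> BB ==> y \<in> I0 ==> u ** y \<in> I0" "u \<in> BB ==> y \<in> I0 ==> y ** u \<in> I0" "u \<in> BB ==> u \<in> W"
 by (simp_all add: BB_def)

lemma BB_I:
 assumes u: "u \<in> W" and l: "!!q. u ** pol Om (q * ff) 1 \<in> I0" and r: "!!q. pol Om (q * ff) u \<in> I0"
 shows "u \<in> BB"
proof -
 have "u ** y \<in> I0 \<and> y ** u \<in> I0" if "y \<in> I0" for y
 proof -
  from that obtain q where q: "y \<in> W" "y - pol Om (q * ff) 1 \<in> ZO" by (auto simp: I0_def)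
  have 1: "pol Om (q * ff) 1 \<in> W" "y - pol Om (q * ff) 1 \<in> W" using pol_W[OF one_W] ZO_W q(2) by auto
  have "u ** y - u ** pol Om (q * ff) 1 = u ** (y - pol Om (q * ff) 1)"
   using zb_add2[OF u, of 1 "y - pol Om (q * ff) 1" "pol Om (q * ff) 1"] by simp
  then have a: "u ** y \<in> I0" using ZO_left[OF u q(2)] by (intro I0_cong[OF _ l[of q]]) simp
  have "y ** u - pol Om (q * ff) u = (y - pol Om (q * ff) 1) ** u - (pol Om (q * ff) (1 ** u) - pol Om (q * ff) 1 ** u)"
   using zb_add[OF 1(2,1), of 1 u] by (simp add: one_star)
  then have b: "y ** u \<in> I0"
   by (intro I0_cong[OF _ r[of q]]) (simp only: ZO_diff[OF ZO_right[OF u q(2)] pol_star[OF one_W u]])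
  show ?thesis using a b ..
 qed
 then show ?thesis using u by (simp add: BB_def)
qed

lemma Om_pol: "Om (pol Om P y) = pol Om ([:0, 1:] * P) y"
 by (simp add: pol_pCons[OF flin_Om])

lemma conf_BB: "om \<in> BB"
proof (rule BB_I[OF conf_W])
 fix q
 have 1: "Om (pol Om (q * ff) 1) \<in> I0" unfolding Om_pol mult.assoc[symmetric] by (rule pol_I0)
 then show "om ** pol Om (q * ff) 1 \<in> I0" by (simp add: Om_def)
 have o: "om = pol Om [:0, 1:] 1" by (simp add: pol_pCons[OF flin_Om] Om_lin) (simp add: Om_def star_one[OF conf_W])
 have "pol Om (q * ff) om = pol Om ([:0, 1:] * q * ff) 1"
  by (subst o) (simp only: pol_mult[OF flin_Om, symmetric] mult_ac)
 then show "pol Om (q * ff) om \<in> I0" by (simp only: pol_I0)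
qed

lemma star_Om: assumes "u \<in> {F, H, E}" "y \<in> W" shows "u ** Om y - Om (u ** y) \<in> ZO"
proof -
 have u: "u \<in> W" by (rule WS_W[OF FHE_WS[OF assms(1)]])
 have 1: "(u ** om) ** y - u ** Om y \<in> ZO" unfolding Om_def by (rule star_assoc[OF u conf_W assms(2)])
 have 2: "Om (u ** y) - Om u ** y \<in> ZO" by (rule Om_star[OF u assms(2)])
 have 3: "(u ** om - Om u) ** y \<in> ZO" by (rule ZO_right[OF assms(2) star_conf[OF assms(1)]])
 have e: "(u ** om) ** y = (u ** om - Om u) ** y + Om u ** y"
  using zb_add[of "u ** om - Om u" "Om u" 1 y] ZO_W star_conf[OF assms(1)] Om_W[OF u] by (simp add: subset_iff)
 have "u ** Om y - Om (u ** y) = (u ** om - Om u) ** y - ((u ** om) ** y - u ** Om y) - (Om (u ** y) - Om u ** y)"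
  unfolding e by simp
 also have "... \<in> ZO" by (rule ZO_diff[OF ZO_diff[OF 3 1] 2])
 finally show ?thesis .
qed

lemma star_pol: assumes "u \<in> {F, H, E}" shows "u ** pol Om P 1 - pol Om P u \<in> ZO"
proof (induction P)
 case 0
 then show ?case using WS_W[OF FHE_WS[OF assms]] by (simp add: zb_0)
next
 case (pCons a P)
 have u: "u \<in> W" by (rule WS_W[OF FHE_WS[OF assms]])
 have "u ** pol Om (pCons a P) 1 - pol Om (pCons a P) u
  = (u ** Om (pol Om P 1) - Om (u ** pol Om P 1)) + Om (u ** pol Om P 1 - pol Om P u)"
  by (simp add: pol_pCons[OF flin_Om] zb_add2[OF u] zb_scale2[OF u] star_one[OF u] Om_lin)
 also have "... \<in> ZO" by (intro ZO_add star_Om[OF assms] pol_W one_W Om_ZO pCons.IH)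
 finally show ?case .
qed

lemma FHE_BB: assumes u: "u \<in> {F, H, E}" shows "u \<in> BB"
proof -
 obtain g where g: "ff = R1 * g" using R1_dvd_ff by (rule dvdE)
 have e: "q * ff = (q * g) * R1" for q by (simp only: g mult_ac)
 have z: "pol Om (q * ff) u \<in> ZO" for q unfolding e pol_mult[OF flin_Om, of "q * g"] by (rule pol_ZO[OF R1_gen[OF u]])
 show ?thesis
 proof (rule BB_I)
  fix q
  show "pol Om (q * ff) u \<in> I0" by (rule ZO_I0[OF z])
  then show "u ** pol Om (q * ff) 1 \<in> I0" by (rule I0_cong[OF star_pol[OF u]])
 qed (rule WS_W[OF FHE_WS[OF u]])
qed

lemma BB_closed: "u \<in> BB ==> v \<in> BB ==> u + v \<in> BB" "u \<in> BB ==> sc c u \<in> BB" "0 \<in> BB" "1 \<in> BB" "u \<in> ZO ==> u \<in> BB"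
 unfolding BB_def
 by (auto simp: zb_add zb_add2 zb_scale zb_scale2 I0_W I0_add I0_scale zb_0 one_star star_one
   intro: ZO_I0 ZO_left ZO_right I0_W dest: subsetD[OF ZO_W])

lemma BB_subspace: "fock.subspace BB" by (simp add: fock.subspace_def BB_closed)

lemma BB_star: assumes "u \<in> BB" "v \<in> BB" shows "u ** v \<in> BB"
proof -
 have uv: "u \<in> W" "v \<in> W" using assms by (simp_all add: BB_D)
 have "(u ** v) ** y \<in> I0 \<and> y ** (u ** v) \<in> I0" if y: "y \<in> I0" for y
 proof
  show "(u ** v) ** y \<in> I0"
   by (rule I0_cong[OF star_assoc[OF uv I0_W[OF y]]]) (intro BB_D(1) assms y)
  have "y ** (u ** v) - (y ** u) ** v \<in> ZO" using ZO_uminus[OF star_assoc[OF I0_W[OF y] uv]] by simp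
  then show "y ** (u ** v) \<in> I0" by (rule I0_cong) (intro BB_D(2) assms y)
 qed
 then show ?thesis using uv by (auto simp: BB_def)
qed

lemma gens_BB: "(w, x) \<in> gens ==> x \<in> BB"
 using conf_BB FHE_BB by (auto simp: gens_def)

text \<open>The vector x_{-1-r} u is the leading term of a residue that is the star product for r =
  0 and an element of O(V) for r > 0, and the other terms have smaller weight. Thus strong
  generation yields generation of Zhu's algebra.\<close>

lemma WS_BB: "WS n \<subseteq> BB"
proof (induction "nat n" arbitrary: n rule: less_induct)
 case less
 have "md x (-1 - int r) u \<in> BB" if g: "(w, x) \<in> gens" and u: "u \<in> WS j" and n: "w + j + int r = n" for w x r u j
 proof (cases "u = 0")
  case True then show ?thesis by (simp add: md_lin BB_closed)
 next
  case False
  then have j: "j >= 0" using WS_neg[OF u] by (cases "j < 0") auto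
  have w: "w >= 2" by (rule gens_wt[OF g])
  have x: "x \<in> WS w" by (rule gens_WS[OF g])
  have uB: "u \<in> BB" using less[of j] u n w j by (auto simp: nat_less_iff)
  have lower: "md x (-1 - int r + int i) u \<in> BB" if "i >= 1" for i
  proof -
   have m: "md x (-1 - int r + int i) u \<in> WS (n - int i)"
    using md_WS[OF x u, of "-1 - int r + int i"] n by (simp add: algebra_simps)
   show ?thesis
   proof (cases "n - int i < 0")
    case True then show ?thesis using WS_neg[OF m] by (simp add: BB_closed)
   next
    case False
    then show ?thesis using less[of "n - int i"] m that by auto
   qed
  qed
  have X: "X w x (-1 - int r) u \<in> BB"
  proof (cases "r = 0")
   case True
   then show ?thesis using BB_star[OF gens_BB[OF g] uB] by (simp add: zb_hom[OF x])
  next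
   case False
   have "X w x (- int (Suc r)) u \<in> ZO" by (rule X_ZO[OF x WS_W[OF u]]) (use False in simp)
   then show ?thesis by (intro BB_closed(5)) simp
  qed
  let ?f = "%i. sc (fps_nth (bp w) i) (md x (-1 - int r + int i) u)"
  have ev: "evz ?f" by (rule bdd_cv_evz[OF bdd_md])
  have ev0: "evz (%i. if i = 0 then ?f 0 else 0)" by (rule evzI[of 1]) simp
  have e: "X w x (-1 - int r) u - Sum_any (%i. ?f i - (if i = 0 then ?f 0 else 0)) = md x (-1 - int r) u"
   unfolding X_def cv_def Sum_any_diff[OF ev ev0] by simp
  have "?f i - (if i = 0 then ?f 0 else 0) \<in> BB" for i
   using lower[of i] by (cases "i = 0") (simp_all add: BB_closed)
  then have "Sum_any (%i. ?f i - (if i = 0 then ?f 0 else 0)) \<in> BB" by (rule subspace_Sum_any[OF BB_subspace])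
  from fock.subspace_diff[OF BB_subspace X this] show ?thesis unfolding e .
 qed
 then have "CC n \<subseteq> BB"
  unfolding CC_def by (intro fock.span_minimal BB_subspace) (auto simp: BB_closed)
 then show ?case using generation by blast
qed

lemma W_BB: "u \<in> W ==> u \<in> BB"
proof (induction u rule: W_induct)
 case (hom n a k) then show ?case using WS_BB W_hg_WS by blast
qed (rule BB_closed)

section \<open>The dimension\<close>

lemma M_low: assumes "x \<in> M" "L 0 x = sc (hp + of_int m) x" "m < 0" shows "x = 0"
proof (rule ccontr)
 assume "x ~= 0"
 then obtain b where b: "b \<in> keys x" by (metis all_not_in_conv keys_eq_empty)
 have "ev b = hp + of_int m" using assms(2) b unfolding L0_eigen_iff supp_def by blast
 moreover have "b \<in> {b. tp dvd snd b - int p \<or> tp dvd snd b - (int p - 2)}"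
  using assms(1) b unfolding supp_M supp_def by blast
 from ev_M[OF this] obtain n :: nat where "ev b = hp + of_nat n" by blast
 ultimately have "of_int m = (of_int (int n) :: complex)" by simp
 then show False using assms(3) by (simp only: of_int_eq_iff)
qed

abbreviation "ep \<equiv> xp (int p)"

lemma L0_ep: "L 0 ep = sc hp ep" by (rule L0_lat_exp)

text \<open>Both parts of the action would land in weight below that of exp(\<alpha>/2), where the
  module has no vectors.\<close>

lemma act_ep: assumes "b \<in> WS n" "r >= n" shows "act b r ep = 0"
proof -
 have W: "b \<in> W" by (rule WS_W[OF assms(1)])
 have V: "b \<in> VV 0" by (rule W_VV[OF W])
 have epV: "ep \<in> VV (int p)" by (rule lat_exp_VV) simp
 have epP: "ep \<in> PP" by (rule VV_p_PP[OF epV])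
 have "md b r ep = 0"
 proof (rule M_low)
  show "md b r ep \<in> M" by (rule md_M(1)[OF V lat_exp_p_M])
  have "L 0 (md b r ep) = sc (of_int n + hp - of_int r - 1) (md b r ep)"
   by (rule L0_md[OF Jac_VL[OF conf_VV V] Jac_one(1)[OF V] WS_L0[OF assms(1)] L0_ep])
  then show "L 0 (md b r ep) = sc (hp + of_int (n - r - 1)) (md b r ep)" by (simp add: algebra_simps)
 qed (use assms(2) in simp)
 moreover have "md (md ee (int j) b) (r - int j) ep = 0" for j
 proof (rule M_low)
  have x: "md ee (int j) b \<in> VV (-2)" by (rule W_ee[OF W])
  have "md (md ee (int j) b) (r - int j) ep \<in> VV (-2 + int p)" by (rule md_VV[OF x epV])
  then have "md (md ee (int j) b) (r - int j) ep \<in> VV (int p - 2)" by simp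
  moreover have "0 \<in> VV (int p)" by auto
  ultimately show "md (md ee (int j) b) (r - int j) ep \<in> M"
   unfolding M_decomp by (metis add_0)
  have 1: "L 0 ee = sc 1 ee" using screening_primary(2) by (simp add: primary_def)
  have "L 0 (md ee (int j) b) = sc (1 + of_int n - of_int (int j) - 1) (md ee (int j) b)"
   by (rule L0_md[OF Jac_scr(2)[OF screening_VV(2) conf_VV W_PP[OF W]] Jac_one(2)[OF screening_VV(2) W_PP[OF W]] 1 WS_L0[OF assms(1)]])
  from L0_md[OF Jac_scr(2)[OF x conf_VV epP] Jac_one(2)[OF x epP] this L0_ep, of "r - int j"]
  show "L 0 (md (md ee (int j) b) (r - int j) ep) = sc (hp + of_int (n - r - 1)) (md (md ee (int j) b) (r - int j) ep)"
   by (simp add: algebra_simps)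
 qed (use assms(2) in simp)
 ultimately show ?thesis by (simp add: act_def act2_def pr_exp_p)
qed

text \<open>Evaluation of zero modes on the lowest weight vector; it factors through Zhu's algebra.\<close>

definition ob :: "fock => fock" where "ob x = Sum_any (%n. act (hc n x) (n - 1) ep)"

lemma finite_ob: "finite {n. act (hc n x) (n - 1) ep ~= 0}"
proof (rule finite_subset)
 show "finite ((of_int :: int => complex) -` (ev ` keys x))" by (rule finite_vimageI) (auto simp: inj_on_def)
 show "{n. act (hc n x) (n - 1) ep ~= 0} \<subseteq> of_int -` (ev ` keys x)"
 proof
  fix n assume "n \<in> {n. act (hc n x) (n - 1) ep ~= 0}"
  then have "hc n x ~= 0" using flin_zero[OF flin_act(1)] by auto
  then obtain b where "lookup (hc n x) b ~= 0" by (metis poly_mapping_eqI lookup_zero)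
  then have "of_int n = ev b" "b \<in> keys x" by (auto simp: hc_def lookup_res in_keys_iff split: if_splits)
  then show "n \<in> of_int -` (ev ` keys x)" by blast
 qed
qed

lemma flin_ob: "flin ob"
proof (rule flinI)
 show "ob (x + y) = ob x + ob y" for x y
  unfolding ob_def flin_add[OF flin_hc] flin_add[OF flin_act(1)] by (rule Sum_any.distrib[OF finite_ob finite_ob])
 show "ob (sc c x) = sc c (ob x)" for c x
 proof -
  have "Sum_any (%n. sc c (act (hc n x) (n - 1) ep)) = sc c (\<Sum>n\<in>{n. act (hc n x) (n - 1) ep ~= 0}. act (hc n x) (n - 1) ep)"
   unfolding sc_sum by (rule Sum_any.expand_superset[OF finite_ob]) auto
  then show ?thesis unfolding ob_def flin_scale[OF flin_hc] flin_scale[OF flin_act(1)] by (simp only: Sum_any.expand_set)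
 qed
qed

lemmas ob_lin = flin_add[OF flin_ob] flin_scale[OF flin_ob] flin_zero[OF flin_ob] flin_diff[OF flin_ob]

lemma ob_hom: "x \<in> WS n ==> ob x = act x (n - 1) ep"
proof -
 assume x: "x \<in> WS n"
 have "act (hc m x) (m - 1) ep = (if m = n then act x (n - 1) ep else 0)" for m
  by (simp add: hc_hom[OF x] flin_zero[OF flin_act(1)])
 then show ?thesis by (simp add: ob_def)
qed

text \<open>The Jacobi identity of the modified action; the product with a next to the lowest weight
  vector drops out, since its mode indices are at least the weight of a.\<close>

lemma ob_X:
 assumes a: "a \<in> WS wa" and b: "b \<in> WS wb"
 shows "ob (X wa a k b) = cv (bn k) (%c. act a (wa + wb - 2 - c) (act b c ep)) (wb - 2 - k)"
proof -
 have "ob (X wa a k b) = cv (bp wa) (%c. ob (md a c b)) k"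
  unfolding X_def by (rule cv_flin[OF bdd_md flin_ob])
 also have "(%c. ob (md a c b)) = (%c. act (md a c b) (wa + (wb - 2 - k) + k - c) ep)"
 proof
  fix c
  have "wa + wb - c - 1 - 1 = wa + (wb - 2 - k) + k - c" by simp
  then show "ob (md a c b) = act (md a c b) (wa + (wb - 2 - k) + k - c) ep" unfolding ob_hom[OF md_WS[OF a b]] by (simp only:)
 qed
 also have "cv (bp wa) ... k = cv (bn k) (%c. act a (wa + (wb - 2 - k) + k - c) (act b c ep)) (wb - 2 - k)
  - sc (sg k) (cv (bn k) (%c. act b (wa + (wb - 2 - k) + k - c) (act a c ep)) wa)"
  by (rule act_Jacobi[OF WS_W[OF a] WS_W[OF b] lat_exp_p_M])
 also have "cv (bn k) (%c. act b (wa + (wb - 2 - k) + k - c) (act a c ep)) wa = 0"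
  by (simp add: cv_def act_ep[OF a] flin_zero[OF flin_act(2)])
 finally show ?thesis by (simp add: algebra_simps)
qed

lemma ob_ZO: "x \<in> ZO ==> ob x = 0"
proof (induction rule: ZO_induct)
 case (base wa a b)
 from base(2) show ?case
 proof (induction b rule: W_induct)
  case (hom n b k)
  have b: "b \<in> WS n" by (rule W_hg_WS[OF hom])
  have "ob (zb 2 a b) = ob (X wa a (-2) b)" by (simp add: zb_hom[OF base(1)])
  also have "... = 0" unfolding ob_X[OF base(1) b] by (simp add: cv_def act_ep[OF b] flin_zero[OF flin_act(2)])
  finally show ?case .
 next
  case (add b b')
  then show ?case by (simp add: zb_add2[OF WS_W[OF base(1)]] ob_lin)
 qed
qed (simp_all add: ob_lin)

lemma ob_Om: "y \<in> W ==> ob (Om y) = act om 1 (ob y)"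
proof (induction y rule: W_induct)
 case (hom n y k)
 have y: "y \<in> WS n" by (rule W_hg_WS[OF hom])
 have "Om y = X 2 om (-1) y" by (simp add: Om_def zb_hom[OF conf_WS])
 then have "ob (Om y) = cv (bn (-1)) (%c. act om (n - c) (act y c ep)) (n - 1)"
  using ob_X[OF conf_WS y, of "-1"] by simp
 also have "... = (\<Sum>s<1. sc (fps_nth (bn (-1)) s) (act om (n - (n - 1 + int s)) (act y (n - 1 + int s) ep)))"
  unfolding cv_def by (rule Sum_any_nat) (simp add: act_ep[OF y] flin_zero[OF flin_act(2)])
 also have "... = act om 1 (ob y)" by (simp add: ob_hom[OF y])
 finally show ?case .
qed (simp add: Om_lin ob_lin flin_add[OF flin_act(2)])

lemma ob_one: "ob 1 = ep"
 by (simp add: ob_hom[OF one_WS] act_one)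

lemma hh_p2: "hh (int p - 2) = hp" by (simp add: hh_eq_iff)

lemma act_conf_ep: "act om 1 ep = sc hp ep + xp (int p - 2)" "act om 1 (xp (int p - 2)) = sc hp (xp (int p - 2))"
 by (simp_all add: act_conf pr_exp_p Qt_exp_p Qt_lin L0_lat_exp hh_p2)

text \<open>The new L(0) acts on the two exponentials as a Jordan block of size two, and a
  polynomial in such a block has its derivative off the diagonal.\<close>

lemma ob_pol: "ob (pol Om P 1) = sc (poly P hp) ep + sc (poly (pderiv P) hp) (xp (int p - 2))"
proof (induction P)
 case 0 then show ?case by (simp add: ob_lin)
next
 case (pCons a P)
 have "ob (pol Om (pCons a P) 1) = sc a ep + act om 1 (ob (pol Om P 1))"
  by (simp add: pol_pCons[OF flin_Om] ob_lin ob_Om pol_W one_W ob_one)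
 also have "... = sc (poly (pCons a P) hp) ep + sc (poly (pderiv (pCons a P)) hp) (xp (int p - 2))"
  unfolding pCons.IH flin_add[OF flin_act(2)] flin_scale[OF flin_act(2)] act_conf_ep pderiv_pCons
  by (simp add: sc_add sc_add_left algebra_simps)
 finally show ?case .
qed

lemma pol_ZO_roots:
 assumes "pol Om P 1 \<in> ZO" shows "poly P hp = 0" "poly (pderiv P) hp = 0"
proof -
 have e: "sc (poly P hp) ep + sc (poly (pderiv P) hp) (xp (int p - 2)) = 0"
  using ob_ZO[OF assms] by (simp add: ob_pol)
 from arg_cong[OF e, of "%x. lookup x ({#}, int p)"] arg_cong[OF e, of "%x. lookup x ({#}, int p - 2)"]
 show "poly P hp = 0" "poly (pderiv P) hp = 0" by (simp_all add: lookup_add lat_exp_def lookup_single)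
qed

text \<open>The first-order Taylor polynomial of 1/f at h, which is the origin of the constants
  \<lambda> and \<nu>: the product with f has value 1 and derivative 0 at h.\<close>

definition v0 :: "complex poly" where "v0 = [:zhu_nu p (p - 1), zhu_lambda p (p - 1):]"
definition vv :: fock where "vv = pol Om (v0 * ff) 1"
definition ww :: fock where "ww = pol Om ([:- hp, 1:] * ff) 1"

lemma v0_hp: "poly v0 hp = 1 / poly ff hp"
 unfolding v0_def zhu_nu_def zhu_lambda_def ff_def[symmetric] hw_eq by simp

text \<open>Division of the cofactor q by (x - h)^2, with remainder written in the basis
  \<open>v0\<close>, x - h. The quotient contributes a multiple of \<open>R0 * R1\<close>, which is
  0 in Zhu's algebra.\<close>

lemma I0_eq: "I0 = {y \<in> W. \<exists>a b. y - (sc a vv + sc b ww) \<in> ZO}"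
proof -
 have 1: "\<exists>a b. pol Om (q * ff) 1 - (sc a vv + sc b ww) \<in> ZO" for q
 proof -
  define a where "a = poly q hp * poly ff hp"
  have "poly (q - smult a v0) hp = 0" using ff_hp by (simp add: a_def v0_hp)
  then obtain g where g: "q - smult a v0 = [:- hp, 1:] * g" by (metis poly_eq_0_iff_dvd dvdE)
  define b where "b = poly g hp"
  have "poly (g - [:b:]) hp = 0" by (simp add: b_def)
  then obtain k where k: "g - [:b:] = [:- hp, 1:] * k" by (metis poly_eq_0_iff_dvd dvdE)
  have "[:- hp, 1:] * g = [:- hp, 1:] * (g - [:b:]) + [:- hp, 1:] * [:b:]" by (simp only: distrib_left[symmetric] diff_add_cancel)
  also have "[:- hp, 1:] * [:b:] = smult b [:- hp, 1:]" by simp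
  finally have g': "q = [:- hp, 1:] * (g - [:b:]) + smult b [:- hp, 1:] + smult a v0"
   using g by (simp only: diff_eq_eq)
  then have q: "q * ff = k * (R0 * R1) + (smult a (v0 * ff) + smult b ([:- hp, 1:] * ff))"
   unfolding g' k R0_R1_ff by (simp only: distrib_left distrib_right mult_smult_left mult_smult_right mult_ac add_ac)
  have "pol Om (q * ff) 1 - (sc a vv + sc b ww) = pol Om k (pol Om (R0 * R1) 1)"
   unfolding q pol_add pol_smult vv_def ww_def pol_mult[OF flin_Om, of k] by simp
  then have "pol Om (q * ff) 1 - (sc a vv + sc b ww) \<in> ZO" using pol_ZO[OF R0_R1_one] by simp
  then show ?thesis by blast
 qed
 have 2: "pol Om ((smult a v0 + smult b [:- hp, 1:]) * ff) 1 = sc a vv + sc b ww" for a b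
  by (simp only: distrib_right pol_add mult_smult_left pol_smult vv_def ww_def)
 show ?thesis
 proof (intro equalityI subsetI)
  fix y assume "y \<in> I0"
  then obtain q where q: "y \<in> W" "y - pol Om (q * ff) 1 \<in> ZO" by (auto simp: I0_def)
  obtain a b where "pol Om (q * ff) 1 - (sc a vv + sc b ww) \<in> ZO" using 1 by blast
  from ZO_add[OF q(2) this] have "y - (sc a vv + sc b ww) \<in> ZO" by (simp add: algebra_simps)
  then show "y \<in> {y \<in> W. \<exists>a b. y - (sc a vv + sc b ww) \<in> ZO}" using q(1) by blast
 next
  fix y assume "y \<in> {y \<in> W. \<exists>a b. y - (sc a vv + sc b ww) \<in> ZO}"
  then obtain a b where "y \<in> W" "y - (sc a vv + sc b ww) \<in> ZO" by blast
  then show "y \<in> I0" unfolding I0_def 2[symmetric] by blast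
 qed
qed

text \<open>The derivative of (x - h) f at h is f(h), so the Jordan block detects this element
  although its value at h is 0.\<close>

lemma ww_ZO: "ww \<notin> ZO"
proof
 assume "ww \<in> ZO"
 then have "poly (pderiv ([:- hp, 1:] * ff)) hp = 0" unfolding ww_def by (rule pol_ZO_roots)
 then show False using ff_hp unfolding pderiv_mult by (simp add: pderiv_pCons)
qed

text \<open>The polynomial of the first element has value 1 at h, that of the second has value
  0.\<close>

lemma vv_ZO: "vv - sc c ww \<notin> ZO"
proof
 assume "vv - sc c ww \<in> ZO"
 moreover have "vv - sc c ww = pol Om (v0 * ff + smult (- c) ([:- hp, 1:] * ff)) 1"
  by (simp only: pol_add pol_smult vv_def ww_def) simp
 ultimately have "poly (v0 * ff + smult (- c) ([:- hp, 1:] * ff)) hp = 0" by (simp only: pol_ZO_roots)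
 then show False using ff_hp by (simp add: v0_hp)
qed

lemma vw_W: "vv \<in> W" "ww \<in> W" unfolding vv_def ww_def by (intro pol_W one_W)+

section \<open>Translation to the quotient ring\<close>

lemma scalar_mult: "y \<in> W ==> zhu_scalar (triplet p) c \<otimes>\<^bsub>A\<^esub> cls y = cls (sc c y)"
 unfolding zhu_scalar_def zhu_class_eq triplet_simps by (simp add: A_mult W_scale one_W zb_scale one_star)

lemma conf_pow: "cls om [^]\<^bsub>A\<^esub> k = cls ((Om ^^ k) 1)"
proof -
 interpret Z: ring A by (rule ring_A)
 have W: "(Om ^^ k) 1 \<in> W" for k by (induction k) (auto simp: one_W)
 show ?thesis
 proof (induction k)
  case 0 then show ?case by (simp add: A_one)
 next
  case (Suc k)
  have "cls om \<in> carrier A" by (simp add: A_carrier conf_W)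
  from Z.nat_pow_Suc2[OF this, of k] have "cls om [^]\<^bsub>A\<^esub> Suc k = cls (om ** (Om ^^ k) 1)"
   unfolding Suc A_mult[OF conf_W W] .
  then show ?case by (simp only: funpow.simps o_apply flip: Om_def)
 qed
qed

lemma zhu_eval_eq: "zhu_eval (triplet p) P (cls om) = cls (pol Om P 1)"
proof -
 interpret Z: ring A by (rule ring_A)
 let ?g = "%k. sc (coeff P k) ((Om ^^ k) 1)"
 have W': "(Om ^^ k) 1 \<in> W" for k by (induction k) (auto simp: one_W)
 have W: "?g k \<in> W" for k using W' by (rule W_scale)
 have c: "(%k. cls (?g k)) \<in> S \<rightarrow> carrier A" for S using W by (auto simp: A_carrier)
 have "(\<Oplus>\<^bsub>A\<^esub>k\<in>{..n}. cls (?g k)) = cls (\<Sum>k\<le>n. ?g k)" for n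
 proof (induction n)
  case 0
  show ?case using Z.finsum_0[OF c] by simp
 next
  case (Suc n)
  have "(\<Oplus>\<^bsub>A\<^esub>k\<in>{..Suc n}. cls (?g k)) = cls (?g (Suc n)) \<oplus>\<^bsub>A\<^esub> (\<Oplus>\<^bsub>A\<^esub>k\<in>{..n}. cls (?g k))"
   by (rule Z.finsum_Suc[OF c])
  also have "... = cls (?g (Suc n) + (\<Sum>k\<le>n. ?g k))"
   unfolding Suc by (rule A_add[OF W W_sum[OF W]])
  finally show ?case by (simp add: add.commute)
 qed
 then show ?thesis
  unfolding zhu_eval_def conf_pow scalar_mult[OF W'] pol_def by simp
qed

lemma zhu_w_eq: "zhu_w p (p - 1) = cls ww"
 unfolding zhu_w_def zhu_class_eq triplet_simps ww_poly zhu_eval_eq ww_def ..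

lemma zhu_v_eq: "zhu_v p (p - 1) = cls vv"
proof -
 have s: "zhu_scalar (triplet p) c = cls (sc c 1)" for c by (simp add: zhu_scalar_def zhu_class_eq triplet_simps)
 let ?l = "zhu_lambda p (p - 1)" and ?n = "zhu_nu p (p - 1)"
 let ?y = "sc ?l om + sc ?n 1"
 have W: "?y \<in> W" "pol Om ff 1 \<in> W" by (intro W_add W_scale conf_W one_W pol_W)+
 have "zhu_v p (p - 1) = (cls (sc ?l om) \<oplus>\<^bsub>A\<^esub> cls (sc ?n 1)) \<otimes>\<^bsub>A\<^esub> cls (pol Om ff 1)"
  unfolding zhu_v_def Let_def zhu_class_eq triplet_simps zhu_eval_eq scalar_mult[OF conf_W] unfolding s ff_def ..
 also have "... = cls (?y ** pol Om ff 1)"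
  by (simp only: A_add[OF W_scale[OF conf_W] W_scale[OF one_W]] A_mult[OF W])
 also have "?y ** pol Om ff 1 = vv"
  unfolding vv_def pol_mult[OF flin_Om]
  by (simp add: v0_def pol_pCons[OF flin_Om] Om_lin zb_add zb_scale W_scale conf_W one_W one_star, simp add: Om_def add.commute)
 finally show ?thesis .
qed

text \<open>\<open>Span\<close> over a list is an iterated \<open>line_extension\<close>, which is
  unwound to representatives; the two nonmembership facts then give the dimension by
  \<open>Suc_dim\<close>.\<close>

lemma zhu_ideal_eq: "zhu_ideal p (p - 1) = cls ` I0"
 and zhu_ideal_dim: "ring.dimension A 2 (zhu_scalars (triplet p)) (zhu_ideal p (p - 1))"
proof -
 interpret Z: ring A by (rule ring_A)
 let ?K = "zhu_scalars (triplet p)"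
 let ?E = "Z.line_extension ?K (cls ww) {\<zero>\<^bsub>A\<^esub>}"
 have c: "cls vv \<in> carrier A" "cls ww \<in> carrier A" using vw_W by (auto simp: A_carrier)
 have E: "?E = range (%b. cls (sc b ww))"
 proof (rule Set.set_eqI)
  fix u
  have "u \<in> ?E \<longleftrightarrow> (\<exists>b. u = cls (sc b ww) \<oplus>\<^bsub>A\<^esub> cls 0)"
   unfolding Z.line_extension_mem_iff zhu_scalars_def A_zero by (auto simp: scalar_mult vw_W)
  then show "u \<in> ?E \<longleftrightarrow> u \<in> range (%b. cls (sc b ww))"
   by (auto simp: A_add vw_W W_scale)
 qed
 have S: "zhu_ideal p (p - 1) = Z.line_extension ?K (cls vv) ?E"
  unfolding zhu_ideal_def zhu_v_eq zhu_w_eq by simp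
 have cls_eq: "cls y = cls (sc a vv + sc b ww) \<longleftrightarrow> y - (sc a vv + sc b ww) \<in> ZO" if "y \<in> W" for y a b
  by (intro cls_eq_iff that W_add W_scale vw_W)
 show "zhu_ideal p (p - 1) = cls ` I0"
 proof (rule Set.set_eqI)
  fix u
  have "u \<in> zhu_ideal p (p - 1) \<longleftrightarrow> (\<exists>a b. u = cls (sc a vv + sc b ww))"
   unfolding S E unfolding Z.line_extension_mem_iff zhu_scalars_def by (auto simp: scalar_mult vw_W A_add W_scale)
  also have "... \<longleftrightarrow> u \<in> cls ` I0"
  proof
   assume "\<exists>a b. u = cls (sc a vv + sc b ww)"
   then obtain a b where u: "u = cls (sc a vv + sc b ww)" by blast
   have "sc a vv + sc b ww \<in> W" by (intro W_add W_scale vw_W)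
   moreover have "(sc a vv + sc b ww) - (sc a vv + sc b ww) \<in> ZO" by simp
   ultimately show "u \<in> cls ` I0" unfolding u I0_eq by blast
  next
   assume "u \<in> cls ` I0"
   then obtain y a b where "u = cls y" "y \<in> W" "y - (sc a vv + sc b ww) \<in> ZO" unfolding I0_eq by blast
   then show "\<exists>a b. u = cls (sc a vv + sc b ww)" using cls_eq by blast
  qed
  finally show "u \<in> zhu_ideal p (p - 1) \<longleftrightarrow> u \<in> cls ` I0" .
 qed
 have w: "cls ww \<notin> {\<zero>\<^bsub>A\<^esub>}"
  using ww_ZO cls_eq_iff[of ww 0] vw_W by (simp add: A_zero)
 have v: "cls vv \<notin> ?E"
 proof
  assume "cls vv \<in> ?E"
  then obtain b where "cls vv = cls (sc b ww)" unfolding E by blast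
  then show False using vv_ZO[of b] cls_eq_iff[OF vw_W(1) W_scale[OF vw_W(2)]] by simp
 qed
 show "Z.dimension 2 ?K (zhu_ideal p (p - 1))"
  unfolding S numeral_2_eq_2 by (intro Z.Suc_dim[OF c(1) v] Z.Suc_dim[OF c(2) w] Z.zero_dim)
qed

lemma zhu_ideal_ideal: "ideal (zhu_ideal p (p - 1)) A"
proof -
 interpret Z: ring A by (rule ring_A)
 show ?thesis
  unfolding zhu_ideal_eq
 proof (rule idealI[OF ring_A])
  have neg: "\<ominus>\<^bsub>A\<^esub> cls y = cls (- y)" if "y \<in> W" for y
  proof (rule Z.minus_equality)
   show "cls (- y) \<oplus>\<^bsub>A\<^esub> cls y = \<zero>\<^bsub>A\<^esub>" using that by (simp add: A_add A_zero W_uminus)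
  qed (use that in \<open>auto simp: A_carrier W_uminus\<close>)
  show "subgroup (cls ` I0) (add_monoid A)"
  proof (rule Z.add.subgroupI)
   show "cls ` I0 \<subseteq> carrier A" by (auto simp: A_carrier I0_W)
   show "cls ` I0 ~= {}" using pol_I0 by blast
   fix x assume "x \<in> cls ` I0"
   then obtain y where y: "x = cls y" "y \<in> I0" by blast
   have "- y \<in> I0" using I0_scale[OF y(2), of "-1"] by simp
   then show "\<ominus>\<^bsub>A\<^esub> x \<in> cls ` I0" by (simp add: y neg I0_W)
   fix x' assume "x' \<in> cls ` I0"
   then obtain y' where y': "x' = cls y'" "y' \<in> I0" by blast
   show "x \<oplus>\<^bsub>A\<^esub> x' \<in> cls ` I0" using I0_add[OF y(2) y'(2)] by (simp add: y y' A_add I0_W)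
  qed
  fix a x assume "a \<in> cls ` I0" "x \<in> carrier A"
  then obtain y u where "a = cls y" "y \<in> I0" "x = cls u" "u \<in> W" by (auto simp: A_carrier)
  then show "x \<otimes>\<^bsub>A\<^esub> a \<in> cls ` I0" "a \<otimes>\<^bsub>A\<^esub> x \<in> cls ` I0"
   using BB_D[OF W_BB] by (simp_all add: A_mult I0_W)
 qed
qed

end

theorem proposition6p6:
  fixes p :: nat
  assumes "p \<ge> 2"
  shows "(\<exists>(M :: fock set) act.
            logarithmic_module (triplet p) fscale M act \<and>
            lowest_gen_weight (triplet p) fscale M act (hw p (p - 1)))
       \<and> ideal (zhu_ideal p (p - 1)) (zhu_algebra (triplet p))
       \<and> ring.dimension (zhu_algebra (triplet p)) 2 (zhu_scalars (triplet p)) (zhu_ideal p (p - 1))"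
proof -
  interpret rank_one p by unfold_locales (rule assms)
  show ?thesis using logarithmic_M lowest_M zhu_ideal_ideal zhu_ideal_dim by blast
qed

end
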